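(* Let $z\in\mathfrak H$ satisfy $$|\operatorname{Re}(2z+1)|<1,\qquad \left|2z+\tfrac12\right|>\tfrac12,\qquad \left|2z+\tfrac32\right|>\tfrac12 .$$ For $t$ on the integration path, write $$A(t)=\frac{i\mathbf K(\sqrt{1-t})}{\mathbf K(\sqrt t)}-2z-1,\qquad B(t)=\frac{i\mathbf K(\sqrt{1-t})}{\mathbf K(\sqrt t)}-2\overline z-1 .$$ Then the following five identities hold, where every integration path is the straight-line segment joining the end points $0$ and $\lambda(2z+1)$: $$E^{\varGamma_0(4)}\left(-\frac1{4z},2\right)-\frac{21\,\zeta(3)}{8\pi^3\operatorname{Im}z}=\operatorname{Re}\int_0^{\lambda(2z+1)}\frac{3[\mathbf K(\sqrt t)]^2}{4\pi^3\operatorname{Im}z}\,A(t)\,B(t)\,dt,$$ $$E^{\varGamma_0(4)}\left(-\frac1{4z},3\right)-\frac{1395\,\zeta(5)}{256\pi^5(\operatorname{Im}z)^2}=\operatorname{Re}\int_0^{\lambda(2z+1)}\frac{15(2t-1)[\mathbf K(\sqrt t)]^4}{32\pi^5(\operatorname{Im}z)^2}\,A(t)^2B(t)^2\,dt,$$ $$E^{\varGamma_0(4)}\left(-\frac1{4z},4\right)-\frac{200025\,\zeta(7)}{17408\pi^7(\operatorname{Im}z)^3}=\operatorname{Re}\int_0^{\lambda(2z+1)}\frac{70[2-17t(1-t)][\mathbf K(\sqrt t)]^6}{1088\pi^7(\operatorname{Im}z)^3}\,A(t)^3B(t)^3\,dt,$$ $$E^{\varGamma_0(4)}\left(-\frac1{4z},5\right)-\frac{50703975\,\zeta(9)}{2031616\pi^9(\operatorname{Im}z)^4}=\operatorname{Re}\int_0^{\lambda(2z+1)}\frac{315(2t-1)[1-31t(1-t)][\mathbf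 K(\sqrt t)]^8}{15872\pi^9(\operatorname{Im}z)^4}\,A(t)^4B(t)^4\,dt,$$ $$E^{\varGamma_0(4)}\left(-\frac1{4z},7\right)-\frac{11506129710075\,\zeta(13)}{91620376576\pi^{13}(\operatorname{Im}z)^6}=\operatorname{Re}\int_0^{\lambda(2z+1)}\frac{3003(2t-1)[1-512t(1-t)+5461t^2(1-t)^2][\mathbf K(\sqrt t)]^{12}}{22368256\pi^{13}(\operatorname{Im}z)^6}\,A(t)^6B(t)^6\,dt.$$
   Context: $\mathfrak H=\{z\in\mathbb C:\operatorname{Im} z>0\}$ is the upper half-plane and $\zeta$ is the Riemann zeta function. For a positive integer $N$, $\varGamma_0(N)=\left\{\begin{pmatrix}a&b\\c&d\end{pmatrix}: a,b,c,d\in\mathbb Z,\ ad-bc=1,\ N\mid c\right\}$, acting on $\mathfrak H$ by $\hat\gamma z=\frac{az+b}{cz+d}$. The Epstein zeta function is $$E^{\varGamma_0(N)}(z,s)=\sum_{\hat\gamma\in B_N\backslash\varGamma_0(N)}[\operatorname{Im}(\hat\gamma z)]^s,\qquad z\in\mathfrak H,\ \operatorname{Re}s>1,$$ where $B_N$ is the subgroup of upper triangular matrices $\begin{pmatrix}*&*\\0&*\end{pmatrix}$ in $\varGamma_0(N)$. The complete elliptic integral is $\mathbf K(\sqrt t)=\int_0^{\pi/2}\frac{d\theta}{\sqrt{1-t\sin^2\theta}}$ for $t\in\mathbb C\smallsetminus[1,+\infty)$ (a holomorphic function of $t$ there). The modular lambda function is $\lambda(z)=\frac{16[\eta(z/2)]^8[\eta(2z)]^{16}}{[\eta(z)]^{24}}$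 for $z\in\mathfrak H$, where $\eta(z)=e^{\pi iz/12}\prod_{n=1}^\infty(1-e^{2\pi inz})$ is the Dedekind eta function. Under the stated inequalities on $z$, $\lambda(2z+1)$ lies in $(\mathbb C\smallsetminus\mathbb R)\cup(0,1)$. *)

theory Defs
  imports "HOL-Complex_Analysis.Complex_Analysis" "HOL-Algebra.Coset"
begin

definition Gamma0 :: "nat \<Rightarrow> (int ^ 2 ^ 2) monoid" where
  "Gamma0 N = \<lparr>carrier = {A. det A = 1 \<and> int N dvd A $ 2 $ 1}, mult = (**), one = mat 1\<rparr>"

definition upper_Gamma0 :: "nat \<Rightarrow> (int ^ 2 ^ 2) set" where
  "upper_Gamma0 N = {A \<in> carrier (Gamma0 N). A $ 2 $ 1 = 0}"

definition frac_lin :: "int ^ 2 ^ 2 \<Rightarrow> complex \<Rightarrow> complex" where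
  "frac_lin A z = (of_int (A $ 1 $ 1) * z + of_int (A $ 1 $ 2)) /
                  (of_int (A $ 2 $ 1) * z + of_int (A $ 2 $ 2))"

(* HOL-Algebra's rcosets are the cosets H #> g, i.e. the elements of H\G.  The imaginary part of
   frac_lin A z is constant on each of them (the_elem_Im_coset below), so the_elem picks out that
   common value.  Meant for Im z > 0 and Re s > 1, where the sum converges absolutely. *)
definition epstein_zeta :: "nat \<Rightarrow> complex \<Rightarrow> complex \<Rightarrow> complex" where
  "epstein_zeta N z s =
     (\<Sum>\<^sub>\<infinity>C \<in> rcosets\<^bsub>Gamma0 N\<^esub> (upper_Gamma0 N).
        of_real (the_elem ((\<lambda>A. Im (frac_lin A z)) ` C)) powr s)"

(* The Dirichlet series: this is the Riemann zeta function on the half-plane Re s > 1 only. *)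
definition riemann_zeta :: "complex \<Rightarrow> complex" where
  "riemann_zeta s = (\<Sum>n. 1 / of_nat (Suc n) powr s)"

(* K(sqrt t) as a function of the parameter t (the square of the modulus), for t outside [1, oo).
   There 1 - t sin^2 avoids the branch cut of csqrt, so the principal square root is the
   holomorphic branch with value 1 at t = 0. *)
definition ellK :: "complex \<Rightarrow> complex" where
  "ellK t = integral {0..pi/2} (\<lambda>\<theta>. 1 / csqrt (1 - t * (of_real (sin \<theta>))\<^sup>2))"

definition dedekind_eta :: "complex \<Rightarrow> complex" where
  "dedekind_eta z = exp (of_real pi * \<i> * z / 12) *
     (\<Prod>n. 1 - exp (2 * of_real pi * \<i> * of_nat (Suc n) * z))"

definition modular_lambda :: "complex \<Rightarrow> complex" where
  "modular_lambda z =
     16 * dedekind_eta (z / 2) ^ 8 * dedekind_eta (2 * z) ^ 16 / dedekind_eta z ^ 24"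

lemma group_Gamma0: "group (Gamma0 N)"
proof (rule groupI)
  fix A assume A: "A \<in> carrier (Gamma0 N)"
  define B :: "int ^ 2 ^ 2" where
    "B = (\<chi> i j. if i = 1 then (if j = 1 then A $ 2 $ 2 else - A $ 1 $ 2)
                 else (if j = 1 then - A $ 2 $ 1 else A $ 1 $ 1))"
  have "B \<in> carrier (Gamma0 N)"
    using A by (simp add: Gamma0_def B_def det_2 algebra_simps)
  moreover have "B ** A = mat 1"
    using A by (simp add: Gamma0_def B_def det_2 vec_eq_iff forall_2 matrix_matrix_mult_def
        mat_def sum_2 algebra_simps)
  ultimately show "\<exists>B\<in>carrier (Gamma0 N). B \<otimes>\<^bsub>Gamma0 N\<^esub> A = \<one>\<^bsub>Gamma0 N\<^esub>"
    by (auto simp: Gamma0_def)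
next
  fix A B assume "A \<in> carrier (Gamma0 N)" "B \<in> carrier (Gamma0 N)"
  then show "A \<otimes>\<^bsub>Gamma0 N\<^esub> B \<in> carrier (Gamma0 N)"
    by (simp add: Gamma0_def det_mul) (simp add: matrix_matrix_mult_def sum_2)
next
  have "(mat 1 :: int ^ 2 ^ 2) $ 2 $ 1 = 0" by (simp add: mat_def)
  then show "\<one>\<^bsub>Gamma0 N\<^esub> \<in> carrier (Gamma0 N)"
    by (simp add: Gamma0_def)
qed (simp_all add: Gamma0_def matrix_mul_assoc)

lemma subgroup_upper_Gamma0: "subgroup (upper_Gamma0 N) (Gamma0 N)"
proof -
  interpret G: group "Gamma0 N" by (rule group_Gamma0)
  show ?thesis
  proof (rule G.subgroupI)
    show "upper_Gamma0 N \<subseteq> carrier (Gamma0 N)"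
      by (auto simp: upper_Gamma0_def)
    have "\<one>\<^bsub>Gamma0 N\<^esub> \<in> upper_Gamma0 N"
      unfolding upper_Gamma0_def using G.one_closed by (simp add: Gamma0_def mat_def)
    then show "upper_Gamma0 N \<noteq> {}" by blast
  next
    fix A B assume "A \<in> upper_Gamma0 N" "B \<in> upper_Gamma0 N"
    then show "A \<otimes>\<^bsub>Gamma0 N\<^esub> B \<in> upper_Gamma0 N"
      unfolding upper_Gamma0_def using G.m_closed[of A B]
      by (simp add: Gamma0_def matrix_matrix_mult_def sum_2)
  next
    fix A assume A: "A \<in> upper_Gamma0 N"
    let ?B = "inv\<^bsub>Gamma0 N\<^esub> A"
    have A': "A \<in> carrier (Gamma0 N)" "A $ 2 $ 1 = 0"
      using A by (auto simp: upper_Gamma0_def)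
    have "?B ** A = mat 1"
      using G.l_inv[OF A'(1)] by (simp add: Gamma0_def)
    then have "(?B ** A) $ 2 $ 1 = 0"
      by (simp add: mat_def)
    then have "?B $ 2 $ 1 * A $ 1 $ 1 = 0"
      using A'(2) by (simp add: matrix_matrix_mult_def sum_2)
    moreover have "A $ 1 $ 1 \<noteq> 0"
      using A' by (auto simp: Gamma0_def det_2)
    ultimately show "?B \<in> upper_Gamma0 N"
      using G.inv_closed[OF A'(1)] by (simp add: upper_Gamma0_def)
  qed
qed

lemma Im_frac_lin:
  assumes "det A = 1"
  shows "Im (frac_lin A z) = Im z / (cmod (of_int (A $ 2 $ 1) * z + of_int (A $ 2 $ 2)))\<^sup>2"
proof -
  have "of_int (A $ 1 $ 1) * of_int (A $ 2 $ 2) - of_int (A $ 1 $ 2) * of_int (A $ 2 $ 1) = (1::real)"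
    using assms unfolding det_2 by (metis of_int_1 of_int_diff of_int_mult)
  then have *: "(of_int (A $ 1 $ 1) * of_int (A $ 2 $ 2) - of_int (A $ 1 $ 2) * of_int (A $ 2 $ 1)) * Im z = Im z"
    by simp
  have "Im (a / b) = (Im a * Re b - Re a * Im b) / (cmod b)\<^sup>2" for a b
    by (simp add: Im_divide cmod_power2)
  then show ?thesis
    unfolding frac_lin_def using * by (simp add: algebra_simps)
qed

lemma the_elem_Im_coset:
  assumes "A \<in> carrier (Gamma0 N)"
  shows "the_elem ((\<lambda>B. Im (frac_lin B z)) ` (upper_Gamma0 N #>\<^bsub>Gamma0 N\<^esub> A)) = Im (frac_lin A z)"
proof -
  interpret G: group "Gamma0 N" by (rule group_Gamma0)
  have inv: "Im (frac_lin (U ** A) z) = Im (frac_lin A z)" if U: "U \<in> upper_Gamma0 N" for U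
  proof -
    have U': "U \<in> carrier (Gamma0 N)" "U $ 2 $ 1 = 0"
      using U by (auto simp: upper_Gamma0_def)
    have "U $ 2 $ 2 = 1 \<or> U $ 2 $ 2 = -1"
      using U' by (auto simp: Gamma0_def det_2 zmult_eq_1_iff)
    moreover have "(U ** A) $ 2 $ i = U $ 2 $ 2 * A $ 2 $ i" for i
      using U'(2) by (simp add: matrix_matrix_mult_def sum_2)
    moreover have "det (U ** A) = 1" "det A = 1"
      using U'(1) assms by (auto simp: Gamma0_def det_mul)
    moreover have "cmod (- (of_int (A $ 2 $ 1) * z) - of_int (A $ 2 $ 2)) =
        cmod (of_int (A $ 2 $ 1) * z + of_int (A $ 2 $ 2))"
      by (metis minus_add_distrib norm_minus_cancel uminus_add_conv_diff add.commute)
    ultimately show ?thesis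
      by (auto simp: Im_frac_lin)
  qed
  have "mat 1 \<in> upper_Gamma0 N"
    using subgroup.one_closed[OF subgroup_upper_Gamma0, of N] by (simp add: Gamma0_def)
  then have "A \<in> (\<lambda>U. U ** A) ` upper_Gamma0 N"
    by (metis image_eqI matrix_mul_lid)
  then have "(\<lambda>B. Im (frac_lin B z)) ` (upper_Gamma0 N #>\<^bsub>Gamma0 N\<^esub> A) = {Im (frac_lin A z)}"
    unfolding r_coset_def using inv by (fastforce simp: Gamma0_def)
  then show ?thesis by simp
qed

end

theory Submission
  imports Defs
begin

text \<open>
  A coset in \<open>B\<^sub>4\<setminus>\<Gamma>\<^sub>0(4)\<close> is determined by its bottom row up to sign, so \<open>E(-1/(4z), s)\<close> is the sum of
  \<open>(Im z / 4)\<^sup>s \<bar>d z + c\<bar>\<^sup>-\<^sup>2\<^sup>s\<close> over coprime \<open>c\<close> and odd \<open>d > 0\<close>; dropping coprimality multiplies it by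
  the sum of the \<open>d\<^sup>-\<^sup>2\<^sup>s\<close>, a rational multiple of \<open>\<pi>\<^sup>2\<^sup>s\<close>. After a partial fraction decomposition the sum
  over \<open>c\<close> is given by the Lipschitz formula, a consequence of the reflection formula for the
  polygamma functions. The constant terms produce \<open>\<zeta>(2s - 1)\<close>. With \<open>w = 2z + 1\<close>, the rest is the real part
  of a multiple of the Eichler integral of \<open>G(\<tau>) (\<tau> - w)\<^sup>s\<^sup>-\<^sup>1 (\<tau> - cnj w)\<^sup>s\<^sup>-\<^sup>1\<close> from \<open>\<i>\<infinity>\<close> to \<open>w\<close>, where \<open>G\<close> is an
  Eisenstein series of weight \<open>2s\<close>, evaluated by partial integration.

  The substitution \<open>t = \<lambda>(\<tau>)\<close> turns this into the integral over \<open>[0, \<lambda>(w)]\<close>. Indeed \<open>G\<close> is an even derivative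
  of the Weierstrass function at a half period, hence a polynomial in the differences of the
  numbers \<open>e\<^sub>i\<close>, which are \<open>K\<^sup>2\<close>, \<open>t K\<^sup>2\<close> and \<open>(1 - t) K\<^sup>2\<close> up to the factor \<open>\<pi>\<^sup>2\<close>. This is checked for \<open>\<tau>\<close> on the
  imaginary axis, where everything is real, and extended by analytic continuation. The segment
  may be used because \<open>t \<mapsto> \<i> K(1 - t) / K(t)\<close> maps the plane without \<open>(-\<infinity>, 0]\<close> and \<open>[1, \<infinity>)\<close> onto the domain
  of the \<open>w\<close> in question; surjectivity follows from the boundary behaviour by connectedness.
\<close>

section \<open>Series and products of holomorphic functions\<close>

text \<open>One recursion yields all the rational constants. If W'^2 = 4 W^3 + 4 A W^2 - 4 B W, the
  even derivatives of W at a critical zero are the polynomials \<open>wconst\<close> in A and B. A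
  Weierstrass function normalised at a half period gives the Eisenstein series; the degenerate case
  \<pi>^2/sin^2(\<pi> x) - \<pi>^2 gives the sums of d^(-2s) over odd d.

  The continuation is done in t: the curve t = \<lambda>(i y), on which the elliptic integrals are
  inverted, has limit points in the cut plane. This gives \<lambda>(\<tau>(t)) = t, but the theorem
  starts from w, so w must be shown to be a value of \<tau>. The image of \<tau> is open, as \<tau>
  is injective. It is closed in the domain because a limit point w whose parameter lands on a cut
  has |Re w| = 1 or |Re w| = |w|^2; this rests on \<tau>(t/(t - 1)) = \<tau>(t) - 1 for Im t > 0, as
  t/(t - 1) moves the negative axis into (0, 1).

  The shift w = 2z + 1 comes from exp(2 \<pi> i d z) = - exp(\<pi> i d w) for odd d: the sign and
  the odd multiples together single out the half period \<pi> i - l/2.\<close>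

lemma suminf_has_field_derivative_local:
  fixes f :: "nat \<Rightarrow> complex \<Rightarrow> complex"
  assumes "open S" "\<And>n x. x \<in> S \<Longrightarrow> (f n has_field_derivative f' n x) (at x)"
    and "\<And>x. x \<in> S \<Longrightarrow> \<exists>d h. 0 < d \<and> summable h \<and> (\<forall>n. \<forall>y\<in>ball x d \<inter> S. norm (f n y) \<le> h n)"
    and x: "x \<in> S"
  shows "summable (\<lambda>n. f n x)"
    and "summable (\<lambda>n. f' n x)"
    and "((\<lambda>x. \<Sum>n. f n x) has_field_derivative (\<Sum>n. f' n x)) (at x)"
proof -
  have *: "\<exists>d h. 0 < d \<and> summable h \<and> (\<forall>\<^sub>F n in sequentially. \<forall>y\<in>ball x d \<inter> S. norm (f n y) \<le> h n)"
    if x: "x \<in> S" for x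
  proof -
    obtain d h where "0 < d" "summable h" "\<forall>n. \<forall>y\<in>ball x d \<inter> S. norm (f n y) \<le> h n"
      using assms(3)[OF x] by (elim exE conjE) (rule that)
    then show ?thesis
      by (intro exI[of _ d] exI[of _ h] conjI always_eventually)
  qed
  have "\<exists>g g'. \<forall>x\<in>S. (\<lambda>n. f n x) sums g x \<and> (\<lambda>n. f' n x) sums g' x \<and> (g has_field_derivative g' x) (at x)"
    using assms(2) * by (intro series_and_derivative_comparison_local[OF assms(1)])
  then obtain g g' where g: "\<forall>x\<in>S. (\<lambda>n. f n x) sums g x \<and> (\<lambda>n. f' n x) sums g' x \<and> (g has_field_derivative g' x) (at x)"
    by blast
  show "summable (\<lambda>n. f n x)" "summable (\<lambda>n. f' n x)"
    using g x by (auto simp: sums_iff)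
  have "(g has_field_derivative (\<Sum>n. f' n x)) (at x)"
    using g x by (auto simp: sums_iff)
  then show "((\<lambda>x. \<Sum>n. f n x) has_field_derivative (\<Sum>n. f' n x)) (at x)"
    by (rule has_field_derivative_transform_within_open[OF _ assms(1) x]) (use g in \<open>auto simp: sums_iff\<close>)
qed

text \<open>Majorants of \<open>f n - 1\<close> near each point make the partial products converge
  uniformly on small closed balls; holomorphy of the product and termwise logarithmic
  differentiation both follow from this.\<close>

lemma holomorphic_prodinf_local:
  fixes f :: "nat \<Rightarrow> complex \<Rightarrow> complex"
  assumes S: "open S" and hol: "\<And>n. f n holomorphic_on S"
    and bd: "\<And>x. x \<in> S \<Longrightarrow> \<exists>d h. 0 < d \<and> summable h \<and> (\<forall>n. \<forall>y\<in>ball x d \<inter> S. norm (f n y - 1) \<le> h n)"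
  shows "\<And>x. x \<in> S \<Longrightarrow> convergent_prod (\<lambda>n. f n x)"
    and "(\<lambda>x. \<Prod>n. f n x) holomorphic_on S"
    and "\<And>x. x \<in> S \<Longrightarrow> (\<Prod>n. f n x) \<noteq> 0 \<Longrightarrow>
      (\<lambda>n. deriv (f n) x / f n x) sums (deriv (\<lambda>x. \<Prod>n. f n x) x / (\<Prod>n. f n x))"
proof -
  show conv: "convergent_prod (\<lambda>n. f n x)" if x: "x \<in> S" for x
  proof -
    obtain d h where d: "0 < d" and h: "summable h" "\<forall>n. \<forall>y\<in>ball x d \<inter> S. norm (f n y - 1) \<le> h n"
      using bd[OF x] by (elim exE conjE) (rule that)
    have "norm (norm (f n x - 1)) \<le> h n" for n
      using h(2)[rule_format, of x n] d x by simp
    then have "summable (\<lambda>n. norm (f n x - 1))"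
      by (intro summable_comparison_test'[OF h(1), of 0])
    then show ?thesis
      by (intro abs_convergent_prod_imp_convergent_prod summable_imp_abs_convergent_prod)
  qed
  have unif: "\<exists>d. 0 < d \<and> cball x d \<subseteq> S \<and>
      uniform_limit (cball x d) (\<lambda>N x. \<Prod>n<N. f n x) (\<lambda>x. \<Prod>n. f n x) sequentially" if x: "x \<in> S" for x
  proof -
    obtain d h where d: "0 < d" and h: "summable h" "\<forall>n. \<forall>y\<in>ball x d \<inter> S. norm (f n y - 1) \<le> h n"
      using bd[OF x] by (elim exE conjE) (rule that)
    have "open (ball x d \<inter> S)" "x \<in> ball x d \<inter> S" using S d x by auto
    then obtain e where e: "0 < e" "cball x e \<subseteq> ball x d \<inter> S"
      by (meson open_contains_cball)
    have "uniformly_convergent_on (cball x e) (\<lambda>N x. \<Prod>n<N. f n x)"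
    proof (rule uniformly_convergent_on_prod')
      show "continuous_on (cball x e) (f n)" for n
        using e(2) by (intro holomorphic_on_imp_continuous_on holomorphic_on_subset[OF hol]) auto
      show "uniformly_convergent_on (cball x e) (\<lambda>N x. \<Sum>n<N. norm (f n x - 1))"
        using h(2) e(2) by (intro Weierstrass_m_test'[OF _ h(1)]) (simp add: subset_iff)
    qed auto
    then obtain l where l: "uniform_limit (cball x e) (\<lambda>N x. \<Prod>n<N. f n x) l sequentially"
      unfolding uniformly_convergent_on_def ..
    have "uniform_limit (cball x e) (\<lambda>N x. \<Prod>n<N. f n x) (\<lambda>x. \<Prod>n. f n x) sequentially"
    proof (rule uniform_limit_cong'[THEN iffD1, OF _ _ l])
      fix y assume y: "y \<in> cball x e"
      have "(\<lambda>N. \<Prod>n<N. f n y) \<longlonglongrightarrow> l y"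
        using l y by (rule tendsto_uniform_limitI)
      moreover have "(\<lambda>N. \<Prod>n<N. f n y) \<longlonglongrightarrow> (\<Prod>n. f n y)"
        using conv[of y] y e(2) by (intro has_prod_imp_tendsto' convergent_prod_has_prod) auto
      ultimately show "l y = (\<Prod>n. f n y)"
        by (rule LIMSEQ_unique)
    qed auto
    with e show ?thesis by (intro exI[of _ e]) auto
  qed
  show "(\<lambda>x. \<Prod>n. f n x) holomorphic_on S"
    by (rule holomorphic_uniform_sequence[OF S _ unif]) (intro holomorphic_intros hol)
  fix x assume x: "x \<in> S" and nz: "(\<Prod>n. f n x) \<noteq> 0"
  obtain d where d: "0 < d" "cball x d \<subseteq> S"
      "uniform_limit (cball x d) (\<lambda>N x. \<Prod>n<N. f n x) (\<lambda>x. \<Prod>n. f n x) sequentially"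
    using unif[OF x] by (elim exE conjE) (rule that)
  show "(\<lambda>n. deriv (f n) x / f n x) sums (deriv (\<lambda>x. \<Prod>n. f n x) x / (\<Prod>n. f n x))"
  proof (rule logderiv_prodinf_complex_uniform_limit)
    show "uniform_limit (ball x d) (\<lambda>N x. \<Prod>n<N. f n x) (\<lambda>x. \<Prod>n. f n x) sequentially"
      using d(3) by (rule uniform_limit_on_subset) auto
    show "f k holomorphic_on ball x d" for k
      using d(2) by (intro holomorphic_on_subset[OF hol]) auto
  qed (use nz d in auto)
qed

lemma prodinf_eq_0_iff':
  fixes f :: "nat \<Rightarrow> complex"
  assumes "convergent_prod f"
  shows "(\<Prod>n. f n) = 0 \<longleftrightarrow> (\<exists>n. f n = 0)"
  using has_prod_eq_0_iff[OF convergent_prod_has_prod[OF assms]] by auto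

text \<open>The infinite \<open>q\<close>-Pochhammer symbol with base \<open>x\<close>.\<close>

definition qp :: "complex \<Rightarrow> complex \<Rightarrow> complex" where
  "qp x a = (\<Prod>n. 1 - a * x ^ n)"

lemma
  assumes "norm x < 1"
  shows convergent_prod_qp: "convergent_prod (\<lambda>n. 1 - a * x ^ n)"
    and holomorphic_qp: "qp x holomorphic_on UNIV"
proof -
  have bd: "\<exists>d h. 0 < d \<and> summable h \<and> (\<forall>n. \<forall>y\<in>ball a d \<inter> UNIV. norm ((1 - y * x ^ n) - 1) \<le> h n)" for a
  proof (intro exI conjI allI ballI)
    show "summable (\<lambda>n. (norm a + 1) * norm x ^ n)"
      using assms by (intro summable_mult summable_geometric) auto
    fix n y assume "y \<in> ball a 1 \<inter> UNIV"
    then have "norm y \<le> norm a + 1"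
      using norm_triangle_sub[of y a] by (auto simp: dist_norm norm_minus_commute)
    then show "norm ((1 - y * x ^ n) - 1) \<le> (norm a + 1) * norm x ^ n"
      by (auto simp: norm_mult norm_power intro!: mult_right_mono)
  qed auto
  have hol: "(\<lambda>a. 1 - a * x ^ n) holomorphic_on UNIV" for n
    by (intro holomorphic_intros)
  note * = holomorphic_prodinf_local[where f = "\<lambda>n a. 1 - a * x ^ n" and S = UNIV, OF open_UNIV hol bd]
  show "convergent_prod (\<lambda>n. 1 - a * x ^ n)"
    using *(1)[of a] by simp
  have "qp x = (\<lambda>a. \<Prod>n. 1 - a * x ^ n)"
    by (simp add: fun_eq_iff qp_def)
  with *(2) show "qp x holomorphic_on UNIV"
    by simp
qed

lemma holomorphic_qp' [holomorphic_intros]: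
  "norm x < 1 \<Longrightarrow> f holomorphic_on A \<Longrightarrow> (\<lambda>z. qp x (f z)) holomorphic_on A"
  using holomorphic_on_compose[of f A "qp x"] holomorphic_on_subset[OF holomorphic_qp, of x] by (simp add: o_def)

lemma qp_eq_0_iff: "norm x < 1 \<Longrightarrow> qp x a = 0 \<longleftrightarrow> (\<exists>n. a * x ^ n = 1)"
  unfolding qp_def by (subst prodinf_eq_0_iff'[OF convergent_prod_qp]) (auto simp: algebra_simps)

lemma qp_rec: assumes "norm x < 1" shows "qp x a = (1 - a) * qp x (a * x)"
proof (cases "a = 1")
  case True
  then show ?thesis using qp_eq_0_iff[OF assms, of a] by (simp add: exI[of _ 0])
next
  case False
  then have "(\<Prod>n. 1 - a * x ^ Suc n) = qp x a / (1 - a * x ^ 0)"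
    unfolding qp_def by (intro prodinf_split_head convergent_prod_qp assms) auto
  with False show ?thesis by (simp add: qp_def mult_ac)
qed

section \<open>The Weierstrass function\<close>

text \<open>The box reaches one full period from 0 in each direction: it contains the closed cell
  centred at 0, while 0 remains its only lattice point, so a single singularity has to be
  treated.\<close>

definition period_box :: "real \<Rightarrow> complex set" where
  "period_box l = {u. \<bar>Re u\<bar> < l \<and> \<bar>Im u\<bar> < 2 * pi}"

lemma period_box_altdef: "period_box l = box (Complex (-l) (-2 * pi)) (Complex l (2 * pi))"
  by (auto simp: period_box_def in_box_complex_iff)

lemma open_period_box: "open (period_box l)" and convex_period_box: "convex (period_box l)"
  by (simp_all add: period_box_altdef open_box convex_box)

lemma connected_period_box_minus: "connected (period_box l - {0})"
  by (intro connected_open_delete open_period_box convex_connected convex_period_box) auto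

text \<open>The condition \<open>lim\<close> removes the singularity at 0, and every point of the
  box is congruent to one of a compact cell inside it; the extension therefore attains its maximum
  modulus in the open box. This is Liouville's theorem for elliptic functions.\<close>

lemma doubly_periodic_const:
  fixes f :: "complex \<Rightarrow> complex"
  assumes l: "l > 0"
    and hol: "f holomorphic_on (period_box l - {0})"
    and lim: "((\<lambda>u. u * f u) \<longlongrightarrow> 0) (at 0)"
    and per: "\<And>u. f (u + of_real l) = f u" "\<And>u. f (u + 2 * of_real pi * \<i>) = f u"
  obtains c where "\<And>u. u \<in> period_box l \<Longrightarrow> u \<noteq> 0 \<Longrightarrow> f u = c"
proof -
  have 0: "0 \<in> period_box l" using l by (simp add: period_box_def)
  have "0 \<in> interior (period_box l)" using 0 open_period_box by (simp add: interior_open)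
  moreover have "((\<lambda>z. (z - 0) * f z) \<longlongrightarrow> 0) (at 0)" using lim by simp
  ultimately obtain g where g: "g holomorphic_on period_box l" "\<And>z. z \<in> period_box l \<Longrightarrow> z \<noteq> 0 \<Longrightarrow> g z = f z"
    using holomorphic_on_extend_lim[OF hol] by auto
  define K where "K = cbox (Complex (-l/2) (-pi)) (Complex (l/2) pi)"
  have K: "K \<subseteq> period_box l" "compact K" "0 \<in> K"
    using l by (auto simp: K_def in_cbox_complex_iff period_box_def abs_less_iff) (use pi_gt_zero in linarith)+
  have cont: "continuous_on K (\<lambda>z. norm (g z))"
    using g(1) K(1) by (intro continuous_intros holomorphic_on_imp_continuous_on) (rule holomorphic_on_subset)
  have "K \<noteq> {}" using K(3) by auto
  from continuous_attains_sup[OF K(2) this cont] obtain \<xi> where \<xi>: "\<xi> \<in> K" "\<And>z. z \<in> K \<Longrightarrow> norm (g z) \<le> norm (g \<xi>)"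
    by blast
  have pm: "f (u - of_real l) = f u" "f (u - 2 * of_real pi * \<i>) = f u" for u
    using per(1)[of "u - of_real l"] per(2)[of "u - 2 * of_real pi * \<i>"] by simp_all
  have max: "norm (g u) \<le> norm (g \<xi>)" if u: "u \<in> period_box l" for u
  proof (cases "u = 0")
    case True
    then show ?thesis using \<xi>(2) K(3) by simp
  next
    case False
    \<comment> \<open>Translation by at most one period in each direction moves \<open>u\<close>
      into the compact cell. As \<open>u\<close> is a nonzero point of the box, the translate is not
      0, so \<open>g\<close> and \<open>f\<close> agree there.\<close>
    define a where "a = (if Re u > l/2 then - l else if Re u < - l/2 then l else 0)"
    define b where "b = (if Im u > pi then - 2 * pi else if Im u < - pi then 2 * pi else 0)"
    define v where "v = u + of_real a"
    define w where "w = v + of_real b * \<i>"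
    have "f v = f u" using pm(1)[of u] per(1)[of u] by (auto simp: v_def a_def)
    moreover have "f w = f v" using pm(2)[of v] per(2)[of v] by (auto simp: w_def b_def)
    moreover have wK: "w \<in> K" using u by (auto simp: K_def in_cbox_complex_iff period_box_def w_def v_def a_def b_def)
    moreover have "w \<noteq> 0"
    proof
      assume "w = 0"
      then have "Re w = 0" "Im w = 0" by auto
      then have "Re u = - a" "Im u = - b" by (auto simp: w_def v_def)
      then have "Re u = 0" "Im u = 0" using u l by (auto simp: period_box_def a_def b_def split: if_splits)
      with False show False by (simp add: complex_eq_iff)
    qed
    ultimately have "g u = g w" using g(2) u False K(1) by auto
    then show ?thesis using \<xi>(2)[OF wK] by simp
  qed
  have "g constant_on period_box l"
    by (rule maximum_modulus_principle[OF g(1) open_period_box convex_connected[OF convex_period_box] open_period_box order_refl _ max])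
      (use \<xi>(1) K(1) in auto)
  then obtain c where "\<And>u. u \<in> period_box l \<Longrightarrow> g u = c" unfolding constant_on_def by auto
  then show thesis using g(2) that by metis
qed

text \<open>The Koebe function, the sum of n v^n for |v| < 1; its double pole at v = 1 supplies the
  poles of the Weierstrass function.\<close>

definition koebe :: "complex \<Rightarrow> complex" where "koebe v = v / (1 - v)\<^sup>2"

lemma koebe_exp_minus: "koebe (exp (- u)) = koebe (exp u)"
proof (cases "exp u = 1")
  case False
  have "(1 - exp (- u))\<^sup>2 = (1 - exp u)\<^sup>2 / (exp u)\<^sup>2"
    by (simp add: exp_minus field_simps power2_eq_square)
  with False show ?thesis
    by (simp add: koebe_def exp_minus field_simps power2_eq_square)
qed (simp add: koebe_def exp_minus)

lemma koebe_bound: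
  assumes "norm v \<le> r" "r < 1"
  shows "norm (koebe v) \<le> norm v / (1 - r)\<^sup>2"
proof -
  have "1 - r \<le> norm (1 - v)" using norm_triangle_ineq2[of 1 v] assms by simp
  then have "(1 - r)\<^sup>2 \<le> (norm (1 - v))\<^sup>2" using assms by (intro power_mono) auto
  moreover have "0 < (1 - r)\<^sup>2" using assms by simp
  ultimately show ?thesis
    unfolding koebe_def norm_divide norm_power by (intro divide_left_mono mult_pos_pos) auto
qed

lemma has_field_derivative_koebe_exp:
  assumes "exp u \<noteq> 1"
  shows "((\<lambda>u. koebe (exp u)) has_field_derivative exp u * (1 + exp u) / (1 - exp u)^3) (at u)"
proof -
  have "1 - exp u \<noteq> 0" using assms by simp
  then show ?thesis unfolding koebe_def
    by (auto intro!: derivative_eq_intros simp: divide_simps power2_eq_square power3_eq_cube) (simp add: algebra_simps)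
qed

text \<open>For k = 1/(4 sinh^2(u/2)) this is k'' = 6 k^2 + k, a degenerate Weierstrass equation.
  Its quadratic term is what later cancels the pole of order four in \<open>wp_ode\<close>.\<close>

lemma has_field_derivative_koebe_exp2:
  assumes "exp u \<noteq> 1"
  shows "((\<lambda>u. exp u * (1 + exp u) / (1 - exp u)^3) has_field_derivative 6 * (koebe (exp u))\<^sup>2 + koebe (exp u)) (at u)"
proof -
  have nz: "1 - exp u \<noteq> 0" using assms by simp
  have "((\<lambda>u. exp u * (1 + exp u) / (1 - exp u)^3) has_field_derivative
      ((exp u * (1 + exp u) + exp u * exp u) * (1 - exp u)^3 + 3 * (1 - exp u)^2 * exp u * (exp u * (1 + exp u))) / ((1 - exp u)^3)^2) (at u)"
    using nz by (auto intro!: derivative_eq_intros simp: power2_eq_square power3_eq_cube)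
  also have "((exp u * (1 + exp u) + exp u * exp u) * (1 - exp u)^3 + 3 * (1 - exp u)^2 * exp u * (exp u * (1 + exp u))) / ((1 - exp u)^3)^2
      = 6 * (koebe (exp u))\<^sup>2 + koebe (exp u)"
    using nz by (simp add: koebe_def divide_simps power2_eq_square power3_eq_cube) (simp add: algebra_simps)
  finally show ?thesis .
qed

text \<open>An even function vanishing at 0 vanishes there to second order, which absorbs the double
  pole of \<open>koebe (exp u)\<close>; the extra factor \<open>u\<close> gives the form required by
  \<open>doubly_periodic_const\<close>.\<close>

lemma tendsto_koebe_mult_even:
  assumes "open S" "0 \<in> S" "\<phi> holomorphic_on S" and even: "\<And>u. \<phi> (- u) = \<phi> u" and 0: "\<phi> 0 = 0"
  shows "((\<lambda>u. u * (koebe (exp u) * \<phi> u)) \<longlongrightarrow> 0) (at 0)"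
proof -
  define D where "D = deriv \<phi> 0"
  have D: "(\<phi> has_field_derivative D) (at 0)"
    unfolding D_def by (rule holomorphic_derivI[OF assms(3,1,2)])
  have "((\<lambda>u. \<phi> (- u)) has_field_derivative D * (-1)) (at 0)"
  proof -
    have "(\<phi> has_field_derivative D) (at (- 0))" using D by simp
    moreover have "((\<lambda>u::complex. - u) has_field_derivative - 1) (at 0)" by (auto intro!: derivative_eq_intros)
    ultimately show ?thesis using DERIV_chain2[of \<phi> D "\<lambda>u. - u" 0 "-1" UNIV] by simp
  qed
  then have "(\<phi> has_field_derivative - D) (at 0)" by (simp add: even)
  from DERIV_unique[OF D this] have "D = 0" by (simp add: eq_neg_iff_add_eq_0)
  with D 0 have 1: "((\<lambda>u. \<phi> u / u) \<longlongrightarrow> 0) (at 0)" by (simp add: DERIV_def)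
  have "(exp has_field_derivative 1) (at (0::complex))" using DERIV_exp[of 0] by simp
  then have e: "((\<lambda>u::complex. (exp u - 1) / u) \<longlongrightarrow> 1) (at 0)" by (simp add: DERIV_def)
  have "((\<lambda>u. exp u / ((exp u - 1) / u)\<^sup>2 * (\<phi> u / u)) \<longlongrightarrow> exp 0 / 1\<^sup>2 * 0) (at (0::complex))"
    by (intro tendsto_intros e 1) auto
  then have "((\<lambda>u. exp u / ((exp u - 1) / u)\<^sup>2 * (\<phi> u / u)) \<longlongrightarrow> 0) (at 0)" by simp
  moreover have "\<forall>\<^sub>F u in at 0. exp u / ((exp u - 1) / u)\<^sup>2 * (\<phi> u / u) = u * (koebe (exp u) * \<phi> u)"
  proof (simp add: eventually_at_filter, rule always_eventually, intro allI impI)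
    fix u :: complex assume u: "u \<noteq> 0"
    have "(1 - exp u)\<^sup>2 = (exp u - 1)\<^sup>2" by (simp add: power2_commute)
    then show "exp u * \<phi> u / (((exp u - 1) / u)\<^sup>2 * u) = u * (koebe (exp u) * \<phi> u)"
      using u by (simp add: koebe_def power_divide power2_eq_square)
  qed
  ultimately show ?thesis
    by (rule Lim_transform_eventually)
qed

text \<open>Up to an additive constant, \<open>wp l\<close> is the Weierstrass function of the lattice with periods
  \<open>l\<close> and \<open>2\<pi>\<i>\<close>: as \<open>koebe (exp u) = 1 / (4 sinh\<^sup>2 (u/2))\<close>, the sum over the period \<open>2\<pi>\<i>\<close> is already done.\<close>

definition wsum :: "real \<Rightarrow> complex \<Rightarrow> complex" where
  "wsum l u = (\<Sum>n. koebe (exp (u - of_real (l * real (Suc n)))))"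

definition wp :: "real \<Rightarrow> complex \<Rightarrow> complex" where
  "wp l u = koebe (exp u) + wsum l u + wsum l (- u)"

lemma norm_exp_shift: "norm (exp (u - of_real (l * real (Suc n)))) = exp (Re u) * exp (- l) * exp (- l) ^ n"
proof -
  have "exp (- l) ^ n = exp (- (l * real n))" by (simp add: exp_of_nat_mult[symmetric] mult.commute)
  then show ?thesis by (simp add: norm_exp_eq_Re exp_add[symmetric] algebra_simps)
qed

lemma koebe_shift_bound:
  assumes "l > 0" "Re u \<le> r" "r < l"
  shows "norm (koebe (exp (u - of_real (l * real (Suc n))))) \<le>
           exp r * exp (- l) / (1 - exp (r - l))\<^sup>2 * exp (- l) ^ n"
proof -
  let ?v = "exp (u - of_real (l * real (Suc n)))"
  have a: "norm ?v \<le> exp r * exp (- l) * exp (- l) ^ n"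
    unfolding norm_exp_shift using assms by (intro mult_right_mono) auto
  also have "\<dots> \<le> exp r * exp (- l) * 1"
    using assms by (intro mult_left_mono power_le_one) auto
  finally have "norm ?v \<le> exp (r - l)" by (simp add: exp_diff exp_minus field_simps)
  moreover have "exp (r - l) < 1" using assms by simp
  ultimately have "norm (koebe ?v) \<le> norm ?v / (1 - exp (r - l))\<^sup>2" by (rule koebe_bound)
  also have "\<dots> \<le> exp r * exp (- l) * exp (- l) ^ n / (1 - exp (r - l))\<^sup>2"
    by (intro divide_right_mono a) auto
  finally show ?thesis by simp
qed

lemma summable_geometric_exp: "l > 0 \<Longrightarrow> summable (\<lambda>n. c * exp (- l) ^ n :: real)"
  by (intro summable_mult summable_geometric) auto

lemma summable_wsum_aux:
  assumes "l > 0" "Re u < l"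
  shows "summable (\<lambda>n. koebe (exp (u - of_real (l * real (Suc n)))))"
  using koebe_shift_bound[OF assms(1) order_refl assms(2)]
  by (intro summable_comparison_test'[OF summable_geometric_exp[OF assms(1)], of 0])

text \<open>Shifting \<open>u\<close> drops finitely many terms. A pole among them contributes 0, as
  division by zero does, so that summability and the functional equations below hold at every
  \<open>u\<close>.\<close>

lemma summable_wsum:
  assumes l: "l > 0"
  shows "summable (\<lambda>n. koebe (exp (u - of_real (l * real (Suc n)))))"
proof -
  obtain N :: nat where "Re u / l < real N" using reals_Archimedean2 by blast
  then have "Re (u - of_real (l * real N)) < l" using l by (simp add: field_simps)
  from summable_wsum_aux[OF l this] have "summable (\<lambda>n. koebe (exp (u - of_real (l * real (Suc (n + N))))))"
    by (simp add: algebra_simps)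
  then show ?thesis using summable_iff_shift[of "\<lambda>n. koebe (exp (u - of_real (l * real (Suc n))))" N] by simp
qed

lemma wsum_shift:
  assumes "l > 0"
  shows "wsum l (u + of_real l) = koebe (exp u) + wsum l u"
proof -
  have *: "u + of_real l - of_real (l * real (Suc n)) = u - of_real (l * real n)" for n
    by (simp add: algebra_simps)
  have "summable (\<lambda>n. koebe (exp (u - of_real (l * real n))))"
    using summable_wsum[OF assms, of "u + of_real l"] by (simp only: *)
  from suminf_split_head[OF this] show ?thesis
    unfolding wsum_def * by simp
qed

lemma wp_minus: "wp l (- u) = wp l u"
  by (simp add: wp_def koebe_exp_minus)

lemma wp_periodic: assumes "l > 0" shows "wp l (u + of_real l) = wp l u"
proof -
  have "wsum l (- u) = koebe (exp (- u - of_real l)) + wsum l (- u - of_real l)"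
    using wsum_shift[OF assms, of "- u - of_real l"] by simp
  moreover have "koebe (exp (- u - of_real l)) = koebe (exp (u + of_real l))"
    using koebe_exp_minus[of "u + of_real l"] by simp
  ultimately show ?thesis
    using wsum_shift[OF assms, of u] by (simp add: wp_def)
qed

lemma exp_plus_2pii: "exp (u + 2 * of_real pi * \<i>) = exp u"
  by (simp add: exp_add)

lemma wsum_2pii: "wsum l (u + 2 * of_real pi * \<i>) = wsum l u"
proof -
  have "exp (u + 2 * of_real pi * \<i> - a) = exp (u - a)" for a
    by (metis exp_plus_2pii diff_add_eq)
  then show ?thesis by (simp add: wsum_def)
qed

lemma wp_periodic': "wp l (u + 2 * of_real pi * \<i>) = wp l u"
proof -
  have "wsum l (- u) = wsum l (- (u + 2 * of_real pi * \<i>) + 2 * of_real pi * \<i>)" by simp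
  also have "\<dots> = wsum l (- (u + 2 * of_real pi * \<i>))" by (rule wsum_2pii)
  finally show ?thesis by (simp only: wp_def exp_plus_2pii wsum_2pii)
qed

text \<open>The poles of the first term lie on Re u = l and those of the others further right.
  Applied to \<open>u\<close> and \<open>- u\<close>, this half plane covers the period box.\<close>

lemma holomorphic_wsum:
  assumes l: "l > 0"
  shows "wsum l holomorphic_on {u. Re u < l}"
proof -
  have op: "open {u. Re u < l}" by (simp add: open_halfspace_Re_lt)
  have der: "((\<lambda>u. koebe (exp (u - of_real (l * real (Suc n))))) has_field_derivative
      deriv (\<lambda>u. koebe (exp (u - of_real (l * real (Suc n))))) u) (at u)" if "u \<in> {u. Re u < l}" for u n
  proof -
    have "norm (exp (u - of_real (l * real (Suc n)))) < 1"
    proof -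
      have "l * 1 \<le> l * real (Suc n)" using l by (intro mult_left_mono) auto
      with that have "Re u - l * real (Suc n) < 0" by simp
      then show ?thesis unfolding norm_exp_eq_Re by (simp del: of_nat_Suc)
    qed
    then have "exp (u - of_real (l * real (Suc n))) \<noteq> 1" by (metis less_irrefl norm_one)
    from has_field_derivative_koebe_exp[OF this]
    have "((\<lambda>v. koebe (exp (v - of_real (l * real (Suc n))))) has_field_derivative
       (exp (u - of_real (l * real (Suc n))) * (1 + exp (u - of_real (l * real (Suc n)))) / (1 - exp (u - of_real (l * real (Suc n))))^3) * 1) (at u)"
      by (rule DERIV_chain2) (auto intro!: derivative_eq_intros)
    then show ?thesis using DERIV_imp_deriv by metis
  qed
  have "wsum l field_differentiable at u" if u: "Re u < l" for u
  proof -
    have "((\<lambda>u. \<Sum>n. koebe (exp (u - of_real (l * real (Suc n))))) has_field_derivative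
      (\<Sum>n. deriv (\<lambda>u. koebe (exp (u - of_real (l * real (Suc n))))) u)) (at u)"
    proof (rule suminf_has_field_derivative_local(3)[OF op der])
      fix x assume "x \<in> {u. Re u < l}"
      then have x: "Re x < l" by simp
      define r where "r = (Re x + l) / 2"
      have r: "Re x < r" "r < l" using x by (auto simp: r_def)
      have "Re y \<le> r" if "y \<in> ball x (r - Re x) \<inter> {u. Re u < l}" for y
        using that abs_Re_le_cmod[of "y - x"] by (auto simp: dist_norm norm_minus_commute)
      note bd = koebe_shift_bound[OF l this r(2)]
      show "\<exists>d h. 0 < d \<and> summable h \<and> (\<forall>n. \<forall>y\<in>ball x d \<inter> {u. Re u < l}. norm (koebe (exp (y - of_real (l * real (Suc n))))) \<le> h n)"
      proof (intro exI conjI allI ballI)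
        show "0 < r - Re x" using r(1) by simp
        show "summable (\<lambda>n. exp r * exp (- l) / (1 - exp (r - l))\<^sup>2 * exp (- l) ^ n)"
          by (rule summable_geometric_exp[OF l])
      qed (rule bd)
    qed (use u in auto)
    then show ?thesis unfolding wsum_def field_differentiable_def by auto
  qed
  then show ?thesis by (simp add: holomorphic_on_def field_differentiable_at_within)
qed

lemma exp_eq_1_period_box: "u \<in> period_box l \<Longrightarrow> exp u = 1 \<longleftrightarrow> u = 0"
proof
  assume u: "u \<in> period_box l" and "exp u = 1"
  then obtain n where n: "Re u = 0" "Im u = of_int (2 * n) * pi" by (auto simp: exp_eq_1)
  then have "\<bar>of_int n :: real\<bar> < 1" using u by (auto simp: period_box_def abs_mult)
  then have "n = 0" by linarith
  with n show "u = 0" by (simp add: complex_eq_iff)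
qed simp

text \<open>The part of \<open>wp\<close> that stays regular at 0: in the period box only the term
  \<open>koebe (exp u)\<close> has a pole.\<close>

definition wreg :: "real \<Rightarrow> complex \<Rightarrow> complex" where "wreg l u = wsum l u + wsum l (- u)"

lemma wreg_holomorphic: assumes "l > 0" shows "wreg l holomorphic_on period_box l"
proof -
  have "wsum l holomorphic_on period_box l"
    by (rule holomorphic_on_subset[OF holomorphic_wsum[OF assms]]) (auto simp: period_box_def)
  moreover have "(wsum l \<circ> uminus) holomorphic_on period_box l"
    by (rule holomorphic_on_compose_gen[OF _ holomorphic_wsum[OF assms]]) (auto simp: period_box_def intro!: holomorphic_intros)
  ultimately show ?thesis unfolding wreg_def[abs_def] by (intro holomorphic_intros) (simp_all add: o_def)
qed

lemma wreg_minus: "wreg l (- u) = wreg l u" by (simp add: wreg_def)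

lemma wp_eq_wreg: "wp l u = koebe (exp u) + wreg l u" by (simp add: wp_def wreg_def)

lemma wp_holomorphic: assumes "l > 0" shows "wp l holomorphic_on (period_box l - {0})"
proof -
  have "(\<lambda>u. koebe (exp u)) holomorphic_on (period_box l - {0})"
    unfolding koebe_def by (intro holomorphic_intros) (auto simp: exp_eq_1_period_box)
  moreover have "wreg l holomorphic_on (period_box l - {0})"
    using wreg_holomorphic[OF assms] by (rule holomorphic_on_subset) auto
  ultimately show ?thesis unfolding wp_eq_wreg[abs_def] by (intro holomorphic_intros)
qed

section \<open>Differential equations of the Weierstrass function\<close>

lemma deriv_periodic:
  assumes "\<And>u::complex. f (u + p) = f u"
  shows "deriv f (u + p) = deriv f u"
proof -
  have "(f has_field_derivative D) (at (u + p)) \<longleftrightarrow> (f has_field_derivative D) (at u)" for D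
    using DERIV_shift[of f D u p] assms by simp
  then show ?thesis unfolding deriv_def by simp
qed

lemma tendsto_mult_self_0:
  assumes "f holomorphic_on S" "open S" "0 \<in> S"
  shows "((\<lambda>u::complex. u * f u) \<longlongrightarrow> 0) (at 0)"
proof -
  have "isCont f 0"
    using assms holomorphic_on_imp_continuous_on continuous_on_eq_continuous_at by metis
  then have "((\<lambda>u. u * f u) \<longlongrightarrow> 0 * f 0) (at 0)"
    by (intro tendsto_intros) (simp add: isCont_def)
  then show ?thesis by simp
qed

lemma wp_derivs:
  assumes l: "l > 0" and u: "u \<in> period_box l - {0}"
  shows "(wp l has_field_derivative exp u * (1 + exp u) / (1 - exp u)^3 + deriv (wreg l) u) (at u)"
    and "(deriv (wp l) has_field_derivative 6 * (koebe (exp u))\<^sup>2 + koebe (exp u) + deriv (deriv (wreg l)) u) (at u)"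
proof -
  have op: "open (period_box l - {0})" using open_period_box by (intro open_delete)
  note r = wreg_holomorphic[OF l]
  have d: "(wp l has_field_derivative exp u * (1 + exp u) / (1 - exp u)^3 + deriv (wreg l) u) (at u)"
    if u: "u \<in> period_box l - {0}" for u
    unfolding wp_eq_wreg[abs_def]
    by (rule DERIV_add[OF has_field_derivative_koebe_exp holomorphic_derivI[OF r open_period_box]])
       (use u exp_eq_1_period_box in auto)
  show "(wp l has_field_derivative exp u * (1 + exp u) / (1 - exp u)^3 + deriv (wreg l) u) (at u)"
    by (rule d[OF u])
  have dd: "((\<lambda>u. exp u * (1 + exp u) / (1 - exp u)^3 + deriv (wreg l) u) has_field_derivative
      6 * (koebe (exp u))\<^sup>2 + koebe (exp u) + deriv (deriv (wreg l)) u) (at u)"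
    by (rule DERIV_add[OF has_field_derivative_koebe_exp2 holomorphic_derivI[OF holomorphic_deriv[OF r open_period_box] open_period_box]])
       (use u exp_eq_1_period_box in auto)
  show "(deriv (wp l) has_field_derivative 6 * (koebe (exp u))\<^sup>2 + koebe (exp u) + deriv (deriv (wreg l)) u) (at u)"
    by (rule has_field_derivative_transform_within_open[OF dd op u]) (use DERIV_imp_deriv[OF d] in simp)
qed

text \<open>Near 0 write wp = k + r with k = \<open>koebe (exp u)\<close>. Since k'' = 6 k^2 + k,
  the coefficient \<open>1 - 12 * r0\<close> is the one for which \<open>H\<close> retains only the
  singular term -12 k (r - r(0)), and this is harmless because r is even. So \<open>H\<close> is
  constant.\<close>

lemma wp_ode:
  assumes l: "l > 0"
  obtains a b where "\<And>u. u \<in> period_box l - {0} \<Longrightarrow> deriv (deriv (wp l)) u = 6 * (wp l u)\<^sup>2 + a * wp l u + b"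
proof -
  define r0 where "r0 = wreg l 0"
  define H where "H = (\<lambda>u. deriv (deriv (wp l)) u - 6 * (wp l u)\<^sup>2 - (1 - 12 * r0) * wp l u)"
  define G where "G = (\<lambda>u. deriv (deriv (wreg l)) u - wreg l u - 6 * (wreg l u)\<^sup>2 + 12 * r0 * wreg l u)"
  have 0: "0 \<in> period_box l" using l by (simp add: period_box_def)
  have op: "open (period_box l - {0})" using open_period_box by (intro open_delete)
  have hol: "H holomorphic_on (period_box l - {0})"
    unfolding H_def by (intro holomorphic_intros holomorphic_deriv op wp_holomorphic l)
  have Ghol: "G holomorphic_on period_box l"
    unfolding G_def by (intro holomorphic_intros holomorphic_deriv open_period_box wreg_holomorphic l)
  have eq: "H u = G u + (-12) * (koebe (exp u) * (wreg l u - r0))" if "u \<in> period_box l - {0}" for u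
    unfolding H_def G_def DERIV_imp_deriv[OF wp_derivs(2)[OF l that]]
    by (simp add: wp_eq_wreg algebra_simps power2_eq_square)
  have "((\<lambda>u. u * G u + (-12) * (u * (koebe (exp u) * (wreg l u - r0)))) \<longlongrightarrow> 0 + (-12) * 0) (at 0)"
    by (intro tendsto_intros tendsto_mult_self_0[OF Ghol open_period_box 0]
        tendsto_koebe_mult_even[OF open_period_box 0])
      (auto intro!: holomorphic_intros wreg_holomorphic l simp: wreg_minus r0_def)
  then have "((\<lambda>u. u * H u) \<longlongrightarrow> 0 + (-12) * 0) (at 0)"
  proof (rule Lim_transform_eventually)
    have "\<forall>\<^sub>F u in at 0. u \<in> period_box l - {0}"
      using open_period_box 0 by (auto simp: eventually_at_topological)
    then show "\<forall>\<^sub>F u in at 0. u * G u + (-12) * (u * (koebe (exp u) * (wreg l u - r0))) = u * H u"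
    proof eventually_elim
      case (elim u)
      show ?case unfolding eq[OF elim] by (simp add: algebra_simps)
    qed
  qed
  then have lim: "((\<lambda>u. u * H u) \<longlongrightarrow> 0) (at 0)" by simp
  have per: "H (u + of_real l) = H u" "H (u + 2 * of_real pi * \<i>) = H u" for u
    using wp_periodic[OF l, of u] wp_periodic'[of l u]
      deriv_periodic[of "deriv (wp l)" "of_real l" u] deriv_periodic[of "wp l" "of_real l"] wp_periodic[OF l]
      deriv_periodic[of "deriv (wp l)" "2 * of_real pi * \<i>" u] deriv_periodic[of "wp l" "2 * of_real pi * \<i>"] wp_periodic'[of l]
    by (simp_all add: H_def)
  obtain c where c: "\<And>u. u \<in> period_box l \<Longrightarrow> u \<noteq> 0 \<Longrightarrow> H u = c"
    by (rule doubly_periodic_const[OF l hol lim per]) (rule that)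
  show thesis
  proof (rule that)
    fix u assume "u \<in> period_box l - {0}"
    then have "H u = c" using c by auto
    then show "deriv (deriv (wp l)) u = 6 * (wp l u)\<^sup>2 + (1 - 12 * r0) * wp l u + c"
      unfolding H_def by (simp add: algebra_simps) 
  qed
qed

text \<open>Multiplying the second order equation by 2 wp' makes it a total derivative; the
  punctured box is connected, so the integration constant is the same throughout.\<close>

lemma wp_first_integral:
  assumes l: "l > 0"
    and ode: "\<And>u. u \<in> period_box l - {0} \<Longrightarrow> deriv (deriv (wp l)) u = 6 * (wp l u)\<^sup>2 + a * wp l u + b"
  obtains d where "\<And>u. u \<in> period_box l - {0} \<Longrightarrow> (deriv (wp l) u)\<^sup>2 = 4 * (wp l u)^3 + a * (wp l u)\<^sup>2 + 2 * b * wp l u + d"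
proof -
  have op: "open (period_box l - {0})" using open_period_box by (intro open_delete)
  define I where "I = (\<lambda>u. (deriv (wp l) u)\<^sup>2 - 4 * (wp l u)^3 - a * (wp l u)\<^sup>2 - 2 * b * wp l u)"
  have D: "(I has_field_derivative 0) (at u)" if u: "u \<in> period_box l - {0}" for u
  proof -
    note [derivative_intros] = holomorphic_derivI[OF wp_holomorphic[OF l] op u]
      holomorphic_derivI[OF holomorphic_deriv[OF wp_holomorphic[OF l] op] op u]
    show ?thesis unfolding I_def
      by (rule derivative_eq_intros refl)+ (simp add: ode[OF u] algebra_simps power2_eq_square power3_eq_cube)
  qed
  have "I holomorphic_on (period_box l - {0})"
    using D by (auto simp: holomorphic_on_open[OF op])
  then have cont: "continuous_on (period_box l - {0}) I" by (rule holomorphic_on_imp_continuous_on)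
  obtain c where "\<And>u. u \<in> period_box l - {0} \<Longrightarrow> I u = c"
    using DERIV_zero_connected_constant[OF connected_period_box_minus op finite.emptyI cont] D by (metis Diff_empty)
  then show thesis
    using that[of c] unfolding I_def by (simp add: algebra_simps)
qed

text \<open>Evenness and the period \<open>2 * w\<close> make \<open>wp\<close> symmetric about
  \<open>w\<close>, so its derivative there equals its own negative.\<close>

lemma deriv_wp_half_period:
  assumes l: "l > 0" and u: "w \<in> period_box l - {0}" and per: "\<And>u. wp l (u + 2 * w) = wp l u"
  shows "deriv (wp l) w = 0"
proof -
  have D: "(wp l has_field_derivative deriv (wp l) w) (at w)"
    using open_period_box by (intro holomorphic_derivI[OF wp_holomorphic[OF l] _ u] open_delete)
  have "(wp l has_field_derivative deriv (wp l) w) (at (2 * w - w))" using D by simp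
  moreover have "((\<lambda>x. 2 * w - x) has_field_derivative - 1) (at w)" by (auto intro!: derivative_eq_intros)
  ultimately have "((\<lambda>x. wp l (2 * w - x)) has_field_derivative - deriv (wp l) w) (at w)"
    using DERIV_chain2[of "wp l" "deriv (wp l) w" "\<lambda>x. 2 * w - x" w "-1" UNIV] by simp
  moreover have "wp l (2 * w - x) = wp l x" for x
    using per[of "- x"] wp_minus[of l x] by simp
  ultimately have "(wp l has_field_derivative - deriv (wp l) w) (at w)" by simp
  from DERIV_unique[OF D this] show ?thesis by (simp add: eq_neg_iff_add_eq_0)
qed

text \<open>Up to an exponential factor, \<open>sg l\<close> is the Weierstrass sigma function; \<open>sv\<close> is \<open>sg\<close> with the factor
  vanishing at 0 removed.\<close>

definition sg :: "real \<Rightarrow> complex \<Rightarrow> complex" where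
  "sg l u = qp (exp (- of_real l)) (exp u) * qp (exp (- of_real l)) (exp (- u - of_real l))"

definition sv :: "real \<Rightarrow> complex \<Rightarrow> complex" where
  "sv l u = qp (exp (- of_real l)) (exp (u - of_real l)) * qp (exp (- of_real l)) (exp (- u - of_real l))"

lemma norm_exp_minus_less_1: "l > 0 \<Longrightarrow> norm (exp (- of_real l :: complex)) < 1"
  by (simp add: norm_exp_eq_Re)

lemma qp_exp_rec: "l > 0 \<Longrightarrow> qp (exp (- of_real l)) (exp u) = (1 - exp u) * qp (exp (- of_real l)) (exp (u - of_real l))"
  using qp_rec[OF norm_exp_minus_less_1, of l "exp u"] by (simp add: exp_diff exp_minus divide_inverse)

lemma sg_eq_sv: "l > 0 \<Longrightarrow> sg l u = (1 - exp u) * sv l u"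
  unfolding sg_def sv_def by (subst qp_exp_rec) simp_all

lemma sv_minus: "sv l (- u) = sv l u"
  by (simp add: sv_def)

lemma sg_minus: "l > 0 \<Longrightarrow> sg l (- u) = - exp (- u) * sg l u"
  by (simp add: sg_eq_sv sv_minus exp_minus field_simps)

lemma sg_2pii: "sg l (u + 2 * of_real pi * \<i>) = sg l u"
proof -
  have "exp (- (u + 2 * of_real pi * \<i>) - of_real l) = exp (- u - of_real l)"
    using exp_plus_2pii[of "- (u + 2 * of_real pi * \<i>) - of_real l"] by (simp add: algebra_simps)
  then show ?thesis unfolding sg_def exp_plus_2pii by (simp only:)
qed

lemma sg_shift:
  assumes "l > 0"
  shows "sg l (u + of_real l) = - exp (u + of_real l) * sg l u"
proof -
  define w where "w = u + of_real l"
  have 1: "sg l w = (1 - exp w) * (qp (exp (- of_real l)) (exp u) * qp (exp (- of_real l)) (exp (- w - of_real l)))"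
    using sg_eq_sv[OF assms, of w] by (simp add: sv_def w_def)
  have "sg l u = qp (exp (- of_real l)) (exp u) * qp (exp (- of_real l)) (exp (- w))"
    by (simp add: sg_def w_def)
  then have 2: "sg l u = (1 - exp (- w)) * (qp (exp (- of_real l)) (exp u) * qp (exp (- of_real l)) (exp (- w - of_real l)))"
    by (simp add: qp_exp_rec[OF assms, of "- w"])
  have "sg l w = - exp w * sg l u" unfolding 1 2 by (simp add: exp_minus field_simps)
  then show ?thesis by (simp add: w_def)
qed

lemma holomorphic_sg: "l > 0 \<Longrightarrow> sg l holomorphic_on A"
  unfolding sg_def[abs_def] by (intro holomorphic_intros norm_exp_minus_less_1)

lemma holomorphic_sv: "l > 0 \<Longrightarrow> sv l holomorphic_on A"
  unfolding sv_def[abs_def] by (intro holomorphic_intros norm_exp_minus_less_1)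

lemma qp_nonzero:
  assumes "l > 0" "norm a < 1"
  shows "qp (exp (- of_real l)) a \<noteq> 0"
proof
  assume "qp (exp (- of_real l)) a = 0"
  then obtain n where "a * exp (- of_real l) ^ n = 1"
    using qp_eq_0_iff[OF norm_exp_minus_less_1[OF assms(1)]] by blast
  then have "norm a * norm (exp (- of_real l :: complex)) ^ n = 1"
    by (metis norm_mult norm_power norm_one)
  moreover have "norm (exp (- of_real l :: complex)) ^ n \<le> 1"
    using norm_exp_minus_less_1[OF assms(1)] by (intro power_le_one) auto
  ultimately have "1 \<le> norm a * 1" by (metis mult_left_mono norm_ge_zero)
  with assms(2) show False by simp
qed

lemma sv_nonzero: "l > 0 \<Longrightarrow> \<bar>Re u\<bar> < l \<Longrightarrow> sv l u \<noteq> 0"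
  unfolding sv_def by (simp add: qp_nonzero norm_exp_eq_Re)

lemma sg_eq_0_iff: "l > 0 \<Longrightarrow> \<bar>Re u\<bar> < l \<Longrightarrow> sg l u = 0 \<longleftrightarrow> exp u = 1"
  by (auto simp: sg_eq_sv sv_nonzero)

text \<open>The classical sigma quotient for wp(u) - wp(a). The exponential multipliers of
  \<open>sg\<close> under the period \<open>l\<close> cancel in the quotient, so both sides are
  elliptic, and \<open>c\<close> is normalised to match the double poles at 0. The remaining
  constant is read off at u = a, where the quotient vanishes.\<close>

lemma wp_diff:
  assumes l: "l > 0" and a: "a \<in> period_box l - {0}" and u: "u \<in> period_box l - {0}"
  shows "wp l u - wp l a = - ((sv l 0)\<^sup>2 * exp a / (sg l a)\<^sup>2) * (sg l (u + a) * sg l (u - a) / (sg l u)\<^sup>2)"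
proof -
  have Re: "\<bar>Re v\<bar> < l" if "v \<in> period_box l" for v using that by (simp add: period_box_def)
  have nz: "sg l v \<noteq> 0" if "v \<in> period_box l - {0}" for v
    using that sg_eq_0_iff[OF l Re] exp_eq_1_period_box by auto
  define c where "c = - ((sv l 0)\<^sup>2 * exp a / (sg l a)\<^sup>2)"
  define N where "N = (\<lambda>u. exp (- u) * (sg l (u + a) * sg l (u - a)) / (sv l u)\<^sup>2)"
  define F where "F = (\<lambda>u. sg l (u + a) * sg l (u - a) / (sg l u)\<^sup>2)"
  define H where "H = (\<lambda>u. wp l u - c * F u)"
  have 0: "0 \<in> period_box l" using l by (simp add: period_box_def)
  note [holomorphic_intros] = holomorphic_on_compose_gen[OF _ holomorphic_sg[OF l, of UNIV], unfolded o_def]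
  have hol1: "(\<lambda>u. sg l (u + a)) holomorphic_on A" "(\<lambda>u. sg l (u - a)) holomorphic_on A" for A
    by (intro holomorphic_intros; simp)+
  have hol: "H holomorphic_on (period_box l - {0})"
    unfolding H_def F_def using nz
    by (intro holomorphic_intros hol1 wp_holomorphic holomorphic_sg l) auto
  have FN: "F u = koebe (exp u) * N u" for u
    by (simp add: F_def N_def koebe_def sg_eq_sv[OF l, of u] exp_minus power_mult_distrib divide_simps)
  have Nhol: "N holomorphic_on period_box l"
    unfolding N_def using sv_nonzero[OF l Re]
    by (intro holomorphic_intros hol1 holomorphic_sv l) auto
  have Nminus: "N (- u) = N u" for u
  proof -
    have "sg l (- u + a) = - exp (- (u - a)) * sg l (u - a)" "sg l (- u - a) = - exp (- (u + a)) * sg l (u + a)"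
      using sg_minus[OF l, of "u - a"] sg_minus[OF l, of "u + a"] by simp_all
    then have "N (- u) = (exp u * exp (- (u - a)) * exp (- (u + a))) * (sg l (u + a) * sg l (u - a)) / (sv l u)\<^sup>2"
      by (simp add: N_def sv_minus mult_ac)
    also have "exp u * exp (- (u - a)) * exp (- (u + a)) = exp (- u)"
      by (simp add: exp_add[symmetric])
    finally show ?thesis by (simp add: N_def)
  qed
  \<comment> \<open>The normalisation of \<open>c\<close>: now \<open>1 - c * N u\<close> is even
    and vanishes at 0, so the double poles cancel.\<close>
  have N0: "c * N 0 = 1"
    using nz[OF a] sv_nonzero[OF l, of 0] l
    by (simp add: c_def N_def sg_minus[OF l, of a] exp_minus field_simps power2_eq_square)
  have "((\<lambda>u. u * wreg l u + u * (koebe (exp u) * (1 - c * N u))) \<longlongrightarrow> 0 + 0) (at 0)"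
    by (intro tendsto_intros tendsto_mult_self_0[OF wreg_holomorphic[OF l] open_period_box 0]
        tendsto_koebe_mult_even[OF open_period_box 0])
      (auto intro!: holomorphic_intros Nhol simp: Nminus N0)
  then have lim: "((\<lambda>u. u * H u) \<longlongrightarrow> 0) (at 0)"
    by (simp add: H_def FN wp_eq_wreg algebra_simps)
  have per1: "H (u + of_real l) = H u" for u
  proof -
    have "sg l (u + of_real l + a) = - exp (u + a + of_real l) * sg l (u + a)"
         "sg l (u + of_real l - a) = - exp (u - a + of_real l) * sg l (u - a)"
         "sg l (u + of_real l) = - exp (u + of_real l) * sg l u"
      using sg_shift[OF l, of "u + a"] sg_shift[OF l, of "u - a"] sg_shift[OF l, of u] by (simp_all add: algebra_simps)
    then have "F (u + of_real l) = (exp (u + a + of_real l) * exp (u - a + of_real l) / (exp (u + of_real l))\<^sup>2) * F u"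
      by (simp add: F_def power_mult_distrib mult_ac)
    also have "exp (u + a + of_real l) * exp (u - a + of_real l) / (exp (u + of_real l))\<^sup>2 = 1"
      by (simp add: exp_add[symmetric] power2_eq_square)
    finally show ?thesis by (simp add: H_def wp_periodic[OF l])
  qed
  have per2: "H (u + 2 * of_real pi * \<i>) = H u" for u
    using sg_2pii[of l "u + a"] sg_2pii[of l "u - a"] sg_2pii[of l u] wp_periodic'[of l u]
    by (simp add: H_def F_def algebra_simps)
  obtain k where "\<And>u. u \<in> period_box l \<Longrightarrow> u \<noteq> 0 \<Longrightarrow> H u = k"
    by (rule doubly_periodic_const[OF l hol lim per1 per2]) (rule that)
  then have "H u = H a" using a u by auto
  moreover have "F a = 0" using sg_eq_sv[OF l, of 0] by (simp add: F_def)
  ultimately have "wp l u - wp l a = c * F u" by (simp add: H_def algebra_simps)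
  then show ?thesis by (simp only: c_def F_def)
qed

section \<open>Complete elliptic integrals as half periods\<close>

definition rellK :: "real \<Rightarrow> real" where
  "rellK t = integral {0..pi/2} (\<lambda>x. 1 / sqrt (1 - t * (sin x)\<^sup>2))"

lemma sin_sq_less_1: "t < 1 \<Longrightarrow> 0 < 1 - t * (sin x)\<^sup>2" for t :: real
proof -
  assume t: "t < 1"
  have "t * (sin x)\<^sup>2 \<le> max t 0 * 1"
    by (intro mult_mono) (auto simp: abs_square_le_1)
  with t show ?thesis by simp
qed

text \<open>Substituting sin^2 \<theta> = m(x) turns the equation for \<open>m'\<close> into
  \<theta>' = k sqrt(1 - t sin^2 \<theta>), so the integral over \<theta> is \<open>k * L\<close>.
  Only the square of \<open>m'\<close> is given; by \<open>ne\<close> the derivative has no zero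
  inside, so Rolle's theorem makes \<open>m\<close> injective, hence increasing.\<close>

lemma rellK_substitution:
  fixes m :: "real \<Rightarrow> real"
  assumes L: "0 < L" and cont: "continuous_on {0..L} m" and m0: "m 0 = 0" and mL: "m L = 1"
    and t: "t < 1" and k: "0 < k"
    and ne: "\<And>x. 0 < x \<Longrightarrow> x < L \<Longrightarrow> m x \<noteq> 0 \<and> m x \<noteq> 1 \<and> t * m x \<noteq> 1"
    and der: "\<And>x. 0 < x \<Longrightarrow> x < L \<Longrightarrow> (m has_real_derivative m' x) (at x)"
    and sq: "\<And>x. 0 < x \<Longrightarrow> x < L \<Longrightarrow> (m' x)\<^sup>2 = 4 * k\<^sup>2 * m x * (1 - m x) * (1 - t * m x)"
  shows "rellK t = k * L"
proof -
  have inj: "inj_on m {0..L}"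
  proof (rule linorder_inj_onI)
    fix x y assume xy: "x < y" "x \<in> {0..L}" "y \<in> {0..L}"
    show "m x \<noteq> m y"
    proof
      assume eq: "m x = m y"
      have c1: "continuous_on {x..y} m" using xy by (intro continuous_on_subset[OF cont]) auto
      have c2: "m differentiable (at v)" if "x < v" "v < y" for v
        using der[of v] xy that by (auto simp: real_differentiable_def)
      from Rolle[OF xy(1) eq c1 c2] obtain z where z: "x < z" "z < y" "(m has_real_derivative 0) (at z)"
        by blast
      then have "0 < z" "z < L" using xy by auto
      have "m' z = 0" using DERIV_unique[OF der[OF \<open>0 < z\<close> \<open>z < L\<close>] z(3)] .
      with sq[OF \<open>0 < z\<close> \<open>z < L\<close>] ne[OF \<open>0 < z\<close> \<open>z < L\<close>] k show False by auto
    qed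
  qed auto
  have mono: "m x < m y" if "0 \<le> x" "x < y" "y \<le> L" for x y
  proof -
    have cont': "continuous_on {a..b} m" "inj_on m {a..b}" if "0 \<le> a" "b \<le> L" for a b
      using that by (intro continuous_on_subset[OF cont] inj_on_subset[OF inj] subsetI; simp)+
    have 1: "0 < m v \<and> m v < 1" if "0 < v" "v < L" for v
      using continuous_inj_imp_mono[OF that cont'] L m0 mL by auto
    show ?thesis
    proof (cases "x = 0 \<or> y = L")
      case True
      then show ?thesis using 1[of x] 1[of y] that m0 mL by (cases "x = 0"; cases "y = L") auto
    next
      case False
      then have "0 < x" "y < L" using that by auto
      then show ?thesis using continuous_inj_imp_mono[of x y L m, OF that(2) _ cont'] 1[of x] that mL by auto
    qed
  qed
  have range: "0 < m x" "m x < 1" if "0 < x" "x < L" for x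
    using mono[of 0 x] mono[of x L] that m0 mL by auto
  have tm: "0 < 1 - t * m x" if "0 < x" "x < L" for x
  proof -
    have "t * m x \<le> max t 0 * 1" using range[OF that] by (intro mult_mono) auto
    with t show ?thesis by simp
  qed
  have pos: "0 \<le> m' x" if x: "0 < x" "x < L" for x
  proof (rule ccontr)
    assume "\<not> 0 \<le> m' x"
    then have "m' x < 0" by simp
    from DERIV_neg_dec_right[OF der[OF x] this] obtain d where d: "0 < d" "\<And>h. 0 < h \<Longrightarrow> h < d \<Longrightarrow> m (x + h) < m x"
      by blast
    define h where "h = min d (L - x) / 2"
    have "0 < h" "h < d" "x + h < L" using d x by (auto simp: h_def min_def field_simps)
    with d(2)[of h] mono[of x "x + h"] x show False by auto
  qed
  define g where "g = (\<lambda>x. 1 / sqrt (1 - t * (sin x)\<^sup>2))"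
  have gcont: "continuous_on A g" for A
  proof -
    have "1 - t * (sin x)\<^sup>2 \<noteq> 0" for x using sin_sq_less_1[OF t, of x] by linarith
    then show ?thesis unfolding g_def by (intro continuous_intros) auto
  qed
  \<comment> \<open>The lower limit -1 puts the end points 0 and \<pi>/2 inside an open interval on
    which \<open>G\<close> is differentiable.\<close>
  define G where "G = (\<lambda>s. integral {-1..s} g)"
  have G: "(G has_real_derivative g s) (at s)" if "-1 < s" "s < 2" for s
  proof -
    have "(G has_real_derivative g s) (at s within {-1..2})"
      unfolding G_def using that gcont[of "{-1..2}"] by (intro integral_has_real_derivative) auto
    moreover have "at s within {-1..2} = at s"
      using that by (intro at_within_interior) (auto simp: interior_atLeastAtMost_real)
    ultimately show ?thesis by simp
  qed
  define \<phi> where "\<phi> = (\<lambda>x. arcsin (sqrt (m x)))"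
  have mrange: "0 \<le> m x \<and> m x \<le> 1" if "0 \<le> x" "x \<le> L" for x
    using range[of x] that m0 mL by (cases "x = 0"; cases "x = L") auto
  have phi_range: "-1 < \<phi> x" "\<phi> x < 2" if "0 \<le> x" "x \<le> L" for x
  proof -
    have "0 \<le> \<phi> x" unfolding \<phi>_def using mrange[OF that] arcsin_le_arcsin[of 0 "sqrt (m x)"] by simp
    then show "-1 < \<phi> x" by simp
    have "-1 \<le> sqrt (m x)" using mrange[OF that] by (intro order_trans[OF _ real_sqrt_ge_zero, of "-1"]) simp_all
    then have "\<phi> x \<le> pi / 2" unfolding \<phi>_def using mrange[OF that] by (intro arcsin_ubound) auto
    then show "\<phi> x < 2" using pi_less_4 by linarith
  qed
  have phi_cont: "continuous_on {0..L} \<phi>"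
  proof -
    have "-1 \<le> sqrt (m x) \<and> sqrt (m x) \<le> 1" if "x \<in> {0..L}" for x
    proof
      show "-1 \<le> sqrt (m x)" using mrange[of x] that by (intro order_trans[OF _ real_sqrt_ge_zero, of "-1"]) simp_all
      show "sqrt (m x) \<le> 1" using mrange[of x] that by simp
    qed
    then show ?thesis unfolding \<phi>_def using cont by (intro continuous_intros) auto
  qed
  have Gcont: "continuous_on {-1<..<2} G"
    by (intro continuous_at_imp_continuous_on ballI DERIV_isCont[OF G]) auto
  have comp_cont: "continuous_on {0..L} (\<lambda>x. G (\<phi> x) - k * x)"
    using phi_range by (intro continuous_intros continuous_on_compose2[OF Gcont phi_cont]) auto
  have "((\<lambda>x. G (\<phi> x) - k * x) has_real_derivative 0) (at x)" if x: "0 < x" "x < L" for x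
  proof -
    note r = range[OF x]
    define a where "a = sqrt (m x)"
    define b where "b = sqrt (1 - m x)"
    define c where "c = sqrt (1 - t * m x)"
    have ab: "0 < a" "a < 1" "0 < b" "0 < c" "a\<^sup>2 = m x" "b\<^sup>2 = 1 - m x" "c\<^sup>2 = 1 - t * m x"
    proof -
      show "0 < a" "a < 1" "a\<^sup>2 = m x" unfolding a_def using r by simp_all
      show "0 < b" "b\<^sup>2 = 1 - m x" unfolding b_def using r by simp_all
      show "0 < c" unfolding c_def using tm[OF x] by (simp only: real_sqrt_gt_0_iff)
      show "c\<^sup>2 = 1 - t * m x" unfolding c_def using tm[OF x] by (intro real_sqrt_pow2) (rule less_imp_le)
    qed
    have "(m' x)\<^sup>2 = (2 * k * a * b * c)\<^sup>2"
      unfolding sq[OF x] power_mult_distrib ab(5-7) by simp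
    moreover have "0 \<le> 2 * k * a * b * c"
      by (intro mult_nonneg_nonneg less_imp_le[OF k] less_imp_le[OF ab(1)] less_imp_le[OF ab(3)] less_imp_le[OF ab(4)]) simp
    ultimately have m': "m' x = 2 * k * a * b * c"
      by (rule power2_eq_imp_eq[OF _ pos[OF x]])
    have a1: "-1 < sqrt (m x)" "sqrt (m x) < 1" using ab(1,2) unfolding a_def by linarith+
    have "((\<lambda>x. sqrt (m x)) has_real_derivative inverse (sqrt (m x)) / 2 * m' x) (at x)"
      by (rule DERIV_chain2[OF DERIV_real_sqrt[OF r(1)] der[OF x]])
    from DERIV_chain2[OF DERIV_arcsin[OF a1] this]
    have "(\<phi> has_real_derivative inverse (sqrt (1 - (sqrt (m x))\<^sup>2)) * (inverse (sqrt (m x)) / 2 * m' x)) (at x)"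
      unfolding \<phi>_def .
    also have "inverse (sqrt (1 - (sqrt (m x))\<^sup>2)) * (inverse (sqrt (m x)) / 2 * m' x) = k * c"
      unfolding m' a_def[symmetric] ab(5) b_def[symmetric] using ab(1,3) by (simp add: field_simps)
    finally have phi': "(\<phi> has_real_derivative k * c) (at x)" .
    have "((\<lambda>x. G (\<phi> x)) has_real_derivative g (\<phi> x) * (k * c)) (at x)"
      by (rule DERIV_chain2[OF G phi']) (use phi_range[of x] x in simp_all)
    moreover have "sin (\<phi> x) = a" unfolding \<phi>_def a_def[symmetric] using ab(1,2) by (intro sin_arcsin) simp_all
    then have "g (\<phi> x) = 1 / c" by (simp only: g_def ab(5) c_def)
    ultimately have "((\<lambda>x. G (\<phi> x) - k * x) has_real_derivative 1 / c * (k * c) - k) (at x)"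
      by (auto intro!: derivative_eq_intros)
    then show ?thesis using ab(4) by simp
  qed
  then have "G (\<phi> L) - k * L = G (\<phi> 0) - k * 0"
    using DERIV_isconst2[OF L comp_cont, of L] L by auto
  then have "k * L = integral {-1..pi/2} g - integral {-1..0} g"
    by (simp add: G_def \<phi>_def m0 mL)
  also have "integral {-1..0} g + integral {0..pi/2} g = integral {-1..pi/2} g"
    by (rule Henstock_Kurzweil_Integration.integral_combine) (auto intro!: integrable_continuous_real gcont)
  then have "integral {-1..pi/2} g - integral {-1..0} g = integral {0..pi/2} g" by simp
  finally show ?thesis by (simp add: rellK_def g_def)
qed

section \<open>Real values at the half periods\<close>

lemma qp_real_pos:
  assumes x: "0 \<le> x" "x < 1" and a: "a < 1"
  obtains r where "0 < r" "qp (of_real x) (of_real a) = of_real r"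
proof -
  have pos: "0 < 1 - a * x ^ n" for n
  proof -
    have "a * x ^ n \<le> max a 0 * 1" using x by (intro mult_mono power_le_one) auto
    with a show ?thesis by simp
  qed
  have nx: "norm (of_real x :: complex) < 1" using x by simp
  have lim: "(\<lambda>n. \<Prod>k<n. 1 - of_real a * of_real x ^ k :: complex) \<longlonglongrightarrow> qp (of_real x) (of_real a)"
    unfolding qp_def by (intro has_prod_imp_tendsto' convergent_prod_has_prod convergent_prod_qp nx)
  have eq: "(\<Prod>k<n. 1 - of_real a * of_real x ^ k :: complex) = of_real (\<Prod>k<n. 1 - a * x ^ k)" for n
    by simp
  have "qp (of_real x) (of_real a) \<noteq> 0"
  proof
    assume "qp (of_real x) (of_real a) = 0"
    then obtain n where "of_real a * of_real x ^ n = (1 :: complex)"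
      unfolding qp_eq_0_iff[OF nx] by (elim exE)
    then have "of_real (a * x ^ n) = (1 :: complex)" by simp
    then have "a * x ^ n = 1" by (simp only: of_real_eq_1_iff)
    with pos[of n] show False by simp
  qed
  moreover have "qp (of_real x) (of_real a) \<in> \<real>"
    by (rule closed_sequentially[OF closed_complex_Reals _ lim]) (unfold eq, rule Reals_of_real)
  then have re: "qp (of_real x) (of_real a) = of_real (Re (qp (of_real x) (of_real a)))"
    by (simp add: complex_is_Real_iff complex_eq_iff)
  have "0 \<le> (\<Prod>k<n. 1 - a * x ^ k)" for n
    using pos by (intro prod_nonneg) (simp add: less_imp_le)
  then have "0 \<le> Re (\<Prod>k<n. 1 - of_real a * of_real x ^ k :: complex)" for n
    unfolding eq Re_complex_of_real .
  then have "0 \<le> Re (qp (of_real x) (of_real a))"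
    by (intro tendsto_lowerbound[OF tendsto_Re[OF lim]] always_eventually) simp_all
  ultimately have "0 < Re (qp (of_real x) (of_real a))"
    using re by (cases "Re (qp (of_real x) (of_real a)) = 0") simp_all
  then show thesis using re by (rule that)
qed

lemma cnj_koebe: "cnj (koebe u) = koebe (cnj u)"
  by (simp add: koebe_def)

lemma wp_cnj: assumes "l > 0" shows "cnj (wp l u) = wp l (cnj u)"
proof -
  have "cnj (wsum l u) = wsum l (cnj u)" for u
    unfolding wsum_def using bounded_linear.suminf[OF bounded_linear_cnj summable_wsum[OF assms, of u]]
    by (simp add: cnj_koebe exp_cnj)
  from this[of u] this[of "- u"] show ?thesis by (simp add: wp_def cnj_koebe exp_cnj)
qed

definition rqp :: "real \<Rightarrow> real \<Rightarrow> real" where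
  "rqp x a = Re (qp (of_real x) (of_real a))"

lemma qp_of_real:
  assumes "0 \<le> x" "x < 1" "a < 1"
  shows "qp (of_real x) (of_real a) = of_real (rqp x a)" and "0 < rqp x a"
  using qp_real_pos[OF assms] unfolding rqp_def by (metis Re_complex_of_real)+

text \<open>The values \<open>e\<^sub>1 < e\<^sub>2 < e\<^sub>3\<close> at the half periods.\<close>

definition "we1 l = Re (wp l (of_real pi * \<i>))"
definition "we2 l = Re (wp l (of_real pi * \<i> - of_real (l / 2)))"
definition "we3 l = Re (wp l (- of_real (l / 2)))"

text \<open>On these two lines complex conjugation is, up to reflection in 0, a translation by a
  period, and \<open>wp\<close> is invariant under both.\<close>

lemma wp_real:
  assumes l: "l > 0"
  shows "wp l (- of_real (l / 2) + of_real x * \<i>) = of_real (Re (wp l (- of_real (l / 2) + of_real x * \<i>)))"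
    and "wp l (of_real pi * \<i> + of_real x) = of_real (Re (wp l (of_real pi * \<i> + of_real x)))"
proof -
  have R: "z = of_real (Re z)" if "cnj z = z" for z
    using that by (metis Reals_cnj_iff of_real_Re)
  have "cnj (wp l (- of_real (l / 2) + of_real x * \<i>)) = wp l (- of_real (l / 2) - of_real x * \<i>)"
    unfolding wp_cnj[OF l] by (rule arg_cong[of _ _ "wp l"]) (simp add: complex_eq_iff)
  also have "\<dots> = wp l (- (- of_real (l / 2) - of_real x * \<i>))"
    by (rule wp_minus[symmetric])
  also have "- (- of_real (l / 2) - of_real x * \<i>) = (- of_real (l / 2) + of_real x * \<i>) + of_real l"
    by (simp add: complex_eq_iff)
  also have "wp l \<dots> = wp l (- of_real (l / 2) + of_real x * \<i>)"
    by (rule wp_periodic[OF l])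
  finally show "wp l (- of_real (l / 2) + of_real x * \<i>) = of_real (Re (wp l (- of_real (l / 2) + of_real x * \<i>)))"
    by (rule R)
  have "cnj (wp l (of_real pi * \<i> + of_real x)) = wp l (- of_real pi * \<i> + of_real x)"
    using l by (simp add: wp_cnj)
  also have "\<dots> = wp l (- of_real pi * \<i> + of_real x + 2 * of_real pi * \<i>)"
    by (rule wp_periodic'[symmetric])
  also have "- of_real pi * \<i> + of_real x + 2 * of_real pi * \<i> = of_real pi * \<i> + of_real x"
    by (simp add: complex_eq_iff)
  finally show "wp l (of_real pi * \<i> + of_real x) = of_real (Re (wp l (of_real pi * \<i> + of_real x)))"
    by (rule R)
qed

lemma wp_half:
  assumes l: "l > 0"
  shows "wp l (of_real pi * \<i>) = of_real (we1 l)"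
    and "wp l (of_real pi * \<i> - of_real (l / 2)) = of_real (we2 l)"
    and "wp l (- of_real (l / 2)) = of_real (we3 l)"
  using wp_real(2)[OF l, of 0] wp_real(2)[OF l, of "- (l / 2)"] wp_real(1)[OF l, of 0]
  by (simp_all only: we1_def we2_def we3_def of_real_0 add_0_right mult_zero_left of_real_minus add_uminus_conv_diff)

lemma half_in_box:
  assumes l: "l > 0"
  shows "of_real pi * \<i> \<in> period_box l - {0}"
    and "of_real pi * \<i> - of_real (l / 2) \<in> period_box l - {0}"
    and "- of_real (l / 2) \<in> period_box l - {0}"
  using l by (simp_all add: period_box_def complex_eq_iff)

lemma sg_nonzero: "l > 0 \<Longrightarrow> u \<in> period_box l - {0} \<Longrightarrow> sg l u \<noteq> 0"
  using sg_eq_0_iff[of l u] exp_eq_1_period_box[of u l] by (simp add: period_box_def)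

lemma exp_pi_i': "exp (of_real pi * \<i> - z) = - exp (- z)" "exp (- (of_real pi * \<i>) - z) = - exp (- z)"
proof -
  show "exp (of_real pi * \<i> - z) = - exp (- z)"
    using exp_add[of "of_real pi * \<i>" "- z"] exp_pi_i by simp
  have "exp (- (of_real pi * \<i>)) = -1" by (simp add: exp_minus exp_pi_i)
  then show "exp (- (of_real pi * \<i>) - z) = - exp (- z)"
    using exp_add[of "- (of_real pi * \<i>)" "- z"] by simp
qed

text \<open>The sigma quotient at two half periods involves \<open>sg\<close> at half periods only,
  where it reduces to products at \<open>q\<close>, \<open>- q\<close>, \<open>Q\<close> and
  \<open>- Q\<close>. By the product identity in \<open>rqp_relations\<close> the three differences
  are one quarter of the fourth powers of the theta constants \<theta>_4, \<theta>_3 and \<theta>_2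
  with nome \<open>q\<close>.\<close>

lemma we_diff:
  assumes l: "l > 0"
  defines "Q \<equiv> exp (- l)" and "q \<equiv> exp (- l / 2)"
  shows "we2 l - we1 l = rqp Q Q ^ 4 * rqp Q q ^ 4 / (4 * rqp Q (- Q) ^ 4 * rqp Q (- q) ^ 4)"
    and "we3 l - we1 l = rqp Q Q ^ 4 * rqp Q (- q) ^ 4 / (4 * rqp Q (- Q) ^ 4 * rqp Q q ^ 4)"
    and "we3 l - we2 l = 4 * q * rqp Q Q ^ 4 * rqp Q (- Q) ^ 4 / (rqp Q q ^ 4 * rqp Q (- q) ^ 4)"
proof -
  have Q: "0 \<le> Q" "Q < 1" "- Q < 1" "q < 1" "- q < 1" "0 < q" using l by (auto simp: Q_def q_def intro: less_trans[of _ 0])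
  have eQ: "exp (- of_real l) = (of_real Q :: complex)" "exp (- of_real (l / 2)) = (of_real q :: complex)"
    by (simp_all add: Q_def q_def exp_of_real[symmetric])
  note r = qp_of_real(1)[OF Q(1,2)]
  have q2: "exp (of_real (l/2) - of_real l) = (of_real q :: complex)"
    by (simp add: q_def exp_of_real[symmetric] field_simps)
  have sv0: "sv l 0 = of_real (rqp Q Q ^ 2)"
    unfolding sv_def using Q by (simp add: eQ r power2_eq_square)
  have m1: "exp (- (of_real pi * \<i>) - of_real l) = (of_real (- Q) :: complex)"
    by (simp add: exp_pi_i' eQ)
  have "qp (of_real Q) (- 1) = 2 * of_real (rqp Q (- Q))"
    using qp_rec[of "of_real Q" "-1"] Q r[of "- Q"] by simp
  then have s1: "sg l (of_real pi * \<i>) = of_real (2 * rqp Q (- Q) ^ 2)"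
    unfolding sg_def m1 eQ exp_pi_i using Q(3) by (simp only: r) (simp add: power2_eq_square)
  have s3: "sg l (- of_real (l / 2)) = of_real (rqp Q q ^ 2)"
    unfolding sg_def eQ using Q(4) q2 by (simp add: r power2_eq_square)
  have e2: "exp (of_real pi * \<i> - of_real (l / 2)) = (of_real (- q) :: complex)"
    by (simp only: exp_pi_i' eQ of_real_minus)
  have "exp (- (of_real pi * \<i> - of_real (l / 2)) - of_real l) = exp (- (of_real pi * \<i>) - (of_real l - of_real (l / 2)) :: complex)"
    by (simp add: algebra_simps)
  also have "\<dots> = (of_real (- q) :: complex)"
    using q2 by (simp add: exp_pi_i')
  finally have e2': "exp (- (of_real pi * \<i> - of_real (l / 2)) - of_real l) = (of_real (- q) :: complex)" .
  have s2: "sg l (of_real pi * \<i> - of_real (l / 2)) = of_real (rqp Q (- q) ^ 2)"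
    unfolding sg_def e2 e2' eQ(1) r[OF Q(5)] by (simp add: power2_eq_square)
  have p1: "sg l (of_real pi * \<i> - of_real (l / 2) + of_real pi * \<i>) = sg l (- of_real (l / 2))"
    using sg_2pii[of l "- of_real (l / 2)"] by (simp add: algebra_simps)
  have p2: "sg l (- of_real (l / 2) - of_real pi * \<i>) = sg l (of_real pi * \<i> - of_real (l / 2))"
    using sg_2pii[of l "- of_real (l / 2) - of_real pi * \<i>"] by (simp add: algebra_simps)
  have p3: "sg l (- (of_real pi * \<i>)) = sg l (of_real pi * \<i>)"
    using sg_2pii[of l "- (of_real pi * \<i>)"] by (simp add: algebra_simps)
  have p4: "sg l (of_real pi * \<i> - of_real l) = sg l (of_real pi * \<i>)"
    using sg_shift[OF l, of "of_real pi * \<i> - of_real l"] exp_pi_i by simp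
  have p5: "of_real pi * \<i> - of_real (l / 2) - of_real pi * \<i> = - (of_real (l / 2) :: complex)"
    and p6: "- of_real (l / 2) + of_real pi * \<i> = of_real pi * \<i> - (of_real (l / 2) :: complex)"
    by simp_all
  have nz: "rqp Q Q \<noteq> 0" "rqp Q q \<noteq> 0" "rqp Q (- q) \<noteq> 0" "rqp Q (- Q) \<noteq> 0"
    using qp_of_real(2)[OF Q(1,2)] Q by (auto simp: less_imp_neq[symmetric])
  have "complex_of_real (we2 l - we1 l) = of_real (rqp Q Q ^ 4 * rqp Q q ^ 4 / (4 * rqp Q (- Q) ^ 4 * rqp Q (- q) ^ 4))"
    using wp_diff[OF l half_in_box(1)[OF l] half_in_box(2)[OF l]] nz
    by (simp only: wp_half[OF l] p1 p5 s1 s2 s3 sv0 exp_pi_i) (simp add: field_simps power2_eq_square power4_eq_xxxx)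
  then show "we2 l - we1 l = rqp Q Q ^ 4 * rqp Q q ^ 4 / (4 * rqp Q (- Q) ^ 4 * rqp Q (- q) ^ 4)"
    by (simp only: of_real_eq_iff)
  have "complex_of_real (we3 l - we1 l) = of_real (rqp Q Q ^ 4 * rqp Q (- q) ^ 4 / (4 * rqp Q (- Q) ^ 4 * rqp Q q ^ 4))"
    using wp_diff[OF l half_in_box(1)[OF l] half_in_box(3)[OF l]] nz
    by (simp only: wp_half[OF l] p2 p6 s1 s2 s3 sv0 exp_pi_i) (simp add: field_simps power2_eq_square power4_eq_xxxx)
  then show "we3 l - we1 l = rqp Q Q ^ 4 * rqp Q (- q) ^ 4 / (4 * rqp Q (- Q) ^ 4 * rqp Q q ^ 4)"
    by (simp only: of_real_eq_iff)
  have "- of_real (l / 2) + (of_real pi * \<i> - of_real (l / 2)) = of_real pi * \<i> - (of_real l :: complex)"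
       "- of_real (l / 2) - (of_real pi * \<i> - of_real (l / 2)) = - (of_real pi * \<i> :: complex)"
    by (simp_all add: complex_eq_iff)
  then have "complex_of_real (we3 l - we2 l) = of_real (4 * q * rqp Q Q ^ 4 * rqp Q (- Q) ^ 4 / (rqp Q q ^ 4 * rqp Q (- q) ^ 4))"
    using wp_diff[OF l half_in_box(2)[OF l] half_in_box(3)[OF l]] nz
    by (simp only: wp_half[OF l] p3 p4 s1 s2 s3 sv0 e2) (simp add: field_simps power2_eq_square power4_eq_xxxx)
  then show "we3 l - we2 l = 4 * q * rqp Q Q ^ 4 * rqp Q (- Q) ^ 4 / (rqp Q q ^ 4 * rqp Q (- q) ^ 4)"
    by (simp only: of_real_eq_iff)
qed

lemma we_less:
  assumes l: "l > 0"
  shows "we1 l < we2 l" "we2 l < we3 l"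
proof -
  define Q q where "Q = exp (- l)" and "q = exp (- l / 2)"
  have Q: "0 \<le> Q" "Q < 1" "- Q < 1" "q < 1" "- q < 1" "0 < q" using l by (auto simp: Q_def q_def intro: less_trans[of _ 0])
  have "0 < rqp Q Q" "0 < rqp Q q" "0 < rqp Q (- q)" "0 < rqp Q (- Q)"
    using qp_of_real(2)[OF Q(1,2)] Q by simp_all
  then have "0 < we2 l - we1 l" "0 < we3 l - we2 l"
    using Q(6) unfolding we_diff[OF l] Q_def[symmetric] q_def[symmetric] by simp_all
  then show "we1 l < we2 l" "we2 l < we3 l" by simp_all
qed

lemma cubic_three_roots:
  fixes e1 e2 e3 a b d x :: "'a :: field_char_0"
  assumes "e1 \<noteq> e2" "e1 \<noteq> e3" "e2 \<noteq> e3"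
    and r: "4 * e1^3 + a * e1^2 + 2 * b * e1 + d = 0" "4 * e2^3 + a * e2^2 + 2 * b * e2 + d = 0" "4 * e3^3 + a * e3^2 + 2 * b * e3 + d = 0"
  shows "a = - 4 * (e1 + e2 + e3)" and "b = 2 * (e1 * e2 + e1 * e3 + e2 * e3)"
    and "4 * x^3 + a * x^2 + 2 * b * x + d = 4 * (x - e1) * (x - e2) * (x - e3)"
proof -
  have "(e1 - e2) * (4 * (e1^2 + e1 * e2 + e2^2) + a * (e1 + e2) + 2 * b) = 0"
    using r(1,2) by algebra
  then have A: "4 * (e1^2 + e1 * e2 + e2^2) + a * (e1 + e2) + 2 * b = 0" using assms(1) by simp
  have "(e1 - e3) * (4 * (e1^2 + e1 * e3 + e3^2) + a * (e1 + e3) + 2 * b) = 0"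
    using r(1,3) by algebra
  then have B: "4 * (e1^2 + e1 * e3 + e3^2) + a * (e1 + e3) + 2 * b = 0" using assms(2) by simp
  have "(e2 - e3) * (4 * (e1 + e2 + e3) + a) = 0" using A B by algebra
  then have C: "4 * (e1 + e2 + e3) + a = 0" using assms(3) by simp
  then show a: "a = - 4 * (e1 + e2 + e3)" by algebra
  have "b * 2 = 2 * (e1 * e2 + e1 * e3 + e2 * e3) * 2" using A C by algebra
  then show b: "b = 2 * (e1 * e2 + e1 * e3 + e2 * e3)" by (rule mult_right_cancel[THEN iffD1, rotated]) simp
  show "4 * x^3 + a * x^2 + 2 * b * x + d = 4 * (x - e1) * (x - e2) * (x - e3)" using a b r(1) by algebra
qed

text \<open>The three half periods are critical points, so \<open>we1\<close>, \<open>we2\<close>,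
  \<open>we3\<close> are distinct roots of the cubic; comparing roots with coefficients eliminates
  the unknown \<open>a\<close>, \<open>b\<close> and \<open>d\<close>.\<close>

lemma wp_odes:
  assumes l: "l > 0" and u: "u \<in> period_box l - {0}"
  shows "(deriv (wp l) u)\<^sup>2 = 4 * (wp l u - of_real (we1 l)) * (wp l u - of_real (we2 l)) * (wp l u - of_real (we3 l))"
    and "deriv (deriv (wp l)) u = 6 * (wp l u)\<^sup>2 - 4 * of_real (we1 l + we2 l + we3 l) * wp l u
           + 2 * of_real (we1 l * we2 l + we1 l * we3 l + we2 l * we3 l)"
proof -
  obtain a b where ode: "\<And>u. u \<in> period_box l - {0} \<Longrightarrow> deriv (deriv (wp l)) u = 6 * (wp l u)\<^sup>2 + a * wp l u + b"
    by (rule wp_ode[OF l]) (rule that)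
  obtain d where d: "\<And>u. u \<in> period_box l - {0} \<Longrightarrow> (deriv (wp l) u)\<^sup>2 = 4 * (wp l u)^3 + a * (wp l u)\<^sup>2 + 2 * b * wp l u + d"
    by (rule wp_first_integral[OF l], rule ode, assumption, rule that)
  have p: "wp l (u + 2 * (of_real pi * \<i>)) = wp l u" "wp l (u + 2 * (- of_real (l / 2))) = wp l u"
       "wp l (u + 2 * (of_real pi * \<i> - of_real (l / 2))) = wp l u" for u
    using wp_periodic'[of l u] wp_periodic[OF l, of "u - of_real l"] wp_periodic'[of l "u - of_real l"]
    by (simp_all add: algebra_simps)
  have z: "deriv (wp l) (of_real pi * \<i>) = 0" "deriv (wp l) (of_real pi * \<i> - of_real (l / 2)) = 0"
      "deriv (wp l) (- of_real (l / 2)) = 0"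
    by (rule deriv_wp_half_period[OF l half_in_box(1)[OF l] p(1)]
        deriv_wp_half_period[OF l half_in_box(2)[OF l] p(3)] deriv_wp_half_period[OF l half_in_box(3)[OF l] p(2)])+
  note r = d[OF half_in_box(1)[OF l], symmetric] d[OF half_in_box(2)[OF l], symmetric] d[OF half_in_box(3)[OF l], symmetric]
  have ne: "of_real (we1 l) \<noteq> (of_real (we2 l) :: complex)" "of_real (we1 l) \<noteq> (of_real (we3 l) :: complex)" "of_real (we2 l) \<noteq> (of_real (we3 l) :: complex)"
    using we_less[OF l] by (simp_all only: of_real_eq_iff)
  note c = cubic_three_roots[OF ne r[unfolded z wp_half[OF l] zero_power2]]
  show "(deriv (wp l) u)\<^sup>2 = 4 * (wp l u - of_real (we1 l)) * (wp l u - of_real (we2 l)) * (wp l u - of_real (we3 l))"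
    unfolding d[OF u] by (rule c(3))
  show "deriv (deriv (wp l)) u = 6 * (wp l u)\<^sup>2 - 4 * of_real (we1 l + we2 l + we3 l) * wp l u
           + 2 * of_real (we1 l * we2 l + we1 l * we3 l + we2 l * we3 l)"
    unfolding ode[OF u] c(1,2) by (simp add: algebra_simps)
qed

section \<open>Inversion of the elliptic integrals along the sides of the half-period
  rectangle\<close>

lemma Re_mult_of_real: "Re (z * of_real r) = Re z * r"
  by simp

text \<open>Along a line on which \<open>wp\<close> is real the derivative in the real parameter is
  \<open>c\<close> times the complex derivative and hence real. The factor
  \<open>Re (c\<^sup>2)\<close> is -1 on vertical lines and 1 on horizontal ones, which adapts the
  sign of the cubic to the interval between the roots.\<close>

lemma wp_line_derivative:
  assumes l: "l > 0" and u: "p + of_real x * c \<in> period_box l - {0}"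
    and real: "\<And>x. wp l (p + of_real x * c) = of_real (X x)"
  obtains X' where "(X has_real_derivative X') (at x)"
    and "X'\<^sup>2 = Re (c\<^sup>2) * (4 * (X x - we1 l) * (X x - we2 l) * (X x - we3 l))"
proof -
  have op: "open (period_box l - {0})" using open_period_box by (intro open_delete)
  define u where "u = p + of_real x * c"
  have uB: "u \<in> period_box l - {0}" using assms(2) by (simp add: u_def)
  have "((\<lambda>x. p + of_real x * c) has_vector_derivative c) (at x)"
    by (auto intro!: derivative_eq_intros)
  moreover have "(wp l has_field_derivative deriv (wp l) u) (at (p + of_real x * c))"
    unfolding u_def[symmetric] by (rule holomorphic_derivI[OF wp_holomorphic[OF l] op uB])
  ultimately have "((wp l \<circ> (\<lambda>x. p + of_real x * c)) has_vector_derivative c * deriv (wp l) u) (at x)"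
    by (rule field_vector_diff_chain_at)
  then have vd: "((\<lambda>x. of_real (X x)) has_vector_derivative c * deriv (wp l) u) (at x)"
    by (simp add: o_def real)
  define D where "D = c * deriv (wp l) u"
  have "((\<lambda>x. Re (of_real (X x))) has_vector_derivative Re D) (at x)"
    unfolding D_def by (rule bounded_linear.has_vector_derivative[OF bounded_linear_Re vd])
  then have X: "(X has_real_derivative Re D) (at x)"
    by (simp add: has_real_derivative_iff_has_vector_derivative)
  have "((\<lambda>x. Im (of_real (X x))) has_vector_derivative Im D) (at x)"
    unfolding D_def by (rule bounded_linear.has_vector_derivative[OF bounded_linear_Im vd])
  then have "((\<lambda>x. 0 :: real) has_vector_derivative Im D) (at x)" by simp
  from vector_derivative_unique_at[OF this has_vector_derivative_const] have "Im D = 0" .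
  then have Dr: "of_real (Re D) = D" by (simp add: complex_eq_iff)
  have "of_real ((Re D)\<^sup>2) = D\<^sup>2" by (simp add: Dr)
  also have "\<dots> = c\<^sup>2 * (deriv (wp l) u)\<^sup>2" by (simp add: D_def power_mult_distrib)
  also have "\<dots> = c\<^sup>2 * of_real (4 * (X x - we1 l) * (X x - we2 l) * (X x - we3 l))"
    unfolding wp_odes(1)[OF l uB] by (simp add: u_def real)
  finally have "Re (of_real ((Re D)\<^sup>2)) = Re (c\<^sup>2 * of_real (4 * (X x - we1 l) * (X x - we2 l) * (X x - we3 l)))"
    by (rule arg_cong)
  then have "(Re D)\<^sup>2 = Re (c\<^sup>2) * (4 * (X x - we1 l) * (X x - we2 l) * (X x - we3 l))"
    using Re_mult_of_real by (simp only: Re_complex_of_real)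
  with X show thesis by (rule that)
qed

lemma wp_neq:
  assumes "l > 0" "a \<in> period_box l - {0}" "u \<in> period_box l - {0}" "sg l (u + a) \<noteq> 0" "sg l (u - a) \<noteq> 0"
  shows "wp l u \<noteq> wp l a"
  using wp_diff[OF assms(1-3)] assms(4,5) sg_nonzero[OF assms(1,2)] sg_nonzero[OF assms(1,3)] sv_nonzero[OF assms(1), of 0] assms(1)
  by auto

lemma wp_line_continuous:
  assumes l: "l > 0" and "\<And>x. x \<in> A \<Longrightarrow> p + of_real x * c \<in> period_box l - {0}"
  shows "continuous_on A (\<lambda>x. Re (wp l (p + of_real x * c)))"
  by (intro continuous_intros continuous_on_compose2[OF holomorphic_on_imp_continuous_on[OF wp_holomorphic[OF l]]])
     (use assms in auto)

lemma sg_imag_nonzero: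
  assumes l: "l > 0" and x: "x \<noteq> 0" "\<bar>x\<bar> < 2 * pi"
  shows "sg l (of_real x * \<i>) \<noteq> 0" and "sg l (of_real x * \<i> - of_real l) \<noteq> 0"
proof -
  show 1: "sg l (of_real x * \<i>) \<noteq> 0"
    using x l by (intro sg_nonzero) (simp_all add: period_box_def complex_eq_iff)
  then show "sg l (of_real x * \<i> - of_real l) \<noteq> 0"
    using sg_shift[OF l, of "of_real x * \<i> - of_real l"] by auto
qed

text \<open>Along the vertical side from -l/2 to \<pi> i - l/2, of length \<pi>, wp runs through
  real values from e_3 to e_2. The affine normalisation \<open>m\<close> sends these to 0 and 1, and
  the root e_1 to 1/t.\<close>

lemma rellK_modulus:
  assumes l: "l > 0"
  shows "rellK ((we3 l - we2 l) / (we3 l - we1 l)) = sqrt (we3 l - we1 l) * pi"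
proof (rule rellK_substitution)
  note w = we_less[OF l]
  define X where "X = (\<lambda>x. Re (wp l (- of_real (l / 2) + of_real x * \<i>)))"
  define m where "m = (\<lambda>x. (we3 l - X x) / (we3 l - we2 l))"
  have X: "wp l (- of_real (l / 2) + of_real x * \<i>) = of_real (X x)" for x
    unfolding X_def by (rule wp_real[OF l])
  have box: "- of_real (l / 2) + of_real x * \<i> \<in> period_box l - {0}" if "0 \<le> x" "x \<le> pi" for x
  proof -
    have "x < 2 * pi" using that pi_gt_zero by linarith
    with that l show ?thesis by (simp add: period_box_def complex_eq_iff)
  qed
  have X_ne: "X x \<noteq> we1 l \<and> X x \<noteq> we2 l \<and> X x \<noteq> we3 l" if x: "0 < x" "x < pi" for x
  proof -
    define u where "u = - of_real (l / 2) + of_real x * \<i>"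
    have u: "u \<in> period_box l - {0}" unfolding u_def by (rule box) (use x in auto)
    have "wp l u \<noteq> wp l (of_real pi * \<i>)"
      by (rule wp_neq[OF l half_in_box(1)[OF l] u]; rule sg_nonzero[OF l])
         (use x l in \<open>simp_all add: u_def period_box_def complex_eq_iff\<close>)
    moreover have "wp l u \<noteq> wp l (- of_real (l / 2))"
    proof (rule wp_neq[OF l half_in_box(3)[OF l] u])
      have "u + - of_real (l / 2) = of_real x * \<i> - of_real l" "u - - of_real (l / 2) = of_real x * \<i>"
        by (simp_all add: u_def complex_eq_iff)
      then show "sg l (u + - of_real (l / 2)) \<noteq> 0" "sg l (u - - of_real (l / 2)) \<noteq> 0"
        using sg_imag_nonzero[OF l, of x] x by simp_all
    qed
    moreover have "wp l u \<noteq> wp l (of_real pi * \<i> - of_real (l / 2))"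
    proof (rule wp_neq[OF l half_in_box(2)[OF l] u])
      have "u + (of_real pi * \<i> - of_real (l / 2)) = of_real (x + pi) * \<i> - of_real l"
           "u - (of_real pi * \<i> - of_real (l / 2)) = of_real (x - pi) * \<i>"
        by (simp_all add: u_def complex_eq_iff algebra_simps)
      then show "sg l (u + (of_real pi * \<i> - of_real (l / 2))) \<noteq> 0" "sg l (u - (of_real pi * \<i> - of_real (l / 2))) \<noteq> 0"
        using sg_imag_nonzero(2)[OF l, of "x + pi"] sg_imag_nonzero(1)[OF l, of "x - pi"] x by simp_all
    qed
    ultimately show ?thesis unfolding wp_half[OF l] u_def X by simp
  qed
  show "0 < pi" by simp
  show "continuous_on {0..pi} m"
    unfolding m_def X_def using w by (intro continuous_intros wp_line_continuous[OF l] box) auto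
  show "m 0 = 0" using wp_half(3)[OF l] by (simp add: m_def X_def)
  have "X pi = we2 l" using wp_half(2)[OF l] X[of pi] by (simp add: X_def add.commute)
  then show "m pi = 1" using w by (simp add: m_def)
  show "(we3 l - we2 l) / (we3 l - we1 l) < 1" using w by (simp add: field_simps)
  show "0 < sqrt (we3 l - we1 l)" using w by simp
  define X' where "X' = (\<lambda>x. SOME d. (X has_real_derivative d) (at x) \<and>
      d\<^sup>2 = Re (\<i>\<^sup>2) * (4 * (X x - we1 l) * (X x - we2 l) * (X x - we3 l)))"
  have X': "(X has_real_derivative X' x) (at x)" "(X' x)\<^sup>2 = - (4 * (X x - we1 l) * (X x - we2 l) * (X x - we3 l))"
    if x: "0 < x" "x < pi" for x
  proof -
    have "\<exists>d. (X has_real_derivative d) (at x) \<and> d\<^sup>2 = Re (\<i>\<^sup>2) * (4 * (X x - we1 l) * (X x - we2 l) * (X x - we3 l))"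
      using wp_line_derivative[OF l box[of x] X] x by (metis less_imp_le)
    from someI_ex[OF this] show "(X has_real_derivative X' x) (at x)" "(X' x)\<^sup>2 = - (4 * (X x - we1 l) * (X x - we2 l) * (X x - we3 l))"
      by (simp_all add: X'_def)
  qed
  fix x assume x: "0 < x" "x < pi"
  have tm: "(we3 l - we2 l) / (we3 l - we1 l) * m x = (we3 l - X x) / (we3 l - we1 l)"
    using w by (simp add: m_def)
  show "m x \<noteq> 0 \<and> m x \<noteq> 1 \<and> (we3 l - we2 l) / (we3 l - we1 l) * m x \<noteq> 1"
    unfolding tm using X_ne[OF x] w by (simp add: m_def field_simps)
  show "(m has_real_derivative (- X' x / (we3 l - we2 l))) (at x)"
    unfolding m_def using DERIV_diff[OF DERIV_const X'(1)[OF x], of "we3 l"] by (intro DERIV_cdivide) simp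
  have "1 - m x = (X x - we2 l) / (we3 l - we2 l)" "1 - (we3 l - X x) / (we3 l - we1 l) = (X x - we1 l) / (we3 l - we1 l)"
    using w by (simp_all add: m_def field_simps)
  moreover have "(sqrt (we3 l - we1 l))\<^sup>2 = we3 l - we1 l" using w by simp
  ultimately show "(- X' x / (we3 l - we2 l))\<^sup>2 = 4 * (sqrt (we3 l - we1 l))\<^sup>2 * m x * (1 - m x) * (1 - (we3 l - we2 l) / (we3 l - we1 l) * m x)"
    unfolding tm power_divide power2_minus X'(2)[OF x] using w by (simp add: m_def divide_simps power2_eq_square) (simp add: algebra_simps)
qed

text \<open>Along the horizontal side from \<pi> i to \<pi> i - l/2, of length l/2, wp runs from e_1
  to e_2, and \<open>m\<close> sends e_3 to 1/(1 - t). Both integrals carry the factor sqrt(e_3 -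
  e_1), so their quotient is l/(2 \<pi>).\<close>

lemma rellK_complementary_modulus:
  assumes l: "l > 0"
  shows "rellK ((we2 l - we1 l) / (we3 l - we1 l)) = sqrt (we3 l - we1 l) * (l / 2)"
proof (rule rellK_substitution)
  note w = we_less[OF l]
  define X where "X = (\<lambda>x. Re (wp l (of_real pi * \<i> + of_real x * (-1))))"
  define m where "m = (\<lambda>x. (X x - we1 l) / (we2 l - we1 l))"
  have X: "wp l (of_real pi * \<i> + of_real x * (-1)) = of_real (X x)" for x
    unfolding X_def using wp_real(2)[OF l, of "- x"] by simp
  have box: "of_real pi * \<i> + of_real x * (-1) \<in> period_box l - {0}" if "0 \<le> x" "x \<le> l / 2" for x
    using that l pi_gt_zero by (simp add: period_box_def complex_eq_iff)
  have X_ne: "X x \<noteq> we1 l \<and> X x \<noteq> we2 l \<and> X x \<noteq> we3 l" if x: "0 < x" "x < l / 2" for x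
  proof -
    define u where "u = of_real pi * \<i> + of_real x * (-1)"
    have u: "u \<in> period_box l - {0}" unfolding u_def by (rule box) (use x in auto)
    have "wp l u \<noteq> wp l (of_real pi * \<i>)"
    proof (rule wp_neq[OF l half_in_box(1)[OF l] u])
      have "sg l (u + of_real pi * \<i>) = sg l (- of_real x)" 
        using sg_2pii[of l "- of_real x"] by (simp add: u_def algebra_simps)
      moreover have "u - of_real pi * \<i> = - of_real x" by (simp add: u_def)
      moreover have "sg l (- of_real x) \<noteq> 0"
        using x l by (intro sg_nonzero) (simp_all add: period_box_def complex_eq_iff)
      ultimately show "sg l (u + of_real pi * \<i>) \<noteq> 0" "sg l (u - of_real pi * \<i>) \<noteq> 0" by simp_all
    qed
    moreover have "wp l u \<noteq> wp l (- of_real (l / 2))"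
      by (rule wp_neq[OF l half_in_box(3)[OF l] u]; rule sg_nonzero[OF l])
         (use x l in \<open>simp_all add: u_def period_box_def complex_eq_iff\<close>)
    moreover have "wp l u \<noteq> wp l (of_real pi * \<i> - of_real (l / 2))"
    proof (rule wp_neq[OF l half_in_box(2)[OF l] u])
      have "sg l (u + (of_real pi * \<i> - of_real (l / 2))) = sg l (of_real (- x - l / 2))"
        using sg_2pii[of l "of_real (- x - l / 2)"] by (simp add: u_def algebra_simps)
      moreover have "sg l (of_real (- x - l / 2)) \<noteq> 0"
        using x l by (intro sg_nonzero) (simp_all add: period_box_def complex_eq_iff)
      ultimately show "sg l (u + (of_real pi * \<i> - of_real (l / 2))) \<noteq> 0" by simp
      show "sg l (u - (of_real pi * \<i> - of_real (l / 2))) \<noteq> 0"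
        using x l by (intro sg_nonzero) (simp_all add: u_def period_box_def complex_eq_iff)
    qed
    ultimately show ?thesis unfolding wp_half[OF l] u_def X by simp
  qed
  show "0 < l / 2" using l by simp
  show "continuous_on {0..l / 2} m"
    unfolding m_def X_def using w by (intro continuous_intros wp_line_continuous[OF l] box) auto
  show "m 0 = 0" using wp_half(1)[OF l] by (simp add: m_def X_def)
  have "X (l / 2) = we2 l" using wp_half(2)[OF l] X[of "l / 2"] by (simp add: X_def)
  then show "m (l / 2) = 1" using w by (simp add: m_def)
  show "(we2 l - we1 l) / (we3 l - we1 l) < 1" using w by (simp add: field_simps)
  show "0 < sqrt (we3 l - we1 l)" using w by simp
  define X' where "X' = (\<lambda>x. SOME d. (X has_real_derivative d) (at x) \<and>
      d\<^sup>2 = Re ((-1)\<^sup>2) * (4 * (X x - we1 l) * (X x - we2 l) * (X x - we3 l)))"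
  have X': "(X has_real_derivative X' x) (at x)" "(X' x)\<^sup>2 = 4 * (X x - we1 l) * (X x - we2 l) * (X x - we3 l)"
    if x: "0 < x" "x < l / 2" for x
  proof -
    have "\<exists>d. (X has_real_derivative d) (at x) \<and> d\<^sup>2 = Re ((-1)\<^sup>2) * (4 * (X x - we1 l) * (X x - we2 l) * (X x - we3 l))"
      using wp_line_derivative[OF l box[of x] X] x by (metis less_imp_le)
    from someI_ex[OF this] show "(X has_real_derivative X' x) (at x)" "(X' x)\<^sup>2 = 4 * (X x - we1 l) * (X x - we2 l) * (X x - we3 l)"
      by (simp_all add: X'_def)
  qed
  fix x assume x: "0 < x" "x < l / 2"
  have tm: "(we2 l - we1 l) / (we3 l - we1 l) * m x = (X x - we1 l) / (we3 l - we1 l)"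
    using w by (simp add: m_def)
  show "m x \<noteq> 0 \<and> m x \<noteq> 1 \<and> (we2 l - we1 l) / (we3 l - we1 l) * m x \<noteq> 1"
    unfolding tm using X_ne[OF x] w by (simp add: m_def field_simps)
  show "(m has_real_derivative (X' x / (we2 l - we1 l))) (at x)"
    unfolding m_def using DERIV_diff[OF X'(1)[OF x] DERIV_const, of "we1 l"] by (intro DERIV_cdivide) simp
  have "1 - m x = (we2 l - X x) / (we2 l - we1 l)" "1 - (X x - we1 l) / (we3 l - we1 l) = (we3 l - X x) / (we3 l - we1 l)"
    using w by (simp_all add: m_def field_simps)
  moreover have "(sqrt (we3 l - we1 l))\<^sup>2 = we3 l - we1 l" using w by simp
  ultimately show "(X' x / (we2 l - we1 l))\<^sup>2 = 4 * (sqrt (we3 l - we1 l))\<^sup>2 * m x * (1 - m x) * (1 - (we2 l - we1 l) / (we3 l - we1 l) * m x)"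
    unfolding tm power_divide X'(2)[OF x] using w by (simp add: m_def divide_simps power2_eq_square) (simp add: algebra_simps)
qed

section \<open>The lambda function of the nome\<close>

definition ef :: "complex \<Rightarrow> complex" where "ef x = qp x x"

text \<open>The eta quotient of \<lambda> in the nome q = exp(\<pi> i z): the exponential prefactors
  combine to the single factor \<open>q\<close>, so that the function is holomorphic in the whole
  disc, including q = 0.\<close>

definition lamq :: "complex \<Rightarrow> complex" where
  "lamq q = 16 * q * ef q ^ 8 * ef (q ^ 4) ^ 16 / ef (q ^ 2) ^ 24"

lemma qp_LIMSEQ: "norm x < 1 \<Longrightarrow> (\<lambda>N. \<Prod>n<N. 1 - a * x ^ n) \<longlonglongrightarrow> qp x a"
  unfolding qp_def by (intro has_prod_imp_tendsto' convergent_prod_has_prod convergent_prod_qp)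

lemma prod_even_odd:
  fixes f :: "nat \<Rightarrow> 'a :: comm_monoid_mult"
  shows "(\<Prod>n<2 * N. f n) = (\<Prod>n<N. f (2 * n)) * (\<Prod>n<N. f (2 * n + 1))"
  by (induction N) (simp_all add: mult_ac)

lemma norm_power_less_1: "norm x < 1 \<Longrightarrow> 0 < n \<Longrightarrow> norm (x ^ n :: complex) < 1"
  by (simp add: norm_power power_less_one_iff)

lemma qp_even_odd:
  assumes x: "norm x < 1"
  shows "qp x a = qp (x\<^sup>2) a * qp (x\<^sup>2) (a * x)"
proof -
  have x2: "norm (x\<^sup>2) < 1" using x by (intro norm_power_less_1) auto
  have "strict_mono (\<lambda>N. 2 * N :: nat)" by (simp add: strict_mono_def)
  from LIMSEQ_subseq_LIMSEQ[OF qp_LIMSEQ[OF x, of a] this]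
  have "(\<lambda>N. \<Prod>n<2 * N. 1 - a * x ^ n) \<longlonglongrightarrow> qp x a" by (simp add: o_def)
  moreover have "(\<lambda>N. (\<Prod>n<N. 1 - a * (x\<^sup>2) ^ n) * (\<Prod>n<N. 1 - a * x * (x\<^sup>2) ^ n)) \<longlonglongrightarrow> qp (x\<^sup>2) a * qp (x\<^sup>2) (a * x)"
    by (intro tendsto_mult qp_LIMSEQ x2)
  moreover have "(\<Prod>n<2 * N. 1 - a * x ^ n) = (\<Prod>n<N. 1 - a * (x\<^sup>2) ^ n) * (\<Prod>n<N. 1 - a * x * (x\<^sup>2) ^ n)" for N
    by (simp add: prod_even_odd power_mult mult.assoc)
  ultimately show ?thesis using LIMSEQ_unique by auto
qed

lemma qp_mult_minus:
  assumes x: "norm x < 1"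
  shows "qp x a * qp x (- a) = qp (x\<^sup>2) (a\<^sup>2)"
proof -
  have x2: "norm (x\<^sup>2) < 1" using x by (intro norm_power_less_1) auto
  have "(\<lambda>N. (\<Prod>n<N. 1 - a * x ^ n) * (\<Prod>n<N. 1 - (- a) * x ^ n)) \<longlonglongrightarrow> qp x a * qp x (- a)"
    by (intro tendsto_mult qp_LIMSEQ x)
  moreover have "(\<Prod>n<N. 1 - a * x ^ n) * (\<Prod>n<N. 1 - (- a) * x ^ n) = (\<Prod>n<N. 1 - a\<^sup>2 * (x\<^sup>2) ^ n)" for N
    unfolding prod.distrib[symmetric] by (intro prod.cong refl) (simp add: power2_eq_square power_mult_distrib algebra_simps)
  ultimately show ?thesis using LIMSEQ_unique[OF qp_LIMSEQ[OF x2, of "a\<^sup>2"]] by auto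
qed

lemma ef_nonzero: "norm x < 1 \<Longrightarrow> ef x \<noteq> 0"
proof
  assume x: "norm x < 1" and "ef x = 0"
  then obtain n where "x * x ^ n = 1" unfolding ef_def qp_eq_0_iff[OF x] by (elim exE)
  then have "norm (x ^ Suc n) = 1" by simp
  with norm_power_less_1[OF x, of "Suc n"] show False by simp
qed

lemma ef_local_bound:
  "\<exists>d h. 0 < d \<and> summable h \<and> (\<forall>n. \<forall>y\<in>ball x d \<inter> ball 0 1. norm ((1 - y ^ Suc n) - 1 :: complex) \<le> h n)"
  if "x \<in> ball 0 1"
proof -
  define r where "r = (1 + norm x) / 2"
  have r: "norm x < r" "r < 1" "0 < r" using that by (auto simp: r_def add_pos_nonneg)
  show ?thesis
  proof (intro exI conjI allI ballI)
    show "0 < r - norm x" using r by simp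
    show "summable (\<lambda>n. r ^ Suc n)" using r by (subst summable_Suc_iff) (simp add: summable_geometric)
    fix n y assume "y \<in> ball x (r - norm x) \<inter> ball 0 1"
    then have "norm y \<le> r" using norm_triangle_ineq2[of y x] by (auto simp: dist_norm norm_minus_commute)
    then have "norm (y ^ Suc n) \<le> r ^ Suc n" unfolding norm_power by (intro power_mono) auto
    then show "norm ((1 - y ^ Suc n) - 1) \<le> r ^ Suc n" by simp
  qed
qed

lemma ef_altdef: "ef x = (\<Prod>n. 1 - x ^ Suc n)"
  by (simp add: ef_def qp_def)

lemma ef_holomorphic: "ef holomorphic_on ball 0 1"
proof -
  have "(\<lambda>x. \<Prod>n. 1 - x ^ Suc n :: complex) holomorphic_on ball 0 1"
    by (rule holomorphic_prodinf_local(2)[OF open_ball _ ef_local_bound]) (intro holomorphic_intros)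
  then show ?thesis by (simp only: ef_altdef[symmetric])
qed

lemma holomorphic_ef' [holomorphic_intros]:
  assumes "f holomorphic_on A" "\<And>z. z \<in> A \<Longrightarrow> norm (f z) < 1"
  shows "(\<lambda>z. ef (f z)) holomorphic_on A"
  using holomorphic_on_compose_gen[OF assms(1) ef_holomorphic] assms(2) by (auto simp: o_def image_subset_iff)

lemma ef_logderiv:
  fixes x :: complex
  assumes x: "norm x < 1"
  shows "(\<lambda>n. - (of_nat (Suc n) * x ^ Suc n / (1 - x ^ Suc n))) sums (x * deriv ef x / ef x)"
proof -
  have x': "x \<in> ball 0 1" using x by simp
  have nz: "(\<Prod>n. 1 - x ^ Suc n) \<noteq> 0" using ef_nonzero[OF x] unfolding ef_altdef .
  have hol: "(\<lambda>x. 1 - x ^ Suc n) holomorphic_on ball 0 (1::real)" for n :: nat by (intro holomorphic_intros)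
  have "(\<lambda>n. deriv (\<lambda>x. 1 - x ^ Suc n) x / (1 - x ^ Suc n)) sums
      (deriv (\<lambda>x. \<Prod>n. 1 - x ^ Suc n :: complex) x / (\<Prod>n. 1 - x ^ Suc n))"
    by (rule holomorphic_prodinf_local(3)[OF open_ball hol ef_local_bound x' nz])
  moreover have "deriv (\<lambda>x::complex. 1 - x ^ Suc n) x = - (of_nat (Suc n) * x ^ n)" for n
  proof (rule DERIV_imp_deriv)
    have "((\<lambda>x. x ^ Suc n) has_field_derivative (1 + of_nat n) * (1 * x ^ n)) (at x)"
      by (rule DERIV_power_Suc[OF DERIV_ident])
    from DERIV_diff[OF DERIV_const this, of 1]
    show "((\<lambda>x. 1 - x ^ Suc n) has_field_derivative - (of_nat (Suc n) * x ^ n)) (at x)" by simp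
  qed
  moreover have "(\<lambda>x. \<Prod>n. 1 - x ^ Suc n :: complex) = ef" by (simp add: fun_eq_iff ef_altdef)
  ultimately have "(\<lambda>n. - (of_nat (Suc n) * x ^ n) / (1 - x ^ Suc n)) sums (deriv ef x / ef x)"
    by (simp only: ef_altdef)
  from sums_mult[OF this, of x] show ?thesis by (simp add: mult_ac)
qed

lemma lamq_holomorphic: "lamq holomorphic_on ball 0 1"
  unfolding lamq_def
  by (intro holomorphic_intros) (use norm_power_less_1 ef_nonzero in \<open>auto simp del: norm_power\<close>)

lemma modular_lambda_eq_lamq:
  assumes z: "Im z > 0"
  shows "modular_lambda z = lamq (exp (of_real pi * \<i> * z))"
proof -
  define q where "q = exp (of_real pi * \<i> * z)"
  have eta: "dedekind_eta w = exp (of_real pi * \<i> * w / 12) * ef (exp (2 * of_real pi * \<i> * w))" for w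
    unfolding dedekind_eta_def ef_altdef exp_of_nat_mult[symmetric] by (simp add: mult_ac)
  have q: "exp (2 * of_real pi * \<i> * (z / 2)) = q" "exp (2 * of_real pi * \<i> * z) = q\<^sup>2"
     "exp (2 * of_real pi * \<i> * (2 * z)) = q ^ 4"
    by (simp_all add: q_def exp_of_nat_mult[symmetric] mult_ac)
  define e where "e = exp (of_real pi * \<i> * z / 24)"
  have e: "exp (of_real pi * \<i> * (z / 2) / 12) = e" "exp (of_real pi * \<i> * z / 12) = e\<^sup>2"
    "exp (of_real pi * \<i> * (2 * z) / 12) = e ^ 4" "q = e ^ 24"
    by (simp_all add: e_def q_def exp_of_nat_mult[symmetric] mult_ac)
  have e0: "e \<noteq> 0" by (simp add: e_def)
  have "modular_lambda z = 16 * (e * ef q) ^ 8 * (e ^ 4 * ef (q ^ 4)) ^ 16 / (e\<^sup>2 * ef (q\<^sup>2)) ^ 24"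
    unfolding modular_lambda_def eta q e ..
  also have "\<dots> = 16 * (e ^ 72 / e ^ 48) * ef q ^ 8 * ef (q ^ 4) ^ 16 / ef (q\<^sup>2) ^ 24"
    by (simp add: power_mult_distrib power_mult[symmetric] power_add[symmetric] mult_ac)
  also have "e ^ 72 / e ^ 48 = q"
    using e0 by (simp add: e(4) power_diff[symmetric])
  finally show ?thesis by (simp add: lamq_def q_def)
qed

text \<open>The first identity is Euler's. Writing (a; x) for \<open>qp x a\<close>, the product (q;
  Q)(-q; Q) is (Q; Q^2) and (Q; Q)(-Q; Q) is (Q^2; Q^2); together they give (Q; Q), and the positive
  factor \<open>rqp Q Q\<close> cancels. The other identities express the factors of \<lambda> at
  \<open>q\<close> and at \<open>- q\<close> through the same four products.\<close>

lemma rqp_relations: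
  assumes q: "0 < q" "q < 1"
  defines "Q \<equiv> q\<^sup>2"
  shows "rqp Q q * rqp Q (- q) * rqp Q (- Q) = 1"
    and "ef (of_real q) = of_real (rqp Q Q * rqp Q q)"
    and "ef (- of_real q) = of_real (rqp Q Q * rqp Q (- q))"
    and "ef (of_real q ^ 2) = of_real (rqp Q Q)"
    and "ef (of_real q ^ 4) = of_real (rqp Q Q * rqp Q (- Q))"
    and "0 < rqp Q Q" "0 < rqp Q q" "0 < rqp Q (- q)" "0 < rqp Q (- Q)"
proof -
  have Q: "0 \<le> Q" "Q < 1" "- Q < 1" "q < 1" "- q < 1"
    using q by (auto simp: Q_def power_less_one_iff intro: less_le_trans[of _ 0])
  note r = qp_of_real(1)[OF Q(1,2), symmetric]
  show pos: "0 < rqp Q Q" "0 < rqp Q q" "0 < rqp Q (- q)" "0 < rqp Q (- Q)"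
    using qp_of_real(2)[OF Q(1,2)] Q by simp_all
  have n: "norm (of_real q :: complex) < 1" "norm (- of_real q :: complex) < 1" "norm (of_real Q :: complex) < 1" using q Q by simp_all
  have e2: "(of_real q)\<^sup>2 = (of_real Q :: complex)" by (simp add: Q_def)
  show 2: "ef (of_real q) = of_real (rqp Q Q * rqp Q q)"
    unfolding ef_def qp_even_odd[OF n(1)] of_real_mult r[OF Q(2)] r[OF Q(4)] e2
    by (simp add: mult.commute e2[symmetric] power2_eq_square)
  show 3: "ef (- of_real q) = of_real (rqp Q Q * rqp Q (- q))"
    unfolding ef_def qp_even_odd[OF n(2)] of_real_mult r[OF Q(2)] r[OF Q(5)] power2_minus e2
    by (simp add: mult.commute e2[symmetric] power2_eq_square)
  show 4: "ef (of_real q ^ 2) = of_real (rqp Q Q)"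
    unfolding ef_def e2 r[OF Q(2)] ..
  have "ef (of_real q ^ 4) = qp ((of_real Q)\<^sup>2) ((of_real Q)\<^sup>2)"
    by (simp add: ef_def Q_def)
  also have "\<dots> = of_real (rqp Q Q * rqp Q (- Q))"
    unfolding qp_mult_minus[OF n(3), symmetric] of_real_mult r[OF Q(2)] r[OF Q(3)] by simp
  finally show 5: "ef (of_real q ^ 4) = of_real (rqp Q Q * rqp Q (- Q))" .
  have "of_real (rqp Q q * rqp Q (- q)) = qp ((of_real Q)\<^sup>2) (of_real Q)"
    using qp_mult_minus[OF n(3), of "of_real q"] unfolding of_real_mult r[OF Q(4)] r[OF Q(5)] by (simp add: e2)
  then have "of_real (rqp Q q * rqp Q (- q) * (rqp Q Q * rqp Q (- Q))) = qp ((of_real Q)\<^sup>2) (of_real Q) * qp ((of_real Q)\<^sup>2) ((of_real Q)\<^sup>2)"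
    using 5 by (simp add: ef_def Q_def)
  also have "\<dots> = (of_real (rqp Q Q) :: complex)"
    unfolding r[OF Q(2)] qp_even_odd[OF n(3), of "of_real Q"] by (simp add: power2_eq_square)
  finally have "rqp Q q * rqp Q (- q) * (rqp Q Q * rqp Q (- Q)) = rqp Q Q" by (simp only: of_real_eq_iff)
  then have "(rqp Q q * rqp Q (- q) * rqp Q (- Q)) * rqp Q Q = 1 * rqp Q Q" by (simp only: mult_ac mult_1)
  then show "rqp Q q * rqp Q (- q) * rqp Q (- Q) = 1" by (simp only: mult_right_cancel[OF less_imp_neq[OF pos(1), symmetric]])
qed

text \<open>The first identity is \<lambda> = \<theta>_2^4/\<theta>_3^4. The second is
  \<lambda>(\<tau> - 1) = \<lambda>/(\<lambda> - 1) freed of denominators; it rests on Jacobi's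
  \<theta>_2^4 + \<theta>_4^4 = \<theta>_3^4, which here is the trivial relation (e_3 - e_2) + (e_2
  - e_1) = e_3 - e_1.\<close>

lemma lamq_real:
  assumes l: "l > 0"
  defines "q \<equiv> exp (- l / 2)"
  shows "lamq (of_real q) = of_real ((we3 l - we2 l) / (we3 l - we1 l))"
    and "lamq (- of_real q) * (lamq (of_real q) - 1) = lamq (of_real q)"
proof -
  define Q where "Q = q\<^sup>2"
  have q: "0 < q" "q < 1" using l by (simp_all add: q_def)
  have Qe: "exp (- l) = Q" by (simp add: Q_def q_def exp_of_nat_mult[symmetric])
  note r = rqp_relations[OF q, folded Q_def]
  note d = we_diff[OF l, unfolded Qe, folded q_def]
  define r0 r1 r2 r3 where rd: "r0 = rqp Q Q" "r1 = rqp Q q" "r2 = rqp Q (- q)" "r3 = rqp Q (- Q)"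
  note r' = r[folded rd] and d' = d[folded rd]
  have nz: "r0 \<noteq> 0" "r1 \<noteq> 0" "r2 \<noteq> 0" "r3 \<noteq> 0" using r'(6-9) by auto
  have r2: "r2 = 1 / (r1 * r3)" using r'(1) nz by (simp add: field_simps)
  have L1: "lamq (of_real q) = of_real (16 * q * r1 ^ 8 * r3 ^ 16)"
    unfolding lamq_def r'(2,4,5) using nz by (simp add: power_mult_distrib field_simps flip: power_add)
  have L2: "lamq (- of_real q) = of_real (- (16 * q * r2 ^ 8 * r3 ^ 16))"
    unfolding lamq_def using r'(3,4,5) nz by (simp add: power_mult_distrib field_simps flip: power_add)
  have t: "(we3 l - we2 l) / (we3 l - we1 l) = 16 * q * r1 ^ 8 * r3 ^ 16"
    unfolding d' r2 using nz by (simp add: power_mult_distrib power_divide field_simps flip: power_add)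
  have "1 - (we3 l - we2 l) / (we3 l - we1 l) = (we2 l - we1 l) / (we3 l - we1 l)"
    using we_less[OF l] by (simp add: field_simps)
  also have "\<dots> = r1 ^ 16 * r3 ^ 8"
    unfolding d' r2 using nz by (simp add: power_mult_distrib power_divide field_simps flip: power_add)
  finally have t1: "16 * q * r1 ^ 8 * r3 ^ 16 - 1 = - (r1 ^ 16 * r3 ^ 8)" unfolding t by simp
  show "lamq (of_real q) = of_real ((we3 l - we2 l) / (we3 l - we1 l))"
    unfolding t by (rule L1)
  have "lamq (- of_real q) * (lamq (of_real q) - 1) = of_real (- (16 * q * r2 ^ 8 * r3 ^ 16) * (16 * q * r1 ^ 8 * r3 ^ 16 - 1))"
    unfolding L1 L2 by simp
  also have "- (16 * q * r2 ^ 8 * r3 ^ 16) * (16 * q * r1 ^ 8 * r3 ^ 16 - 1) = 16 * q * r1 ^ 8 * r3 ^ 16"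
    unfolding t1 r2 using nz by (simp add: power_mult_distrib power_divide field_simps flip: power_add)
  finally show "lamq (- of_real q) * (lamq (of_real q) - 1) = lamq (of_real q)" unfolding L1 .
qed

section \<open>Lambert series and the logarithmic derivative of lambda\<close>

definition rkoebe :: "real \<Rightarrow> real" where "rkoebe v = v / (1 - v)\<^sup>2"

lemma koebe_of_real: "koebe (of_real v) = of_real (rkoebe v)"
  by (simp add: koebe_def rkoebe_def)

text \<open>For 0 < x < 1 the sum of \<sigma>(n) x^n, with \<sigma>(n) the sum of the divisors of n,
  that is (1 - E_2)/24.\<close>

definition lambert :: "real \<Rightarrow> real" where "lambert x = (\<Sum>n. rkoebe (x ^ Suc n))"

lemma rkoebe_pow_bound:
  assumes "0 < x" "x < 1"
  shows "0 \<le> rkoebe (x ^ Suc n)" "rkoebe (x ^ Suc n) \<le> x ^ Suc n / (1 - x)\<^sup>2"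
proof -
  have "x ^ Suc n \<le> x ^ 1" using assms by (intro power_decreasing) auto
  then have "(1 - x)\<^sup>2 \<le> (1 - x ^ Suc n)\<^sup>2" using assms by (intro power_mono) auto
  moreover have "0 < (1 - x)\<^sup>2" using assms by simp
  moreover have "0 \<le> x ^ Suc n" using assms by simp
  ultimately show "0 \<le> rkoebe (x ^ Suc n)" "rkoebe (x ^ Suc n) \<le> x ^ Suc n / (1 - x)\<^sup>2"
    unfolding rkoebe_def by (auto intro!: divide_nonneg_nonneg divide_left_mono mult_pos_pos simp del: power_Suc)
qed

lemma summable_power_Suc: "0 < x \<Longrightarrow> x < 1 \<Longrightarrow> summable (\<lambda>n. x ^ Suc n :: real)"
  by (subst summable_Suc_iff) (simp add: summable_geometric)

lemma summable_lambert:
  assumes "0 < x" "x < 1"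
  shows "summable (\<lambda>n. rkoebe (x ^ Suc n))"
proof (rule summable_comparison_test'[of _ 0])
  show "summable (\<lambda>n. x ^ Suc n / (1 - x)\<^sup>2)"
    by (intro summable_divide summable_power_Suc assms)
  show "norm (rkoebe (x ^ Suc n)) \<le> x ^ Suc n / (1 - x)\<^sup>2" for n
    using rkoebe_pow_bound[OF assms] by simp
qed

text \<open>Both sides are the double series over \<open>n x\<^sup>n\<^sup>k\<close>, summed in the two possible orders.\<close>

lemma lambert_sums:
  assumes x: "0 < x" "x < 1"
  shows "(\<lambda>n. real (Suc n) * x ^ Suc n / (1 - x ^ Suc n)) sums lambert x"
proof -
  define f where "f = (\<lambda>(k, n). real (Suc n) * (x ^ Suc k) ^ Suc n)"
  have pw: "0 < x ^ Suc k" "x ^ Suc k < 1" for k using x by (simp_all add: power_less_one_iff del: power_Suc)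
  have f0: "0 \<le> f p" for p using x by (simp add: f_def case_prod_unfold)
  have inner: "((\<lambda>n. f (k, n)) has_sum rkoebe (x ^ Suc k)) UNIV" for k
  proof (rule sums_nonneg_imp_has_sum)
    have "(\<lambda>n. x ^ Suc k * (of_nat (Suc n) * (x ^ Suc k) ^ n)) sums (x ^ Suc k * (1 / (1 - x ^ Suc k)\<^sup>2))"
      using pw[of k] by (intro sums_mult geometric_deriv_sums) simp
    then show "(\<lambda>n. f (k, n)) sums rkoebe (x ^ Suc k)"
      by (simp add: f_def rkoebe_def mult_ac)
  qed (rule f0)
  have outer: "((\<lambda>k. rkoebe (x ^ Suc k)) has_sum lambert x) UNIV"
    unfolding lambert_def using rkoebe_pow_bound(1)[OF x]
    by (intro sums_nonneg_imp_has_sum summable_sums summable_lambert x)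
  have sm: "f summable_on (UNIV \<times> UNIV)"
    by (rule summable_on_SigmaI[where g = "\<lambda>k. rkoebe (x ^ Suc k)"])
       (use inner outer f0 in \<open>auto simp: summable_on_def simp del: power_Suc\<close>)
  have "(f has_sum lambert x) (UNIV \<times> UNIV)"
    by (rule has_sum_SigmaI[OF _ outer sm]) (rule inner)
  then have "((\<lambda>(n, k). f (k, n)) has_sum lambert x) (UNIV \<times> UNIV)"
    by (subst (asm) has_sum_swap)
  then have "((\<lambda>n. real (Suc n) * x ^ Suc n / (1 - x ^ Suc n)) has_sum lambert x) UNIV"
  proof (rule has_sum_SigmaD)
    fix n
    show "((\<lambda>k. (\<lambda>(n, k). f (k, n)) (n, k)) has_sum real (Suc n) * x ^ Suc n / (1 - x ^ Suc n)) UNIV"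
    proof (rule sums_nonneg_imp_has_sum)
      have "(\<lambda>k. (real (Suc n) * x ^ Suc n) * (x ^ Suc n) ^ k) sums ((real (Suc n) * x ^ Suc n) * (1 / (1 - x ^ Suc n)))"
        using pw[of n] by (intro sums_mult geometric_sums) simp
      moreover have "(real (Suc n) * x ^ Suc n) * (x ^ Suc n) ^ k = f (k, n)" for k
        by (simp only: f_def split_conv power_mult[symmetric] mult.assoc power_add[symmetric]) (simp add: algebra_simps)
      ultimately show "(\<lambda>k. (\<lambda>(n, k). f (k, n)) (n, k)) sums (real (Suc n) * x ^ Suc n / (1 - x ^ Suc n))"
        by simp
    qed (simp add: f0)
  qed
  then show ?thesis by (rule has_sum_imp_sums)
qed

text \<open>The number \<open>d\<close> is f'/f at \<open>x\<close>. Multiplied by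
  \<open>f x\<close> it becomes a plain derivative statement that composes under products, quotients
  and powers.\<close>

definition logderiv_at :: "(complex \<Rightarrow> complex) \<Rightarrow> complex \<Rightarrow> complex \<Rightarrow> bool" where
  "logderiv_at f x d \<longleftrightarrow> f x \<noteq> 0 \<and> (f has_field_derivative f x * d) (at x)"

lemma logderiv_at_mult: "logderiv_at f x d \<Longrightarrow> logderiv_at g x e \<Longrightarrow> logderiv_at (\<lambda>x. f x * g x) x (d + e)"
  unfolding logderiv_at_def by (auto intro!: derivative_eq_intros simp: algebra_simps)

lemma logderiv_at_divide: "logderiv_at f x d \<Longrightarrow> logderiv_at g x e \<Longrightarrow> logderiv_at (\<lambda>x. f x / g x) x (d - e)"
  unfolding logderiv_at_def by (auto intro!: derivative_eq_intros simp: field_simps)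

lemma logderiv_at_power: "logderiv_at f x d \<Longrightarrow> logderiv_at (\<lambda>x. f x ^ n) x (of_nat n * d)"
proof (induction n)
  case 0
  then show ?case by (simp add: logderiv_at_def)
next
  case (Suc n)
  from logderiv_at_mult[OF Suc.prems Suc.IH[OF Suc.prems]] show ?case by (simp add: algebra_simps)
qed

lemma logderiv_at_ef:
  assumes x: "0 < x" "x < 1" and n: "0 < n"
  shows "logderiv_at (\<lambda>z. ef (z ^ n)) (of_real x) (- of_real (real n * lambert (x ^ n) / x))"
proof -
  define y where "y = x ^ n"
  have y: "0 < y" "y < 1" using x n by (simp_all add: y_def power_less_one_iff)
  have ny: "norm (of_real y :: complex) < 1" using y by simp
  have "(\<lambda>k. of_real (- (real (Suc k) * y ^ Suc k / (1 - y ^ Suc k)))) sums (of_real (- lambert y) :: complex)"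
    by (intro sums_of_real sums_minus lambert_sums y)
  moreover have "of_real (- (real (Suc k) * y ^ Suc k / (1 - y ^ Suc k))) =
      - (of_nat (Suc k) * of_real y ^ Suc k / (1 - of_real y ^ Suc k) :: complex)" for k
    by simp
  ultimately have "of_real y * deriv ef (of_real y) / ef (of_real y) = of_real (- lambert y)"
    using sums_unique2[OF ef_logderiv[OF ny]] by (simp del: of_nat_Suc power_Suc)
  then have d: "deriv ef (of_real y) = ef (of_real y) * of_real (- lambert y / y)"
    using y ef_nonzero[OF ny] by (simp add: field_simps)
  have "(ef has_field_derivative deriv ef (of_real y)) (at (of_real y))"
    using ny by (intro holomorphic_derivI[OF ef_holomorphic]) auto
  then have "(ef has_field_derivative ef (of_real y) * of_real (- lambert y / y)) (at ((of_real x) ^ n))"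
    unfolding d by (simp add: y_def)
  moreover have "((\<lambda>z. z ^ n) has_field_derivative of_nat n * of_real x ^ (n - 1)) (at (of_real x :: complex))"
    by (auto intro!: derivative_eq_intros)
  ultimately have "((\<lambda>z. ef (z ^ n)) has_field_derivative ef (of_real y) * of_real (- lambert y / y) * (of_nat n * of_real x ^ (n - 1))) (at (of_real x))"
    by (rule DERIV_chain2)
  also have "ef (of_real y) * of_real (- lambert y / y) * (of_nat n * of_real x ^ (n - 1)) =
      ef (of_real x ^ n) * (- of_real (real n * lambert (x ^ n) / x))"
    using x n by (cases n) (simp_all add: y_def field_simps)
  finally show ?thesis
    unfolding logderiv_at_def using ef_nonzero[OF ny] by (simp add: y_def)
qed

text \<open>Each factor \<open>ef (z ^ n)\<close> contributes - n \<open>lambert (q ^ n)\<close> /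
  q; the exponents 8, 16 and -24 at n = 1, 4 and 2 yield the coefficients 8, 64 and 48.\<close>

lemma logderiv_lamq:
  assumes q: "0 < q" "q < 1"
  shows "logderiv_at lamq (of_real q)
           (of_real ((1 - 8 * lambert q - 64 * lambert (q ^ 4) + 48 * lambert (q\<^sup>2)) / q))"
proof -
  have 1: "logderiv_at (\<lambda>z. 16 * z) (of_real q) (of_real (1 / q))"
    using q by (auto simp: logderiv_at_def intro!: derivative_eq_intros)
  have 2: "logderiv_at (\<lambda>z. ef z) (of_real q) (- of_real (lambert q / q))"
    using logderiv_at_ef[OF q, of 1] by simp
  have "logderiv_at lamq (of_real q) (of_real (1 / q) + of_nat 8 * (- of_real (lambert q / q))
       + of_nat 16 * (- of_real (real 4 * lambert (q ^ 4) / q)) - of_nat 24 * (- of_real (real 2 * lambert (q ^ 2) / q)))"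
    unfolding lamq_def by (intro logderiv_at_mult logderiv_at_divide logderiv_at_power 1 2 logderiv_at_ef q) auto
  also have "(of_real (1 / q) + of_nat 8 * (- of_real (lambert q / q))
       + of_nat 16 * (- of_real (real 4 * lambert (q ^ 4) / q)) - of_nat 24 * (- of_real (real 2 * lambert (q ^ 2) / q)) :: complex)
     = of_real ((1 - 8 * lambert q - 64 * lambert (q ^ 4) + 48 * lambert (q\<^sup>2)) / q)"
    using q by (simp add: field_simps)
  finally show ?thesis .
qed

lemma sum_even_odd:
  fixes f :: "nat \<Rightarrow> 'a :: comm_monoid_add"
  shows "(\<Sum>n<2 * N. f n) = (\<Sum>n<N. f (2 * n)) + (\<Sum>n<N. f (2 * n + 1))"
  by (induction N) (simp_all add: add_ac)

lemma suminf_even_odd: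
  fixes f :: "nat \<Rightarrow> real"
  assumes "summable f" "summable (\<lambda>n. f (2 * n + 1))"
  shows "(\<lambda>n. f (2 * n)) sums (suminf f - (\<Sum>n. f (2 * n + 1)))"
proof -
  have "strict_mono (\<lambda>N. 2 * N :: nat)" by (simp add: strict_mono_def)
  from LIMSEQ_subseq_LIMSEQ[OF summable_LIMSEQ[OF assms(1)] this]
  have "(\<lambda>N. \<Sum>n<2 * N. f n) \<longlonglongrightarrow> suminf f" by (simp add: o_def)
  from tendsto_diff[OF this summable_LIMSEQ[OF assms(2)]] show ?thesis
    by (simp add: sums_def sum_even_odd)
qed

lemma rkoebe_minus: "\<bar>v\<bar> < 1 \<Longrightarrow> rkoebe (- v) = 4 * rkoebe (v\<^sup>2) - rkoebe v"
proof -
  assume "\<bar>v\<bar> < 1"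
  then have nz: "1 - v \<noteq> 0" "1 + v \<noteq> 0" by auto
  have "1 - v\<^sup>2 = (1 - v) * (1 + v)" by (simp add: power2_eq_square algebra_simps)
  then show ?thesis using nz unfolding rkoebe_def
    by (simp add: power_mult_distrib divide_simps) (simp add: power2_eq_square algebra_simps)
qed

text \<open>The right side is the numerator in \<open>logderiv_lamq\<close>, so q
  \<lambda>'/\<lambda> = 4 (e_2 - e_1) = \<theta>_4^4. Both e_1 and e_2 are sums of
  \<open>rkoebe\<close> at \<open>- (q ^ k)\<close>, over even and odd k respectively, and
  \<open>rkoebe_minus\<close> reduces these to \<open>lambert\<close>.\<close>

lemma we_diff_lambert:
  assumes l: "l > 0"
  defines "q \<equiv> exp (- l / 2)"
  shows "4 * (we2 l - we1 l) = 1 - 8 * lambert q - 64 * lambert (q ^ 4) + 48 * lambert (q\<^sup>2)"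
proof -
  have q: "0 < q" "q < 1" using l by (simp_all add: q_def)
  have q2: "0 < q\<^sup>2" "q\<^sup>2 < 1" "0 < q ^ 4" "q ^ 4 < 1" using q by (simp_all add: power_less_one_iff)
  define c where "c = (\<lambda>n. rkoebe (- (q ^ Suc n)))"
  have c_eq: "c n = 4 * rkoebe ((q\<^sup>2) ^ Suc n) - rkoebe (q ^ Suc n)" for n
    using rkoebe_minus[of "q ^ Suc n"] q unfolding c_def
    by (simp add: power_less_one_iff abs_of_pos power_mult[symmetric] mult.commute del: power_Suc)
  have c: "c sums (4 * lambert (q\<^sup>2) - lambert q)"
    unfolding c_eq lambert_def using summable_lambert[OF q] summable_lambert[OF q2(1,2)]
    by (intro sums_diff sums_mult summable_sums)
  have "c (2 * n + 1) = 4 * rkoebe ((q ^ 4) ^ Suc n) - rkoebe ((q\<^sup>2) ^ Suc n)" for n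
  proof -
    have "(q\<^sup>2) ^ Suc (2 * n + 1) = (q ^ 4) ^ Suc n" "q ^ Suc (2 * n + 1) = (q\<^sup>2) ^ Suc n"
      unfolding power_mult[symmetric] by (rule arg_cong[of _ _ "power q"], simp)+
    then show ?thesis by (simp only: c_eq)
  qed
  then have "(\<lambda>n. c (2 * n + 1)) sums (4 * lambert (q ^ 4) - lambert (q\<^sup>2))"
    unfolding lambert_def using summable_lambert[OF q2(1,2)] summable_lambert[OF q2(3,4)]
    by (simp only:) (intro sums_diff sums_mult summable_sums)
  note odd = this
  have even: "(\<lambda>n. c (2 * n)) sums ((4 * lambert (q\<^sup>2) - lambert q) - (4 * lambert (q ^ 4) - lambert (q\<^sup>2)))"
    using suminf_even_odd[of c] c odd by (auto simp: sums_iff)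
  have ex: "exp (- of_real (l / 2 * real n)) = (of_real (q ^ n) :: complex)" for n
    unfolding q_def by (simp add: exp_of_real[symmetric] exp_of_nat_mult[symmetric] mult_ac)
  have exq: "exp (of_real pi * \<i> - of_real (l / 2 * real n)) = (of_real (- (q ^ n)) :: complex)"
            "exp (- (of_real pi * \<i>) - of_real (l / 2 * real n)) = (of_real (- (q ^ n)) :: complex)" for n
    unfolding exp_pi_i' ex by simp_all
  \<comment> \<open>The summand -1/4 is \<open>koebe (-1)\<close>, the value of
    \<open>koebe (exp u)\<close> at u = \<pi> i.\<close>
  have "complex_of_real (we1 l) = of_real (- 1 / 4 + 2 * (\<Sum>n. c (2 * n + 1)))"
  proof -
    have "koebe (exp (of_real pi * \<i> - of_real (l * real (Suc n)))) = of_real (c (2 * n + 1))"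
         "koebe (exp (- (of_real pi * \<i>) - of_real (l * real (Suc n)))) = of_real (c (2 * n + 1))" for n
    proof -
      have e: "l * real (Suc n) = l / 2 * real (Suc (2 * n + 1))" by (simp add: field_simps)
      show "koebe (exp (of_real pi * \<i> - of_real (l * real (Suc n)))) = of_real (c (2 * n + 1))"
           "koebe (exp (- (of_real pi * \<i>) - of_real (l * real (Suc n)))) = of_real (c (2 * n + 1))"
        unfolding e exq koebe_of_real c_def by (rule refl)+
    qed
    moreover have "summable (\<lambda>n. c (2 * n + 1))" using odd by (simp add: sums_iff)
    ultimately have "wsum l (of_real pi * \<i>) = of_real (\<Sum>n. c (2 * n + 1))" "wsum l (- (of_real pi * \<i>)) = of_real (\<Sum>n. c (2 * n + 1))"
      unfolding wsum_def by (simp_all only: suminf_of_real)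
    then show ?thesis
      unfolding wp_half(1)[OF l, symmetric] wp_def exp_pi_i by (simp add: koebe_def)
  qed
  then have e1: "we1 l = - 1 / 4 + 2 * (\<Sum>n. c (2 * n + 1))" by (simp only: of_real_eq_iff)
  have "complex_of_real (we2 l) = of_real (2 * (\<Sum>n. c (2 * n)))"
  proof -
    have "koebe (exp (of_real pi * \<i> - of_real (l / 2) - of_real (l * real (Suc n)))) = of_real (c (2 * Suc n))"
         "koebe (exp (- (of_real pi * \<i> - of_real (l / 2)) - of_real (l * real (Suc n)))) = of_real (c (2 * n))" for n
    proof -
      have e: "of_real pi * \<i> - of_real (l / 2) - of_real (l * real (Suc n)) = of_real pi * \<i> - (of_real (l / 2 * real (Suc (2 * Suc n))) :: complex)"
         "- (of_real pi * \<i> - of_real (l / 2)) - of_real (l * real (Suc n)) = - (of_real pi * \<i>) - (of_real (l / 2 * real (Suc (2 * n))) :: complex)"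
        by (simp_all add: complex_eq_iff field_simps)
      show "koebe (exp (of_real pi * \<i> - of_real (l / 2) - of_real (l * real (Suc n)))) = of_real (c (2 * Suc n))"
         "koebe (exp (- (of_real pi * \<i> - of_real (l / 2)) - of_real (l * real (Suc n)))) = of_real (c (2 * n))"
        unfolding e exq koebe_of_real c_def by (rule refl)+
    qed
    moreover have "summable (\<lambda>n. c (2 * n))" using even by (simp add: sums_iff)
    moreover from this have "summable (\<lambda>n. c (2 * Suc n))" by (subst summable_Suc_iff)
    ultimately have "wsum l (of_real pi * \<i> - of_real (l / 2)) = of_real (\<Sum>n. c (2 * Suc n))"
        "wsum l (- (of_real pi * \<i> - of_real (l / 2))) = of_real (\<Sum>n. c (2 * n))"
      unfolding wsum_def by (simp_all only: suminf_of_real)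
    moreover have "koebe (exp (of_real pi * \<i> - of_real (l / 2))) = of_real (c 0)"
    proof -
      have "exp (of_real pi * \<i> - of_real (l / 2)) = (of_real (- (q ^ 1)) :: complex)"
        using exq(1)[of 1] by simp
      then show ?thesis by (simp only: koebe_of_real c_def) simp
    qed
    moreover have "(\<Sum>n. c (2 * Suc n)) = (\<Sum>n. c (2 * n)) - c 0"
      using suminf_split_head[OF \<open>summable (\<lambda>n. c (2 * n))\<close>] by simp
    ultimately show ?thesis
      unfolding wp_half(2)[OF l, symmetric] wp_def by simp
  qed
  then have e2: "we2 l = 2 * (\<Sum>n. c (2 * n))" by (simp only: of_real_eq_iff)
  show ?thesis
    unfolding e1 e2 sums_unique[OF even, symmetric] sums_unique[OF odd, symmetric] by simp
qed

lemma lamq_has_derivative_real: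
  assumes l: "l > 0"
  defines "q \<equiv> exp (- l / 2)"
  shows "(lamq has_field_derivative lamq (of_real q) * of_real (4 * (we2 l - we1 l) / q)) (at (of_real q))"
proof -
  have q: "0 < q" "q < 1" using l by (simp_all add: q_def)
  show ?thesis
    using logderiv_lamq[OF q] we_diff_lambert[OF l, folded q_def] by (simp add: logderiv_at_def)
qed

section \<open>The ratio of the complete elliptic integrals\<close>

text \<open>The plane without the cuts of both K(t) and K(1 - t); \<open>ray_plane\<close> is the
  domain of K(t) alone.\<close>

definition cut_plane :: "complex set" where
  "cut_plane = - (complex_of_real ` ({..0} \<union> {1..}))"

definition ray_plane :: "complex set" where
  "ray_plane = - (complex_of_real ` {1..})"

lemma ray_plane_iff: "t \<in> ray_plane \<longleftrightarrow> (Im t = 0 \<longrightarrow> Re t < 1)"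
  unfolding ray_plane_def by (auto simp: image_iff complex_eq_iff not_le)

lemma cut_plane_iff: "t \<in> cut_plane \<longleftrightarrow> (Im t = 0 \<longrightarrow> 0 < Re t \<and> Re t < 1)"
  unfolding cut_plane_def by (auto simp: image_iff complex_eq_iff not_le)

lemma open_ray_plane: "open ray_plane"
proof -
  have "closed (complex_of_real ` {1..})"
    by (intro closed_injective_linear_image) (auto simp: linear_iff inj_on_def scaleR_conv_of_real)
  then show ?thesis unfolding ray_plane_def by (simp add: open_Compl)
qed

lemma cut_plane_eq: "cut_plane = ray_plane \<inter> {t. 1 - t \<in> ray_plane}"
  by (auto simp: cut_plane_iff ray_plane_iff)

lemma open_cut_plane: "open cut_plane"
proof -
  have "open ((\<lambda>t. 1 - t) -` ray_plane)"
    by (intro open_vimage open_ray_plane continuous_intros)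
  moreover have "(\<lambda>t. 1 - t) -` ray_plane = {t. 1 - t \<in> ray_plane}" by auto
  ultimately show ?thesis unfolding cut_plane_eq using open_ray_plane by auto
qed

lemma segment_in_ray_plane:
  assumes "t \<in> ray_plane" "0 \<le> x" "x \<le> 1"
  shows "of_real x * t \<in> ray_plane"
proof -
  have "x * Re t < 1" if "Re t < 1"
  proof (cases "Re t \<le> 0")
    case True
    then have "x * Re t \<le> 0" using assms(2) by (rule mult_nonneg_nonpos[rotated])
    then show ?thesis by simp
  next
    case False
    then have "x * Re t \<le> 1 * Re t" using assms by (intro mult_right_mono) auto
    with that show ?thesis by simp
  qed
  then show ?thesis using assms by (auto simp: ray_plane_iff)
qed

lemma segment_in_cut_plane:
  assumes "t \<in> cut_plane" "0 < x" "x \<le> 1"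
  shows "of_real x * t \<in> cut_plane"
  using segment_in_ray_plane[of t x] assms
  by (auto simp: cut_plane_iff ray_plane_iff zero_less_mult_iff)

lemma connected_cut_plane: "connected cut_plane"
proof -
  have "starlike cut_plane"
  proof (unfold starlike_def, intro bexI ballI)
    show "1 / 2 \<in> cut_plane" by (simp add: cut_plane_iff)
    fix t assume t: "t \<in> cut_plane"
    show "closed_segment (1 / 2) t \<subseteq> cut_plane"
    proof
      fix s assume "s \<in> closed_segment (1 / 2) t"
      then obtain u where u: "0 \<le> u" "u \<le> 1" "s = (1 - u) *\<^sub>R (1 / 2) + u *\<^sub>R t"
        by (auto simp: in_segment)
      show "s \<in> cut_plane"
      proof (cases "u = 0")
        case True
        then have "s = 1 / 2" using u(3) by (simp add: scaleR_conv_of_real)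
        then show ?thesis by (simp only:) (simp add: cut_plane_iff)
      next
        case False
        have "0 < (1 - u) / 2 + u * Re t \<and> (1 - u) / 2 + u * Re t < 1" if "0 < Re t" "Re t < 1"
        proof -
          have "0 < u * Re t" "u * Re t < u" using that False u by simp_all
          then show ?thesis using u by (auto simp: field_simps)
        qed
        then show ?thesis using t False by (auto simp: cut_plane_iff u(3))
      qed
    qed
  qed
  then show ?thesis by (rule starlike_imp_connected)
qed

lemma one_minus_sin_sq:
  assumes "t \<in> ray_plane"
  shows "1 - t * (of_real (sin \<theta>))\<^sup>2 \<notin> \<real>\<^sub>\<le>\<^sub>0"
proof -
  have "0 \<le> (sin \<theta>)\<^sup>2" "(sin \<theta>)\<^sup>2 \<le> 1" by (simp_all add: abs_square_le_1)
  then have "of_real ((sin \<theta>)\<^sup>2) * t \<in> ray_plane" by (intro segment_in_ray_plane assms)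
  then show ?thesis by (auto simp: ray_plane_iff complex_nonpos_Reals_iff mult.commute)
qed

section \<open>The complete elliptic integral as a holomorphic function\<close>

lemma continuous_on_csqrt':
  assumes "continuous_on A f" "\<And>x. x \<in> A \<Longrightarrow> f x \<notin> \<real>\<^sub>\<le>\<^sub>0"
  shows "continuous_on A (\<lambda>x. csqrt (f x))"
  by (rule continuous_on_compose2[OF continuous_on_csqrt assms(1)]) (use assms(2) in auto)

lemma integrable_ellK:
  assumes "t \<in> ray_plane"
  shows "(\<lambda>\<theta>. 1 / csqrt (1 - t * (of_real (sin \<theta>))\<^sup>2)) integrable_on {0..pi/2}"
    and "continuous_on A (\<lambda>\<theta>. 1 / csqrt (1 - t * (of_real (sin \<theta>))\<^sup>2))"
proof -
  show c: "continuous_on A (\<lambda>\<theta>. 1 / csqrt (1 - t * (of_real (sin \<theta>))\<^sup>2))" for A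
  proof -
    have "csqrt (1 - t * (of_real (sin \<theta>))\<^sup>2) \<noteq> 0" for \<theta> using one_minus_sin_sq[OF assms, of \<theta>] by auto
    then show ?thesis by (intro continuous_intros continuous_on_csqrt' ballI one_minus_sin_sq assms)
  qed
  show "(\<lambda>\<theta>. 1 / csqrt (1 - t * (of_real (sin \<theta>))\<^sup>2)) integrable_on {0..pi/2}"
    by (intro integrable_continuous_real c)
qed

lemma Re_csqrt_pos: assumes "w \<notin> \<real>\<^sub>\<le>\<^sub>0" shows "0 < Re (csqrt w)"
proof (rule ccontr)
  assume "\<not> 0 < Re (csqrt w)"
  then have "Re (csqrt w) = 0" using Re_csqrt[of w] by linarith
  define r where "r = Im (csqrt w)"
  have e: "csqrt w = of_real r * \<i>" using \<open>Re (csqrt w) = 0\<close> unfolding r_def by (intro complex_eqI) simp_all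
  have "w = (csqrt w)\<^sup>2" by simp
  also have "\<dots> = of_real (- (r\<^sup>2))" unfolding e by (simp add: power_mult_distrib)
  finally have "w \<in> \<real>\<^sub>\<le>\<^sub>0" by (simp only: nonpos_Reals_of_real_iff) simp
  with assms show False by simp
qed

lemma Re_inverse_csqrt_pos: assumes "w \<notin> \<real>\<^sub>\<le>\<^sub>0" shows "0 < Re (1 / csqrt w)"
proof -
  have *: "0 < Re (1 / z)" if "0 < Re z" for z :: complex
  proof -
    have "z \<noteq> 0" using that by auto
    moreover have "Re (1 / z) = Re z / (cmod z)\<^sup>2" by (simp add: Re_divide cmod_power2)
    ultimately show ?thesis using that by simp
  qed
  show ?thesis by (rule *[OF Re_csqrt_pos[OF assms]])
qed

lemma integral_linear':
  assumes "f integrable_on S" "bounded_linear h"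
  shows "integral S (\<lambda>x. h (f x)) = h (integral S f)"
  using integral_linear[OF assms] by (simp add: o_def)

text \<open>Principal square roots off the cut have positive real part, and so have their inverses
  and the integral over them. In particular K has no zeros, which makes the ratio \<open>tau\<close>
  holomorphic.\<close>

lemma Re_ellK_pos:
  assumes "t \<in> ray_plane"
  shows "0 < Re (ellK t)"
proof -
  let ?f = "\<lambda>\<theta>. 1 / csqrt (1 - t * (of_real (sin \<theta>))\<^sup>2)"
  have c: "continuous_on {0..pi/2} (\<lambda>\<theta>. Re (?f \<theta>))"
    by (intro continuous_intros integrable_ellK(2)[OF assms])
  have "Re (ellK t) = integral {0..pi/2} (\<lambda>\<theta>. Re (?f \<theta>))"
    unfolding ellK_def by (rule integral_linear'[OF integrable_ellK(1)[OF assms] bounded_linear_Re, symmetric])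
  moreover have "integral {0..pi/2} (\<lambda>\<theta>. 0) < integral {0..pi/2} (\<lambda>\<theta>. Re (?f \<theta>))"
  proof (rule integral_less_real)
    show "{0<..<pi/2} \<noteq> {}" using pi_gt_zero by (simp add: not_le)
    show "0 < Re (?f \<theta>)" for \<theta> by (rule Re_inverse_csqrt_pos[OF one_minus_sin_sq[OF assms]])
  qed (simp_all add: c)
  ultimately show ?thesis by simp
qed

lemma ellK_nonzero: "t \<in> ray_plane \<Longrightarrow> ellK t \<noteq> 0"
  using Re_ellK_pos by force

lemma ellK_of_real:
  assumes "t < 1"
  shows "ellK (of_real t) = of_real (rellK t)"
proof -
  have "1 / csqrt (1 - of_real t * (of_real (sin x))\<^sup>2) = of_real (1 / sqrt (1 - t * (sin x)\<^sup>2))" for x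
  proof -
    have "1 - of_real t * (of_real (sin x))\<^sup>2 = (of_real (1 - t * (sin x)\<^sup>2) :: complex)" by simp
    also have "csqrt \<dots> = of_real (sqrt (1 - t * (sin x)\<^sup>2))"
      using sin_sq_less_1[OF assms, of x] by (intro of_real_sqrt[symmetric]) simp
    finally show ?thesis by simp
  qed
  moreover have "(\<lambda>x. 1 / sqrt (1 - t * (sin x)\<^sup>2)) integrable_on {0..pi/2}"
  proof (intro integrable_continuous_real continuous_intros ballI)
    show "sqrt (1 - t * (sin x)\<^sup>2) \<noteq> 0" for x using sin_sq_less_1[OF assms, of x] by simp
  qed
  ultimately show ?thesis unfolding ellK_def rellK_def
    by (simp only: integral_linear'[OF _ bounded_linear_of_real])
qed

lemma ellK_cnj:
  assumes "t \<in> ray_plane"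
  shows "ellK (cnj t) = cnj (ellK t)"
proof -
  have "1 / csqrt (1 - cnj t * (of_real (sin x))\<^sup>2) = cnj (1 / csqrt (1 - t * (of_real (sin x))\<^sup>2))" for x
  proof -
    have "csqrt (cnj (1 - t * (of_real (sin x))\<^sup>2)) = cnj (csqrt (1 - t * (of_real (sin x))\<^sup>2))"
      using one_minus_sin_sq[OF assms, of x] by (rule cnj_csqrt[symmetric])
    then show ?thesis by simp
  qed
  then show ?thesis unfolding ellK_def using integrable_ellK(1)[OF assms]
    by (simp only: integral_linear'[OF _ bounded_linear_cnj])
qed

lemma ellK_holomorphic: "ellK holomorphic_on ray_plane"
proof -
  have "ellK field_differentiable at t" if t: "t \<in> ray_plane" for t
  proof -
    obtain e where e: "0 < e" "ball t e \<subseteq> ray_plane"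
      using open_ray_plane t by (meson open_contains_ball)
    have nr: "1 - s * (of_real (sin x))\<^sup>2 \<notin> \<real>\<^sub>\<le>\<^sub>0" if "s \<in> ball t e" for s x
      using one_minus_sin_sq e(2) that by blast
    have "(\<lambda>s. integral (cbox 0 (pi/2)) (\<lambda>\<theta>. 1 / csqrt (1 - s * (of_real (sin \<theta>))\<^sup>2))) holomorphic_on ball t e"
    proof (rule leibniz_rule_holomorphic)
      fix s :: complex and x :: real assume s: "s \<in> ball t e"
      have nz: "csqrt (1 - s * (of_real (sin x))\<^sup>2) \<noteq> 0" using nr[OF s, of x] by auto
      show "((\<lambda>s. 1 / csqrt (1 - s * (of_real (sin x))\<^sup>2)) has_field_derivative
         (of_real (sin x))\<^sup>2 / (2 * csqrt (1 - s * (of_real (sin x))\<^sup>2) ^ 3)) (at s within ball t e)"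
        using nr[OF s, of x] nz
        by (auto intro!: derivative_eq_intros simp: field_simps power2_eq_square power3_eq_cube)
    next
      show "(\<lambda>\<theta>. 1 / csqrt (1 - s * (of_real (sin \<theta>))\<^sup>2)) integrable_on cbox 0 (pi/2)" if "s \<in> ball t e" for s
        using integrable_ellK(1)[of s] e(2) that by auto
      show "continuous_on (ball t e \<times> cbox 0 (pi/2)) (\<lambda>(s, x). (of_real (sin x))\<^sup>2 / (2 * csqrt (1 - s * (of_real (sin x))\<^sup>2) ^ 3))"
        unfolding case_prod_unfold
      proof (intro continuous_intros continuous_on_csqrt' ballI)
        fix p assume p: "p \<in> ball t e \<times> cbox 0 (pi/2)"
        show n: "1 - fst p * (of_real (sin (snd p)))\<^sup>2 \<notin> \<real>\<^sub>\<le>\<^sub>0" using p by (intro nr) auto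
        then show "2 * csqrt (1 - fst p * (of_real (sin (snd p)))\<^sup>2) ^ 3 \<noteq> 0" by auto
      qed
    qed simp
    then have "ellK holomorphic_on ball t e" by (simp add: ellK_def[abs_def])
    then show ?thesis using e(1) by (intro holomorphic_on_imp_differentiable_at[of ellK "ball t e"]) auto
  qed
  then show ?thesis by (simp add: holomorphic_on_def field_differentiable_at_within)
qed

text \<open>The ratio of the periods. The functions A and B of the theorem are
  \<open>tau t - w\<close> and \<open>tau t - cnj w\<close> with w = 2z + 1.\<close>

definition tau :: "complex \<Rightarrow> complex" where "tau t = \<i> * ellK (1 - t) / ellK t"

lemma cut_plane_ray: "t \<in> cut_plane \<Longrightarrow> t \<in> ray_plane" "t \<in> cut_plane \<Longrightarrow> 1 - t \<in> ray_plane"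
  by (simp_all add: cut_plane_eq)

lemma tau_holomorphic: "tau holomorphic_on cut_plane"
proof -
  have "ellK holomorphic_on cut_plane"
    using ellK_holomorphic by (rule holomorphic_on_subset) (auto simp: cut_plane_ray)
  moreover have "(ellK \<circ> (\<lambda>t. 1 - t)) holomorphic_on cut_plane"
    by (rule holomorphic_on_compose_gen[OF _ ellK_holomorphic]) (auto simp: cut_plane_ray intro!: holomorphic_intros)
  ultimately show ?thesis
    unfolding tau_def[abs_def] using ellK_nonzero[OF cut_plane_ray(1)]
    by (intro holomorphic_intros) (auto simp: o_def)
qed

lemma tau_one_minus: "t \<in> cut_plane \<Longrightarrow> tau (1 - t) = - 1 / tau t"
  using ellK_nonzero[OF cut_plane_ray(1)] ellK_nonzero[OF cut_plane_ray(2)]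
  by (simp add: tau_def field_simps)

lemma tau_cnj: "t \<in> cut_plane \<Longrightarrow> tau (cnj t) = - cnj (tau t)"
  using ellK_cnj[OF cut_plane_ray(1)] ellK_cnj[OF cut_plane_ray(2)]
  by (simp add: tau_def)

lemma Im_csqrt_sgn:
  assumes "w \<notin> \<real>\<^sub>\<le>\<^sub>0"
  shows "0 \<le> Im w \<Longrightarrow> 0 \<le> Im (csqrt w)" and "Im w \<le> 0 \<Longrightarrow> Im (csqrt w) \<le> 0"
proof -
  have *: "0 \<le> Im (z\<^sup>2) \<Longrightarrow> 0 \<le> Im z" "Im (z\<^sup>2) \<le> 0 \<Longrightarrow> Im z \<le> 0" if "0 < Re z" for z
    using that unfolding Im_power2 by (auto simp: zero_le_mult_iff mult_le_0_iff)
  from *[OF Re_csqrt_pos[OF assms]]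
  show "0 \<le> Im w \<Longrightarrow> 0 \<le> Im (csqrt w)" "Im w \<le> 0 \<Longrightarrow> Im (csqrt w) \<le> 0"
    by (simp_all only: power2_csqrt)
qed

text \<open>The triangle with vertices \<open>0, 1, t\<close> has angle sum \<open>\<pi>\<close>, so the arguments of the two
  square roots differ by less than \<open>\<pi>/2\<close>.\<close>

lemma Re_csqrt_mult_cnj_pos:
  assumes t: "Im t > 0" and x: "0 \<le> x" "x \<le> 1" and y: "0 \<le> y" "y \<le> 1"
    and u: "1 - (1 - t) * of_real x \<notin> \<real>\<^sub>\<le>\<^sub>0" and v: "1 - t * of_real y \<notin> \<real>\<^sub>\<le>\<^sub>0"
  shows "0 < Re (1 / csqrt (1 - (1 - t) * of_real x) * cnj (1 / csqrt (1 - t * of_real y)))"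
proof -
  define A where "A = csqrt (1 - (1 - t) * of_real x)"
  define B where "B = csqrt (1 - t * of_real y)"
  define \<alpha> where "\<alpha> = A * cnj B"
  have A: "0 < Re A" "0 \<le> Im A" unfolding A_def using t x by (intro Re_csqrt_pos Im_csqrt_sgn u; simp)+
  have B: "0 < Re B" "Im B \<le> 0" unfolding B_def using t y by (intro Re_csqrt_pos Im_csqrt_sgn v; simp)+
  have "0 \<le> Im A * Re B" "Re A * Im B \<le> 0"
    using A B by (simp_all add: mult_nonneg_nonneg mult_nonneg_nonpos)
  then have Im\<alpha>: "0 \<le> Im \<alpha>" unfolding \<alpha>_def by simp
  have pos: "0 < Re \<alpha>"
  proof (cases "x = 0 \<and> y = 0")
    case True
    then show ?thesis by (simp add: \<alpha>_def A_def B_def)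
  next
    case False
    have "\<alpha>\<^sup>2 = (1 - (1 - t) * of_real x) * cnj (1 - t * of_real y)"
      by (simp add: \<alpha>_def A_def B_def power_mult_distrib flip: complex_cnj_power)
    then have "Im (\<alpha>\<^sup>2) = Im ((1 - (1 - t) * of_real x) * cnj (1 - t * of_real y))"
      by (rule arg_cong)
    also have "\<dots> = Im t * (x + (1 - x) * y)"
      by (simp add: algebra_simps)
    finally have "Im (\<alpha>\<^sup>2) = Im t * (x + (1 - x) * y)" .
    moreover have "0 < x + (1 - x) * y"
    proof (cases "x = 0")
      case True
      then show ?thesis using False y by simp
    next
      case False
      then show ?thesis using x y by (intro add_pos_nonneg) auto
    qed
    ultimately have "0 < 2 * Re \<alpha> * Im \<alpha>" using t unfolding Im_power2 by simp
    then show ?thesis using Im\<alpha> by (simp add: zero_less_mult_iff)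
  qed
  have "1 / A * cnj (1 / B) = cnj \<alpha> / of_real ((cmod \<alpha>)\<^sup>2)"
    using A B pos unfolding \<alpha>_def complex_norm_square
    by (auto simp: divide_simps)
  then have "Re (1 / A * cnj (1 / B)) = Re \<alpha> / (cmod \<alpha>)\<^sup>2" by (simp only: Re_divide_of_real) simp
  also have "0 < \<dots>" using pos by (intro divide_pos_pos) auto
  finally show ?thesis unfolding A_def B_def .
qed

lemma integral_Re_mult_pos:
  assumes "continuous_on {0..pi/2} f" "\<And>x. 0 < Re (f x * c)"
  shows "0 < Re (integral {0..pi/2} f * c)"
proof -
  have i: "f integrable_on {0..pi/2}" by (intro integrable_continuous_real assms)
  have c: "continuous_on {0..pi/2} (\<lambda>x. Re (f x * c))" by (intro continuous_intros assms)
  have "integral {0..pi/2} (\<lambda>x. 0) < integral {0..pi/2} (\<lambda>x. Re (f x * c))"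
  proof (rule integral_less_real)
    show "{0<..<pi/2} \<noteq> {}" using pi_gt_zero by (simp add: not_le)
  qed (simp_all only: c assms(2) continuous_on_const)
  also have "\<dots> = Re (integral {0..pi/2} f * c)"
    by (rule integral_linear'[OF i, of "\<lambda>z. Re (z * c)"])
       (intro bounded_linear_compose[OF bounded_linear_Re] bounded_linear_mult_left)
  finally show ?thesis by simp
qed

text \<open>The integrands satisfy the inequality for each pair of angles separately. Since
  \<open>Re (a * cnj b)\<close> is real linear in each argument, it stays positive under integration
  over one angle and then over the other.\<close>

lemma Im_tau_pos_upper:
  assumes t: "Im t > 0"
  shows "0 < Re (ellK (1 - t) * cnj (ellK t))"
proof -
  have tc: "t \<in> ray_plane" "1 - t \<in> ray_plane" using t by (auto simp: ray_plane_iff)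
  let ?a = "\<lambda>x. 1 / csqrt (1 - (1 - t) * (of_real (sin x))\<^sup>2)" and ?b = "\<lambda>x. 1 / csqrt (1 - t * (of_real (sin x))\<^sup>2)"
  have pos: "0 < Re (?a x * cnj (?b y))" for x y
    using Re_csqrt_mult_cnj_pos[OF t, of "(sin x)\<^sup>2" "(sin y)\<^sup>2"] one_minus_sin_sq[OF tc(2), of x] one_minus_sin_sq[OF tc(1), of y]
    by (simp add: abs_square_le_1)
  have 1: "0 < Re (ellK (1 - t) * cnj (?b y))" for y
    unfolding ellK_def by (intro integral_Re_mult_pos integrable_ellK(2)[OF tc(2)] pos)
  have sw: "Re (z * cnj w) = Re (w * cnj z)" for z w by simp
  have "0 < Re (ellK t * cnj (ellK (1 - t)))"
    using 1 unfolding ellK_def[of t] sw[of "ellK (1 - t)"]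
    by (intro integral_Re_mult_pos integrable_ellK(2)[OF tc(1)])
  then show ?thesis using sw by metis
qed

text \<open>Im \<tau> has the sign of Re (K(1 - t) cnj K(t)). The lower half plane follows by
  conjugation, and on (0, 1) both integrals are positive.\<close>

lemma Im_tau_pos:
  assumes t: "t \<in> cut_plane"
  shows "0 < Im (tau t)"
proof -
  have K: "ellK t \<noteq> 0" by (intro ellK_nonzero cut_plane_ray t)
  have "0 < Re (ellK (1 - t) * cnj (ellK t))"
  proof (cases "Im t" "0 :: real" rule: linorder_cases)
    case greater
    then show ?thesis by (rule Im_tau_pos_upper)
  next
    case less
    then have "0 < Re (ellK (1 - cnj t) * cnj (ellK (cnj t)))" using Im_tau_pos_upper[of "cnj t"] by simp
    moreover have "ellK (1 - cnj t) = cnj (ellK (1 - t))" using ellK_cnj[OF cut_plane_ray(2)[OF t]] by simp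
    ultimately show ?thesis by (simp add: ellK_cnj[OF cut_plane_ray(1)[OF t]])
  next
    case equal
    have pos: "0 < rellK x" if "x < 1" for x
    proof -
      have "of_real x \<in> ray_plane" using that by (simp add: ray_plane_iff)
      from Re_ellK_pos[OF this] show ?thesis using that by (simp add: ellK_of_real)
    qed
    have r: "0 < Re t" "Re t < 1" using t equal by (auto simp: cut_plane_iff)
    have "t = of_real (Re t)" "1 - t = of_real (1 - Re t)" using equal by (simp_all add: complex_eq_iff)
    then have "ellK t = of_real (rellK (Re t))" "ellK (1 - t) = of_real (rellK (1 - Re t))"
      using ellK_of_real r by (metis, metis diff_less_eq less_add_same_cancel1)
    then show ?thesis using pos[of "Re t"] pos[of "1 - Re t"] r by simp
  qed
  moreover have "tau t = \<i> * (ellK (1 - t) * cnj (ellK t)) / of_real ((cmod (ellK t))\<^sup>2)"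
    unfolding tau_def complex_norm_square using K by simp
  then have "Im (tau t) = Re (ellK (1 - t) * cnj (ellK t)) / (cmod (ellK t))\<^sup>2"
    by (simp only: Im_divide_of_real) simp
  ultimately show ?thesis using K by simp
qed

section \<open>Inversion of the lambda function\<close>

definition lam :: "complex \<Rightarrow> complex" where "lam w = lamq (exp (of_real pi * \<i> * w))"

lemma norm_nome: "norm (exp (of_real pi * \<i> * w)) = exp (- (pi * Im w))"
  by (simp add: norm_exp_eq_Re)

lemma norm_nome_less_1: "Im w > 0 \<Longrightarrow> norm (exp (of_real pi * \<i> * w)) < 1"
  unfolding norm_nome by simp

lemma open_upper_half: "open {w. 0 < Im w}"
  by (simp add: open_halfspace_Im_gt)

lemma lam_holomorphic: "lam holomorphic_on {w. 0 < Im w}"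
proof -
  have "(lamq \<circ> (\<lambda>w. exp (of_real pi * \<i> * w))) holomorphic_on {w. 0 < Im w}"
    by (rule holomorphic_on_compose_gen[OF _ lamq_holomorphic])
       (use norm_nome_less_1 in \<open>auto intro!: holomorphic_intros\<close>)
  then show ?thesis by (simp add: o_def lam_def[abs_def])
qed

text \<open>The choice \<open>l = 2 * pi * y\<close> makes exp(-l/2) the nome of i y, and then K(1 -
  t)/K(t) = l/(2 \<pi>) = y.\<close>

lemma lam_imag_axis:
  assumes y: "y > 0"
  defines "l \<equiv> 2 * pi * y"
  defines "t \<equiv> (we3 l - we2 l) / (we3 l - we1 l)"
  shows "lam (of_real y * \<i>) = of_real t" "0 < t" "t < 1"
    and "ellK (of_real t) = of_real (sqrt (we3 l - we1 l) * pi)"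
    and "tau (of_real t) = of_real y * \<i>"
proof -
  have l: "l > 0" using y by (simp add: l_def)
  note w = we_less[OF l]
  have "exp (of_real pi * \<i> * (of_real y * \<i>)) = complex_of_real (exp (- l / 2))"
    by (simp add: exp_of_real[symmetric] l_def mult_ac)
  then show "lam (of_real y * \<i>) = of_real t"
    unfolding lam_def t_def using lamq_real(1)[OF l] by simp
  show t: "0 < t" "t < 1" using w by (simp_all add: t_def field_simps)
  show K: "ellK (of_real t) = of_real (sqrt (we3 l - we1 l) * pi)"
    using ellK_of_real[OF t(2)] rellK_modulus[OF l] by (simp add: t_def)
  have "1 - t = (we2 l - we1 l) / (we3 l - we1 l)" using w by (simp add: t_def field_simps)
  then have "ellK (1 - of_real t) = of_real (sqrt (we3 l - we1 l) * (l / 2))"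
  proof -
    assume e: "1 - t = (we2 l - we1 l) / (we3 l - we1 l)"
    have "ellK (of_real (1 - t)) = of_real (rellK (1 - t))" using t(1) by (intro ellK_of_real) simp
    also have "rellK (1 - t) = sqrt (we3 l - we1 l) * (l / 2)"
      unfolding e by (rule rellK_complementary_modulus[OF l])
    finally show ?thesis by simp
  qed
  then show "tau (of_real t) = of_real y * \<i>"
    unfolding tau_def K using w by (simp add: l_def field_simps)
qed

lemma real_in_cut_plane: "0 < t \<Longrightarrow> t < 1 \<Longrightarrow> of_real t \<in> cut_plane"
  by (simp add: cut_plane_iff)

lemma tau_lam_imag_axis:
  assumes "y > 0" shows "lam (of_real y * \<i>) \<in> cut_plane" "tau (lam (of_real y * \<i>)) = of_real y * \<i>"
  using lam_imag_axis[OF assms] by (simp_all only: real_in_cut_plane)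

text \<open>Supplies limit points for the identity theorem: the injective continuous image of a ray
  is connected and not a single point.\<close>

lemma islimpt_connected_image:
  fixes f :: "real \<Rightarrow> complex"
  assumes "continuous_on {a<..} f" "inj_on f {a<..}" "a < x"
  shows "f x islimpt f ` {a<..}"
proof (rule connected_imp_perfect)
  show "connected (f ` {a<..})" by (intro connected_continuous_image assms(1)) simp
  show "f x \<in> f ` {a<..}" using assms(3) by auto
  show "f ` {a<..} \<noteq> {c}" for c
  proof
    assume "f ` {a<..} = {c}"
    moreover have "f x \<in> f ` {a<..}" "f (x + 1) \<in> f ` {a<..}" using assms(3) by auto
    ultimately have "f x = c" "f (x + 1) = c" by simp_all
    with inj_onD[OF assms(2), of x "x + 1"] assms(3) show False by simp
  qed
qed

text \<open>The curve t = \<lambda>(i y) is injective because \<open>tau\<close> inverts it, so it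
  accumulates at a point of the cut plane and the identity theorem applies. The results
  \<open>lam_tau\<close>, \<open>deriv_tau\<close> and \<open>eis_tau\<close> are obtained this way
  from the imaginary axis.\<close>

lemma cut_plane_identity:
  assumes hol: "f holomorphic_on cut_plane" and eq: "\<And>y. 0 < y \<Longrightarrow> f (lam (of_real y * \<i>)) = 0"
    and t: "t \<in> cut_plane"
  shows "f t = 0"
proof -
  define g where "g = (\<lambda>y. lam (of_real y * \<i>))"
  have "continuous_on {0<..} g"
    unfolding g_def by (intro continuous_on_compose2[OF holomorphic_on_imp_continuous_on[OF lam_holomorphic]] continuous_intros) auto
  moreover have "inj_on g {0<..}"
  proof (rule inj_onI)
    fix x y :: real assume "x \<in> {0<..}" "y \<in> {0<..}" and gxy: "g x = g y"
    then have xy: "0 < x" "0 < y" by simp_all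
    have "of_real x * \<i> = tau (g x)" unfolding g_def by (rule tau_lam_imag_axis(2)[OF xy(1), symmetric])
    also have "\<dots> = tau (g y)" by (simp only: gxy)
    also have "\<dots> = of_real y * \<i>" unfolding g_def by (rule tau_lam_imag_axis(2)[OF xy(2)])
    finally show "x = y" by simp
  qed
  ultimately have lim: "g 1 islimpt g ` {0<..}" by (intro islimpt_connected_image) auto
  have sub: "g ` {0<..} \<subseteq> cut_plane" using tau_lam_imag_axis(1) by (auto simp: g_def)
  show ?thesis
  proof (rule analytic_continuation[OF hol open_cut_plane connected_cut_plane sub _ lim])
    show "g 1 \<in> cut_plane" by (rule subsetD[OF sub], rule imageI, simp)
    show "f z = 0" if "z \<in> g ` {0<..}" for z using that eq by (auto simp: g_def)
  qed (rule t)
qed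

lemma lam_tau_holomorphic: "(\<lambda>t. lam (tau t)) holomorphic_on cut_plane"
proof -
  have "(lam \<circ> tau) holomorphic_on cut_plane"
    by (rule holomorphic_on_compose_gen[OF tau_holomorphic lam_holomorphic]) (auto simp: Im_tau_pos)
  then show ?thesis by (simp only: o_def)
qed

lemma lam_tau:
  assumes t: "t \<in> cut_plane"
  shows "lam (tau t) = t"
proof -
  have "lam (tau t) - t = 0"
    by (rule cut_plane_identity[OF _ _ t]) (auto intro!: holomorphic_intros lam_tau_holomorphic simp: tau_lam_imag_axis(2))
  then show ?thesis by simp
qed

lemma inj_tau: "inj_on tau cut_plane"
  by (rule inj_on_inverseI[where g = lam]) (rule lam_tau)

section \<open>The lambda function near the cusp\<close>

lemma ef_0: "ef 0 = 1"
  unfolding ef_altdef by simp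

text \<open>Here \<lambda> = 16 q h(q) with h(0) = 1. The inequality |Im h| < Re h says that |arg h|
  < \<pi>/4, the margin used in \<open>lam_high\<close>.\<close>

lemma lamq_near_0:
  obtains M where "0 < M"
    "\<And>w. M < Im w \<Longrightarrow> \<exists>h. lam w = 16 * exp (of_real pi * \<i> * w) * h \<and> \<bar>Im h\<bar> < Re h \<and> norm (lam w) < 1"
proof -
  define h where "h = (\<lambda>q. ef q ^ 8 * ef (q ^ 4) ^ 16 / ef (q\<^sup>2) ^ 24)"
  have "h holomorphic_on ball 0 1"
    unfolding h_def by (intro holomorphic_intros) (use norm_power_less_1 ef_nonzero in \<open>auto simp del: norm_power\<close>)
  then have cont: "continuous_on (ball 0 1) h" by (rule holomorphic_on_imp_continuous_on)
  then have "isCont h 0" by (simp add: continuous_on_eq_continuous_at)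
  then obtain d where d: "0 < d" "\<And>q. dist q 0 < d \<Longrightarrow> dist (h q) (h 0) < 1 / 2"
    unfolding continuous_at_eps_delta by (metis half_gt_zero zero_less_one)
  have h0: "h 0 = 1" by (simp add: h_def ef_0)
  \<comment> \<open>With |q| < 1/32 and |h| < 2 the modulus 16 |q| |h| stays below 1.\<close>
  define e where "e = min d (1 / 32)"
  have e: "0 < e" "e \<le> d" "e \<le> 1 / 32" using d(1) by (auto simp: e_def)
  define M where "M = max 1 (- ln e / pi)"
  show thesis
  proof (rule that)
    show "0 < M" by (simp add: M_def)
    fix w assume "M < Im w"
    then have "- ln e / pi < Im w" by (simp add: M_def)
    then have "- (pi * Im w) < ln e" using pi_gt_zero by (simp add: field_simps)
    then have "exp (- (pi * Im w)) < e" using e(1) by (metis exp_less_mono exp_ln)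
    then have q: "norm (exp (of_real pi * \<i> * w)) < e" unfolding norm_nome .
    define q where "q = exp (of_real pi * \<i> * w)"
    have qe: "norm q < e" using q by (simp add: q_def)
    have "dist (h q) 1 < 1 / 2" using d(2)[of q] qe e(2) h0 by simp
    then have hq: "norm (h q - 1) < 1 / 2" by (simp add: dist_norm)
    have eq: "lam w = 16 * q * h q" by (simp add: lam_def lamq_def h_def q_def)
    have "\<bar>Re (h q) - 1\<bar> < 1 / 2" "\<bar>Im (h q)\<bar> < 1 / 2"
      using abs_Re_le_cmod[of "h q - 1"] abs_Im_le_cmod[of "h q - 1"] hq by simp_all
    then have "\<bar>Im (h q)\<bar> < Re (h q)" by linarith
    moreover have "norm (lam w) < 1"
    proof -
      have "norm (h q) < 2" using norm_triangle_ineq2[of "h q" 1] hq by simp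
      then have "norm q * norm (h q) \<le> norm q * 2" by (intro mult_left_mono) auto
      also have "\<dots> < 1 / 16" using qe e(3) by linarith
      finally show ?thesis unfolding eq norm_mult by simp
    qed
    ultimately show "\<exists>h. lam w = 16 * exp (of_real pi * \<i> * w) * h \<and> \<bar>Im h\<bar> < Re h \<and> norm (lam w) < 1"
      using eq unfolding q_def by (intro exI[of _ "h q"]) (simp add: q_def)
  qed
qed

text \<open>An argument below 3\<pi>/4 in modulus leaves room for a further \<pi>/4 before the
  negative axis is reached; the formula behind it is cos a + sin a = sqrt 2 sin(a +
  \<pi>/4).\<close>

lemma cos_plus_abs_sin_pos:
  assumes "\<bar>x\<bar> < 3 / 4"
  shows "0 < cos (pi * x) + \<bar>sin (pi * x)\<bar>"
proof -
  define a where "a = pi * \<bar>x\<bar>"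
  have a: "0 \<le> a" "a < pi * (3 / 4)" using assms by (simp_all add: a_def)
  have "0 < sin (a + pi / 4)" using a pi_gt_zero by (intro sin_gt_zero) (linarith | simp add: field_simps)+
  also have "sin (a + pi / 4) = (cos a + sin a) * (sqrt 2 / 2)"
    by (simp add: sin_add sin_45 cos_45 algebra_simps)
  finally have "0 < cos a + sin a" by (simp add: zero_less_mult_iff)
  moreover have "cos a = cos (pi * x)" "sin a \<le> \<bar>sin (pi * x)\<bar>"
    by (cases "0 \<le> x"; simp add: a_def)+
  ultimately show ?thesis by linarith
qed

text \<open>High up in the strip |Re w| < 3/4 the arguments of q and h add up to less than \<pi> and
  |\<lambda>| < 1, so \<lambda> avoids both cuts and \<open>tau (lam w) = w\<close> continues from
  the imaginary axis. The bound 3/4 is chosen above 1/2, so that the lines Re w = 1/2 and Re w =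
  -1/2 both lie in the strip.\<close>

lemma lam_high:
  obtains M where "0 < M"
    "\<And>w. M < Im w \<Longrightarrow> \<bar>Re w\<bar> < 3 / 4 \<Longrightarrow> lam w \<in> cut_plane \<and> tau (lam w) = w"
    "\<And>w. M < Im w \<Longrightarrow> Re w = 1 / 2 \<Longrightarrow> 0 < Im (lam w)"
proof -
  obtain M where M: "0 < M"
    "\<And>w. M < Im w \<Longrightarrow> \<exists>h. lam w = 16 * exp (of_real pi * \<i> * w) * h \<and> \<bar>Im h\<bar> < Re h \<and> norm (lam w) < 1"
    by (rule lamq_near_0) (rule that)
  have q: "Re (exp (of_real pi * \<i> * w)) = exp (- (pi * Im w)) * cos (pi * Re w)"
      "Im (exp (of_real pi * \<i> * w)) = exp (- (pi * Im w)) * sin (pi * Re w)" for w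
    by (simp_all add: Re_exp Im_exp)
  define U where "U = {w. M < Im w \<and> \<bar>Re w\<bar> < 3 / 4}"
  have cut: "lam w \<in> cut_plane" if "w \<in> U" for w
  proof -
    have w: "M < Im w" "\<bar>Re w\<bar> < 3 / 4" using that by (auto simp: U_def)
    obtain h where h: "lam w = 16 * exp (of_real pi * \<i> * w) * h" "\<bar>Im h\<bar> < Re h" "norm (lam w) < 1"
      using M(2)[OF w(1)] by auto
    define q where "q = exp (of_real pi * \<i> * w)"
    have qpos: "0 < Re q + \<bar>Im q\<bar>"
    proof -
      have "Re q + \<bar>Im q\<bar> = exp (- (pi * Im w)) * (cos (pi * Re w) + \<bar>sin (pi * Re w)\<bar>)"
        unfolding q_def q by (simp add: abs_mult algebra_simps)
      then show ?thesis using cos_plus_abs_sin_pos[OF w(2)] by simp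
    qed
    have q0: "q \<noteq> 0" by (simp add: q_def)
    \<comment> \<open>If \<lambda> = s \<le> 0, then |q|^2 h = (s/16) cnj q. The quantity Re - |Im|
      is positive on the left, while on the right it equals (s/16)(Re q + |Im q|) \<le> 0.\<close>
    have False if s: "lam w = of_real s" "s \<le> 0" for s
    proof -
      define n where "n = (cmod q)\<^sup>2"
      have "of_real n = q * cnj q" unfolding n_def by (rule complex_norm_square)
      then have "of_real n * h = (q * h) * cnj q" by (simp only: mult_ac)
      also have "q * h = of_real (s / 16)" using h(1) s(1) by (simp add: q_def)
      finally have eq: "of_real n * h = of_real (s / 16) * cnj q" .
      have e1: "n * Re h = s / 16 * Re q" using arg_cong[OF eq, of Re] by (simp del: of_real_divide)
      have "n * Im h = - (s / 16 * Im q)" using arg_cong[OF eq, of Im] by (simp del: of_real_divide)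
      moreover have "0 \<le> n" by (simp add: n_def)
      ultimately have e2: "n * \<bar>Im h\<bar> = - (s / 16) * \<bar>Im q\<bar>"
        using s(2) by (metis abs_minus_cancel abs_mult abs_of_nonneg abs_of_nonpos divide_nonpos_pos zero_less_numeral)
      have "n * (Re h - \<bar>Im h\<bar>) = s / 16 * (Re q + \<bar>Im q\<bar>)"
        using e1 e2 by (simp add: algebra_simps)
      moreover have "0 < n * (Re h - \<bar>Im h\<bar>)" using q0 h(2) by (simp add: n_def)
      moreover have "s / 16 * (Re q + \<bar>Im q\<bar>) \<le> 0" using s(2) qpos by (intro mult_nonpos_nonneg) auto
      ultimately show False by linarith
    qed
    then have "\<not> (Im (lam w) = 0 \<and> Re (lam w) \<le> 0)" by (metis complex_eq_iff Re_complex_of_real Im_complex_of_real)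
    moreover have "Re (lam w) < 1" using complex_Re_le_cmod[of "lam w"] h(3) by linarith
    ultimately show ?thesis by (auto simp: cut_plane_iff)
  qed
  have oU: "open U"
  proof -
    have "U = {w. M < Im w} \<inter> {w. Re w < 3 / 4} \<inter> {w. - 3 / 4 < Re w}" by (auto simp: U_def)
    then show ?thesis by (simp only:) (intro open_Int open_halfspace_Im_gt open_halfspace_Re_lt open_halfspace_Re_gt)
  qed
  have cU: "connected U"
  proof (rule convex_connected)
    have "U = {w. M < Im w} \<inter> {w. Re w < 3 / 4} \<inter> {w. - 3 / 4 < Re w}" by (auto simp: U_def)
    then show "convex U" by (simp only:) (intro convex_Int convex_halfspace_Im_gt convex_halfspace_Re_lt convex_halfspace_Re_gt)
  qed
  have hol: "(\<lambda>w. tau (lam w) - w) holomorphic_on U"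
  proof -
    have "lam holomorphic_on U" using lam_holomorphic by (rule holomorphic_on_subset) (use M(1) in \<open>auto simp: U_def\<close>)
    from holomorphic_on_compose_gen[OF this tau_holomorphic] cut show ?thesis
      by (intro holomorphic_intros) (auto simp: o_def)
  qed
  define f where "f = (\<lambda>y. of_real y * \<i>)"
  have lim: "f (M + 1) islimpt f ` {M<..}"
    by (rule islimpt_connected_image) (auto simp: f_def inj_on_def intro!: continuous_intros)
  have sub: "f ` {M<..} \<subseteq> U" by (auto simp: f_def U_def)
  have id: "tau (lam w) = w" if "w \<in> U" for w
  proof -
    have "tau (lam w) - w = 0"
    proof (rule analytic_continuation[OF hol oU cU sub _ lim _ that])
      show "f (M + 1) \<in> U" using sub by auto
      show "tau (lam z) - z = 0" if "z \<in> f ` {M<..}" for z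
        using that tau_lam_imag_axis(2) M(1) by (auto simp: f_def)
    qed
    then show ?thesis by simp
  qed
  have half: "0 < Im (lam w)" if w: "M < Im w" "Re w = 1 / 2" for w
  proof -
    obtain h where h: "lam w = 16 * exp (of_real pi * \<i> * w) * h" "\<bar>Im h\<bar> < Re h"
      using M(2)[OF w(1)] by auto
    have "exp (of_real pi * \<i> * w) = of_real (exp (- (pi * Im w))) * \<i>"
      unfolding complex_eq_iff q w(2) by simp
    then have "Im (lam w) = 16 * exp (- (pi * Im w)) * Re h" unfolding h(1) by simp
    then show ?thesis using h(2) by simp
  qed
  show thesis
    by (rule that[OF M(1)]) (use cut id half in \<open>auto simp: U_def\<close>)
qed

text \<open>Continued from q = exp(-l/2) to the unit disc. The form without denominators also shows
  \<lambda> \<noteq> 1, since \<lambda> = 1 would turn it into 0 = 1.\<close>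

lemma lamq_minus:
  assumes q: "norm q < 1"
  shows "lamq (- q) * (lamq q - 1) = lamq q"
proof -
  define f where "f = (\<lambda>l. complex_of_real (exp (- l / 2)))"
  have "(lamq \<circ> (\<lambda>q. - q)) holomorphic_on ball 0 1"
    by (rule holomorphic_on_compose_gen[OF _ lamq_holomorphic]) (auto intro!: holomorphic_intros)
  then have m: "(\<lambda>q. lamq (- q)) holomorphic_on ball 0 1" by (simp only: o_def)
  have hol: "(\<lambda>q. lamq (- q) * (lamq q - 1) - lamq q) holomorphic_on ball 0 1"
    by (intro holomorphic_intros m lamq_holomorphic)
  have lim: "f 1 islimpt f ` {0<..}"
    by (rule islimpt_connected_image) (auto simp: f_def inj_on_def intro!: continuous_intros)
  have sub: "f ` {0<..} \<subseteq> ball 0 1" by (auto simp: f_def)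
  have "lamq (- q) * (lamq q - 1) - lamq q = 0"
  proof (rule analytic_continuation[OF hol open_ball connected_ball sub _ lim])
    show "f 1 \<in> ball 0 1" by (rule subsetD[OF sub], rule imageI, simp)
    show "lamq (- z) * (lamq z - 1) - lamq z = 0" if "z \<in> f ` {0<..}" for z
      using that lamq_real(2) by (auto simp: f_def)
  qed (use q in simp)
  then show ?thesis by simp
qed

section \<open>Translation by 1 and boundary values of the ratio\<close>

lemma lam_nonzero: "Im w > 0 \<Longrightarrow> lam w \<noteq> 0"
  using norm_nome_less_1[of w] ef_nonzero norm_power_less_1[of "exp (of_real pi * \<i> * w)"]
  unfolding lam_def lamq_def by simp

lemma lam_neq_1: assumes "Im w > 0" shows "lam w \<noteq> 1"
  using lamq_minus[OF norm_nome_less_1[OF assms]] unfolding lam_def by auto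

lemma lam_minus_one: assumes "Im w > 0" shows "lam (w - 1) = lam w / (lam w - 1)"
proof -
  have "exp (of_real pi * \<i> * (w - 1)) = - exp (of_real pi * \<i> * w)"
    by (simp add: algebra_simps exp_diff exp_pi_i)
  then show ?thesis
    using lamq_minus[OF norm_nome_less_1[OF assms]] lam_neq_1[OF assms] unfolding lam_def by (simp add: field_simps)
qed

lemma Im_divide_minus_one: "Im (t / (t - 1)) = - Im t / (cmod (t - 1))\<^sup>2"
  by (simp add: Im_divide cmod_power2) (simp add: algebra_simps)

text \<open>On the curve t = \<lambda>(1/2 + i y), y large, the values of \<open>tau\<close> at t
  and at t/(t - 1) = \<lambda>(-1/2 + i y) are known from \<open>lam_high\<close>; the identity
  theorem extends the rule to the upper half plane. In the lower half plane the shift has the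
  opposite sign, so the two halves are treated separately.\<close>

lemma tau_divide_minus_one_upper:
  assumes t: "0 < Im t"
  shows "tau (t / (t - 1)) = tau t - 1"
proof -
  obtain M where M: "0 < M"
    "\<And>w. M < Im w \<Longrightarrow> \<bar>Re w\<bar> < 3 / 4 \<Longrightarrow> lam w \<in> cut_plane \<and> tau (lam w) = w"
    "\<And>w. M < Im w \<Longrightarrow> Re w = 1 / 2 \<Longrightarrow> 0 < Im (lam w)"
    by (rule lam_high) (rule that)
  define g where "g = (\<lambda>y. lam (1 / 2 + of_real y * \<i>))"
  have g: "0 < Im (g y)" "tau (g y) = 1 / 2 + of_real y * \<i>" "tau (g y / (g y - 1)) = tau (g y) - 1" if "M < y" for y
  proof -
    show "0 < Im (g y)" "tau (g y) = 1 / 2 + of_real y * \<i>"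
      using M(2,3)[of "1 / 2 + of_real y * \<i>"] that by (simp_all add: g_def)
    moreover have "g y / (g y - 1) = lam (1 / 2 + of_real y * \<i> - 1)"
      unfolding g_def using that M(1) by (intro lam_minus_one[symmetric]) simp
    moreover have "tau (lam (1 / 2 + of_real y * \<i> - 1)) = 1 / 2 + of_real y * \<i> - 1"
      using M(2)[of "1 / 2 + of_real y * \<i> - 1"] that by simp
    ultimately show "tau (g y / (g y - 1)) = tau (g y) - 1" by simp
  qed
  have cont: "continuous_on {M<..} g"
    unfolding g_def using M(1)
    by (intro continuous_on_compose2[OF holomorphic_on_imp_continuous_on[OF lam_holomorphic]] continuous_intros) auto
  have "inj_on g {M<..}"
  proof (rule inj_onI)
    fix x y :: real assume x: "x \<in> {M<..}" and y: "y \<in> {M<..}" and "g x = g y"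
    then have "tau (g x) = tau (g y)" by simp
    with g(2)[of x] g(2)[of y] x y have "(1 / 2 + of_real x * \<i> :: complex) = 1 / 2 + of_real y * \<i>"
      by (simp only: greaterThan_iff)
    then show "x = y" by simp
  qed
  with cont have lim: "g (M + 1) islimpt g ` {M<..}" by (intro islimpt_connected_image) auto
  have up: "t \<in> cut_plane" "t / (t - 1) \<in> cut_plane" if "0 < Im t" for t
  proof -
    show "t \<in> cut_plane" using that by (simp add: cut_plane_iff)
    have "t - 1 \<noteq> 0" using that by auto
    then have "Im (t / (t - 1)) \<noteq> 0" unfolding Im_divide_minus_one using that by simp
    then show "t / (t - 1) \<in> cut_plane" by (simp add: cut_plane_iff)
  qed
  have c: "connected {t. 0 < Im t}" by (intro convex_connected) (simp add: convex_halfspace_Im_gt)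
  have "(tau \<circ> (\<lambda>t. t / (t - 1))) holomorphic_on {t. 0 < Im t}"
    by (rule holomorphic_on_compose_gen[OF _ tau_holomorphic]) (use up in \<open>auto intro!: holomorphic_intros\<close>)
  moreover have "tau holomorphic_on {t. 0 < Im t}"
    using tau_holomorphic by (rule holomorphic_on_subset) (use up in auto)
  ultimately have hol: "(\<lambda>t. tau (t / (t - 1)) - (tau t - 1)) holomorphic_on {t. 0 < Im t}"
    by (intro holomorphic_intros) (simp add: o_def)
  have sub: "g ` {M<..} \<subseteq> {t. 0 < Im t}" using g(1) by auto
  have "tau (t / (t - 1)) - (tau t - 1) = 0"
  proof (rule analytic_continuation[OF hol open_upper_half c sub _ lim])
    show "g (M + 1) \<in> {t. 0 < Im t}" by (rule subsetD[OF sub], rule imageI, simp)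
    show "tau (z / (z - 1)) - (tau z - 1) = 0" if "z \<in> g ` {M<..}" for z
      using that g(3) by auto
  qed (use t in simp)
  then show ?thesis by simp
qed

text \<open>The shift is -1 above and +1 below the real axis; the absolute values give one estimate
  for both sides of the cut.\<close>

lemma abs_Re_tau_close_to_1:
  assumes t: "t \<in> cut_plane" "Re t < 0"
  shows "\<bar>\<bar>Re (tau t)\<bar> - 1\<bar> \<le> \<bar>Re (tau (t / (t - 1)))\<bar>"
proof (cases "Im t" "0 :: real" rule: linorder_cases)
  case equal
  with t show ?thesis by (auto simp: cut_plane_iff)
next
  case greater
  show ?thesis unfolding tau_divide_minus_one_upper[OF greater] by simp
next
  case less
  have "Im (t / (t - 1)) \<noteq> 0" using less unfolding Im_divide_minus_one by auto
  then have c: "t / (t - 1) \<in> cut_plane" by (simp add: cut_plane_iff)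
  have "tau (cnj t / (cnj t - 1)) = tau (cnj t) - 1"
    using less by (intro tau_divide_minus_one_upper) simp
  moreover have "cnj t / (cnj t - 1) = cnj (t / (t - 1))" by simp
  ultimately have "- cnj (tau (t / (t - 1))) = - cnj (tau t) - 1"
    using tau_cnj[OF t(1)] tau_cnj[OF c] by (simp only:)
  then have "Re (- cnj (tau (t / (t - 1)))) = Re (- cnj (tau t) - 1)" by (rule arg_cong)
  then have "Re (tau (t / (t - 1))) = Re (tau t) + 1" by simp
  then show ?thesis by simp
qed

lemma Re_tau_real:
  assumes "0 < x" "x < 1" shows "Re (tau (of_real x)) = 0"
proof -
  have "tau (cnj (of_real x)) = - cnj (tau (of_real x))" by (intro tau_cnj real_in_cut_plane assms)
  then have "Re (tau (of_real x)) = Re (- cnj (tau (of_real x)))" by simp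
  then show ?thesis by simp
qed

text \<open>The map t/(t - 1) sends the negative axis into (0, 1), where \<open>tau\<close> is
  continuous and purely imaginary. So the right side of \<open>abs_Re_tau_close_to_1\<close> tends
  to 0 along the sequence.\<close>

lemma boundary_value_tau:
  assumes t: "\<And>n. t n \<in> cut_plane" and lim: "t \<longlonglongrightarrow> s" "(\<lambda>n. tau (t n)) \<longlonglongrightarrow> w"
    and s: "Im s = 0" "Re s < 0"
  shows "\<bar>Re w\<bar> = 1"
proof -
  define x where "x = Re s / (Re s - 1)"
  have sx: "s / (s - 1) = of_real x"
  proof -
    have "s = of_real (Re s)" using s by (simp add: complex_eq_iff)
    then show ?thesis unfolding x_def by (metis of_real_1 of_real_diff of_real_divide)
  qed
  have x: "0 < x" "x < 1" using s by (simp_all add: x_def divide_simps)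
  have "s - 1 \<noteq> 0" using s by (auto simp: complex_eq_iff)
  then have "(\<lambda>n. t n / (t n - 1)) \<longlonglongrightarrow> s / (s - 1)" by (intro tendsto_intros lim) auto
  moreover have "isCont tau (s / (s - 1))"
    unfolding sx using holomorphic_on_imp_continuous_on[OF tau_holomorphic] open_cut_plane real_in_cut_plane[OF x]
    by (simp add: continuous_on_eq_continuous_at)
  ultimately have "(\<lambda>n. tau (t n / (t n - 1))) \<longlonglongrightarrow> tau (s / (s - 1))"
    by (rule isCont_tendsto_compose[rotated])
  then have "(\<lambda>n. \<bar>Re (tau (t n / (t n - 1)))\<bar>) \<longlonglongrightarrow> \<bar>Re (tau (s / (s - 1)))\<bar>"
    by (intro tendsto_intros)
  then have 0: "(\<lambda>n. \<bar>Re (tau (t n / (t n - 1)))\<bar>) \<longlonglongrightarrow> 0"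
    unfolding sx Re_tau_real[OF x] by simp
  have ev: "\<forall>\<^sub>F n in sequentially. Re (t n) < 0"
    using tendsto_Re[OF lim(1)] s(2) by (rule order_tendstoD)
  have "(\<lambda>n. \<bar>Re (tau (t n))\<bar> - 1) \<longlonglongrightarrow> 0"
  proof (rule Lim_null_comparison[OF _ 0])
    show "\<forall>\<^sub>F n in sequentially. norm (\<bar>Re (tau (t n))\<bar> - 1) \<le> \<bar>Re (tau (t n / (t n - 1)))\<bar>"
      using ev by eventually_elim (use abs_Re_tau_close_to_1 t in simp)
  qed
  moreover have "(\<lambda>n. \<bar>Re (tau (t n))\<bar> - 1) \<longlonglongrightarrow> \<bar>Re w\<bar> - 1"
    by (intro tendsto_intros lim)
  ultimately have "\<bar>Re w\<bar> - 1 = 0" by (rule LIMSEQ_unique[rotated])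
  then show ?thesis by simp
qed

text \<open>The interior of the usual fundamental domain of \<Gamma>(2); with w = 2z + 1 its
  conditions are the hypotheses on z.\<close>

definition fund_domain :: "complex set" where
  "fund_domain = {w. 0 < Im w \<and> \<bar>Re w\<bar> < 1 \<and> 1 / 2 < cmod (w - 1 / 2) \<and> 1 / 2 < cmod (w + 1 / 2)}"

text \<open>Squaring turns the two circle conditions into |Re w| < |w|^2, which is |Re (-1/w)| < 1.
  The map -1/w thus exchanges the circles with the lines |Re w| = 1.\<close>

lemma fund_domain_iff: "w \<in> fund_domain \<longleftrightarrow> 0 < Im w \<and> \<bar>Re w\<bar> < 1 \<and> \<bar>Re w\<bar> < (cmod w)\<^sup>2"
proof -
  have "1 / 2 < cmod (w - of_real a / 2) \<longleftrightarrow> a * Re w < (cmod w)\<^sup>2" if "a\<^sup>2 = 1" for a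
  proof -
    have "1 / 2 < cmod (w - of_real a / 2) \<longleftrightarrow> (1 / 2)\<^sup>2 < (cmod (w - of_real a / 2))\<^sup>2"
      by (auto intro: power_strict_mono dest: power_less_imp_less_base)
    also have "(cmod (w - of_real a / 2))\<^sup>2 = (cmod w)\<^sup>2 - a * Re w + (1 / 2)\<^sup>2"
    proof -
      have "(cmod (w - of_real a / 2))\<^sup>2 = (Re w)\<^sup>2 - a * Re w + a\<^sup>2 / 4 + (Im w)\<^sup>2"
        unfolding cmod_power2 by (simp add: power2_eq_square algebra_simps)
      then show ?thesis unfolding that cmod_power2 by (simp add: power2_eq_square)
    qed
    finally show ?thesis by simp
  qed
  from this[of 1] this[of "-1"] show ?thesis
    unfolding fund_domain_def by (auto simp: abs_less_iff)
qed

text \<open>From each point a vertical ray stays in the domain and enters a convex half strip, which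
  joins all the rays.\<close>

lemma connected_fund_domain: "connected fund_domain"
proof -
  define C where "C = {w. 1 / 2 < Im w \<and> \<bar>Re w\<bar> < 1}"
  have conv: "convex C"
  proof -
    have "C = {w. 1 / 2 < Im w} \<inter> {w. Re w < 1} \<inter> {w. -1 < Re w}" by (auto simp: C_def)
    then show ?thesis by (simp only:) (intro convex_Int convex_halfspace_Im_gt convex_halfspace_Re_lt convex_halfspace_Re_gt)
  qed
  define R where "R = (\<lambda>w. (\<lambda>s. w + of_real s * \<i>) ` {0..})"
  have cR: "connected (R w)" for w
    unfolding R_def by (intro connected_continuous_image continuous_intros) simp
  have up: "w + of_real s * \<i> \<in> fund_domain" if "w \<in> fund_domain" "0 \<le> s" for w s
  proof -
    have "(Im w)\<^sup>2 \<le> (Im w + s)\<^sup>2" using that by (intro power_mono) (auto simp: fund_domain_iff)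
    moreover have "\<bar>Re w\<bar> < (Re w)\<^sup>2 + (Im w)\<^sup>2" using that by (simp add: fund_domain_iff cmod_power2)
    ultimately have "\<bar>Re w\<bar> < (Re w)\<^sup>2 + (Im w + s)\<^sup>2" by linarith
    then show ?thesis using that by (simp add: fund_domain_iff cmod_power2)
  qed
  have C_sub: "C \<subseteq> fund_domain"
  proof
    fix w assume w: "w \<in> C"
    have "\<bar>Re w\<bar> < (Re w)\<^sup>2 + (Im w)\<^sup>2"
    proof -
      have "(1 / 2)\<^sup>2 < (Im w)\<^sup>2" using w by (intro power_strict_mono) (auto simp: C_def)
      moreover have "0 \<le> (\<bar>Re w\<bar> - 1 / 2)\<^sup>2" by simp
      then have "\<bar>Re w\<bar> \<le> (Re w)\<^sup>2 + (1 / 2)\<^sup>2" by (simp add: power2_eq_square algebra_simps)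
      ultimately show ?thesis by linarith
    qed
    with w show "w \<in> fund_domain" by (auto simp: fund_domain_iff C_def cmod_power2)
  qed
  have "connected (C \<union> R w)" if w: "w \<in> fund_domain" for w
  proof (rule connected_Un[OF convex_connected[OF conv] cR])
    have "w + of_real 1 * \<i> \<in> C \<inter> R w" using w by (auto simp: C_def R_def fund_domain_iff)
    then show "C \<inter> R w \<noteq> {}" by blast
  qed
  moreover have "fund_domain = (\<Union>w\<in>fund_domain. C \<union> R w)"
  proof
    show "fund_domain \<subseteq> (\<Union>w\<in>fund_domain. C \<union> R w)"
    proof
      fix w assume "w \<in> fund_domain"
      moreover have "w \<in> R w" unfolding R_def by (rule image_eqI[of _ _ 0]) auto
      ultimately show "w \<in> (\<Union>w\<in>fund_domain. C \<union> R w)" by blast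
    qed
    show "(\<Union>w\<in>fund_domain. C \<union> R w) \<subseteq> fund_domain" using C_sub up by (auto simp: R_def)
  qed
  moreover have "\<i> \<in> C" by (simp add: C_def)
  then have "\<Inter> ((\<lambda>w. C \<union> R w) ` fund_domain) \<noteq> {}" by blast
  ultimately show ?thesis
    by (metis (mono_tags, lifting) connected_Union imageE)
qed

text \<open>Continuity of \<lambda> carries w = lim tau(t_n) to s = lim t_n = \<lambda>(w), and only
  s on a cut can prevent w = tau(s). For s < 0 this forces |Re w| = 1; for s > 1 the reflection of t
  to 1 - t, which maps tau to -1/tau, gives |Re w| = |w|^2. The end points 0 and 1 are never values
  of \<lambda>.\<close>

lemma fund_domain_closure:
  assumes w: "w \<in> fund_domain" "w \<in> closure (tau ` cut_plane)"
  shows "w \<in> tau ` cut_plane"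
proof -
  have Imw: "0 < Im w" using w by (simp add: fund_domain_iff)
  then have w0: "w \<noteq> 0" by auto
  obtain u where u: "\<And>n. u n \<in> tau ` cut_plane" "u \<longlonglongrightarrow> w"
    using w(2) unfolding closure_sequential by blast
  define t where "t = (\<lambda>n. lam (u n))"
  have t: "t n \<in> cut_plane" "tau (t n) = u n" for n
    using u(1)[of n] lam_tau by (auto simp: t_def)
  have tw: "(\<lambda>n. tau (t n)) \<longlonglongrightarrow> w" using u(2) t(2) by simp
  define s where "s = lam w"
  have "isCont lam w"
    using holomorphic_on_imp_continuous_on[OF lam_holomorphic] Imw open_upper_half by (simp add: continuous_on_eq_continuous_at)
  then have ts: "t \<longlonglongrightarrow> s" unfolding t_def s_def using u(2) by (rule isCont_tendsto_compose)
  have s01: "s \<noteq> 0" "s \<noteq> 1" using lam_nonzero[OF Imw] lam_neq_1[OF Imw] by (simp_all add: s_def)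
  show ?thesis
  proof (cases "s \<in> cut_plane")
    case True
    then have "isCont tau s"
      using holomorphic_on_imp_continuous_on[OF tau_holomorphic] open_cut_plane by (simp add: continuous_on_eq_continuous_at)
    then have "(\<lambda>n. tau (t n)) \<longlonglongrightarrow> tau s" using ts by (rule isCont_tendsto_compose)
    then have "w = tau s" using tw by (rule LIMSEQ_unique[rotated])
    with True show ?thesis by blast
  next
    case False
    then have Ims: "Im s = 0" and "Re s \<le> 0 \<or> 1 \<le> Re s" by (auto simp: cut_plane_iff)
    then consider "Re s < 0" | "1 < Re s" using s01 by (auto simp: complex_eq_iff)
    then show ?thesis
    proof cases
      case 1
      with boundary_value_tau[OF t(1) ts tw Ims] w(1) show ?thesis by (simp add: fund_domain_iff)
    next
      case 2
      have c: "1 - t n \<in> cut_plane" for n using t(1)[of n] by (auto simp: cut_plane_iff)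
      have "(\<lambda>n. - 1 / tau (t n)) \<longlonglongrightarrow> - 1 / w" by (intro tendsto_intros tw w0)
      then have A: "(\<lambda>n. tau (1 - t n)) \<longlonglongrightarrow> - 1 / w" by (simp only: tau_one_minus[OF t(1)])
      have B: "(\<lambda>n. 1 - t n) \<longlonglongrightarrow> 1 - s" by (intro tendsto_intros ts)
      have "\<bar>Re (- 1 / w)\<bar> = 1"
        by (rule boundary_value_tau[OF c B A]) (use Ims 2 in simp_all)
      moreover have "Re (- 1 / w) = - Re w / (cmod w)\<^sup>2" by (simp add: Re_divide cmod_power2)
      ultimately have "\<bar>Re w\<bar> = (cmod w)\<^sup>2" using w0 by (simp add: abs_divide)
      with w(1) show ?thesis by (simp add: fund_domain_iff)
    qed
  qed
qed

text \<open>The image of \<open>tau\<close> and the complement of its closure are open, disjoint and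
  cover the connected domain; the point i lies in the image.\<close>

lemma fund_domain_image:
  assumes w: "w \<in> fund_domain"
  shows "lam w \<in> cut_plane" "tau (lam w) = w"
proof -
  have oT: "open (tau ` cut_plane)"
    by (rule open_mapping_thm3[OF tau_holomorphic open_cut_plane inj_tau])
  have oC: "open (- closure (tau ` cut_plane))" by (intro open_Compl closed_closure)
  have "fund_domain \<subseteq> tau ` cut_plane \<union> - closure (tau ` cut_plane)"
    using fund_domain_closure by blast
  moreover have "tau ` cut_plane \<inter> - closure (tau ` cut_plane) \<inter> fund_domain = {}"
    using closure_subset[of "tau ` cut_plane"] by auto
  moreover have "\<i> \<in> tau ` cut_plane \<inter> fund_domain"
  proof -
    have "\<i> = tau (lam (of_real 1 * \<i>))" using tau_lam_imag_axis(2)[of 1] by simp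
    moreover have "lam (of_real 1 * \<i>) \<in> cut_plane" by (rule tau_lam_imag_axis(1)) simp
    ultimately show ?thesis by (auto simp: fund_domain_iff)
  qed
  ultimately have "- closure (tau ` cut_plane) \<inter> fund_domain = {}"
    using connectedD[OF connected_fund_domain oT oC] by blast
  then have "w \<in> tau ` cut_plane" using fund_domain_closure w by blast
  then show "lam w \<in> cut_plane" "tau (lam w) = w" using lam_tau by auto
qed

section \<open>Behaviour of the ratio as t tends to 0 along a ray\<close>

lemma Re_csqrt_ge:
  assumes c: "0 \<le> c" "c < 1" and u: "- c * cmod u \<le> Re u"
  shows "sqrt ((1 - c) / 2) * cmod (csqrt u) \<le> Re (csqrt u)"
proof -
  define z where "z = csqrt u"
  have z: "0 \<le> Re z" "z\<^sup>2 = u" unfolding z_def by (rule Re_csqrt) simp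
  have "(cmod z)\<^sup>2 = cmod u" by (simp add: z(2)[symmetric] norm_power)
  then have n: "(Re z)\<^sup>2 + (Im z)\<^sup>2 = cmod u" by (simp add: cmod_power2)
  have "(Re z)\<^sup>2 - (Im z)\<^sup>2 = Re u" using z(2) by (simp only: Re_power2[symmetric])
  \<comment> \<open>The half-angle formula: if cos(arg u) \<ge> -c, then the squared cosine of half
    the argument is at least (1 - c)/2.\<close>
  with n u have "(1 - c) / 2 * (cmod z)\<^sup>2 \<le> (Re z)\<^sup>2"
    using \<open>(cmod z)\<^sup>2 = cmod u\<close> by (simp add: algebra_simps)
  then have "(sqrt ((1 - c) / 2) * cmod z)\<^sup>2 \<le> (Re z)\<^sup>2" using c by (simp add: power_mult_distrib)
  then have "sqrt ((1 - c) / 2) * cmod z \<le> Re z" using z(1) by (rule power2_le_imp_le)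
  then show ?thesis by (simp only: z_def)
qed

lemma Re_inverse_ge:
  assumes "d * cmod z \<le> Re z" "z \<noteq> 0"
  shows "d * cmod (1 / z) \<le> Re (1 / z)"
proof -
  have "Re (1 / z) = Re z / (cmod z)\<^sup>2" by (simp add: Re_divide cmod_power2)
  moreover have "d * cmod (1 / z) = d * cmod z / (cmod z)\<^sup>2" using assms(2) by (simp add: norm_divide power2_eq_square)
  ultimately show ?thesis using assms(1) by (simp add: divide_right_mono)
qed

text \<open>For t = r T the radicand cos^2 + t sin^2 is a nonnegative combination of 1 and T, so its
  argument is bounded by that of T, uniformly in r. Hence the integrand lies in a sector where Re
  dominates the modulus; nothing cancels, and the logarithmic divergence of the integral of the
  modulus passes to Re K.\<close>

lemma ellK_one_minus_bounds:
  assumes T: "T \<in> cut_plane"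
  obtains d where "0 < d" "d \<le> 1"
    "\<And>r. 0 < r \<Longrightarrow> r \<le> 1 \<Longrightarrow> d * cmod (ellK (1 - of_real r * T)) \<le> Re (ellK (1 - of_real r * T))"
    "\<And>r. 0 < r \<Longrightarrow> r \<le> 1 \<Longrightarrow> d * (- ln (sqrt (r * cmod T))) \<le> Re (ellK (1 - of_real r * T))"
proof -
  have T0: "T \<noteq> 0" using T by (auto simp: cut_plane_iff)
  \<comment> \<open>Minus the cosine of arg T, where that is positive; c < 1 because T is not on the
    negative axis.\<close>
  define c where "c = max 0 (- Re T / cmod T)"
  have "- Re T < cmod T"
  proof (rule ccontr)
    assume "\<not> - Re T < cmod T"
    then have "cmod T \<le> - Re T" by simp
    then have "(cmod T)\<^sup>2 \<le> (- Re T)\<^sup>2" by (intro power_mono) auto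
    then have "Im T = 0" by (simp add: cmod_power2)
    then have "0 < Re T" using T by (simp add: cut_plane_iff)
    with \<open>cmod T \<le> - Re T\<close> show False using norm_ge_zero[of T] by linarith
  qed
  then have c: "0 \<le> c" "c < 1" using T0 by (auto simp: c_def field_simps)
  have cT: "- c * cmod T \<le> Re T"
  proof -
    have "- Re T / cmod T \<le> c" by (simp add: c_def)
    then show ?thesis using T0 by (simp add: field_simps)
  qed
  define d where "d = sqrt ((1 - c) / 2)"
  have d: "0 < d" "d \<le> 1" using c by (simp_all add: d_def)
  have main: "d * cmod (ellK (1 - of_real r * T)) \<le> Re (ellK (1 - of_real r * T)) \<and>
       d * (- ln (sqrt (r * cmod T))) \<le> Re (ellK (1 - of_real r * T))" if r: "0 < r" "r \<le> 1" for r
  proof -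
    define t where "t = of_real r * T"
    have tc: "t \<in> cut_plane" unfolding t_def by (rule segment_in_cut_plane[OF T r])
    note ray = cut_plane_ray(2)[OF tc]
    \<comment> \<open>With e^2 = |t| the modulus of the radicand is at most cos^2 + e^2 \<le> (cos +
      e)^2, and cos \<theta> \<le> \<pi>/2 - \<theta> gives a comparison integral that is a
      logarithm.\<close>
    define e where "e = sqrt (r * cmod T)"
    have e: "0 < e" "e\<^sup>2 = cmod t" using r T0 by (simp_all add: e_def t_def norm_mult)
    define a where "a = (\<lambda>\<theta>. 1 / csqrt (1 - (1 - t) * (of_real (sin \<theta>))\<^sup>2))"
    have K: "ellK (1 - t) = integral {0..pi/2} a" by (simp add: ellK_def a_def)
    have ai: "a integrable_on {0..pi/2}" "continuous_on A a" for A
      unfolding a_def by (rule integrable_ellK[OF ray])+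
    have ni: "(\<lambda>\<theta>. cmod (a \<theta>)) integrable_on {0..pi/2}"
      by (intro integrable_continuous_real continuous_intros ai)
    have ri: "(\<lambda>\<theta>. Re (a \<theta>)) integrable_on {0..pi/2}"
      by (intro integrable_continuous_real continuous_intros ai)
    have ueq: "1 - (1 - t) * (of_real (sin \<theta>))\<^sup>2 = of_real ((cos \<theta>)\<^sup>2) + t * of_real ((sin \<theta>)\<^sup>2)" for \<theta>
    proof -
      have "complex_of_real ((cos \<theta>)\<^sup>2) = 1 - (of_real (sin \<theta>))\<^sup>2"
        by (simp only: cos_squared_eq of_real_diff of_real_1 of_real_power)
      then show ?thesis by (simp only:) (simp add: algebra_simps)
    qed
    have ge: "d * cmod (a \<theta>) \<le> Re (a \<theta>)" for \<theta>
      unfolding a_def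
    proof (rule Re_inverse_ge)
      show "csqrt (1 - (1 - t) * (of_real (sin \<theta>))\<^sup>2) \<noteq> 0" using one_minus_sin_sq[OF ray, of \<theta>] by auto
      define u where "u = of_real ((cos \<theta>)\<^sup>2) + t * of_real ((sin \<theta>)\<^sup>2)"
      define x y where "x = (cos \<theta>)\<^sup>2" and "y = (sin \<theta>)\<^sup>2"
      have xy: "0 \<le> x" "0 \<le> y" by (simp_all add: x_def y_def)
      have "cmod (t * of_real y) - cmod (of_real x) \<le> cmod u"
        unfolding u_def x_def[symmetric] y_def[symmetric] using norm_diff_ineq[of "t * of_real y" "of_real x"] by (simp add: add.commute)
      then have "y * cmod t - x \<le> cmod u" using xy by (simp add: norm_mult mult.commute)
      then have "c * (y * cmod t - x) \<le> c * cmod u" using c(1) by (rule mult_left_mono)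
      moreover have "- c * cmod t \<le> Re t"
      proof -
        have "r * (- c * cmod T) \<le> r * Re T" using cT r(1) by (intro mult_left_mono) auto
        then show ?thesis using r by (simp add: t_def norm_mult mult_ac)
      qed
      then have "y * (- c * cmod t) \<le> y * Re t" using xy(2) by (rule mult_left_mono)
      moreover have "Re u = x + y * Re t" by (simp add: u_def x_def y_def mult.commute)
      moreover have "c * x \<le> 1 * x" using c xy by (intro mult_right_mono) auto
      ultimately have "- c * cmod u \<le> Re u" by (simp add: algebra_simps)
      then show "d * cmod (csqrt (1 - (1 - t) * (of_real (sin \<theta>))\<^sup>2)) \<le> Re (csqrt (1 - (1 - t) * (of_real (sin \<theta>))\<^sup>2))"
        unfolding d_def ueq u_def by (rule Re_csqrt_ge[OF c])
    qed
    have "Re (ellK (1 - t)) = integral {0..pi/2} (\<lambda>\<theta>. Re (a \<theta>))"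
      unfolding K by (rule integral_linear'[OF ai(1) bounded_linear_Re, symmetric])
    also have "\<dots> \<ge> integral {0..pi/2} (\<lambda>\<theta>. d * cmod (a \<theta>))"
    proof (rule integral_le[OF _ ri ge])
      show "(\<lambda>\<theta>. d * cmod (a \<theta>)) integrable_on {0..pi/2}"
        by (intro integrable_continuous_real continuous_intros ai)
    qed
    also have "integral {0..pi/2} (\<lambda>\<theta>. d * cmod (a \<theta>)) = d * integral {0..pi/2} (\<lambda>\<theta>. cmod (a \<theta>))"
      by (rule integral_mult_right)
    finally have R: "d * integral {0..pi/2} (\<lambda>\<theta>. cmod (a \<theta>)) \<le> Re (ellK (1 - t))" .
    have "cmod (ellK (1 - t)) \<le> integral {0..pi/2} (\<lambda>\<theta>. cmod (a \<theta>))"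
      unfolding K by (intro integral_norm_bound_integral ai ni order_refl)
    then have 1: "d * cmod (ellK (1 - t)) \<le> Re (ellK (1 - t))"
      using R d(1) by (meson mult_left_mono less_imp_le order_trans)
    have "((\<lambda>\<theta>. 1 / (pi / 2 - \<theta> + e)) has_integral (- ln (pi / 2 - pi / 2 + e) - (- ln (pi / 2 - 0 + e)))) {0..pi/2}"
    proof (rule fundamental_theorem_of_calculus)
      fix x assume x: "x \<in> {0..pi/2}"
      have "((\<lambda>\<theta>. - ln (pi / 2 - \<theta> + e)) has_real_derivative 1 / (pi / 2 - x + e)) (at x within {0..pi/2})"
        using x e(1) by (auto intro!: derivative_eq_intros simp: divide_simps)
      then show "((\<lambda>\<theta>. - ln (pi / 2 - \<theta> + e)) has_vector_derivative 1 / (pi / 2 - x + e)) (at x within {0..pi/2})"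
        by (simp add: has_real_derivative_iff_has_vector_derivative)
    qed simp
    then have hi: "((\<lambda>\<theta>. 1 / (pi / 2 - \<theta> + e)) has_integral (ln (pi / 2 + e) - ln e)) {0..pi/2}" by simp
    have "integral {0..pi/2} (\<lambda>\<theta>. 1 / (pi / 2 - \<theta> + e)) \<le> integral {0..pi/2} (\<lambda>\<theta>. cmod (a \<theta>))"
    proof (intro integral_le ni has_integral_integrable[OF hi])
      fix \<theta> assume th: "\<theta> \<in> {0..pi/2}"
      have c0: "0 \<le> cos \<theta>" using th by (intro cos_ge_zero) auto
      have "cos \<theta> = sin (pi / 2 - \<theta>)" by (simp add: sin_diff)
      also have "\<dots> \<le> pi / 2 - \<theta>" using th by (intro sin_x_le_x) auto
      finally have cs: "cos \<theta> + e \<le> pi / 2 - \<theta> + e" by simp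
      define z where "z = csqrt (1 - (1 - t) * (of_real (sin \<theta>))\<^sup>2)"
      have z0: "z \<noteq> 0" unfolding z_def using one_minus_sin_sq[OF ray, of \<theta>] by auto
      have "(cmod z)\<^sup>2 = cmod (of_real ((cos \<theta>)\<^sup>2) + t * of_real ((sin \<theta>)\<^sup>2))"
        unfolding z_def norm_power[symmetric] ueq[symmetric] by (simp only: power2_csqrt)
      also have "\<dots> \<le> (cos \<theta>)\<^sup>2 + cmod t * 1"
        by (intro order_trans[OF norm_triangle_ineq] add_mono) (auto simp: norm_mult norm_power abs_square_le_1 intro!: mult_left_le)
      also have "\<dots> \<le> (cos \<theta> + e)\<^sup>2" using e c0 by (simp add: power2_sum)
      finally have "cmod z \<le> cos \<theta> + e" using c0 e(1) by (intro power2_le_imp_le[of "cmod z"]) auto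
      with cs have "cmod z \<le> pi / 2 - \<theta> + e" by linarith
      moreover have "0 < cmod z" using z0 by simp
      ultimately have "1 / (pi / 2 - \<theta> + e) \<le> 1 / cmod z" by (intro divide_left_mono mult_pos_pos) linarith+
      then show "1 / (pi / 2 - \<theta> + e) \<le> cmod (a \<theta>)" by (simp add: a_def z_def norm_divide)
    qed
    then have "ln (pi / 2 + e) - ln e \<le> integral {0..pi/2} (\<lambda>\<theta>. cmod (a \<theta>))"
      by (simp only: integral_unique[OF hi])
    moreover have "0 \<le> ln (pi / 2 + e)" using e(1) pi_gt3 by (intro ln_ge_zero) linarith
    ultimately have "- ln e \<le> integral {0..pi/2} (\<lambda>\<theta>. cmod (a \<theta>))" by linarith
    then have 2: "d * (- ln e) \<le> Re (ellK (1 - t))"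
      using R d(1) by (meson mult_left_mono less_imp_le order_trans)
    from 1 2 show ?thesis unfolding t_def e_def by simp
  qed
  show thesis by (rule that[OF d]) (use main in auto)
qed

text \<open>As K(t) tends to \<pi>/2, tau behaves like (2 i/\<pi>) K(1 - t). The bound of |tau| by a
  multiple of Im tau is what lets the exponential decay of the Eisenstein series in Im tau beat the
  powers of tau in the Eichler integral.\<close>

lemma tau_near_0:
  assumes T: "T \<in> cut_plane"
  obtains C where "0 < C"
    "filterlim (\<lambda>r. Im (tau (of_real r * T))) at_top (at_right 0)"
    "\<forall>\<^sub>F r in at_right 0. cmod (tau (of_real r * T)) \<le> C * Im (tau (of_real r * T))"
proof -
  have T0: "T \<noteq> 0" using T by (auto simp: cut_plane_iff)
  obtain d where d: "0 < d" "d \<le> 1"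
    "\<And>r. 0 < r \<Longrightarrow> r \<le> 1 \<Longrightarrow> d * cmod (ellK (1 - of_real r * T)) \<le> Re (ellK (1 - of_real r * T))"
    "\<And>r. 0 < r \<Longrightarrow> r \<le> 1 \<Longrightarrow> d * (- ln (sqrt (r * cmod T))) \<le> Re (ellK (1 - of_real r * T))"
    by (rule ellK_one_minus_bounds[OF T]) (rule that)
  have K0: "ellK 0 = of_real (pi / 2)"
    using ellK_of_real[of 0] by (simp add: rellK_def)
  have "isCont ellK 0"
    using holomorphic_on_imp_continuous_on[OF ellK_holomorphic] open_ray_plane
    by (simp add: continuous_on_eq_continuous_at ray_plane_iff)
  moreover have "((\<lambda>r. of_real r * T) \<longlongrightarrow> of_real 0 * T) (at_right 0)" by (intro tendsto_intros)
  then have "((\<lambda>r. of_real r * T) \<longlongrightarrow> 0) (at_right 0)" by simp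
  ultimately have "((\<lambda>r. ellK (of_real r * T)) \<longlongrightarrow> ellK 0) (at_right 0)"
    by (rule isCont_tendsto_compose)
  moreover have "ellK 0 \<noteq> 0" by (rule ellK_nonzero) (simp add: ray_plane_iff)
  ultimately have "((\<lambda>r. 1 / ellK (of_real r * T)) \<longlongrightarrow> 1 / ellK 0) (at_right 0)"
    by (rule tendsto_divide[OF tendsto_const])
  then have "((\<lambda>r. 1 / ellK (of_real r * T)) \<longlongrightarrow> of_real (2 / pi)) (at_right 0)"
    by (simp add: K0)
  moreover have "0 < d / pi" using d(1) by simp
  \<comment> \<open>The tolerance is d/\<pi>: for k = K(1 - r T) one has d |k| \<le> Re k, so the
    error costs at most Re k/\<pi>, half of the main term 2 Re k/\<pi>.\<close>
  ultimately have ev: "\<forall>\<^sub>F r in at_right 0. dist (1 / ellK (of_real r * T)) (of_real (2 / pi)) < d / pi"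
    by (rule tendstoD)
  have ev1: "\<forall>\<^sub>F r in at_right 0. 0 < r \<and> r \<le> (1::real)"
    by (auto simp: eventually_at_right[of 0 1] intro!: exI[of _ 1])
  have E: "\<forall>\<^sub>F r in at_right 0. Re (ellK (1 - of_real r * T)) / pi \<le> Im (tau (of_real r * T)) \<and>
     cmod (tau (of_real r * T)) \<le> (pi / d) * Im (tau (of_real r * T)) \<and>
     d / pi * (- ln (sqrt (r * cmod T))) \<le> Im (tau (of_real r * T))"
    using ev ev1
  proof eventually_elim
    case (elim r)
    define k where "k = ellK (1 - of_real r * T)"
    define z where "z = 1 / ellK (of_real r * T)"
    have zd: "cmod (z - of_real (2 / pi)) < d / pi" using elim by (simp only: z_def dist_norm)
    have k: "d * cmod k \<le> Re k" "d * (- ln (sqrt (r * cmod T))) \<le> Re k" using d(3,4)[of r] elim by (simp_all add: k_def)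
    have tau: "tau (of_real r * T) = \<i> * (k * z)" by (simp add: tau_def k_def z_def)
    have "Re (k * z) = Re k * (2 / pi) + Re (k * (z - of_real (2 / pi)))" by (simp add: algebra_simps)
    moreover have "\<bar>Re (k * (z - of_real (2 / pi)))\<bar> \<le> cmod k * (d / pi)"
      using abs_Re_le_cmod[of "k * (z - of_real (2 / pi))"] mult_left_mono[OF less_imp_le[OF zd], of "cmod k"] by (simp add: norm_mult)
    moreover have "cmod k * (d / pi) \<le> Re k / pi" using k(1) by (simp add: divide_right_mono mult.commute)
    ultimately have I: "Re k / pi \<le> Im (tau (of_real r * T))" unfolding tau by (simp add: field_simps)
    have "cmod z \<le> cmod (z - of_real (2 / pi)) + cmod (of_real (2 / pi))" using norm_triangle_ineq[of "z - of_real (2 / pi)" "of_real (2 / pi)"] by simp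
    also have "cmod (of_real (2 / pi)) = 2 / pi" unfolding norm_of_real by simp
    also have "cmod (z - of_real (2 / pi)) + 2 / pi \<le> d / pi + 2 / pi" using zd by simp
    also have "\<dots> \<le> 1" using d(2) pi_gt3 by (simp add: field_simps)
    finally have "cmod z \<le> 1" .
    then have "cmod (tau (of_real r * T)) \<le> cmod k * 1" unfolding tau norm_mult by (simp add: mult_left_le)
    also have "\<dots> \<le> Re k / d" using k(1) d(1) by (simp add: field_simps)
    also have "\<dots> = (pi / d) * (Re k / pi)" by simp
    also have "\<dots> \<le> (pi / d) * Im (tau (of_real r * T))" using d(1) by (intro mult_left_mono I) auto
    finally have "cmod (tau (of_real r * T)) \<le> (pi / d) * Im (tau (of_real r * T))" .
    moreover have "d / pi * (- ln (sqrt (r * cmod T))) \<le> Re k / pi"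
      unfolding times_divide_eq_left by (rule divide_right_mono[OF k(2)]) simp
    ultimately show ?case using I unfolding k_def by (intro conjI) linarith+
  qed
  have "filterlim (\<lambda>r. sqrt (r * cmod T)) (at_right 0) (at_right 0)"
  proof (subst filterlim_at, intro conjI)
    have "((\<lambda>r. sqrt (r * cmod T)) \<longlongrightarrow> sqrt (0 * cmod T)) (at_right 0)" by (intro tendsto_intros)
    then show "((\<lambda>r. sqrt (r * cmod T)) \<longlongrightarrow> 0) (at_right 0)" by simp
    show "\<forall>\<^sub>F r in at_right 0. sqrt (r * cmod T) \<in> {0<..} \<and> sqrt (r * cmod T) \<noteq> 0"
      using ev1 by eventually_elim (use T0 in auto)
  qed
  from filterlim_compose[OF ln_at_0 this]
  have "filterlim (\<lambda>r. - ln (sqrt (r * cmod T))) at_top (at_right 0)"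
    by (simp only: filterlim_uminus_at_bot)
  then have "filterlim (\<lambda>r. d / pi * (- ln (sqrt (r * cmod T)))) at_top (at_right 0)"
    using d(1) by (intro filterlim_tendsto_pos_mult_at_top[OF tendsto_const]) auto
  then have 1: "filterlim (\<lambda>r. Im (tau (of_real r * T))) at_top (at_right 0)"
    by (rule filterlim_at_top_mono) (use E in \<open>auto elim: eventually_mono\<close>)
  show thesis
    by (rule that[OF _ 1, of "pi / d"]) (use d(1) E in \<open>auto elim: eventually_mono\<close>)
qed

section \<open>Eisenstein series and Eichler integrals\<close>

lemma summable_nat_power_geometric:
  fixes x :: complex
  shows "norm x < 1 \<Longrightarrow> summable (\<lambda>n. of_nat n ^ k * x ^ n)"
proof (induction k arbitrary: x)
  case 0
  then show ?case by (simp add: summable_geometric)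
next
  case (Suc k)
  have "summable (\<lambda>n. diffs (\<lambda>n. of_nat n ^ k) n * x ^ n)"
    by (rule termdiff_converges[of x 1]) (use Suc in auto)
  from summable_mult[OF this, of x] have "summable (\<lambda>n. of_nat (Suc n) ^ Suc k * x ^ Suc n)"
    by (simp add: diffs_def mult_ac)
  then show ?case
    using summable_Suc_iff[of "\<lambda>n. of_nat n ^ Suc k * x ^ n"] by simp
qed

text \<open>The polylogarithm of order -a, in the shape in which it occurs in Lipschitz's
  formula.\<close>

definition lip :: "nat \<Rightarrow> complex \<Rightarrow> complex" where
  "lip a v = (\<Sum>n. of_nat (Suc n) ^ a * v ^ Suc n)"

lemma summable_lip: "norm (v :: complex) < 1 \<Longrightarrow> summable (\<lambda>n. of_nat (Suc n) ^ a * v ^ Suc n)"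
  using summable_nat_power_geometric[of v a] summable_Suc_iff[of "\<lambda>n. of_nat n ^ a * v ^ n"] by blast

lemma koebe_eq_lip: "norm v < 1 \<Longrightarrow> koebe v = lip 1 v"
proof -
  assume "norm v < 1"
  from sums_mult[OF geometric_deriv_sums[OF this], of v]
  have "(\<lambda>n. of_nat (Suc n) ^ 1 * v ^ Suc n) sums koebe v" by (simp add: koebe_def mult_ac)
  then show ?thesis unfolding lip_def by (rule sums_unique)
qed

lemma lip_0: "norm v < 1 \<Longrightarrow> lip 0 v = v / (1 - v)"
proof -
  assume "norm v < 1"
  from sums_mult[OF geometric_sums[OF this], of v]
  have "(\<lambda>n. of_nat (Suc n) ^ 0 * v ^ Suc n) sums (v / (1 - v))" by (simp add: mult_ac)
  then show ?thesis unfolding lip_def by (rule sums_unique[symmetric])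
qed

lemma summable_lip_real:
  assumes "0 \<le> r" "r < 1"
  shows "summable (\<lambda>n. real (Suc n) ^ a * r ^ Suc n)"
proof -
  have "summable (\<lambda>n. of_nat (Suc n) ^ a * (complex_of_real r) ^ Suc n)"
    using assms by (intro summable_lip) simp
  then have "summable (\<lambda>n. Re (of_nat (Suc n) ^ a * (complex_of_real r) ^ Suc n))" by (rule summable_Re)
  moreover have "Re (of_nat (Suc n) ^ a * (complex_of_real r) ^ Suc n) = real (Suc n) ^ a * r ^ Suc n" for n
  proof -
    have "of_nat (Suc n) ^ a * (complex_of_real r) ^ Suc n = of_real (real (Suc n) ^ a * r ^ Suc n)"
      by (simp del: of_nat_Suc)
    then show ?thesis by (simp only: Re_complex_of_real)
  qed
  ultimately show ?thesis by simp
qed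

lemma lip_bound:
  assumes "0 < r" "r < 1"
  obtains C where "0 < C" "\<And>v. norm v \<le> r \<Longrightarrow> norm (lip a v) \<le> C * norm v"
proof (rule that)
  define S where "S = (\<Sum>n. real (Suc n) ^ a * r ^ n)"
  have sr: "summable (\<lambda>n. real (Suc n) ^ a * r ^ n)"
    using summable_mult[OF summable_lip_real[of r a], of "1 / r"] assms by (simp add: field_simps)
  have Sn: "0 \<le> S" unfolding S_def using assms by (intro suminf_nonneg sr) auto
  then show "0 < S + 1" by simp
  fix v :: complex assume v: "norm v \<le> r"
  have b: "norm (of_nat (Suc n) ^ a * v ^ Suc n) \<le> (real (Suc n) ^ a * r ^ n) * norm v" for n
  proof -
    have "norm (of_nat (Suc n) ^ a * v ^ Suc n) = real (Suc n) ^ a * (norm v ^ n * norm v)"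
      by (simp add: norm_mult norm_power del: of_nat_Suc)
    also have "\<dots> \<le> real (Suc n) ^ a * (r ^ n * norm v)"
      using v by (intro mult_left_mono mult_right_mono power_mono) auto
    finally show ?thesis by (simp add: mult_ac)
  qed
  have "norm (lip a v) \<le> (\<Sum>n. (real (Suc n) ^ a * r ^ n) * norm v)"
    unfolding lip_def by (intro norm_suminf_le b summable_mult2 sr)
  also have "\<dots> = S * norm v" unfolding S_def by (rule suminf_mult2[OF sr, symmetric])
  also have "\<dots> \<le> (S + 1) * norm v" by (intro mult_right_mono) auto
  finally show "norm (lip a v) \<le> (S + 1) * norm v" .
qed

lemma ball_Re_bound: "y \<in> ball x (r - Re x) \<Longrightarrow> Re y < r"
  using abs_Re_le_cmod[of "y - x"] by (auto simp: dist_norm norm_minus_commute)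

lemma lip_exp_has_field_derivative:
  assumes x: "Re x < 0"
  shows "((\<lambda>x. lip a (exp x)) has_field_derivative lip (Suc a) (exp x)) (at x)"
proof -
  have op: "open {x::complex. Re x < 0}" by (rule open_halfspace_Re_lt)
  have "((\<lambda>x. \<Sum>n. of_nat (Suc n) ^ a * exp x ^ Suc n) has_field_derivative
          (\<Sum>n. of_nat (Suc n) ^ Suc a * exp x ^ Suc n)) (at x)"
  proof (rule suminf_has_field_derivative_local(3)[OF op])
    show "((\<lambda>x. of_nat (Suc n) ^ a * exp x ^ Suc n) has_field_derivative of_nat (Suc n) ^ Suc a * exp x ^ Suc n) (at x)" for n and x :: complex
      unfolding exp_of_nat_mult[symmetric]
      by (rule derivative_eq_intros refl)+ (simp add: mult_ac)
    fix x :: complex assume "x \<in> {x. Re x < 0}"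
    then have xr: "Re x < 0" by simp
    show "\<exists>d h. 0 < d \<and> summable h \<and> (\<forall>n. \<forall>y\<in>ball x d \<inter> {x. Re x < 0}. norm (of_nat (Suc n) ^ a * exp y ^ Suc n) \<le> h n)"
    proof (intro exI conjI allI ballI)
      show "0 < Re x / 2 - Re x" using xr by simp
      show "summable (\<lambda>n. real (Suc n) ^ a * exp (Re x / 2) ^ Suc n)" using xr by (intro summable_lip_real) auto
      fix n y assume "y \<in> ball x (Re x / 2 - Re x) \<inter> {x. Re x < 0}"
      then have "Re y \<le> Re x / 2" using ball_Re_bound[of y x "Re x / 2"] by simp
      then have "exp (Re y) ^ Suc n \<le> exp (Re x / 2) ^ Suc n" by (intro power_mono) auto
      then show "norm (of_nat (Suc n) ^ a * exp y ^ Suc n) \<le> real (Suc n) ^ a * exp (Re x / 2) ^ Suc n"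
        unfolding norm_mult norm_power norm_exp_eq_Re norm_of_nat by (intro mult_left_mono) auto
    qed
  qed (use x in simp)
  then show ?thesis by (simp only: lip_def)
qed

text \<open>For \<open>D (2 k)\<close>, the even derivatives of a solution of \<open>W'\<^sup>2 = R(W)\<close>, \<open>W'' = Q(W)\<close>,
  as polynomials in \<open>W\<close>.\<close>

fun even_deriv_poly :: "'a :: field_char_0 poly \<Rightarrow> 'a poly \<Rightarrow> nat \<Rightarrow> 'a poly" where
  "even_deriv_poly R Q 0 = [:0, 1:]"
| "even_deriv_poly R Q (Suc k) =
     pderiv (pderiv (even_deriv_poly R Q k)) * R + pderiv (even_deriv_poly R Q k) * Q"

text \<open>Differentiating p(W) twice gives p''(W) W'^2 + p'(W) W'', again a polynomial in W, so
  the order is raised by two at a time.\<close>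

lemma even_deriv_poly:
  fixes D :: "nat \<Rightarrow> complex \<Rightarrow> complex"
  assumes S: "open S" and D: "\<And>j x. x \<in> S \<Longrightarrow> (D j has_field_derivative D (Suc j) x) (at x)"
    and R: "\<And>x. x \<in> S \<Longrightarrow> (D 1 x)\<^sup>2 = poly R (D 0 x)"
    and Q: "\<And>x. x \<in> S \<Longrightarrow> D 2 x = poly Q (D 0 x)"
  shows "x \<in> S \<Longrightarrow> D (2 * k) x = poly (even_deriv_poly R Q k) (D 0 x)"
proof (induction k arbitrary: x)
  case (Suc k)
  define p where "p = even_deriv_poly R Q k"
  have 1: "D (Suc (2 * k)) y = poly (pderiv p) (D 0 y) * D (Suc 0) y" if y: "y \<in> S" for y
  proof -
    have "((\<lambda>y. poly p (D 0 y)) has_field_derivative poly (pderiv p) (D 0 y) * D (Suc 0) y) (at y)"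
      by (rule DERIV_chain2[OF poly_DERIV D[OF y, of 0]])
    moreover have "((\<lambda>y. poly p (D 0 y)) has_field_derivative D (Suc (2 * k)) y) (at y)"
      by (rule has_field_derivative_transform_within_open[OF D[OF y, of "2 * k"] S y]) (unfold p_def, rule Suc.IH)
    ultimately show ?thesis by (rule DERIV_unique[rotated])
  qed
  have x: "x \<in> S" by fact
  have "((\<lambda>y. poly (pderiv p) (D 0 y) * D (Suc 0) y) has_field_derivative
      poly (pderiv (pderiv p)) (D 0 x) * D (Suc 0) x * D (Suc 0) x + D (Suc (Suc 0)) x * poly (pderiv p) (D 0 x)) (at x)"
    by (rule DERIV_mult[OF DERIV_chain2[OF poly_DERIV D[OF x, of 0]] D[OF x, of "Suc 0"]])
  moreover have "((\<lambda>y. poly (pderiv p) (D 0 y) * D (Suc 0) y) has_field_derivative D (Suc (Suc (2 * k))) x) (at x)"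
    by (rule has_field_derivative_transform_within_open[OF D[OF x, of "Suc (2 * k)"] S x]) (rule 1)
  ultimately have "D (Suc (Suc (2 * k))) x = poly (pderiv (pderiv p)) (D 0 x) * D (Suc 0) x * D (Suc 0) x + D (Suc (Suc 0)) x * poly (pderiv p) (D 0 x)"
    by (rule DERIV_unique[rotated])
  then have "D (2 * Suc k) x = poly (pderiv (pderiv p)) (D 0 x) * D 1 x * D 1 x + D 2 x * poly (pderiv p) (D 0 x)"
    by (simp add: numeral_2_eq_2)
  also have "\<dots> = poly (pderiv (pderiv p)) (D 0 x) * (D 1 x)\<^sup>2 + poly (pderiv p) (D 0 x) * D 2 x"
    by (simp add: power2_eq_square mult_ac)
  also have "\<dots> = poly (even_deriv_poly R Q (Suc k)) (D 0 x)"
    unfolding R[OF x] Q[OF x] by (simp add: p_def)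
  finally show ?case .
qed simp

text \<open>The case W'^2 = 4 W^3 + 4 A W^2 - 4 B W, evaluated at a zero of W. For W = wp - e_2 one
  has A = 2 e_2 - e_1 - e_3 and B = (e_2 - e_1)(e_3 - e_2).\<close>

definition wconst :: "'a :: field_char_0 \<Rightarrow> 'a \<Rightarrow> nat \<Rightarrow> 'a" where
  "wconst A B k = poly (even_deriv_poly [:0, - 4 * B, 4 * A, 4:] [:- 2 * B, 4 * A, 6:] k) 0"

lemma wconst_values:
  "wconst A B 1 = - 2 * B"
  "wconst A B 2 = - 8 * A * B"
  "wconst A B 3 = - 32 * A^2 * B + 144 * B^2"
  "wconst A B 4 = - 128 * A^3 * B + 3456 * A * B^2"
  "wconst A B 6 = - 2048 * A^5 * B + 1032192 * A^3 * B^2 - 7022592 * A * B^3"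
proof -
  define P where "P = even_deriv_poly [:0, - 4 * B, 4 * A, 4:] [:- 2 * B, 4 * A, 6:]"
  have S: "P (Suc k) = pderiv (pderiv (P k)) * [:0, - 4 * B, 4 * A, 4:] + pderiv (P k) * [:- 2 * B, 4 * A, 6:]" for k
    by (simp add: P_def)
  have P0: "P 0 = [:0, 1:]" by (simp add: P_def)
  have P1: "P 1 = [:-2*B, 4*A, 6:]"
    unfolding One_nat_def S P0 by (simp add: pderiv_pCons)
  have P2: "P 2 = [:-8*A*B, 16*A^2 - 72*B, 120*A, 120:]"
    unfolding Suc_1[symmetric] S P1[unfolded One_nat_def[symmetric]] by (simp add: pderiv_pCons power2_eq_square algebra_simps)
  have e: "3 = Suc 2" "4 = Suc (3::nat)" by simp_all
  have P3: "P 3 = [:-32*A^2*B + 144*B^2, 64*A^3 - 1728*A*B, 2016*A^2 - 4032*B, 6720*A, 5040:]"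
  proof -
    have "P 3 = P (Suc 2)" by (simp only: e(1))
    then show ?thesis unfolding S[of 2] P2 by (simp add: pderiv_pCons eval_nat_numeral algebra_simps)
  qed
  have P4: "P 4 = [:-128*A^3*B + 3456*A*B^2, 256*A^4 - 31104*A^2*B + 48384*B^2, 32640*A^3 - 276480*A*B, 282240*A^2 - 362880*B, 604800*A, 362880:]"
  proof -
    have "P 4 = P (Suc 3)" by (simp only: e(2))
    then show ?thesis unfolding S[of 3] P3 by (simp add: pderiv_pCons eval_nat_numeral algebra_simps)
  qed
  show "wconst A B 1 = - 2 * B" "wconst A B 2 = - 8 * A * B" "wconst A B 3 = - 32 * A^2 * B + 144 * B^2" "wconst A B 4 = - 128 * A^3 * B + 3456 * A * B^2"
    unfolding wconst_def P_def[symmetric] P1 P2 P3 P4 by simp_all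
  have e5: "5 = Suc 4" "6 = Suc (5::nat)" by simp_all
  \<comment> \<open>Index 5 serves only as the passage from 4 to 6.\<close>
  have P5: "P 5 = [:-512*A^4*B + 62208*A^2*B^2 - 96768*B^3, 1024*A^5 - 516096*A^3*B + 3511296*A*B^2, 523776*A^4 - 13077504*A^2*B + 11176704*B^2, 10813440*A^3 - 52462080*A*B, 50561280*A^2 - 47900160*B, 79833600*A, 39916800:]"
    unfolding e5(1) S P4 by (simp add: pderiv_pCons eval_nat_numeral algebra_simps)
  show "wconst A B 6 = - 2048 * A^5 * B + 1032192 * A^3 * B^2 - 7022592 * A * B^3"
    unfolding wconst_def P_def[symmetric] e5(2) S P5 by (simp add: pderiv_pCons eval_nat_numeral algebra_simps)
qed

text \<open>For a = 1 one of the two one-sided sums that make up \<open>wp\<close> near the half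
  period \<pi> i - l/2, with \<open>x\<close> measured from it. Each differentiation raises
  \<open>a\<close> by one.\<close>

definition wseries :: "real \<Rightarrow> nat \<Rightarrow> complex \<Rightarrow> complex" where
  "wseries l a x = (\<Sum>n. lip a (exp (of_real pi * \<i> - of_real (l / 2 * real (2 * n + 1)) + x)))"

lemma wseries_has_field_derivative:
  assumes l: "l > 0" and x: "Re x < l / 2"
  shows "summable (\<lambda>n. lip a (exp (of_real pi * \<i> - of_real (l / 2 * real (2 * n + 1)) + x)))"
    and "(wseries l a has_field_derivative wseries l (Suc a) x) (at x)"
proof -
  have op: "open {x::complex. Re x < l / 2}" by (rule open_halfspace_Re_lt)
  have neg: "Re (of_real pi * \<i> - of_real (l / 2 * real (2 * n + 1)) + x) < 0" if "Re x < l / 2" for n x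
  proof -
    have "l / 2 * 1 \<le> l / 2 * real (2 * n + 1)" using l by (intro mult_left_mono) auto
    then show ?thesis using that by simp
  qed
  have der: "((\<lambda>x. lip a (exp (of_real pi * \<i> - of_real (l / 2 * real (2 * n + 1)) + x))) has_field_derivative
      lip (Suc a) (exp (of_real pi * \<i> - of_real (l / 2 * real (2 * n + 1)) + x))) (at x)" if "x \<in> {x. Re x < l / 2}" for n x
  proof -
    have "((\<lambda>x. of_real pi * \<i> - of_real (l / 2 * real (2 * n + 1)) + x) has_field_derivative 1) (at x)"
      by (auto intro!: derivative_eq_intros)
    from DERIV_chain2[OF lip_exp_has_field_derivative[OF neg] this] that show ?thesis by simp
  qed
  have bd: "\<exists>d h. 0 < d \<and> summable h \<and> (\<forall>n. \<forall>y\<in>ball x d \<inter> {x. Re x < l / 2}. norm (lip a (exp (of_real pi * \<i> - of_real (l / 2 * real (2 * n + 1)) + y))) \<le> h n)"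
    if "x \<in> {x. Re x < l / 2}" for x
  proof -
    define r where "r = (Re x + l / 2) / 2"
    have r: "Re x < r" "r < l / 2" using that by (auto simp: r_def)
    obtain C where C: "0 < C" "\<And>v. norm v \<le> exp (r - l / 2) \<Longrightarrow> norm (lip a v) \<le> C * norm v"
      using lip_bound[of "exp (r - l / 2)" a] r(2) by (metis exp_gt_zero exp_less_one_iff diff_less_0_iff_less)
    show ?thesis
    proof (intro exI conjI allI ballI)
      show "0 < r - Re x" using r by simp
      show "summable (\<lambda>n. C * exp (r - l / 2) * exp (- l) ^ n)" by (rule summable_geometric_exp[OF l])
      fix n y assume "y \<in> ball x (r - Re x) \<inter> {x. Re x < l / 2}"
      then have y: "Re y \<le> r" using ball_Re_bound[of y x r] by simp
      have "exp (- l) ^ n = exp (- (l * real n))" by (simp add: exp_of_nat_mult[symmetric] mult.commute)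
      then have e: "exp (r - l / 2) * exp (- l) ^ n = exp (r - l / 2 * real (2 * n + 1))"
        by (simp add: exp_add[symmetric] algebra_simps)
      have n1: "norm (exp (of_real pi * \<i> - of_real (l / 2 * real (2 * n + 1)) + y)) \<le> exp (r - l / 2) * exp (- l) ^ n"
        unfolding e norm_exp_eq_Re using y by simp
      also have "\<dots> \<le> exp (r - l / 2) * 1" using l by (intro mult_left_mono power_le_one) auto
      finally have "norm (exp (of_real pi * \<i> - of_real (l / 2 * real (2 * n + 1)) + y)) \<le> exp (r - l / 2)" by simp
      from C(2)[OF this] have "norm (lip a (exp (of_real pi * \<i> - of_real (l / 2 * real (2 * n + 1)) + y)))
          \<le> C * norm (exp (of_real pi * \<i> - of_real (l / 2 * real (2 * n + 1)) + y))" .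
      also have "\<dots> \<le> C * (exp (r - l / 2) * exp (- l) ^ n)" using C(1) by (intro mult_left_mono n1) auto
      finally show "norm (lip a (exp (of_real pi * \<i> - of_real (l / 2 * real (2 * n + 1)) + y))) \<le> C * exp (r - l / 2) * exp (- l) ^ n"
        by (simp add: mult.assoc)
    qed
  qed
  have xs: "x \<in> {x. Re x < l / 2}" using x by simp
  note * = suminf_has_field_derivative_local[OF op der bd xs]
  show "summable (\<lambda>n. lip a (exp (of_real pi * \<i> - of_real (l / 2 * real (2 * n + 1)) + x)))" by (rule *(1))
  show "(wseries l a has_field_derivative wseries l (Suc a) x) (at x)" unfolding wseries_def[abs_def] by (rule *(3))
qed

text \<open>Seen from the half period, the poles lie at odd multiples of l/2 on either side. The
  term \<open>koebe (exp u)\<close> supplies the first one of one side, and the period 2 \<pi> i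
  turns -\<pi> i into \<pi> i on the other.\<close>

lemma wp_eq_wseries:
  assumes l: "l > 0" and x: "\<bar>Re x\<bar> < l / 2"
  shows "wp l (of_real pi * \<i> - of_real (l / 2) + x) = wseries l 1 x + wseries l 1 (- x)"
proof -
  have lt: "koebe (exp (of_real pi * \<i> - of_real (l / 2 * real (2 * n + 1)) + x)) = lip 1 (exp (of_real pi * \<i> - of_real (l / 2 * real (2 * n + 1)) + x))"
    if "Re x < l / 2" for n x
  proof (rule koebe_eq_lip)
    have "l / 2 * 1 \<le> l / 2 * real (2 * n + 1)" using l by (intro mult_left_mono) auto
    then show "norm (exp (of_real pi * \<i> - of_real (l / 2 * real (2 * n + 1)) + x)) < 1"
      unfolding norm_exp_eq_Re using that by simp
  qed
  define c where "c = (\<lambda>x n. koebe (exp (of_real pi * \<i> - of_real (l / 2 * real (2 * n + 1)) + x)))"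
  have s: "wseries l 1 x = suminf (c x)" "summable (c x)" if "Re x < l / 2" for x
    using wseries_has_field_derivative(1)[OF l that, of 1] lt[OF that] unfolding wseries_def c_def by (simp_all only:)
  have e1: "of_real pi * \<i> - of_real (l / 2) + x - of_real (l * real (Suc n)) = of_real pi * \<i> - of_real (l / 2 * real (2 * Suc n + 1)) + x" for n
    by (simp add: complex_eq_iff field_simps)
  have e2: "exp (- (of_real pi * \<i> - of_real (l / 2) + x) - of_real (l * real (Suc n))) = exp (of_real pi * \<i> - of_real (l / 2 * real (2 * n + 1)) - x)" for n
  proof -
    have "of_real pi * \<i> - of_real (l / 2 * real (2 * n + 1)) - x = (- (of_real pi * \<i> - of_real (l / 2) + x) - of_real (l * real (Suc n))) + 2 * of_real pi * \<i>"
      by (simp add: complex_eq_iff field_simps)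
    then show ?thesis by (simp only: exp_plus_2pii)
  qed
  have xx: "Re x < l / 2" "Re (- x) < l / 2" using x by auto
  have "wsum l (of_real pi * \<i> - of_real (l / 2) + x) = (\<Sum>n. c x (Suc n))"
    unfolding wsum_def e1 c_def ..
  also have "\<dots> = suminf (c x) - c x 0" by (rule suminf_split_head[OF s(2)[OF xx(1)]])
  finally have A: "wsum l (of_real pi * \<i> - of_real (l / 2) + x) = suminf (c x) - c x 0" .
  have B: "wsum l (- (of_real pi * \<i> - of_real (l / 2) + x)) = suminf (c (- x))"
    unfolding wsum_def e2 c_def by simp
  have C: "koebe (exp (of_real pi * \<i> - of_real (l / 2) + x)) = c x 0" by (simp add: c_def)
  show ?thesis unfolding wp_def A B C s(1)[OF xx(1)] s(1)[OF xx(2)] by simp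
qed

text \<open>The half period \<open>\<pi> \<i> - l / 2\<close> is the one at which the even derivatives of \<^term>\<open>wp\<close> are the
  Eisenstein series in question.\<close>

lemma wseries_eq_wconst:
  assumes l: "l > 0" and k: "k > 0"
  shows "2 * wseries l (2 * k + 1) 0 =
    wconst (of_real (2 * we2 l - we1 l - we3 l)) (of_real ((we2 l - we1 l) * (we3 l - we2 l))) k"
proof -
  define w where "w = of_real pi * \<i> - complex_of_real (l / 2)"
  define S where "S = {x. Re x < l / 2} \<inter> {x. - (l / 2) < Re x} \<inter> {x. Im x < pi} \<inter> {x. - pi < Im x}"
  have oS: "open S" unfolding S_def by (intro open_Int open_halfspace_Re_lt open_halfspace_Re_gt open_halfspace_Im_lt open_halfspace_Im_gt)
  have S0: "0 \<in> S" using l by (simp add: S_def)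
  \<comment> \<open>Subtracting e_2 makes \<open>D 0\<close> vanish at 0, where
    \<open>wconst\<close> is evaluated. In derivatives of even order the two one-sided series add
    up, hence the factor 2.\<close>
  define D where "D = (\<lambda>j x. if j = 0 then wp l (w + x) - of_real (we2 l)
      else wseries l (Suc j) x + (-1) ^ j * wseries l (Suc j) (- x))"
  have Sx: "Re x < l / 2" "Re (- x) < l / 2" "\<bar>Re x\<bar> < l / 2" if "x \<in> S" for x using that by (auto simp: S_def)
  have box: "w + x \<in> period_box l - {0}" if "x \<in> S" for x
    using that by (auto simp: S_def w_def period_box_def complex_eq_iff)
  have d: "((\<lambda>x. wseries l (Suc j) x + (-1) ^ j * wseries l (Suc j) (- x)) has_field_derivative
       wseries l (Suc (Suc j)) x + (-1) ^ Suc j * wseries l (Suc (Suc j)) (- x)) (at x)" if x: "x \<in> S" for j x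
  proof -
    have "((\<lambda>x::complex. - x) has_field_derivative - 1) (at x)" by (auto intro!: derivative_eq_intros)
    from DERIV_chain2[OF wseries_has_field_derivative(2)[OF l Sx(2)[OF x]] this]
    have "((\<lambda>x. wseries l (Suc j) (- x)) has_field_derivative wseries l (Suc (Suc j)) (- x) * (- 1)) (at x)" .
    from DERIV_add[OF wseries_has_field_derivative(2)[OF l Sx(1)[OF x]] DERIV_cmult[OF this, of "(-1) ^ j"]]
    show ?thesis by simp
  qed
  have D: "(D j has_field_derivative D (Suc j) x) (at x)" if x: "x \<in> S" for j x
  proof (cases j)
    case 0
    have "((\<lambda>x. wseries l (Suc 0) x + (-1) ^ 0 * wseries l (Suc 0) (- x) - of_real (we2 l)) has_field_derivative D (Suc 0) x - 0) (at x)"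
      using DERIV_diff[OF d[OF x, of 0] DERIV_const] by (simp add: D_def)
    then have "(D 0 has_field_derivative D (Suc 0) x - 0) (at x)"
      by (rule has_field_derivative_transform_within_open[OF _ oS x])
         (use wp_eq_wseries[OF l Sx(3)] in \<open>simp add: D_def w_def\<close>)
    then show ?thesis by (simp add: 0)
  next
    case (Suc i)
    then have "D j = (\<lambda>x. wseries l (Suc j) x + (-1) ^ j * wseries l (Suc j) (- x))" by (simp add: D_def fun_eq_iff)
    then show ?thesis using d[OF x, of j] by (simp add: D_def)
  qed
  have op: "open (period_box l - {0})" using open_period_box by (intro open_delete)
  have sh: "((\<lambda>x. w + x) has_field_derivative 1) (at x)" for x by (auto intro!: derivative_eq_intros)
  have D1: "D 1 x = deriv (wp l) (w + x)" if x: "x \<in> S" for x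
  proof -
    have "((\<lambda>x. wp l (w + x)) has_field_derivative deriv (wp l) (w + x) * 1) (at x)"
      by (rule DERIV_chain2[OF holomorphic_derivI[OF wp_holomorphic[OF l] op box[OF x]] sh])
    from DERIV_diff[OF this DERIV_const, of "of_real (we2 l)"]
    have "(D 0 has_field_derivative deriv (wp l) (w + x)) (at x)" by (simp add: D_def)
    from DERIV_unique[OF D[OF x, of 0] this] show ?thesis by simp
  qed
  have D2: "D 2 x = deriv (deriv (wp l)) (w + x)" if x: "x \<in> S" for x
  proof -
    have "((\<lambda>x. deriv (wp l) (w + x)) has_field_derivative deriv (deriv (wp l)) (w + x) * 1) (at x)"
      by (rule DERIV_chain2[OF holomorphic_derivI[OF holomorphic_deriv[OF wp_holomorphic[OF l] op] op box[OF x]] sh])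
    moreover have "((\<lambda>x. deriv (wp l) (w + x)) has_field_derivative D (Suc 1) x) (at x)"
      by (rule has_field_derivative_transform_within_open[OF D[OF x, of 1] oS x]) (rule D1)
    ultimately have "D (Suc 1) x = deriv (deriv (wp l)) (w + x) * 1" by (rule DERIV_unique[rotated])
    then show ?thesis by (simp add: numeral_2_eq_2)
  qed
  define A B where "A = complex_of_real (2 * we2 l - we1 l - we3 l)" and "B = complex_of_real ((we2 l - we1 l) * (we3 l - we2 l))"
  define R Q where "R = [:0, - 4 * B, 4 * A, 4:]" and "Q = [:- 2 * B, 4 * A, 6:]"
  have D0: "D 0 x = wp l (w + x) - of_real (we2 l)" for x by (simp add: D_def)
  have "D (2 * k) 0 = poly (even_deriv_poly R Q k) (D 0 0)"
  proof (rule even_deriv_poly[where S = S and D = D, OF oS _ _ _ S0])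
    show "(D j has_field_derivative D (Suc j) x) (at x)" if "x \<in> S" for j x by (rule D[OF that])
    fix x assume x: "x \<in> S"
    show "(D 1 x)\<^sup>2 = poly R (D 0 x)"
      unfolding D1[OF x] wp_odes(1)[OF l box[OF x]] R_def A_def B_def D0 by (simp add: algebra_simps)
    show "D 2 x = poly Q (D 0 x)"
      unfolding D2[OF x] wp_odes(2)[OF l box[OF x]] Q_def A_def B_def D0 by (simp add: algebra_simps power2_eq_square)
  qed
  moreover have "D 0 0 = 0" using wp_half(2)[OF l] by (simp add: D_def w_def)
  moreover have "D (2 * k) 0 = 2 * wseries l (2 * k + 1) 0" using k by (simp add: D_def)
  ultimately show ?thesis by (simp add: wconst_def R_def Q_def A_def B_def)
qed

text \<open>For \<open>j = 0\<close> an Eisenstein series of weight \<open>a + 1\<close>; increasing \<open>j\<close> and decreasing \<open>a\<close> integrates it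
  from \<open>\<i>\<infinity>\<close> termwise.\<close>

definition eis :: "nat \<Rightarrow> nat \<Rightarrow> complex \<Rightarrow> complex" where
  "eis a j \<tau> = (\<Sum>m. lip a (exp (of_real pi * \<i> * (1 + of_nat (2 * m + 1) * \<tau>))) / (of_real pi * \<i> * of_nat (2 * m + 1)) ^ j)"

lemma norm_exp_eis: "norm (exp (of_real pi * \<i> * (1 + of_nat (2 * m + 1) * \<tau>))) = exp (- (pi * Im \<tau>)) * exp (- (2 * pi * Im \<tau>)) ^ m"
  by (simp add: norm_exp_eq_Re exp_of_nat_mult[symmetric] exp_add[symmetric] algebra_simps)

lemma norm_eis_denominator: "1 \<le> norm ((of_real pi * \<i> * of_nat (2 * m + 1)) ^ j :: complex)"
proof -
  have "1 * 1 \<le> pi * real (2 * m + 1)" using pi_ge_two by (intro mult_mono) auto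
  then have "1 \<le> norm (of_real pi * \<i> * of_nat (2 * m + 1) :: complex)"
    unfolding norm_mult norm_of_real norm_of_nat by simp
  then show ?thesis unfolding norm_power by (rule one_le_power)
qed

lemma eis_term_bound:
  assumes "0 < Y"
  obtains C where "0 < C" "\<And>\<tau> m j. Y \<le> Im \<tau> \<Longrightarrow>
    norm (lip a (exp (of_real pi * \<i> * (1 + of_nat (2 * m + 1) * \<tau>))) / (of_real pi * \<i> * of_nat (2 * m + 1)) ^ j)
      \<le> C * exp (- (pi * Im \<tau>)) * exp (- (2 * pi * Y)) ^ m"
proof -
  have r: "0 < exp (- (pi * Y))" "exp (- (pi * Y)) < 1" using assms by simp_all
  obtain C where C: "0 < C" "\<And>v. norm v \<le> exp (- (pi * Y)) \<Longrightarrow> norm (lip a v) \<le> C * norm v"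
    by (rule lip_bound[OF r]) (rule that)
  show thesis
  proof (rule that[OF C(1)])
    fix \<tau> m j assume Y: "Y \<le> Im \<tau>"
    define v where "v = exp (of_real pi * \<i> * (1 + of_nat (2 * m + 1) * \<tau>))"
    have le: "exp (- (2 * pi * Im \<tau>)) ^ m \<le> exp (- (2 * pi * Y)) ^ m" using Y by (intro power_mono) auto
    have v: "norm v = exp (- (pi * Im \<tau>)) * exp (- (2 * pi * Im \<tau>)) ^ m" unfolding v_def by (rule norm_exp_eis)
    also have "\<dots> \<le> exp (- (pi * Y)) * 1" using Y assms by (intro mult_mono power_le_one) auto
    finally have "norm (lip a v) \<le> C * norm v" by (intro C(2)) simp
    also have "\<dots> \<le> C * (exp (- (pi * Im \<tau>)) * exp (- (2 * pi * Y)) ^ m)"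
      unfolding v using C(1) le by (intro mult_left_mono) auto
    finally have l: "norm (lip a v) \<le> C * exp (- (pi * Im \<tau>)) * exp (- (2 * pi * Y)) ^ m" by (simp add: mult.assoc)
    have "norm (lip a v / (of_real pi * \<i> * of_nat (2 * m + 1)) ^ j) \<le> norm (lip a v) / 1"
      unfolding norm_divide by (intro divide_left_mono norm_eis_denominator mult_pos_pos norm_ge_zero
          zero_less_one less_le_trans[OF zero_less_one norm_eis_denominator])
    with l show "norm (lip a (exp (of_real pi * \<i> * (1 + of_nat (2 * m + 1) * \<tau>))) / (of_real pi * \<i> * of_nat (2 * m + 1)) ^ j)
      \<le> C * exp (- (pi * Im \<tau>)) * exp (- (2 * pi * Y)) ^ m"
      unfolding v_def by simp
  qed
qed

lemma summable_geometric_exp2: "0 < Y \<Longrightarrow> summable (\<lambda>m. c * exp (- (2 * pi * Y)) ^ m :: real)"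
  by (intro summable_mult summable_geometric) auto

lemma eis_bound:
  obtains C where "0 < C" "\<And>\<tau>. 1 \<le> Im \<tau> \<Longrightarrow> norm (eis a j \<tau>) \<le> C * exp (- (pi * Im \<tau>))"
proof -
  obtain C where C: "0 < C" "\<And>\<tau> m j. 1 \<le> Im \<tau> \<Longrightarrow>
    norm (lip a (exp (of_real pi * \<i> * (1 + of_nat (2 * m + 1) * \<tau>))) / (of_real pi * \<i> * of_nat (2 * m + 1)) ^ j)
      \<le> C * exp (- (pi * Im \<tau>)) * exp (- (2 * pi * 1)) ^ m"
    by (rule eis_term_bound[of 1 a]) (simp, rule that)
  have s: "summable (\<lambda>m. c * exp (- (2 * pi * 1)) ^ m :: real)" for c by (rule summable_geometric_exp2) simp
  define S where "S = (\<Sum>m. exp (- (2 * pi * 1)) ^ m :: real)"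
  have S: "0 \<le> S" unfolding S_def using s[of 1] by (intro suminf_nonneg) auto
  show thesis
  proof (rule that)
    show "0 < C * (S + 1)" using C(1) S by simp
    fix \<tau> :: complex assume t: "1 \<le> Im \<tau>"
    have "norm (eis a j \<tau>) \<le> (\<Sum>m. C * exp (- (pi * Im \<tau>)) * exp (- (2 * pi * 1)) ^ m)"
      unfolding eis_def by (intro norm_suminf_le C(2) t s)
    also have "\<dots> = C * exp (- (pi * Im \<tau>)) * S" unfolding S_def using s[of 1] by (intro suminf_mult) simp
    also have "\<dots> \<le> C * exp (- (pi * Im \<tau>)) * (S + 1)" using C(1) by (intro mult_left_mono) auto
    finally show "norm (eis a j \<tau>) \<le> C * (S + 1) * exp (- (pi * Im \<tau>))" by (simp add: mult_ac)
  qed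
qed

lemma eis_has_field_derivative:
  assumes t: "0 < Im \<tau>"
  shows "summable (\<lambda>m. lip a (exp (of_real pi * \<i> * (1 + of_nat (2 * m + 1) * \<tau>))) / (of_real pi * \<i> * of_nat (2 * m + 1)) ^ j)"
    and "(eis a (Suc j) has_field_derivative eis (Suc a) j \<tau>) (at \<tau>)"
proof -
  have der: "((\<lambda>\<tau>. lip a (exp (of_real pi * \<i> * (1 + of_nat (2 * m + 1) * \<tau>))) / (of_real pi * \<i> * of_nat (2 * m + 1)) ^ Suc j) has_field_derivative
      lip (Suc a) (exp (of_real pi * \<i> * (1 + of_nat (2 * m + 1) * \<tau>))) / (of_real pi * \<i> * of_nat (2 * m + 1)) ^ j) (at \<tau>)"
    if "\<tau> \<in> {\<tau>. 0 < Im \<tau>}" for m \<tau>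
  proof -
    define c where "c = complex_of_real pi * \<i> * of_nat (2 * m + 1)"
    have c0: "c \<noteq> 0" unfolding c_def by (simp del: of_nat_Suc of_nat_add)
    have neg: "Re (of_real pi * \<i> * (1 + of_nat (2 * m + 1) * \<tau>)) < 0"
    proof -
      have "0 < pi * (real (2 * m + 1) * Im \<tau>)" using that by simp
      moreover have "Re (of_real pi * \<i> * (1 + of_nat (2 * m + 1) * \<tau>)) = - (pi * (real (2 * m + 1) * Im \<tau>))"
        by simp
      ultimately show ?thesis by linarith
    qed
    have "((\<lambda>\<tau>. of_real pi * \<i> * (1 + of_nat (2 * m + 1) * \<tau>)) has_field_derivative c) (at \<tau>)"
      unfolding c_def by (auto intro!: derivative_eq_intros)
    from DERIV_cdivide[OF DERIV_chain2[OF lip_exp_has_field_derivative[OF neg] this], of _ "c ^ Suc j"]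
    have "((\<lambda>\<tau>. lip a (exp (of_real pi * \<i> * (1 + of_nat (2 * m + 1) * \<tau>))) / c ^ Suc j) has_field_derivative
       lip (Suc a) (exp (of_real pi * \<i> * (1 + of_nat (2 * m + 1) * \<tau>))) * c / c ^ Suc j) (at \<tau>)" .
    then show ?thesis using c0 unfolding c_def[symmetric] by simp
  qed
  have bd: "\<exists>d h. 0 < d \<and> summable h \<and> (\<forall>m. \<forall>y\<in>ball \<tau> d \<inter> {\<tau>. 0 < Im \<tau>}.
      norm (lip a (exp (of_real pi * \<i> * (1 + of_nat (2 * m + 1) * y))) / (of_real pi * \<i> * of_nat (2 * m + 1)) ^ j) \<le> h m)"
    if "\<tau> \<in> {\<tau>. 0 < Im \<tau>}" for \<tau> j
  proof -
    define Y where "Y = Im \<tau> / 2"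
    have Y: "0 < Y" using that by (simp add: Y_def)
    obtain C where C: "0 < C" "\<And>\<tau> m j. Y \<le> Im \<tau> \<Longrightarrow>
      norm (lip a (exp (of_real pi * \<i> * (1 + of_nat (2 * m + 1) * \<tau>))) / (of_real pi * \<i> * of_nat (2 * m + 1)) ^ j)
        \<le> C * exp (- (pi * Im \<tau>)) * exp (- (2 * pi * Y)) ^ m"
      by (rule eis_term_bound[OF Y]) (rule that)
    show ?thesis
    proof (intro exI conjI allI ballI)
      show "0 < Y" by (rule Y)
      show "summable (\<lambda>m. C * exp (- (2 * pi * Y)) ^ m)" by (rule summable_geometric_exp2[OF Y])
      fix m y assume y: "y \<in> ball \<tau> Y \<inter> {\<tau>. 0 < Im \<tau>}"
      then have yY: "Y \<le> Im y" using abs_Im_le_cmod[of "\<tau> - y"] by (auto simp: dist_norm Y_def)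
      have "C * exp (- (pi * Im y)) * exp (- (2 * pi * Y)) ^ m \<le> C * 1 * exp (- (2 * pi * Y)) ^ m"
        using C(1) y by (intro mult_right_mono mult_left_mono) auto
      with C(2)[OF yY, of m j]
      show "norm (lip a (exp (of_real pi * \<i> * (1 + of_nat (2 * m + 1) * y))) / (of_real pi * \<i> * of_nat (2 * m + 1)) ^ j)
          \<le> C * exp (- (2 * pi * Y)) ^ m" by simp
    qed
  qed
  have tt: "\<tau> \<in> {\<tau>. 0 < Im \<tau>}" using t by simp
  show "(eis a (Suc j) has_field_derivative eis (Suc a) j \<tau>) (at \<tau>)"
    unfolding eis_def[abs_def] by (rule suminf_has_field_derivative_local(3)[OF open_upper_half der bd tt])
  show "summable (\<lambda>m. lip a (exp (of_real pi * \<i> * (1 + of_nat (2 * m + 1) * \<tau>))) / (of_real pi * \<i> * of_nat (2 * m + 1)) ^ j)"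
  proof -
    obtain d h where dh: "0 < d" "summable h" "\<forall>m. \<forall>y\<in>ball \<tau> d \<inter> {\<tau>. 0 < Im \<tau>}.
      norm (lip a (exp (of_real pi * \<i> * (1 + of_nat (2 * m + 1) * y))) / (of_real pi * \<i> * of_nat (2 * m + 1)) ^ j) \<le> h m"
      using bd[OF tt, of j] by (elim exE conjE) (rule that)
    have "norm (lip a (exp (of_real pi * \<i> * (1 + of_nat (2 * m + 1) * \<tau>))) / (of_real pi * \<i> * of_nat (2 * m + 1)) ^ j) \<le> h m" for m
      using dh(3) dh(1) tt by (metis IntI centre_in_ball)
    then show ?thesis by (intro summable_comparison_test'[OF dh(2), of 0])
  qed
qed

lemma eis_holomorphic: "eis (Suc a) 0 holomorphic_on {\<tau>. 0 < Im \<tau>}"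
proof -
  have "eis a (Suc 0) holomorphic_on {\<tau>. 0 < Im \<tau>}"
    using eis_has_field_derivative(2)[of _ a 0] by (auto simp: holomorphic_on_open[OF open_upper_half])
  from holomorphic_deriv[OF this open_upper_half] show ?thesis
    by (rule holomorphic_transform) (use DERIV_imp_deriv[OF eis_has_field_derivative(2)] in auto)
qed

lemma eis_imag_axis: "eis a 0 (of_real y * \<i>) = wseries (2 * pi * y) a 0"
proof -
  have "of_real pi * \<i> * (1 + of_nat (2 * m + 1) * (of_real y * \<i>)) = of_real pi * \<i> - of_real (2 * pi * y / 2 * real (2 * m + 1)) + 0" for m
    by (simp add: complex_eq_iff)
  then show ?thesis unfolding eis_def wseries_def by (simp only: power_0 div_by_1)
qed

section \<open>Eichler integrals\<close>

definition eichler_poly :: "complex \<Rightarrow> nat \<Rightarrow> complex poly" where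
  "eichler_poly w n = ([:- w, 1:] * [:- cnj w, 1:]) ^ n"

text \<open>The primitive of \<open>eichler_poly w n \<cdot> eis (2 n + 1) 0\<close> given by repeated partial integration.\<close>

definition eichler :: "complex \<Rightarrow> nat \<Rightarrow> complex \<Rightarrow> complex" where
  "eichler w n \<tau> = (\<Sum>j\<le>2 * n. (-1) ^ j * poly ((pderiv ^^ j) (eichler_poly w n)) \<tau> * eis (2 * n - j) (Suc j) \<tau>)"

lemma degree_eichler_poly: "degree (eichler_poly w n) = 2 * n"
  unfolding eichler_poly_def by (subst degree_power_eq) (simp_all add: degree_mult_eq)

text \<open>The sum telescopes, and the term left over contains the derivative of order 2n + 1 of a
  polynomial of degree 2n.\<close>

lemma eichler_has_field_derivative:
  assumes t: "0 < Im \<tau>"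
  shows "(eichler w n has_field_derivative poly (eichler_poly w n) \<tau> * eis (2 * n + 1) 0 \<tau>) (at \<tau>)"
proof -
  define P where "P = (\<lambda>j. poly ((pderiv ^^ j) (eichler_poly w n)) \<tau>)"
  define F where "F = (\<lambda>j. eis (2 * n + 1 - j) j \<tau>)"
  have "(pderiv ^^ Suc (2 * n)) (eichler_poly w n) = 0"
    by (rule poly_eqI) (simp only: coeff_higher_pderiv coeff_0, rule mult_eq_0_iff[THEN iffD2], rule disjI2, rule coeff_eq_0, simp add: degree_eichler_poly)
  then have P0: "P (Suc (2 * n)) = 0" by (simp add: P_def)
  have "(eichler w n has_field_derivative (\<Sum>j\<le>2 * n. (-1) ^ j * (P j * F j + P (Suc j) * F (Suc j)))) (at \<tau>)"
    unfolding eichler_def[abs_def]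
  proof (rule DERIV_sum)
    fix j assume j: "j \<in> {..2 * n}"
    have "(eis (2 * n - j) (Suc j) has_field_derivative eis (Suc (2 * n - j)) j \<tau>) (at \<tau>)"
      by (rule eis_has_field_derivative(2)[OF t])
    also have "eis (Suc (2 * n - j)) j \<tau> = F j" using j by (simp add: F_def Suc_diff_le)
    finally have "((\<lambda>x. poly ((pderiv ^^ j) (eichler_poly w n)) x * eis (2 * n - j) (Suc j) x) has_field_derivative
       P (Suc j) * eis (2 * n - j) (Suc j) \<tau> + F j * P j) (at \<tau>)"
      using DERIV_mult[OF poly_DERIV[of "(pderiv ^^ j) (eichler_poly w n)" \<tau>]] by (simp add: P_def)
    from DERIV_cmult[OF this, of "(-1) ^ j"]
    show "((\<lambda>x. (-1) ^ j * poly ((pderiv ^^ j) (eichler_poly w n)) x * eis (2 * n - j) (Suc j) x) has_field_derivative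
        (-1) ^ j * (P j * F j + P (Suc j) * F (Suc j))) (at \<tau>)"
      by (simp add: F_def algebra_simps)
  qed
  also have "(\<Sum>j\<le>k. (-1) ^ j * (P j * F j + P (Suc j) * F (Suc j))) = P 0 * F 0 + (-1) ^ k * (P (Suc k) * F (Suc k))" for k
    by (induction k) (simp_all add: algebra_simps)
  finally show ?thesis by (simp add: P0) (simp add: P_def F_def)
qed

text \<open>In the variable x = \<tau> - w the polynomial is x^n (x + w - cnj w)^n, so its
  derivatives of order below n vanish at w and the others are given by the binomial theorem.\<close>

lemma eichler_at_base:
  "eichler w n w = (\<Sum>j=n..2 * n. (-1) ^ j * (fact j * of_nat (n choose (j - n)) * (w - cnj w) ^ (2 * n - j)) * eis (2 * n - j) (Suc j) w)"
proof -
  have c: "poly ((pderiv ^^ j) p) w = fact j * coeff (p \<circ>\<^sub>p [:w, 1:]) j" for p j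
  proof -
    have "(pderiv ^^ j) (p \<circ>\<^sub>p [:w, 1:]) = (pderiv ^^ j) p \<circ>\<^sub>p [:w, 1:]"
      by (induction j) (simp_all add: pderiv_pcompose pderiv_pCons)
    then have "coeff ((pderiv ^^ j) (p \<circ>\<^sub>p [:w, 1:])) 0 = poly ((pderiv ^^ j) p) w"
      by (simp add: poly_0_coeff_0[symmetric] poly_pcompose)
    then show ?thesis by (simp add: coeff_higher_pderiv pochhammer_fact[symmetric])
  qed
  have pw: "(p ^ n) \<circ>\<^sub>p q = (p \<circ>\<^sub>p q) ^ n" for p q :: "complex poly" and n
    by (induction n) (simp_all add: pcompose_mult pcompose_1)
  have "eichler_poly w n \<circ>\<^sub>p [:w, 1:] = ([:0, 1:] * [:w - cnj w, 1:]) ^ n"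
    unfolding eichler_poly_def pw by (simp add: pcompose_mult pcompose_pCons)
  also have "\<dots> = monom 1 n * [:w - cnj w, 1:] ^ n"
    unfolding power_mult_distrib by (simp add: monom_altdef)
  finally have e: "eichler_poly w n \<circ>\<^sub>p [:w, 1:] = monom 1 n * [:w - cnj w, 1:] ^ n" .
  have co: "coeff (eichler_poly w n \<circ>\<^sub>p [:w, 1:]) j = (if j < n then 0 else of_nat (n choose (j - n)) * (w - cnj w) ^ (2 * n - j))" if "j \<le> 2 * n" for j
  proof (cases "j < n")
    case False
    then have "j - n \<le> n" "n - (j - n) = 2 * n - j" using that by auto
    then show ?thesis unfolding e coeff_monom_mult using False by (simp add: coeff_linear_poly_power)
  qed (simp add: e coeff_monom_mult)
  have "eichler w n w = (\<Sum>j\<le>2 * n. if j < n then 0 else (-1) ^ j * (fact j * of_nat (n choose (j - n)) * (w - cnj w) ^ (2 * n - j)) * eis (2 * n - j) (Suc j) w)"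
    unfolding eichler_def c by (intro sum.cong refl) (simp add: co)
  also have "\<dots> = (\<Sum>j=n..2 * n. (-1) ^ j * (fact j * of_nat (n choose (j - n)) * (w - cnj w) ^ (2 * n - j)) * eis (2 * n - j) (Suc j) w)"
    by (rule sum.mono_neutral_cong_right) auto
  finally show ?thesis .
qed

section \<open>Eisenstein series and the Jacobian as functions of t\<close>

lemma ellK_holomorphic_cut_plane: "ellK holomorphic_on cut_plane"
  using ellK_holomorphic by (rule holomorphic_on_subset) (auto simp: cut_plane_ray)

lemma lam_imag_axis_we:
  assumes y: "y > 0"
  defines "l \<equiv> 2 * pi * y" and "t \<equiv> lam (of_real y * \<i>)"
  shows "of_real (we3 l - we1 l) = (ellK t)\<^sup>2 / of_real pi ^ 2"
    and "of_real (we2 l - we1 l) = (1 - t) * (ellK t)\<^sup>2 / of_real pi ^ 2"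
    and "of_real (we3 l - we2 l) = t * (ellK t)\<^sup>2 / of_real pi ^ 2"
proof -
  have l: "l > 0" using y by (simp add: l_def)
  note w = we_less[OF l]
  define D where "D = complex_of_real (we3 l - we1 l)"
  have D0: "D \<noteq> 0" using w by (simp add: D_def)
  note L = lam_imag_axis[OF y, folded l_def t_def]
  have "ellK t = of_real (sqrt (we3 l - we1 l) * pi)" unfolding L(1) by (rule L(4))
  then have "(ellK t)\<^sup>2 = of_real ((sqrt (we3 l - we1 l) * pi)\<^sup>2)" by (simp only: of_real_power)
  also have "(sqrt (we3 l - we1 l) * pi)\<^sup>2 = (we3 l - we1 l) * pi\<^sup>2" using w by (simp add: power_mult_distrib)
  finally have "(ellK t)\<^sup>2 = D * of_real pi ^ 2" by (simp add: D_def)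
  then have K: "(ellK t)\<^sup>2 / of_real pi ^ 2 = D" by simp
  then show "of_real (we3 l - we1 l) = (ellK t)\<^sup>2 / of_real pi ^ 2" by (simp add: D_def)
  have t: "t = of_real (we3 l - we2 l) / D" unfolding L(1) D_def by (simp only: of_real_divide)
  then have t3: "t * D = of_real (we3 l - we2 l)" using D0 by simp
  then show "of_real (we3 l - we2 l) = t * (ellK t)\<^sup>2 / of_real pi ^ 2" unfolding times_divide_eq_right[symmetric] K by simp
  have "(1 - t) * D = D - t * D" by (simp add: algebra_simps)
  also have "\<dots> = of_real (we2 l - we1 l)" unfolding t3 by (simp add: D_def)
  finally show "of_real (we2 l - we1 l) = (1 - t) * (ellK t)\<^sup>2 / of_real pi ^ 2"
    unfolding times_divide_eq_right[symmetric] K by simp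
qed

lemma deriv_lam_imag_axis:
  assumes y: "y > 0"
  defines "t \<equiv> lam (of_real y * \<i>)"
  shows "deriv lam (of_real y * \<i>) = 4 * \<i> * t * (1 - t) * (ellK t)\<^sup>2 / of_real pi"
proof -
  define l where "l = 2 * pi * y"
  define q where "q = exp (- l / 2)"
  have l: "l > 0" using y by (simp add: l_def)
  have q0: "q \<noteq> 0" by (simp add: q_def)
  have e: "exp (of_real pi * \<i> * (of_real y * \<i>)) = complex_of_real q"
    by (simp add: exp_of_real[symmetric] q_def l_def mult_ac)
  have 1: "(lamq has_field_derivative lamq (of_real q) * of_real (4 * (we2 l - we1 l) / q)) (at (exp (of_real pi * \<i> * (of_real y * \<i>))))"
    unfolding e unfolding q_def by (rule lamq_has_derivative_real[OF l])
  have 2: "((\<lambda>w. exp (of_real pi * \<i> * w)) has_field_derivative of_real q * (of_real pi * \<i>)) (at (of_real y * \<i>))"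
    unfolding e[symmetric] by (auto intro!: derivative_eq_intros)
  have "(lam has_field_derivative lamq (of_real q) * of_real (4 * (we2 l - we1 l) / q) * (of_real q * (of_real pi * \<i>))) (at (of_real y * \<i>))"
    unfolding lam_def[abs_def] by (rule DERIV_chain2[OF 1 2])
  then have "deriv lam (of_real y * \<i>) = lamq (of_real q) * of_real (4 * (we2 l - we1 l) / q) * (of_real q * (of_real pi * \<i>))"
    by (rule DERIV_imp_deriv)
  also have "lamq (of_real q) = t" by (simp only: t_def lam_def e)
  also have "t * of_real (4 * (we2 l - we1 l) / q) * (of_real q * (of_real pi * \<i>)) = t * 4 * of_real (we2 l - we1 l) * of_real pi * \<i>"
    using q0 by simp
  also have "of_real (we2 l - we1 l) = (1 - t) * (ellK t)\<^sup>2 / of_real pi ^ 2"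
    unfolding t_def l_def by (rule lam_imag_axis_we(2)[OF y])
  finally show ?thesis by (simp add: power2_eq_square)
qed

text \<open>The Jacobian of the substitution: tau' times d\<lambda>/d\<tau> = 4 i t (1 - t)
  K^2/\<pi> is 1. It is written as a product, so that both sides are visibly holomorphic on the cut
  plane.\<close>

lemma deriv_tau:
  assumes t: "t \<in> cut_plane"
  shows "4 * \<i> * t * (1 - t) * (ellK t)\<^sup>2 * deriv tau t = of_real pi"
proof -
  have "4 * \<i> * t * (1 - t) * (ellK t)\<^sup>2 * deriv tau t - of_real pi = 0"
  proof (rule cut_plane_identity[OF _ _ t])
    show "(\<lambda>t. 4 * \<i> * t * (1 - t) * (ellK t)\<^sup>2 * deriv tau t - of_real pi) holomorphic_on cut_plane"
      by (intro holomorphic_intros holomorphic_deriv tau_holomorphic open_cut_plane ellK_holomorphic_cut_plane)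
    fix y :: real assume y: "0 < y"
    define u where "u = lam (of_real y * \<i>)"
    have tc: "u \<in> cut_plane" and tt: "tau u = of_real y * \<i>" unfolding u_def by (rule tau_lam_imag_axis[OF y])+
    have 1: "(lam has_field_derivative deriv lam (of_real y * \<i>)) (at (tau u))"
      unfolding tt using y by (intro holomorphic_derivI[OF lam_holomorphic open_upper_half]) simp
    have 2: "(tau has_field_derivative deriv tau u) (at u)"
      by (rule holomorphic_derivI[OF tau_holomorphic open_cut_plane tc])
    have "((\<lambda>t. lam (tau t)) has_field_derivative deriv lam (of_real y * \<i>) * deriv tau u) (at u)"
      by (rule DERIV_chain2[OF 1 2])
    moreover have "((\<lambda>t. lam (tau t)) has_field_derivative 1) (at u)"
      by (rule has_field_derivative_transform_within_open[OF DERIV_ident open_cut_plane tc]) (simp add: lam_tau)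
    ultimately have "deriv lam (of_real y * \<i>) * deriv tau u = 1" by (rule DERIV_unique)
    then have "4 * \<i> * u * (1 - u) * (ellK u)\<^sup>2 / of_real pi * deriv tau u = 1"
      unfolding deriv_lam_imag_axis[OF y] u_def[symmetric] .
    then have "4 * \<i> * u * (1 - u) * (ellK u)\<^sup>2 * deriv tau u - of_real pi = 0" by simp
    then show "4 * \<i> * lam (of_real y * \<i>) * (1 - lam (of_real y * \<i>)) * (ellK (lam (of_real y * \<i>)))\<^sup>2 * deriv tau (lam (of_real y * \<i>)) - of_real pi = 0"
      by (simp only: u_def)
  qed
  then show ?thesis by simp
qed

text \<open>On the imaginary axis \<open>eis\<close> is a value of \<open>wseries\<close>, with A
  and B expressed by t and K. For the five values of \<open>k\<close> the explicit form of
  \<open>wconst\<close> shows that the right side is holomorphic in t.\<close>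

lemma eis_tau:
  assumes k: "k \<in> {1, 2, 3, 4, 6}" and t: "t \<in> cut_plane"
  shows "2 * eis (2 * k + 1) 0 (tau t) =
    wconst ((1 - 2 * t) * (ellK t)\<^sup>2 / of_real pi ^ 2) (t * (1 - t) * (ellK t) ^ 4 / of_real pi ^ 4) k"
proof -
  define A B where "A = (\<lambda>t. (1 - 2 * t) * (ellK t)\<^sup>2 / of_real pi ^ 2)" and "B = (\<lambda>t. t * (1 - t) * (ellK t) ^ 4 / of_real pi ^ 4)"
  have hA: "A holomorphic_on cut_plane" and hB: "B holomorphic_on cut_plane"
    unfolding A_def B_def by (intro holomorphic_intros ellK_holomorphic_cut_plane; simp)+
  have hw: "(\<lambda>t. wconst (A t) (B t) k) holomorphic_on cut_plane"
    using k by (elim insertE emptyE; simp only: wconst_values; intro holomorphic_intros hA hB)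
  have he: "(\<lambda>t. eis (2 * k + 1) 0 (tau t)) holomorphic_on cut_plane"
  proof -
    have "(eis (Suc (2 * k)) 0 \<circ> tau) holomorphic_on cut_plane"
      by (rule holomorphic_on_compose_gen[OF tau_holomorphic eis_holomorphic]) (auto simp: Im_tau_pos)
    then show ?thesis by (simp add: o_def)
  qed
  have "2 * eis (2 * k + 1) 0 (tau t) - wconst (A t) (B t) k = 0"
  proof (rule cut_plane_identity[OF _ _ t])
    show "(\<lambda>t. 2 * eis (2 * k + 1) 0 (tau t) - wconst (A t) (B t) k) holomorphic_on cut_plane"
      by (intro holomorphic_intros hw he)
    fix y :: real assume y: "0 < y"
    define u where "u = lam (of_real y * \<i>)"
    define l where "l = 2 * pi * y"
    have l: "l > 0" using y by (simp add: l_def)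
    have tt: "tau u = of_real y * \<i>" unfolding u_def by (rule tau_lam_imag_axis(2)[OF y])
    note L = lam_imag_axis_we[OF y, folded l_def u_def]
    have a: "of_real (2 * we2 l - we1 l - we3 l) = A u"
    proof -
      have "of_real (2 * we2 l - we1 l - we3 l) = of_real (we2 l - we1 l) - (of_real (we3 l - we2 l) :: complex)" by simp
      also have "\<dots> = A u" unfolding L(2,3) A_def by (simp add: diff_divide_distrib algebra_simps)
      finally show ?thesis .
    qed
    have b: "of_real ((we2 l - we1 l) * (we3 l - we2 l)) = B u"
    proof -
      have "of_real ((we2 l - we1 l) * (we3 l - we2 l)) = of_real (we2 l - we1 l) * (of_real (we3 l - we2 l) :: complex)" by (rule of_real_mult)
      also have "\<dots> = B u" unfolding L(2,3) B_def by (simp add: power2_eq_square power4_eq_xxxx mult_ac)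
      finally show ?thesis .
    qed
    have "k > 0" using k by auto
    have "2 * wseries l (2 * k + 1) 0 = wconst (A u) (B u) k"
      using wseries_eq_wconst[OF l \<open>k > 0\<close>] unfolding a b .
    moreover have "eis (2 * k + 1) 0 (tau u) = wseries l (2 * k + 1) 0"
      unfolding tt eis_imag_axis l_def ..
    ultimately have "2 * eis (2 * k + 1) 0 (tau u) - wconst (A u) (B u) k = 0" by simp
    then show "2 * eis (2 * k + 1) 0 (tau (lam (of_real y * \<i>))) - wconst (A (lam (of_real y * \<i>))) (B (lam (of_real y * \<i>))) k = 0"
      by (simp only: u_def)
  qed
  then show ?thesis by (simp add: A_def B_def)
qed

section \<open>The contour integral as an Eichler integral\<close>

lemma power_times_exp_tendsto_0:
  fixes f :: "real \<Rightarrow> complex" and h :: "real \<Rightarrow> complex"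
  assumes lim: "filterlim (\<lambda>r. Im (f r)) at_top F"
    and C: "\<forall>\<^sub>F r in F. cmod (f r) \<le> C * Im (f r)" and D: "\<forall>\<^sub>F r in F. cmod (h r) \<le> D * exp (- (pi * Im (f r)))"
    and pos: "0 < C" "0 < D"
  shows "((\<lambda>r. f r ^ k * h r) \<longlongrightarrow> 0) F"
proof (rule Lim_null_comparison)
  have ge: "\<forall>\<^sub>F r in F. 0 \<le> Im (f r)" using lim by (simp add: filterlim_at_top)
  show "\<forall>\<^sub>F r in F. norm (f r ^ k * h r) \<le> C ^ k * D * (Im (f r) ^ k / exp (Im (f r)))"
    using C D ge
  proof eventually_elim
    case (elim r)
    have "cmod (f r) ^ k \<le> (C * Im (f r)) ^ k" using elim by (intro power_mono) auto
    moreover have "cmod (h r) \<le> D * exp (- Im (f r))"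
    proof -
      have "1 * Im (f r) \<le> pi * Im (f r)" using elim pi_ge_two by (intro mult_right_mono) auto
      then have "D * exp (- (pi * Im (f r))) \<le> D * exp (- Im (f r))" using pos by (intro mult_left_mono) auto
      with elim show ?thesis by linarith
    qed
    ultimately have "norm (f r ^ k * h r) \<le> (C * Im (f r)) ^ k * (D * exp (- Im (f r)))"
      unfolding norm_mult norm_power using pos elim by (intro mult_mono) auto
    then show ?case by (simp add: power_mult_distrib exp_minus divide_inverse mult_ac)
  qed
  have "((\<lambda>r. Im (f r) ^ k / exp (Im (f r))) \<longlongrightarrow> 0) F"
    by (rule filterlim_compose[OF tendsto_power_div_exp_0 lim])
  then show "((\<lambda>r. C ^ k * D * (Im (f r) ^ k / exp (Im (f r)))) \<longlongrightarrow> 0) F"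
    by (rule tendsto_mult_right_zero)
qed

text \<open>The powers of tau are dominated by the exponential decay of \<open>eis\<close>; the end
  point t = 0 of the segment corresponds to i\<infinity> and contributes nothing.\<close>

lemma eichler_tau_tendsto_0:
  assumes T: "T \<in> cut_plane"
  shows "((\<lambda>r. eichler w n (tau (of_real r * T))) \<longlongrightarrow> 0) (at_right 0)"
proof -
  obtain C where C: "0 < C" "filterlim (\<lambda>r. Im (tau (of_real r * T))) at_top (at_right 0)"
    "\<forall>\<^sub>F r in at_right 0. cmod (tau (of_real r * T)) \<le> C * Im (tau (of_real r * T))"
    by (rule tau_near_0[OF T]) (rule that)
  have ge: "\<forall>\<^sub>F r in at_right 0. 1 \<le> Im (tau (of_real r * T))" using C(2) by (simp add: filterlim_at_top)
  have mono: "((\<lambda>r. tau (of_real r * T) ^ k * eis a j (tau (of_real r * T))) \<longlongrightarrow> 0) (at_right 0)" for k a j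
  proof -
    obtain D where D: "0 < D" "\<And>\<tau>. 1 \<le> Im \<tau> \<Longrightarrow> norm (eis a j \<tau>) \<le> D * exp (- (pi * Im \<tau>))"
      by (rule eis_bound) (rule that)
    have "\<forall>\<^sub>F r in at_right 0. cmod (eis a j (tau (of_real r * T))) \<le> D * exp (- (pi * Im (tau (of_real r * T))))"
      using ge by eventually_elim (rule D(2))
    then show ?thesis by (rule power_times_exp_tendsto_0[OF C(2,3) _ C(1) D(1)])
  qed
  have pol: "((\<lambda>r. poly p (tau (of_real r * T)) * eis a j (tau (of_real r * T))) \<longlongrightarrow> 0) (at_right 0)" for p a j
  proof -
    have "((\<lambda>r. \<Sum>i\<le>degree p. coeff p i * (tau (of_real r * T) ^ i * eis a j (tau (of_real r * T)))) \<longlongrightarrow> (\<Sum>i\<le>degree p. coeff p i * 0)) (at_right 0)"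
      by (intro tendsto_intros mono)
    then show ?thesis by (simp add: poly_altdef sum_distrib_right mult.assoc)
  qed
  have "((\<lambda>r. \<Sum>j\<le>2 * n. (-1) ^ j * (poly ((pderiv ^^ j) (eichler_poly w n)) (tau (of_real r * T)) * eis (2 * n - j) (Suc j) (tau (of_real r * T))))
      \<longlongrightarrow> (\<Sum>j\<le>2 * n. (-1) ^ j * 0)) (at_right 0)"
    by (intro tendsto_intros pol)
  then show ?thesis by (simp add: eichler_def mult.assoc)
qed

text \<open>The integrand is the derivative of \<open>c * eichler w n (tau t)\<close> along the
  half-open segment, and \<open>eichler_tau_tendsto_0\<close> extends this primitive continuously by
  0 to r = 0. \<open>G\<close> is prescribed on the cut plane only, which excludes the end point
  0.\<close>

lemma contour_integral_eichler:
  assumes w: "w \<in> fund_domain"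
    and G: "\<And>t. t \<in> cut_plane \<Longrightarrow> G t = c * (eis (2 * n + 1) 0 (tau t) * deriv tau t)"
  shows "contour_integral (linepath 0 (lam w)) (\<lambda>t. G t * (tau t - w) ^ n * (tau t - cnj w) ^ n) = c * eichler w n w"
proof -
  define T where "T = lam w"
  have T: "T \<in> cut_plane" "tau T = w" unfolding T_def by (rule fund_domain_image[OF w])+
  define \<Psi> where "\<Psi> = (\<lambda>r. if r = 0 then 0 else c * eichler w n (tau (of_real r * T)))"
  define I where "I = (\<lambda>t. G t * (tau t - w) ^ n * (tau t - cnj w) ^ n)"
  have der: "((\<lambda>r. c * eichler w n (tau (of_real r * T))) has_vector_derivative I (of_real r * T) * T) (at r)" if r: "0 < r" "r \<le> 1" for r
  proof -
    define t where "t = of_real r * T"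
    have t: "t \<in> cut_plane" unfolding t_def by (rule segment_in_cut_plane[OF T(1) r])
    have 1: "(eichler w n has_field_derivative poly (eichler_poly w n) (tau t) * eis (2 * n + 1) 0 (tau t)) (at (tau t))"
      by (rule eichler_has_field_derivative[OF Im_tau_pos[OF t]])
    have 2: "(tau has_field_derivative deriv tau t) (at t)"
      by (rule holomorphic_derivI[OF tau_holomorphic open_cut_plane t])
    have "((\<lambda>t. c * eichler w n (tau t)) has_field_derivative
        c * (poly (eichler_poly w n) (tau t) * eis (2 * n + 1) 0 (tau t) * deriv tau t)) (at t)"
      by (rule DERIV_cmult[OF DERIV_chain2[OF 1 2]])
    also have "c * (poly (eichler_poly w n) (tau t) * eis (2 * n + 1) 0 (tau t) * deriv tau t) = I t"
    proof -
      have "poly (eichler_poly w n) (tau t) = (tau t - w) ^ n * (tau t - cnj w) ^ n"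
        unfolding eichler_poly_def poly_power poly_mult power_mult_distrib by simp
      then show ?thesis unfolding I_def G[OF t] by (simp only: mult_ac)
    qed
    finally have f: "((\<lambda>t. c * eichler w n (tau t)) has_field_derivative I t) (at (of_real r * T))" by (simp only: t_def)
    have "((\<lambda>r. of_real r * T) has_vector_derivative T) (at r)" by (auto intro!: derivative_eq_intros)
    from field_vector_diff_chain_at[OF this f]
    show ?thesis by (simp add: o_def t_def mult.commute)
  qed
  \<comment> \<open>Continuity on the closed interval and the derivative in its interior suffice, so
    the exceptional end point t = 0 does no harm.\<close>
  have "((\<lambda>r. I (of_real r * T) * T) has_integral (\<Psi> 1 - \<Psi> 0)) {0..1}"
  proof (rule fundamental_theorem_of_calculus_interior)
    show "(0::real) \<le> 1" by simp
    show "(\<Psi> has_vector_derivative I (of_real r * T) * T) (at r)" if "r \<in> {0<..<1}" for r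
    proof (rule has_vector_derivative_transform_within_open[OF der])
      show "c * eichler w n (tau (of_real x * T)) = \<Psi> x" if "x \<in> {0<..<1}" for x using that by (simp add: \<Psi>_def)
    qed (use that in auto)
    show "continuous_on {0..1} \<Psi>"
    proof (rule continuous_on_eq_continuous_within[THEN iffD2], rule ballI)
      fix x :: real assume x: "x \<in> {0..1}"
      show "continuous (at x within {0..1}) \<Psi>"
      proof (cases "x = 0")
        case True
        have "((\<lambda>r. c * eichler w n (tau (of_real r * T))) \<longlongrightarrow> c * 0) (at_right 0)"
          by (intro tendsto_mult tendsto_const eichler_tau_tendsto_0 T)
        then have "(\<Psi> \<longlongrightarrow> \<Psi> 0) (at_right 0)"
          by (rule Lim_transform_eventually[THEN back_subst[of "\<lambda>l. (\<Psi> \<longlongrightarrow> l) (at_right 0)"]])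
             (auto simp: \<Psi>_def eventually_at_filter)
        moreover have "at 0 within {0..1::real} = at_right 0" by (simp add: at_within_Icc_at_right)
        ultimately show ?thesis unfolding True continuous_within by simp
      next
        case False
        then have x0: "0 < x" "x \<le> 1" using x by auto
        have "continuous (at x) (\<lambda>r. c * eichler w n (tau (of_real r * T)))"
          by (rule has_vector_derivative_continuous[OF der[OF x0]])
        then have "continuous (at x within {0..1}) (\<lambda>r. c * eichler w n (tau (of_real r * T)))"
          by (rule continuous_at_imp_continuous_at_within)
        then show ?thesis
          by (rule continuous_transform_within[of _ _ _ x]) (use x0 x in \<open>auto simp: \<Psi>_def dist_real_def\<close>)
      qed
    qed
  qed
  then have "(I has_contour_integral (\<Psi> 1 - \<Psi> 0)) (linepath 0 T)"
    unfolding has_contour_integral_linepath by (simp add: linepath_def scaleR_conv_of_real)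
  then have "contour_integral (linepath 0 T) I = \<Psi> 1 - \<Psi> 0" by (rule contour_integral_unique)
  also have "\<dots> = c * eichler w n w" by (simp add: \<Psi>_def T(2))
  finally show ?thesis unfolding I_def T_def .
qed

section \<open>Lattice sums\<close>

text \<open>The n-th derivative of - \<pi> cot(\<pi> z); up to the factor (-1)^(n+1) n! it is the
  sum of 1/(z + c)^(n+1) over all integers c, for n = 0 in the symmetric sense.\<close>

definition refl_Polygamma :: "nat \<Rightarrow> complex \<Rightarrow> complex" where
  "refl_Polygamma n z = Polygamma n z - (-1) ^ n * Polygamma n (1 - z)"

lemma not_Ints_imp_not_nonpos_Ints:
  fixes z :: complex
  assumes "z \<notin> \<int>"
  shows "z \<notin> \<int>\<^sub>\<le>\<^sub>0" "1 - z \<notin> \<int>\<^sub>\<le>\<^sub>0" "sin (of_real pi * z) \<noteq> 0"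
proof -
  show "z \<notin> \<int>\<^sub>\<le>\<^sub>0" using assms nonpos_Ints_Int by auto
  show "1 - z \<notin> \<int>\<^sub>\<le>\<^sub>0"
  proof
    assume "1 - z \<in> \<int>\<^sub>\<le>\<^sub>0"
    then have "1 - (1 - z) \<in> \<int>" by (intro Ints_diff Ints_1 nonpos_Ints_Int)
    with assms show False by simp
  qed
  show "sin (of_real pi * z) \<noteq> 0"
  proof
    assume "sin (of_real pi * z) = 0"
    then obtain k where "of_real pi * z = of_real (of_int k * pi)" unfolding sin_eq_0 by (auto simp: mult_ac)
    then have "z = of_int k" by simp
    with assms show False by simp
  qed
qed

lemma refl_Polygamma_has_field_derivative:
  assumes "z \<notin> \<int>"
  shows "(refl_Polygamma n has_field_derivative refl_Polygamma (Suc n) z) (at z)"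
proof -
  note z = not_Ints_imp_not_nonpos_Ints[OF assms]
  have 1: "((\<lambda>z. 1 - z) has_field_derivative - 1) (at z)" by (auto intro!: derivative_eq_intros)
  have "((\<lambda>z. Polygamma n (1 - z)) has_field_derivative Polygamma (Suc n) (1 - z) * - 1) (at z)"
    by (rule DERIV_chain2[OF has_field_derivative_Polygamma[OF z(2)] 1])
  from DERIV_diff[OF has_field_derivative_Polygamma[OF z(1), of n] DERIV_cmult[OF this, of "(-1) ^ n"]]
  show ?thesis unfolding refl_Polygamma_def[abs_def] by simp
qed

lemma open_not_Ints: "open (- (\<int> :: complex set))"
  using closed_Ints by (simp add: open_Compl)

text \<open>The logarithmic derivative of the reflection formula Gamma(z) Gamma(1 - z) =
  \<pi>/sin(\<pi> z).\<close>

lemma refl_Polygamma_0: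
  assumes "z \<notin> \<int>"
  shows "refl_Polygamma 0 z = - of_real pi * cos (of_real pi * z) / sin (of_real pi * z)"
proof -
  note z = not_Ints_imp_not_nonpos_Ints[OF assms]
  define s c where "s = sin (of_real pi * z)" and "c = cos (of_real pi * z)"
  have s0: "s \<noteq> 0" using z by (simp add: s_def)
  have 1: "((\<lambda>z. 1 - z) has_field_derivative - 1) (at z)" by (auto intro!: derivative_eq_intros)
  have "((\<lambda>z. Gamma (1 - z)) has_field_derivative Gamma (1 - z) * Digamma (1 - z) * - 1) (at z)"
    by (rule DERIV_chain2[OF has_field_derivative_Gamma[OF z(2)] 1])
  from DERIV_mult[OF has_field_derivative_Gamma[OF z(1)] this]
  have "((\<lambda>z. Gamma z * Gamma (1 - z)) has_field_derivative Gamma z * Gamma (1 - z) * refl_Polygamma 0 z) (at z)"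
    by (simp add: refl_Polygamma_def algebra_simps)
  moreover have "((\<lambda>z. Gamma z * Gamma (1 - z)) has_field_derivative - (of_real pi ^ 2 * c / s ^ 2)) (at z)"
  proof -
    have "((\<lambda>z. of_real pi / sin (of_real pi * z)) has_field_derivative - (of_real pi ^ 2 * c / s ^ 2)) (at z)"
      unfolding s_def c_def using z(3) by (auto intro!: derivative_eq_intros simp: power2_eq_square)
    then show ?thesis by (simp only: Gamma_reflection_complex)
  qed
  ultimately have "Gamma z * Gamma (1 - z) * refl_Polygamma 0 z = - (of_real pi ^ 2 * c / s ^ 2)" by (rule DERIV_unique)
  then have "of_real pi / s * refl_Polygamma 0 z = - (of_real pi ^ 2 * c / s ^ 2)"
    unfolding Gamma_reflection_complex s_def .
  also have "\<dots> = of_real pi / s * (- of_real pi * c / s)" by (simp add: power2_eq_square)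
  finally have "refl_Polygamma 0 z = - of_real pi * c / s"
    by (rule mult_left_cancel[THEN iffD1, rotated]) (use s0 in simp)
  then show ?thesis unfolding s_def c_def .
qed

lemma refl_Polygamma_1:
  assumes z: "z \<notin> \<int>"
  shows "refl_Polygamma 1 z = of_real pi ^ 2 / sin (of_real pi * z) ^ 2"
proof -
  define s c p where "s = sin (of_real pi * z)" and "c = cos (of_real pi * z)" and "p = complex_of_real pi"
  have s: "s \<noteq> 0" unfolding s_def by (rule not_Ints_imp_not_nonpos_Ints(3)[OF z])
  have cs: "c * c = 1 - s * s" using sin_cos_squared_add[of "of_real pi * z"] by (simp add: s_def c_def power2_eq_square algebra_simps)
  have 1: "((\<lambda>z. - p * cos (p * z)) has_field_derivative p * p * s) (at z)"
    unfolding s_def p_def by (rule derivative_eq_intros refl)+ simp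
  have 2: "((\<lambda>z. sin (p * z)) has_field_derivative p * c) (at z)"
    unfolding c_def p_def by (rule derivative_eq_intros refl)+ simp
  have "((\<lambda>z. - p * cos (p * z) / sin (p * z)) has_field_derivative (p * p * s * s - - p * c * (p * c)) / (s * s)) (at z)"
    using DERIV_divide[OF 1 2 s[unfolded s_def, folded p_def]] by (simp only: s_def c_def p_def)
  also have "p * p * s * s - - p * c * (p * c) = p * p * (s * s + c * c)" by (simp add: algebra_simps)
  also have "\<dots> = p\<^sup>2" unfolding cs by (simp add: power2_eq_square)
  finally have "((\<lambda>z. - of_real pi * cos (of_real pi * z) / sin (of_real pi * z)) has_field_derivative of_real pi ^ 2 / sin (of_real pi * z) ^ 2) (at z)"
    by (simp only: s_def p_def power2_eq_square)
  then have "(refl_Polygamma 0 has_field_derivative of_real pi ^ 2 / sin (of_real pi * z) ^ 2) (at z)"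
    by (rule has_field_derivative_transform_within_open[OF _ open_not_Ints]) (use z in \<open>auto simp: refl_Polygamma_0\<close>)
  from DERIV_unique[OF refl_Polygamma_has_field_derivative[OF z] this] show ?thesis by simp
qed

lemma refl_Polygamma_2:
  assumes z: "z \<notin> \<int>"
  shows "refl_Polygamma 2 z = - 2 * of_real pi ^ 3 * cos (of_real pi * z) / sin (of_real pi * z) ^ 3"
proof -
  note s = not_Ints_imp_not_nonpos_Ints(3)[OF z]
  have "((\<lambda>z. of_real pi ^ 2 / sin (of_real pi * z) ^ 2) has_field_derivative
      - 2 * of_real pi ^ 3 * cos (of_real pi * z) / sin (of_real pi * z) ^ 3) (at z)"
    using s by (auto intro!: derivative_eq_intros simp: field_simps power2_eq_square power3_eq_cube)
  then have "(refl_Polygamma 1 has_field_derivative - 2 * of_real pi ^ 3 * cos (of_real pi * z) / sin (of_real pi * z) ^ 3) (at z)"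
    by (rule has_field_derivative_transform_within_open[OF _ open_not_Ints]) (use z in \<open>auto simp: refl_Polygamma_1[unfolded One_nat_def]\<close>)
  from DERIV_unique[OF refl_Polygamma_has_field_derivative[OF z] this] show ?thesis by (simp add: numeral_2_eq_2)
qed

text \<open>With the square of the first derivative this is the degenerate Weierstrass equation of
  \<pi>^2/sin^2(\<pi> z), so that \<open>even_deriv_poly\<close> governs its even derivatives
  too.\<close>

lemma refl_Polygamma_3:
  assumes z: "z \<notin> \<int>"
  shows "refl_Polygamma 3 z = 6 * refl_Polygamma 1 z ^ 2 - 4 * of_real pi ^ 2 * refl_Polygamma 1 z"
proof -
  define s c where "s = sin (of_real pi * z)" and "c = cos (of_real pi * z)"
  have s: "s \<noteq> 0" unfolding s_def by (rule not_Ints_imp_not_nonpos_Ints(3)[OF z])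
  have cs: "c\<^sup>2 = 1 - s\<^sup>2" using sin_cos_squared_add[of "of_real pi * z"] by (simp add: s_def c_def algebra_simps)
  define p where "p = complex_of_real pi"
  have 1: "((\<lambda>z. - 2 * p ^ 3 * cos (p * z)) has_field_derivative 2 * p ^ 4 * s) (at z)"
    unfolding s_def p_def by (rule derivative_eq_intros refl)+ (simp add: eval_nat_numeral)
  have 2: "((\<lambda>z. sin (p * z) ^ 3) has_field_derivative 3 * p * s\<^sup>2 * c) (at z)"
    unfolding s_def c_def p_def by (rule derivative_eq_intros refl)+ (simp add: mult_ac)
  have s3: "sin (p * z) ^ 3 \<noteq> 0" using s by (simp add: s_def p_def)
  have "((\<lambda>z. - 2 * p ^ 3 * cos (p * z) / sin (p * z) ^ 3) has_field_derivative
      (2 * p ^ 4 * s * s ^ 3 - - 2 * p ^ 3 * c * (3 * p * s\<^sup>2 * c)) / (s ^ 3 * s ^ 3)) (at z)"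
    using DERIV_divide[OF 1 2 s3] by (simp only: s_def c_def p_def)
  also have "2 * p ^ 4 * s * s ^ 3 - - 2 * p ^ 3 * c * (3 * p * s\<^sup>2 * c) = 2 * p ^ 4 * s ^ 4 + 6 * p ^ 4 * c\<^sup>2 * s\<^sup>2"
    by (simp add: eval_nat_numeral algebra_simps)
  also have "s ^ 3 * s ^ 3 = s ^ 6" by (simp flip: power_add)
  finally have "((\<lambda>z. - 2 * of_real pi ^ 3 * cos (of_real pi * z) / sin (of_real pi * z) ^ 3) has_field_derivative
     (2 * of_real pi ^ 4 * s ^ 4 + 6 * of_real pi ^ 4 * c\<^sup>2 * s\<^sup>2) / s ^ 6) (at z)"
    by (simp only: p_def)
  then have "(refl_Polygamma 2 has_field_derivative (2 * of_real pi ^ 4 * s ^ 4 + 6 * of_real pi ^ 4 * c\<^sup>2 * s\<^sup>2) / s ^ 6) (at z)"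
    by (rule has_field_derivative_transform_within_open[OF _ open_not_Ints]) (use z in \<open>auto simp: refl_Polygamma_2\<close>)
  from DERIV_unique[OF refl_Polygamma_has_field_derivative[OF z] this]
  have "refl_Polygamma 3 z = (2 * of_real pi ^ 4 * s ^ 4 + 6 * of_real pi ^ 4 * c\<^sup>2 * s\<^sup>2) / s ^ 6"
    by (simp add: numeral_3_eq_3 numeral_2_eq_2)
  also have "\<dots> = 6 * (of_real pi ^ 2 / s\<^sup>2) ^ 2 - 4 * of_real pi ^ 2 * (of_real pi ^ 2 / s\<^sup>2)"
    unfolding cs using s by (simp add: field_simps eval_nat_numeral)
  finally show ?thesis unfolding refl_Polygamma_1[OF z] s_def .
qed

text \<open>Here W = \<pi>^2/sin^2(\<pi> x) - \<pi>^2 satisfies W'^2 = 4 W (W + \<pi>^2)^2, the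
  cubic of \<open>wconst\<close> with A = 2 \<pi>^2 and B = - \<pi>^4, and W vanishes at x = 1/2. At
  this point the two polygamma terms coincide, and the powers of 1/2 + m produce the odd
  integers.\<close>

lemma sums_inverse_half_power:
  assumes k: "k > 0"
  shows "(\<lambda>m. 1 / of_nat (2 * m + 1) ^ (2 * k + 2)) sums
    (wconst (2 * of_real pi ^ 2) (- (of_real pi ^ 4)) k / (2 ^ (2 * k + 3) * fact (2 * k + 1)) :: complex)"
proof -
  define A B where "A = 2 * complex_of_real pi ^ 2" and "B = - (complex_of_real pi ^ 4)"
  define D where "D = (\<lambda>j z. if j = 0 then refl_Polygamma 1 z - of_real pi ^ 2 else refl_Polygamma (Suc j) z)"
  define S where "S = - (\<int> :: complex set)"
  have S: "x \<notin> \<int>" if "x \<in> S" for x using that by (simp add: S_def)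
  have half: "1 / 2 \<in> S" using fraction_not_in_Ints[where 'a = complex, of 2 1] by (simp add: S_def)
  have "D (2 * k) (1 / 2) = poly (even_deriv_poly [:0, - 4 * B, 4 * A, 4:] [:- 2 * B, 4 * A, 6:] k) (D 0 (1 / 2))"
  proof (rule even_deriv_poly[where S = S and D = D, OF _ _ _ _ half])
    show "open S" unfolding S_def by (rule open_not_Ints)
    show "(D j has_field_derivative D (Suc j) x) (at x)" if x: "x \<in> S" for j x
    proof (cases j)
      case 0
      have "(D 0 has_field_derivative refl_Polygamma (Suc 1) x - 0) (at x)"
        unfolding D_def if_P[OF refl] by (rule DERIV_diff[OF refl_Polygamma_has_field_derivative[OF S[OF x]] DERIV_const])
      then show ?thesis by (simp add: 0) (simp add: D_def)
    next
      case (Suc i)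
      then have "D j = refl_Polygamma (Suc j)" by (simp add: D_def fun_eq_iff)
      then show ?thesis using refl_Polygamma_has_field_derivative[OF S[OF x]] by (simp add: D_def)
    qed
    fix x assume "x \<in> S"
    note x = S[OF this]
    have D0: "refl_Polygamma 1 x = D 0 x + of_real pi ^ 2" by (simp add: D_def)
    define s c where "s = sin (of_real pi * x)" and "c = cos (of_real pi * x)"
    have s: "s \<noteq> 0" unfolding s_def by (rule not_Ints_imp_not_nonpos_Ints(3)[OF x])
    have cs: "c\<^sup>2 = 1 - s\<^sup>2" using sin_cos_squared_add[of "of_real pi * x"] by (simp add: s_def c_def algebra_simps)
    have "(D 1 x)\<^sup>2 = 4 * of_real pi ^ 6 * c\<^sup>2 / s ^ 6"
      using refl_Polygamma_2[OF x] by (simp add: D_def s_def c_def numeral_2_eq_2 power_mult_distrib power_divide flip: power_mult)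
    also have "\<dots> = 4 * refl_Polygamma 1 x ^ 3 - 4 * of_real pi ^ 2 * refl_Polygamma 1 x ^ 2"
      unfolding refl_Polygamma_1[OF x] s_def[symmetric] cs using s by (simp add: field_simps eval_nat_numeral)
    also have "\<dots> = poly [:0, - 4 * B, 4 * A, 4:] (D 0 x)"
      unfolding D0 by (simp add: A_def B_def algebra_simps eval_nat_numeral)
    finally show "(D 1 x)\<^sup>2 = poly [:0, - 4 * B, 4 * A, 4:] (D 0 x)" .
    have "D 2 x = refl_Polygamma 3 x" by (simp add: D_def)
    also have "\<dots> = poly [:- 2 * B, 4 * A, 6:] (D 0 x)"
      unfolding refl_Polygamma_3[OF x] D0 by (simp add: A_def B_def algebra_simps eval_nat_numeral)
    finally show "D 2 x = poly [:- 2 * B, 4 * A, 6:] (D 0 x)" .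
  qed
  moreover have "D 0 (1 / 2) = 0"
  proof -
    have "sin (complex_of_real (pi / 2)) = 1" by (simp only: sin_of_real sin_pi_half of_real_1)
    then show ?thesis using refl_Polygamma_1[OF S[OF half]] by (simp add: D_def)
  qed
  ultimately have "D (2 * k) (1 / 2) = wconst A B k" by (simp add: wconst_def)
  moreover have "D (2 * k) (1 / 2) = 2 * Polygamma (2 * k + 1) (1 / 2)"
    using k by (simp add: D_def refl_Polygamma_def)
  ultimately have P: "Polygamma (2 * k + 1) (1 / 2) = wconst A B k / 2" by (simp only: eq_divide_eq_numeral1) (simp add: mult.commute)
  have "(\<lambda>m. inverse ((1 / 2 + of_nat m) ^ Suc (2 * k + 1))) sums ((-1) ^ Suc (2 * k + 1) * Polygamma (2 * k + 1) (1 / 2 :: complex) / fact (2 * k + 1))"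
    by (rule Polygamma_LIMSEQ) auto
  note 1 = sums_mult[OF this, of "1 / 2 ^ (2 * k + 2)"]
  have "(\<lambda>m. 1 / 2 ^ (2 * k + 2) * inverse ((1 / 2 + of_nat m) ^ Suc (2 * k + 1))) sums (wconst A B k / (2 ^ (2 * k + 3) * fact (2 * k + 1)))"
  proof -
    have "1 / 2 ^ (2 * k + 2) * ((-1) ^ Suc (2 * k + 1) * Polygamma (2 * k + 1) (1 / 2) / fact (2 * k + 1)) =
        wconst A B k / (2 ^ (2 * k + 3) * fact (2 * k + 1))"
      unfolding P by (simp add: power_add)
    with 1 show ?thesis by (simp only:)
  qed
  moreover have "1 / 2 ^ (2 * k + 2) * inverse ((1 / 2 + of_nat m) ^ Suc (2 * k + 1)) = 1 / (of_nat (2 * m + 1) ^ (2 * k + 2) :: complex)" for m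
  proof -
    have "of_nat (2 * m + 1) = (2 :: complex) * (1 / 2 + of_nat m)" by (simp add: distrib_left)
    then have "of_nat (2 * m + 1) ^ (2 * k + 2) = (2 :: complex) ^ (2 * k + 2) * (1 / 2 + of_nat m) ^ (2 * k + 2)"
      by (simp only: power_mult_distrib)
    moreover have "Suc (2 * k + 1) = 2 * k + 2" by simp
    ultimately show ?thesis by (simp only: inverse_eq_divide times_divide_times_eq mult_1_left mult_1_right)
  qed
  ultimately show ?thesis by (simp add: A_def B_def)
qed

text \<open>Lipschitz's formula: - \<pi> cot(\<pi> z) is \<pi> i plus 2 \<pi> i times a geometric
  series in exp(2 \<pi> i z), and each differentiation raises the index of \<open>lip\<close>. The
  constant \<pi> i survives for n = 0 only; it later gives the term with \<zeta>(2s - 1).\<close>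

lemma refl_Polygamma_upper:
  assumes z: "0 < Im z"
  shows "refl_Polygamma n z = (if n = 0 then of_real pi * \<i> else 0) + (2 * of_real pi * \<i>) ^ Suc n * lip n (exp (2 * of_real pi * \<i> * z))"
proof -
  define H where "H = {z. 0 < Im z}"
  have oH: "open H" unfolding H_def by (rule open_halfspace_Im_gt)
  have H: "z \<notin> \<int>" if "z \<in> H" for z using that by (auto simp: H_def elim!: Ints_cases)
  have ex: "norm (exp (2 * of_real pi * \<i> * z)) < 1" if "z \<in> H" for z
    using that by (simp add: H_def norm_exp_eq_Re)
  have base: "refl_Polygamma 0 z = of_real pi * \<i> + 2 * of_real pi * \<i> * lip 0 (exp (2 * of_real pi * \<i> * z))" if z: "z \<in> H" for z
  proof -
    define u where "u = exp (\<i> * (of_real pi * z))"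
    have u0: "u \<noteq> 0" by (simp add: u_def)
    have v: "exp (2 * of_real pi * \<i> * z) = u\<^sup>2" by (simp add: u_def exp_of_nat_mult[symmetric] mult_ac)
    have v1: "1 - u\<^sup>2 \<noteq> 0" using ex[OF z] unfolding v by auto
    have c: "cos (of_real pi * z) = (u + 1 / u) / 2" by (simp add: cos_exp_eq u_def exp_minus field_simps)
    have s: "sin (of_real pi * z) = (u - 1 / u) / (2 * \<i>)" by (simp add: sin_exp_eq u_def exp_minus field_simps)
    have s': "sin (of_real pi * z) = \<i> * (1 - u\<^sup>2) / (2 * u)" unfolding s using u0 by (simp add: field_simps power2_eq_square)
    have c': "cos (of_real pi * z) = (1 + u\<^sup>2) / (2 * u)" unfolding c using u0 by (simp add: field_simps power2_eq_square)
    have "refl_Polygamma 0 z = - of_real pi * ((1 + u\<^sup>2) / (2 * u)) / (\<i> * (1 - u\<^sup>2) / (2 * u))"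
      unfolding refl_Polygamma_0[OF H[OF z]] s' c' ..
    also have "\<dots> = of_real pi * \<i> * ((1 + u\<^sup>2) / (1 - u\<^sup>2))" using u0 v1 by (simp add: field_simps)
    also have "(1 + u\<^sup>2) / (1 - u\<^sup>2) = 1 + 2 * (u\<^sup>2 / (1 - u\<^sup>2))" using v1 by (simp add: field_simps)
    finally have "refl_Polygamma 0 z = of_real pi * \<i> + 2 * of_real pi * \<i> * (u\<^sup>2 / (1 - u\<^sup>2))" by (simp add: distrib_left)
    then show ?thesis using lip_0[OF ex[OF z]] by (simp only: v)
  qed
  have "z \<in> H \<Longrightarrow> refl_Polygamma n z = (if n = 0 then of_real pi * \<i> else 0) + (2 * of_real pi * \<i>) ^ Suc n * lip n (exp (2 * of_real pi * \<i> * z))" for z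
  proof (induction n arbitrary: z)
    case 0
    then show ?case using base[of z] by simp
  next
    case (Suc n)
    have x: "Re (2 * of_real pi * \<i> * z) < 0" using Suc.prems by (simp add: H_def mult_pos_pos)
    have 1: "((\<lambda>z. 2 * of_real pi * \<i> * z) has_field_derivative 2 * of_real pi * \<i>) (at z)"
      by (auto intro!: derivative_eq_intros)
    have 2: "((\<lambda>z. lip n (exp (2 * of_real pi * \<i> * z))) has_field_derivative lip (Suc n) (exp (2 * of_real pi * \<i> * z)) * (2 * of_real pi * \<i>)) (at z)"
      by (rule DERIV_chain2[OF lip_exp_has_field_derivative[OF x] 1])
    from DERIV_add[OF DERIV_const DERIV_cmult[OF this, of "(2 * of_real pi * \<i>) ^ Suc n"]]
    have "((\<lambda>z. (if n = 0 then of_real pi * \<i> else 0) + (2 * of_real pi * \<i>) ^ Suc n * lip n (exp (2 * of_real pi * \<i> * z))) has_field_derivative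
       0 + (2 * of_real pi * \<i>) ^ Suc n * (lip (Suc n) (exp (2 * of_real pi * \<i> * z)) * (2 * of_real pi * \<i>))) (at z)" .
    then have "(refl_Polygamma n has_field_derivative
       0 + (2 * of_real pi * \<i>) ^ Suc n * (lip (Suc n) (exp (2 * of_real pi * \<i> * z)) * (2 * of_real pi * \<i>))) (at z)"
      by (rule has_field_derivative_transform_within_open[OF _ oH Suc.prems]) (rule Suc.IH[symmetric])
    from DERIV_unique[OF refl_Polygamma_has_field_derivative[OF H[OF Suc.prems]] this]
    show ?case by (simp add: mult_ac)
  qed
  with z show ?thesis by (simp add: H_def)
qed

section \<open>Sums over one row of the lattice\<close>

lemma lip_cnj:
  assumes "norm v < 1"
  shows "lip a (cnj v) = cnj (lip a v)"
proof -
  have "(\<lambda>n. cnj (of_nat (Suc n) ^ a * v ^ Suc n)) sums cnj (lip a v)"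
    unfolding lip_def sums_cnj by (rule summable_sums[OF summable_lip[OF assms]])
  then have "(\<lambda>n. of_nat (Suc n) ^ a * cnj v ^ Suc n) sums cnj (lip a v)" by (simp del: of_nat_Suc add: complex_cnj_of_nat)
  then show ?thesis unfolding lip_def by (rule sums_unique[symmetric])
qed

text \<open>The reflection 1 - cnj z lies in the upper half plane again, and its exponential is the
  conjugate of that of z.\<close>

lemma refl_Polygamma_cnj:
  assumes z: "0 < Im z"
  shows "refl_Polygamma n (cnj z) = cnj (refl_Polygamma n z)"
proof -
  define v where "v = exp (2 * of_real pi * \<i> * z)"
  have v: "norm v < 1" using z by (simp add: v_def norm_exp_eq_Re)
  have "exp (2 * of_real pi * \<i> * (1 - cnj z)) = exp (2 * of_real pi * \<i>) * cnj v"
    unfolding v_def exp_cnj exp_add[symmetric] by (simp add: algebra_simps)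
  then have e: "exp (2 * of_real pi * \<i> * (1 - cnj z)) = cnj v" by simp
  have "refl_Polygamma n (cnj z) = - ((-1) ^ n * refl_Polygamma n (1 - cnj z))"
    by (simp add: refl_Polygamma_def algebra_simps flip: power_mult_distrib mult.assoc)
  also have "refl_Polygamma n (1 - cnj z) = (if n = 0 then of_real pi * \<i> else 0) + (2 * of_real pi * \<i>) ^ Suc n * lip n (cnj v)"
  proof -
    have "0 < Im (1 - cnj z)" using z by simp
    from refl_Polygamma_upper[OF this] show ?thesis unfolding e .
  qed
  also have "- ((-1) ^ n * \<dots>) = cnj ((if n = 0 then of_real pi * \<i> else 0) + (2 * of_real pi * \<i>) ^ Suc n * lip n v)"
  proof -
    have "(- (2 * of_real pi * \<i>)) ^ Suc n = - ((-1) ^ n * (2 * of_real pi * \<i>) ^ Suc n)"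
      by (simp add: power_minus[of "2 * of_real pi * \<i>"])
    moreover have "cnj ((2 * of_real pi * \<i>) ^ Suc n * lip n v) = (- (2 * of_real pi * \<i>)) ^ Suc n * lip n (cnj v)"
      unfolding lip_cnj[OF v] by (simp del: power_Suc)
    ultimately show ?thesis by (simp add: algebra_simps del: power_Suc)
  qed
  also have "\<dots> = cnj (refl_Polygamma n z)" by (simp only: refl_Polygamma_upper[OF z] v_def)
  finally show ?thesis .
qed

text \<open>For 0 < u < 1 one part is the probability that n + 1 successes occur before n + 1
  failures, the other that of the opposite event. In the induction step the two parts change by
  opposite amounts, since the increment is symmetric in \<open>u\<close> and \<open>v\<close> except
  for the factor u - v.\<close>

lemma sum_binomial_split_unity:
  fixes u v :: "'a :: comm_ring_1"
  assumes uv: "u + v = 1"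
  shows "(\<Sum>i\<le>n. of_nat ((n + i) choose i) * (u ^ Suc n * v ^ i + v ^ Suc n * u ^ i)) = 1"
proof (induction n)
  case 0
  then show ?case using uv by simp
next
  case (Suc n)
  have step: "u ^ Suc (Suc n) * (\<Sum>i\<le>Suc n. of_nat ((Suc n + i) choose i) * v ^ i)
      = u ^ Suc n * (\<Sum>i\<le>n. of_nat ((n + i) choose i) * v ^ i)
        + of_nat ((2 * n + 1) choose n) * (u * v) ^ Suc n * (u - v)"
    if uv: "u + v = 1" for u v :: 'a
  proof -
    define T where "T = (\<Sum>i\<le>Suc n. of_nat ((Suc n + i) choose i) * v ^ i)"
    define A where "A = (\<Sum>i\<le>n. of_nat ((n + i) choose i) * v ^ i)"
    define N :: 'a where "N = of_nat ((2 * n + 1) choose n)"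
    have sym: "(2 * n + 1) choose Suc n = (2 * n + 1) choose n"
      using binomial_symmetric[of n "2 * n + 1"] by simp
    have top: "(Suc n + Suc n) choose Suc n = 2 * ((2 * n + 1) choose n)"
    proof -
      have "Suc n + Suc n = Suc (2 * n + 1)" by simp
      then have "(Suc n + Suc n) choose Suc n = ((2 * n + 1) choose n) + ((2 * n + 1) choose Suc n)"
        by (simp only: binomial_Suc_Suc)
      then show ?thesis unfolding sym by simp
    qed
    have pascal: "(Suc n + Suc i) choose Suc i = ((n + Suc i) choose Suc i) + ((Suc n + i) choose i)" for i
      by simp
    have "T = 1 + (\<Sum>i\<le>n. of_nat ((Suc n + Suc i) choose Suc i) * v ^ Suc i)"
      unfolding T_def by (subst sum.atMost_Suc_shift) simp
    also have "\<dots> = (1 + (\<Sum>i\<le>n. of_nat ((n + Suc i) choose Suc i) * v ^ Suc i)) + v * (\<Sum>i\<le>n. of_nat ((Suc n + i) choose i) * v ^ i)"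
      unfolding pascal by (simp add: sum.distrib sum_distrib_left algebra_simps)
    also have "1 + (\<Sum>i\<le>n. of_nat ((n + Suc i) choose Suc i) * v ^ Suc i) = (\<Sum>i\<le>Suc n. of_nat ((n + i) choose i) * v ^ i)"
      by (subst sum.atMost_Suc_shift) simp
    also have "\<dots> = A + N * v ^ Suc n"
    proof -
      have "n + Suc n = 2 * n + 1" by simp
      then show ?thesis unfolding sum.atMost_Suc A_def N_def by (simp only: sym)
    qed
    also have "(\<Sum>i\<le>n. of_nat ((Suc n + i) choose i) * v ^ i) = T - 2 * N * v ^ Suc n"
      unfolding T_def sum.atMost_Suc top N_def by simp
    finally have "(1 - v) * T = A + N * v ^ Suc n * (1 - 2 * v)"
      by (simp add: algebra_simps)
    moreover have "1 - v = u" "1 - 2 * v = u - v" using uv by (simp_all add: algebra_simps)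
    ultimately have "u * T = A + N * v ^ Suc n * (u - v)" by simp
    then have "u ^ Suc (Suc n) * T = u ^ Suc n * (A + N * v ^ Suc n * (u - v))"
      by (simp only: power_Suc2[of u "Suc n"] mult.assoc)
    also have "\<dots> = u ^ Suc n * A + N * (u * v) ^ Suc n * (u - v)"
      unfolding power_mult_distrib by (simp only: distrib_left mult_ac)
    finally show ?thesis unfolding T_def A_def N_def .
  qed
  have split: "(\<Sum>i\<le>m. of_nat ((m + i) choose i) * (u ^ Suc m * v ^ i + v ^ Suc m * u ^ i)) =
      u ^ Suc m * (\<Sum>i\<le>m. of_nat ((m + i) choose i) * v ^ i) + v ^ Suc m * (\<Sum>i\<le>m. of_nat ((m + i) choose i) * u ^ i)" for m
    by (simp add: sum.distrib sum_distrib_left algebra_simps)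
  have vu: "v + u = 1" using uv by (simp add: add.commute)
  show ?case
    using Suc.IH unfolding split step[OF uv] step[OF vu] by (simp add: algebra_simps)
qed

text \<open>With u = x/h and v = -y/h, which add up to 1, the preceding identity splits 1/(x
  y)^(n+1) into pure powers of 1/x and 1/y. In the application \<open>h\<close> is 2 i Im z,
  independent of the summation index.\<close>

lemma inverse_mult_power_partial_fractions:
  fixes x y :: complex
  assumes x: "x \<noteq> 0" and y: "y \<noteq> 0" and h: "x - y = h" "h \<noteq> 0"
  shows "1 / (x * y) ^ Suc n = (\<Sum>i\<le>n. (-1) ^ Suc n * of_nat ((n + i) choose i) / h ^ (Suc n + i) *
    (inverse (x ^ Suc (n - i)) + (-1) ^ Suc (n - i) * inverse (y ^ Suc (n - i))))"
proof -
  define u v where "u = x / h" and "v = - (y / h)"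
  have "u + v = 1" using h by (simp add: u_def v_def flip: diff_divide_distrib)
  note S = sum_binomial_split_unity[OF this, of n]
  have "1 / (x * y) ^ Suc n = 1 / (x * y) ^ Suc n * (\<Sum>i\<le>n. of_nat ((n + i) choose i) * (u ^ Suc n * v ^ i + v ^ Suc n * u ^ i))"
    unfolding S by simp
  also have "\<dots> = (\<Sum>i\<le>n. (-1) ^ Suc n * of_nat ((n + i) choose i) / h ^ (Suc n + i) *
    (inverse (x ^ Suc (n - i)) + (-1) ^ Suc (n - i) * inverse (y ^ Suc (n - i))))"
    unfolding sum_distrib_left
  proof (intro sum.cong refl)
    fix i assume "i \<in> {..n}"
    then obtain k where n: "n = i + k" using le_Suc_ex by auto
    have m: "((-1) ^ k :: complex) * (-1) ^ k = 1" by (simp flip: power_mult_distrib)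
    have 1: "1 / (x * y) ^ Suc n * (u ^ Suc n * v ^ i) = (-1) ^ i / h ^ (Suc n + i) * inverse (y ^ Suc (n - i))"
      unfolding u_def v_def n using x y h(2) by (simp add: power_mult_distrib power_divide power_minus[of "y / h"] power_add field_simps)
    have 2: "1 / (x * y) ^ Suc n * (v ^ Suc n * u ^ i) = (-1) ^ Suc n / h ^ (Suc n + i) * inverse (x ^ Suc (n - i))"
      unfolding u_def v_def n using x y h(2) by (simp add: power_mult_distrib power_divide power_minus[of "y / h"] power_add field_simps)
    have s: "(-1) ^ i = (-1) ^ Suc n * ((-1) ^ Suc (n - i) :: complex)" unfolding n using m by (simp add: power_add)
    have "1 / (x * y) ^ Suc n * (of_nat ((n + i) choose i) * (u ^ Suc n * v ^ i + v ^ Suc n * u ^ i)) =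
      of_nat ((n + i) choose i) * (1 / (x * y) ^ Suc n * (u ^ Suc n * v ^ i) + 1 / (x * y) ^ Suc n * (v ^ Suc n * u ^ i))"
      by (simp only: distrib_left mult_ac)
    also have "\<dots> = (-1) ^ Suc n * of_nat ((n + i) choose i) / h ^ (Suc n + i) *
        (inverse (x ^ Suc (n - i)) + (-1) ^ Suc (n - i) * inverse (y ^ Suc (n - i)))"
      unfolding 1 2 s by (simp add: divide_inverse algebra_simps del: power_Suc)
    finally show "1 / (x * y) ^ Suc n * (of_nat ((n + i) choose i) * (u ^ Suc n * v ^ i + v ^ Suc n * u ^ i)) = \<dots>" .
  qed
  finally show ?thesis .
qed

text \<open>For n = 0 the single series diverge and only their difference converges, to a difference
  of digamma values; hence the two powers are kept together.\<close>

lemma sums_inverse_power_diff_Polygamma: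
  fixes z w :: complex
  assumes z: "z \<notin> \<int>\<^sub>\<le>\<^sub>0" and w: "w \<notin> \<int>\<^sub>\<le>\<^sub>0"
  shows "(\<lambda>k. inverse ((z + of_nat k) ^ Suc n) + (-1) ^ Suc n * inverse ((w + of_nat k) ^ Suc n)) sums
    ((-1) ^ Suc n / fact n * (Polygamma n z + (-1) ^ Suc n * Polygamma n w))"
proof (cases "n = 0")
  case True
  have d: "(\<lambda>k. inverse (of_nat (Suc k)) - inverse (x + of_nat k)) sums (Digamma x + euler_mascheroni)"
    if "x \<notin> \<int>\<^sub>\<le>\<^sub>0" for x :: complex
  proof -
    have "x \<noteq> 0" using that by auto
    then show ?thesis using summable_sums[OF summable_Digamma[of x]] by (simp add: Digamma_def)
  qed
  have "(\<lambda>k. (inverse (of_nat (Suc k)) - inverse (w + of_nat k)) - (inverse (of_nat (Suc k)) - inverse (z + of_nat k))) sums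
      ((Digamma w + euler_mascheroni) - (Digamma z + euler_mascheroni))"
    by (rule sums_diff[OF d[OF w] d[OF z]])
  then show ?thesis unfolding True by simp
next
  case False
  have z0: "z \<noteq> 0" "w \<noteq> 0" using z w by auto
  have n: "0 < n" using False by simp
  from sums_add[OF Polygamma_LIMSEQ[OF z0(1) n] sums_mult[OF Polygamma_LIMSEQ[OF z0(2) n], of "(-1) ^ Suc n"]]
  show ?thesis by (simp only: distrib_left divide_inverse mult_ac)
qed

text \<open>Index k is paired with -1 - k, and each point with its conjugate. The pairing with the
  conjugate gives convergence for n = 0 as well, and conjugate terms combine to a real part.\<close>

lemma sums_inverse_power_lattice_row:
  assumes z: "0 < Im z"
  shows "(\<lambda>k. (inverse ((z + of_nat k) ^ Suc n) + (-1) ^ Suc n * inverse (cnj (z + of_nat k) ^ Suc n)) +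
      (inverse ((z - 1 - of_nat k) ^ Suc n) + (-1) ^ Suc n * inverse (cnj (z - 1 - of_nat k) ^ Suc n))) sums
    ((-1) ^ Suc n / fact n * ((if n = 0 then 2 * of_real pi * \<i> else 0) +
       2 * (2 * of_real pi * \<i>) ^ Suc n * of_real (Re (lip n (exp (2 * of_real pi * \<i> * z))))))"
proof -
  define E :: complex where "E = (-1) ^ Suc n"
  have E: "E * E = 1" by (simp add: E_def flip: power_mult_distrib)
  have nz: "z \<notin> \<int>" "cnj z \<notin> \<int>" using z by (auto elim!: Ints_cases simp: complex_eq_iff)
  note z1 = not_Ints_imp_not_nonpos_Ints[OF nz(1)] and z2 = not_Ints_imp_not_nonpos_Ints[OF nz(2)]
  have m: "inverse ((z - 1 - of_nat k) ^ Suc n) + E * inverse (cnj (z - 1 - of_nat k) ^ Suc n) =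
     E * (inverse ((1 - z + of_nat k) ^ Suc n) + E * inverse ((1 - cnj z + of_nat k) ^ Suc n))" for k
  proof -
    have a: "inverse ((- x) ^ Suc n) = E * inverse (x ^ Suc n)" for x :: complex
      unfolding power_minus[of x] E_def by (simp only: inverse_mult_distrib power_inverse[symmetric]) (simp del: power_Suc)
    have b: "z - 1 - of_nat k = - (1 - z + of_nat k)" "cnj (z - 1 - of_nat k) = - (1 - cnj z + of_nat k)" by simp_all
    show ?thesis unfolding b(2) unfolding b(1) a by (simp only: distrib_left mult_ac)
  qed
  have c: "cnj (z + of_nat k) = cnj z + of_nat k" for k by simp
  have L: "refl_Polygamma n z + E * refl_Polygamma n (cnj z) = (if n = 0 then 2 * of_real pi * \<i> else 0) +
       2 * (2 * of_real pi * \<i>) ^ Suc n * of_real (Re (lip n (exp (2 * of_real pi * \<i> * z))))"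
  proof -
    define l Q d where "l = lip n (exp (2 * of_real pi * \<i> * z))" and "Q = (2 * of_real pi * \<i>) ^ Suc n"
      and "d = (if n = 0 then of_real pi * \<i> else 0)"
    have "E * cnj Q = E * (- (2 * of_real pi * \<i>)) ^ Suc n" unfolding Q_def complex_cnj_power by simp
    also have "\<dots> = Q" unfolding E_def Q_def power_mult_distrib[symmetric] by simp
    finally have Q: "E * cnj Q = Q" .
    have d: "E * cnj d = d" by (simp add: E_def d_def)
    have l: "l + cnj l = 2 * of_real (Re l)" by (simp add: complex_add_cnj)
    have "refl_Polygamma n z + E * refl_Polygamma n (cnj z) = (d + Q * l) + E * cnj (d + Q * l)"
      unfolding refl_Polygamma_cnj[OF z] refl_Polygamma_upper[OF z] l_def Q_def d_def ..
    also have "\<dots> = (d + E * cnj d) + (Q * l + (E * cnj Q) * cnj l)" by (simp add: algebra_simps)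
    also have "\<dots> = 2 * d + Q * (l + cnj l)" unfolding Q d by (simp add: algebra_simps)
    also have "\<dots> = 2 * d + 2 * Q * of_real (Re l)" unfolding l by simp
    also have "2 * d = (if n = 0 then 2 * of_real pi * \<i> else 0)" by (simp add: d_def)
    finally show ?thesis unfolding l_def Q_def .
  qed
  have P: "E / fact n * (Polygamma n z + E * Polygamma n (cnj z)) + E * (E / fact n * (Polygamma n (1 - z) + E * Polygamma n (1 - cnj z))) =
      E / fact n * (refl_Polygamma n z + E * refl_Polygamma n (cnj z))"
    by (simp add: refl_Polygamma_def E_def algebra_simps)
  have "(\<lambda>k. (inverse ((z + of_nat k) ^ Suc n) + E * inverse ((cnj z + of_nat k) ^ Suc n)) +
      E * (inverse ((1 - z + of_nat k) ^ Suc n) + E * inverse ((1 - cnj z + of_nat k) ^ Suc n))) sums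
     (E / fact n * (refl_Polygamma n z + E * refl_Polygamma n (cnj z)))"
    unfolding P[symmetric] unfolding E_def
    by (intro sums_add sums_mult sums_inverse_power_diff_Polygamma z1 z2)
  then show ?thesis unfolding L unfolding m[symmetric, unfolded E_def] c E_def .
qed

lemma has_sum_int_of_sums:
  fixes f :: "int \<Rightarrow> real"
  assumes f: "\<And>c. 0 \<le> f c" and S: "(\<lambda>k. f (int k) + f (- 1 - int k)) sums S"
  shows "(f has_sum S) UNIV"
proof -
  have s: "summable (\<lambda>k. f (int k))" "summable (\<lambda>k. f (- 1 - int k))"
    by (rule summable_comparison_test'[OF sums_summable[OF S], of 0]; use f in \<open>simp add: add_nonneg_nonneg\<close>)+
  have 1: "((\<lambda>k. f (int k)) has_sum (\<Sum>k. f (int k))) UNIV" "((\<lambda>k. f (- 1 - int k)) has_sum (\<Sum>k. f (- 1 - int k))) UNIV"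
    using s f by (auto intro!: sums_nonneg_imp_has_sum summable_sums)
  have p: "(f has_sum (\<Sum>k. f (int k))) (range int)"
    using 1(1) unfolding has_sum_reindex[OF inj_of_nat] o_def .
  have "inj (\<lambda>k. - 1 - int k)" by (simp add: inj_on_def)
  then have m: "(f has_sum (\<Sum>k. f (- 1 - int k))) (range (\<lambda>k. - 1 - int k))"
    using 1(2) by (simp only: has_sum_reindex o_def)
  have d: "range int \<inter> range (\<lambda>k. - 1 - int k) = {}" by auto
  have "x \<in> range int \<union> range (\<lambda>k. - 1 - int k)" for x
  proof (cases "x < 0")
    case True
    then have "x = - 1 - int (nat (- 1 - x))" by simp
    then show ?thesis by blast
  next
    case False
    then have "x = int (nat x)" by simp
    then show ?thesis by blast
  qed
  then have u: "range int \<union> range (\<lambda>k. - 1 - int k) = UNIV" by blast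
  have "(f has_sum ((\<Sum>k. f (int k)) + (\<Sum>k. f (- 1 - int k)))) UNIV"
    using has_sum_Un_disjoint[OF p m d] unfolding u .
  also have "(\<Sum>k. f (int k)) + (\<Sum>k. f (- 1 - int k)) = S"
    using suminf_add[OF s] sums_unique[OF S] by simp
  finally show ?thesis .
qed

text \<open>Partial fractions with x = z + c and y = cnj x reduce the sum to Lipschitz's formula.
  The simple poles, i = n, alone contribute a constant term; the powers of the imaginary unit in
  \<open>h\<close> and in 2 \<pi> i cancel, leaving a real expression.\<close>

lemma has_sum_lattice_row:
  assumes z: "0 < Im z"
  shows "((\<lambda>c::int. 1 / cmod (z + of_int c) ^ (2 * n + 2)) has_sum
    (2 * pi * real ((2 * n) choose n) / (2 * Im z) ^ (2 * n + 1) +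
     (\<Sum>i\<le>n. 2 * real ((n + i) choose i) * (2 * pi) ^ Suc (n - i) / (fact (n - i) * (2 * Im z) ^ (Suc n + i)) *
        Re (lip (n - i) (exp (2 * of_real pi * \<i> * z)))))) UNIV"
proof (rule has_sum_int_of_sums)
  define h where "h = 2 * \<i> * of_real (Im z)"
  have h: "x - cnj x = h" if "Im x = Im z" for x using that by (simp add: h_def complex_eq_iff)
  have h0: "h \<noteq> 0" using z by (simp add: h_def)
  define t where "t = (\<lambda>i x. inverse (x ^ Suc (n - i)) + (-1) ^ Suc (n - i) * inverse (cnj x ^ Suc (n - i)))"
  define a where "a = (\<lambda>i. (-1) ^ Suc n * of_nat ((n + i) choose i) / h ^ (Suc n + i))"
  define L where "L = (\<lambda>i. Re (lip (n - i) (exp (2 * of_real pi * \<i> * z))))"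
  define R where "R = (\<lambda>i. (-1) ^ Suc (n - i) / fact (n - i) * ((if n - i = 0 then 2 * of_real pi * \<i> else 0) +
       2 * (2 * of_real pi * \<i>) ^ Suc (n - i) * of_real (L i)))"
  have pf: "of_real (1 / cmod x ^ (2 * n + 2)) = (\<Sum>i\<le>n. a i * t i x)" if "Im x = Im z" for x
  proof -
    have "x \<noteq> 0" using that z by auto
    have "of_real (1 / cmod x ^ (2 * n + 2)) = 1 / (x * cnj x) ^ Suc n"
    proof -
      have "Suc n * 2 = 2 * n + 2" by simp
      then have "(x * cnj x) ^ Suc n = of_real (cmod x ^ (2 * n + 2))"
        unfolding complex_norm_square[symmetric] of_real_power[symmetric] power_mult[symmetric] by (simp only: mult.commute)
      then show ?thesis by (simp only: of_real_divide of_real_1)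
    qed
    also have "\<dots> = (\<Sum>i\<le>n. a i * t i x)"
      unfolding a_def t_def by (rule inverse_mult_power_partial_fractions[OF _ _ h[OF that] h0]) (use \<open>x \<noteq> 0\<close> in auto)
    finally show ?thesis .
  qed
  have "(\<lambda>k. \<Sum>i\<le>n. a i * (t i (z + of_nat k) + t i (z - 1 - of_nat k))) sums (\<Sum>i\<le>n. a i * R i)"
    unfolding t_def R_def L_def by (intro sums_sum sums_mult sums_inverse_power_lattice_row[OF z])
  also have "(\<lambda>k. \<Sum>i\<le>n. a i * (t i (z + of_nat k) + t i (z - 1 - of_nat k))) =
      (\<lambda>k. of_real (1 / cmod (z + of_int (int k)) ^ (2 * n + 2) + 1 / cmod (z + of_int (- 1 - int k)) ^ (2 * n + 2)))"
  proof
    fix k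
    have "of_real (1 / cmod (z + of_nat k) ^ (2 * n + 2)) + of_real (1 / cmod (z - 1 - of_nat k) ^ (2 * n + 2)) =
      (\<Sum>i\<le>n. a i * (t i (z + of_nat k) + t i (z - 1 - of_nat k)))"
      by (subst (1 2) pf) (simp_all add: sum.distrib distrib_left)
    moreover have "z + of_int (int k) = z + of_nat k" "z + of_int (- 1 - int k) = z - 1 - of_nat k" by simp_all
    ultimately show "(\<Sum>i\<le>n. a i * (t i (z + of_nat k) + t i (z - 1 - of_nat k))) =
      of_real (1 / cmod (z + of_int (int k)) ^ (2 * n + 2) + 1 / cmod (z + of_int (- 1 - int k)) ^ (2 * n + 2))"
      by (simp only: of_real_add)
  qed
  finally have sums: "(\<lambda>k. of_real (1 / cmod (z + of_int (int k)) ^ (2 * n + 2) + 1 / cmod (z + of_int (- 1 - int k)) ^ (2 * n + 2))) sums (\<Sum>i\<le>n. a i * R i)" .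
  have aR: "a i * R i = of_real ((if i = n then 2 * pi * real ((2 * n) choose n) / (2 * Im z) ^ (2 * n + 1) else 0) +
      2 * real ((n + i) choose i) * (2 * pi) ^ Suc (n - i) / (fact (n - i) * (2 * Im z) ^ (Suc n + i)) * L i)" if i: "i \<le> n" for i
  proof -
    obtain k where n: "n = i + k" using i le_Suc_ex by auto
    have ii: "\<i> ^ (2 * j) = (-1) ^ j" for j by (simp add: power_mult)
    have m: "((-1) ^ k :: complex) * (-1) ^ k = 1" for k by (simp flip: power_mult_distrib)
    have y: "complex_of_real (Im z) \<noteq> 0" using z by simp
    have e1: "a i * ((-1) ^ Suc (n - i) / fact (n - i) * (2 * (2 * of_real pi * \<i>) ^ Suc (n - i) * of_real (L i))) =
        of_real (2 * real ((n + i) choose i) * (2 * pi) ^ Suc (n - i) / (fact (n - i) * (2 * Im z) ^ (Suc n + i)) * L i)"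
    proof -
      have "Suc n + i = 2 * i + Suc k" "h = \<i> * (2 * of_real (Im z))" by (simp_all add: n h_def)
      then have "h ^ (Suc n + i) = \<i> ^ (2 * i + Suc k) * (2 * of_real (Im z)) ^ (Suc n + i)"
        by (simp only: power_mult_distrib)
      then have H: "h ^ (Suc n + i) = (-1) ^ i * \<i> ^ Suc k * (2 * of_real (Im z)) ^ (Suc n + i)"
        by (simp only: power_add ii)
      have E: "(-1) ^ Suc n * (-1) ^ Suc (n - i) = ((-1) ^ i :: complex)"
        unfolding n using m[of k] by (simp add: power_add)
      have Q: "(2 * of_real pi * \<i>) ^ Suc (n - i) = \<i> ^ Suc k * (2 * of_real pi) ^ Suc (n - i)"
        unfolding n by (simp add: power_mult_distrib)
      \<comment> \<open>Isolates the cancellation of signs and powers of the imaginary unit: the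
        common factor \<open>e'' * I\<close> occurs in numerator and denominator.\<close>
      have gen: "e * C / H' * (e' / F * (2 * Q' * l)) = 2 * C * Q / (F * H) * l"
        if "H' = e'' * I * H" "e * e' = e''" "Q' = I * Q" "I \<noteq> 0" "e'' \<noteq> 0" for C I H F Q l e e' e'' H' Q' :: complex
      proof -
        have "e * C / H' * (e' / F * (2 * Q' * l)) = (e * e' * I) * (2 * C * Q * l) / ((e * e' * I) * (F * H))"
          unfolding that(1,3) that(2)[symmetric] by (simp add: divide_inverse mult_ac)
        also have "\<dots> = 2 * C * Q / (F * H) * l" using that(2,4,5) by simp
        finally show ?thesis .
      qed
      have "a i * ((-1) ^ Suc (n - i) / fact (n - i) * (2 * (2 * of_real pi * \<i>) ^ Suc (n - i) * of_real (L i))) =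
         2 * of_nat ((n + i) choose i) * (2 * of_real pi) ^ Suc (n - i) / (fact (n - i) * (2 * of_real (Im z)) ^ (Suc n + i)) * of_real (L i)"
        unfolding a_def by (rule gen[OF H E Q]) simp_all
      then show ?thesis
        by (simp only: of_real_mult of_real_divide of_real_power of_real_numeral of_real_of_nat_eq of_real_fact)
    qed
    have e2: "a n * (- 1 * (2 * of_real pi * \<i>)) = of_real (2 * pi * real ((2 * n) choose n) / (2 * Im z) ^ (2 * n + 1))"
    proof -
      have "h ^ (2 * n + 1) = \<i> ^ (2 * n + 1) * (2 * of_real (Im z)) ^ (2 * n + 1)"
        unfolding h_def power_mult_distrib[symmetric] by (simp only: mult_ac)
      then have H: "h ^ (2 * n + 1) = (-1) ^ n * \<i> * (2 * of_real (Im z)) ^ (2 * n + 1)"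
        by (simp only: power_add ii power_one_right)
      have gen: "- e * C / H' * (- 1 * (2 * p * \<i>)) = 2 * p * C / H" if "H' = e * \<i> * H" "e \<noteq> 0" for e C H' p H :: complex
        unfolding that(1) using that(2) by simp
      have "a n = - ((-1) ^ n) * of_nat ((2 * n) choose n) / h ^ (2 * n + 1)"
        unfolding a_def by (simp add: mult_2)
      then have "a n * (- 1 * (2 * of_real pi * \<i>)) = 2 * of_real pi * of_nat ((2 * n) choose n) / (2 * of_real (Im z)) ^ (2 * n + 1)"
        by (simp only:) (rule gen[OF H], simp)
      then show ?thesis
        by (simp only: of_real_mult of_real_divide of_real_power of_real_numeral of_real_of_nat_eq)
    qed
    show ?thesis
    proof (cases "i = n")
      case True
      have "a i * R i = a n * (- 1 * (2 * of_real pi * \<i>)) +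
          a i * ((-1) ^ Suc (n - i) / fact (n - i) * (2 * (2 * of_real pi * \<i>) ^ Suc (n - i) * of_real (L i)))"
        unfolding R_def True by (simp add: algebra_simps)
      then show ?thesis unfolding e1 e2 of_real_add by (simp only: True simp_thms if_True)
    next
      case False
      then have "n - i \<noteq> 0" using i by simp
      then show ?thesis using e1 False by (simp add: R_def mult.assoc del: power_Suc)
    qed
  qed
  have "(\<Sum>i\<le>n. a i * R i) = of_real (\<Sum>i\<le>n. (if i = n then 2 * pi * real ((2 * n) choose n) / (2 * Im z) ^ (2 * n + 1) else 0) +
      2 * real ((n + i) choose i) * (2 * pi) ^ Suc (n - i) / (fact (n - i) * (2 * Im z) ^ (Suc n + i)) * L i)"
    unfolding of_real_sum by (intro sum.cong refl aR) simp
  also have "\<dots> = of_real (2 * pi * real ((2 * n) choose n) / (2 * Im z) ^ (2 * n + 1) +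
     (\<Sum>i\<le>n. 2 * real ((n + i) choose i) * (2 * pi) ^ Suc (n - i) / (fact (n - i) * (2 * Im z) ^ (Suc n + i)) * L i))"
    unfolding sum.distrib by simp
  finally show "(\<lambda>k. 1 / cmod (z + of_int (int k)) ^ (2 * n + 2) + 1 / cmod (z + of_int (- 1 - int k)) ^ (2 * n + 2)) sums
    (2 * pi * real ((2 * n) choose n) / (2 * Im z) ^ (2 * n + 1) +
     (\<Sum>i\<le>n. 2 * real ((n + i) choose i) * (2 * pi) ^ Suc (n - i) / (fact (n - i) * (2 * Im z) ^ (Suc n + i)) *
        Re (lip (n - i) (exp (2 * of_real pi * \<i> * z)))))"
    using sums unfolding L_def by (simp only: sums_of_real_iff)
qed simp

section \<open>Zeta values over the odd integers\<close>

definition odd_zeta :: "nat \<Rightarrow> real" where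
  "odd_zeta p = (\<Sum>m. 1 / real (2 * m + 1) ^ p)"

lemma summable_odd_zeta: "2 \<le> p \<Longrightarrow> summable (\<lambda>m. 1 / real (2 * m + 1) ^ p)"
proof (rule summable_comparison_test'[where N = 0])
  assume p: "2 \<le> p"
  show "summable (\<lambda>m. inverse (real (Suc m) ^ p))"
    using inverse_power_summable[OF p, where 'a = real] summable_Suc_iff[of "\<lambda>n. inverse (real n ^ p)"] by simp
  fix m
  have "real (Suc m) ^ p \<le> real (2 * m + 1) ^ p" by (intro power_mono) auto
  then show "norm (1 / real (2 * m + 1) ^ p) \<le> inverse (real (Suc m) ^ p)"
    by (simp add: inverse_eq_divide del: of_nat_Suc of_nat_add of_nat_mult) (intro divide_left_mono, auto simp del: of_nat_add of_nat_mult)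
qed

lemma riemann_zeta_of_nat:
  assumes p: "2 \<le> p"
  shows "riemann_zeta (of_nat p) = of_real (\<Sum>n. 1 / real (Suc n) ^ p)"
proof -
  have "summable (\<lambda>n. 1 / real (Suc n) ^ p)"
    using inverse_power_summable[OF p, where 'a = real] summable_Suc_iff[of "\<lambda>n. inverse (real n ^ p)"] by (simp add: inverse_eq_divide)
  then have "(\<lambda>n. of_real (1 / real (Suc n) ^ p)) sums complex_of_real (\<Sum>n. 1 / real (Suc n) ^ p)"
    unfolding sums_of_real_iff by (rule summable_sums)
  moreover have "of_real (1 / real (Suc n) ^ p) = 1 / complex_of_nat (Suc n) powr of_nat p" for n
    by (subst powr_nat') (simp_all del: of_nat_Suc)
  ultimately show ?thesis unfolding riemann_zeta_def by (simp only: sums_iff)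
qed

lemma odd_zeta_eq_riemann_zeta:
  assumes p: "2 \<le> p"
  shows "of_real (odd_zeta p) = (1 - 1 / 2 ^ p) * riemann_zeta (of_nat p)"
proof -
  define f where "f = (\<lambda>n. 1 / real (Suc n) ^ p)"
  have s: "summable f" unfolding f_def
    using inverse_power_summable[OF p, where 'a = real] summable_Suc_iff[of "\<lambda>n. inverse (real n ^ p)"] by (simp add: inverse_eq_divide)
  have "(\<lambda>n. sum f {n * 2..<n * 2 + 2}) sums (suminf f)" by (rule sums_group[OF summable_sums[OF s]]) simp
  moreover have "sum f {n * 2..<n * 2 + 2} = 1 / real (2 * n + 1) ^ p + 1 / 2 ^ p * f n" for n
  proof -
    have "{n * 2..<n * 2 + 2} = {2 * n, 2 * n + 1}" by auto
    moreover have "f (2 * n + 1) = 1 / 2 ^ p * f n"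
    proof -
      have "real (Suc (2 * n + 1)) = 2 * real (Suc n)" by simp
      then show ?thesis unfolding f_def by (simp only: power_mult_distrib) simp
    qed
    moreover have "f (2 * n) = 1 / real (2 * n + 1) ^ p" by (simp add: f_def)
    ultimately show ?thesis by simp
  qed
  ultimately have "(\<lambda>n. 1 / real (2 * n + 1) ^ p + 1 / 2 ^ p * f n) sums (suminf f)" by simp
  moreover have "(\<lambda>n. 1 / real (2 * n + 1) ^ p + 1 / 2 ^ p * f n) sums (odd_zeta p + 1 / 2 ^ p * suminf f)"
    unfolding odd_zeta_def by (intro sums_add sums_mult summable_sums summable_odd_zeta p s)
  ultimately have "suminf f = odd_zeta p + 1 / 2 ^ p * suminf f" by (rule sums_unique2)
  then have "odd_zeta p = (1 - 1 / 2 ^ p) * suminf f" by (simp add: algebra_simps)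
  then have "complex_of_real (odd_zeta p) = (1 - 1 / 2 ^ p) * of_real (suminf f)" by simp
  then show ?thesis unfolding riemann_zeta_of_nat[OF p] f_def .
qed

lemma odd_zeta_even:
  assumes k: "k > 0"
  shows "of_real (odd_zeta (2 * k + 2)) = (wconst (2 * of_real pi ^ 2) (- (of_real pi ^ 4)) k / (2 ^ (2 * k + 3) * fact (2 * k + 1)) :: complex)"
proof -
  have "(\<lambda>m. of_real (1 / real (2 * m + 1) ^ (2 * k + 2))) sums (of_real (odd_zeta (2 * k + 2)) :: complex)"
    unfolding sums_of_real_iff odd_zeta_def by (rule summable_sums, rule summable_odd_zeta) simp
  then have "(\<lambda>m. 1 / of_nat (2 * m + 1) ^ (2 * k + 2)) sums (of_real (odd_zeta (2 * k + 2)) :: complex)"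
    by (simp only: of_real_divide of_real_1 of_real_power of_real_of_nat_eq)
  then show ?thesis using sums_inverse_half_power[OF k] by (rule sums_unique2)
qed

text \<open>The numerators 17, 31 and 5461 return as leading coefficients in
  \<open>wconst_scaled\<close>: A = 2 \<pi>^2, B = - \<pi>^4 is the limit k \<rightarrow> 0 with A =
  a k and B = T k^2 fixed, in which only the highest power of T survives.\<close>

lemma odd_zeta_values:
  "odd_zeta 4 = pi ^ 4 / 96" "odd_zeta 6 = pi ^ 6 / 960" "odd_zeta 8 = 17 * pi ^ 8 / 161280"
  "odd_zeta 10 = 31 * pi ^ 10 / 2903040" "odd_zeta 14 = 5461 * pi ^ 14 / 49816166400"
proof -
  have e: "odd_zeta p = r" if "complex_of_real (odd_zeta p) = of_real r" for p r using that by simp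
  show "odd_zeta 4 = pi ^ 4 / 96"
  proof (intro e)
    have "2 * 1 + 2 = (4 :: nat)" "2 * 1 + 1 = (3 :: nat)" "2 * 1 + 3 = (5 :: nat)" by simp_all
    from odd_zeta_even[of 1, unfolded wconst_values this]
    show "complex_of_real (odd_zeta 4) = of_real (pi ^ 4 / 96)" by (simp add: fact_numeral)
  qed
  show "odd_zeta 6 = pi ^ 6 / 960"
    using odd_zeta_even[of 2] by (intro e) (simp add: wconst_values fact_numeral power_mult_distrib flip: power_add power_mult)
  show "odd_zeta 8 = 17 * pi ^ 8 / 161280"
    using odd_zeta_even[of 3] by (intro e) (simp add: wconst_values fact_numeral power_mult_distrib field_simps flip: power_add power_mult)
  show "odd_zeta 10 = 31 * pi ^ 10 / 2903040"
    using odd_zeta_even[of 4] by (intro e) (simp add: wconst_values fact_numeral power_mult_distrib field_simps flip: power_add power_mult)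
  show "odd_zeta 14 = 5461 * pi ^ 14 / 49816166400"
    using odd_zeta_even[of 6] by (intro e) (simp add: wconst_values fact_numeral power_mult_distrib field_simps flip: power_add power_mult)
qed

text \<open>The contributions to the sum over a lattice row of the constant term and of the \<open>lip\<close> terms;
  \<open>lattice_factor\<close> is the constant that turns the latter into \<open>eichler\<close>.\<close>

definition lattice_main :: "nat \<Rightarrow> real \<Rightarrow> real" where
  "lattice_main n y = 2 * pi * real ((2 * n) choose n) / (2 * y) ^ (2 * n + 1)"

definition lattice_factor :: "nat \<Rightarrow> real \<Rightarrow> complex" where
  "lattice_factor n y = \<i> * of_real ((-1) ^ n * 2 * pi ^ (2 * n + 2) / (4 ^ n * (fact n)\<^sup>2 * y ^ (2 * n + 1)))"

text \<open>The quotient of (n+i)!/(i! n! (n-i)!) by (n+i)! n!/(i! (n-i)!) is 1/(n!)^2, independent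
  of i, and the remaining powers match as well; so one constant serves all terms and all
  rows.\<close>

lemma lattice_factor_term:
  fixes d :: nat
  assumes y: "0 < y" and d: "0 < d" and i: "i \<le> n"
  shows "lattice_factor n y * ((-1) ^ (n + i) * (fact (n + i) * of_nat (n choose i) * (4 * \<i> * of_real y) ^ (n - i)) *
      (l / (of_real pi * \<i> * of_nat d) ^ Suc (n + i))) =
    of_real (2 * real ((n + i) choose i) * (2 * pi) ^ Suc (n - i) / (fact (n - i) * (2 * (real d * y)) ^ (Suc n + i))) * l"
proof -
  obtain k where n: "n = i + k" using i le_Suc_ex by auto
  define p Y D where "p = complex_of_real pi" and "Y = complex_of_real y" and "D = complex_of_nat d"
  have nz: "p \<noteq> 0" "Y \<noteq> 0" "D \<noteq> 0" using y d by (simp_all add: p_def Y_def D_def)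
  have c1: "of_nat ((n + i) choose i) = (fact (n + i) / (fact i * fact n) :: complex)"
    using binomial_fact[of i "n + i", where 'a = complex] by simp
  have c2: "of_nat (n choose i) = (fact n / (fact i * fact (n - i)) :: complex)"
    using binomial_fact[OF i, where 'a = complex] by simp
  have I: "\<i> * ((-1) ^ n * ((-1) ^ (n + i) * \<i> ^ k)) = \<i> ^ Suc (n + i)"
  proof -
    have "((-1) ^ n :: complex) * (-1) ^ (n + i) = (-1) ^ i" unfolding power_add by (simp flip: power_mult_distrib mult.assoc)
    moreover have "\<i> ^ Suc (n + i) = \<i> ^ (2 * i + Suc k)" by (rule arg_cong[where f = "\<lambda>j. \<i> ^ j"]) (simp add: n)
    then have "\<i> ^ Suc (n + i) = (-1) ^ i * \<i> ^ Suc k" by (simp only: power_add power_mult power2_i)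
    ultimately show ?thesis by (simp add: mult.assoc[symmetric])
  qed
  have four: "(4 :: complex) ^ j = 2 ^ j * 2 ^ j" for j by (simp flip: power_mult_distrib)
  have "lattice_factor n y * ((-1) ^ (n + i) * (fact (n + i) * of_nat (n choose i) * (4 * \<i> * Y) ^ (n - i)) *
      (l / (p * \<i> * D) ^ Suc (n + i))) =
    (\<i> * ((-1) ^ n * ((-1) ^ (n + i) * \<i> ^ k))) / \<i> ^ Suc (n + i) *
     (2 * p ^ (2 * n + 2) / (4 ^ n * (fact n)\<^sup>2 * Y ^ (2 * n + 1)) * (fact (n + i) * of_nat (n choose i) * (4 * Y) ^ k) * (l / (p * D) ^ Suc (n + i)))"
  proof -
    have "(4 * \<i> * Y) ^ (n - i) = \<i> ^ k * (4 * Y) ^ k" "(p * \<i> * D) ^ Suc (n + i) = \<i> ^ Suc (n + i) * (p * D) ^ Suc (n + i)"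
      unfolding n power_mult_distrib[symmetric] by (simp_all add: mult_ac)
    moreover have "lattice_factor n y = \<i> * ((-1) ^ n * (2 * p ^ (2 * n + 2) / (4 ^ n * (fact n)\<^sup>2 * Y ^ (2 * n + 1))))"
      unfolding lattice_factor_def p_def Y_def by simp
    ultimately show ?thesis by (simp only: divide_inverse inverse_mult_distrib mult_ac)
  qed
  also have "\<dots> = 2 * p ^ (2 * n + 2) / (4 ^ n * (fact n)\<^sup>2 * Y ^ (2 * n + 1)) * (fact (n + i) * of_nat (n choose i) * (4 * Y) ^ k) * (l / (p * D) ^ Suc (n + i))"
    unfolding I by simp
  also have "\<dots> = 2 * of_nat ((n + i) choose i) * (2 * p) ^ Suc (n - i) / (fact (n - i) * (2 * (D * Y)) ^ (Suc n + i)) * l"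
    unfolding c1 c2 using nz unfolding n by (simp add: power_mult_distrib power_add power_mult field_simps power2_eq_square) (simp add: four)
  finally show ?thesis unfolding p_def Y_def D_def
    by (simp only: of_real_mult of_real_divide of_real_power of_real_numeral of_real_of_nat_eq of_real_fact)
qed

lemma complex_of_real_mult_Re: "Re (of_real r * x) = r * Re x"
  by simp

text \<open>For odd d the number 1 + d is even, so exp(2 \<pi> i d z) = exp(\<pi> i (1 + d w)) with
  w = 2z + 1: the terms become those of \<open>eis\<close> at w. Moreover w - cnj w = 4 i Im
  z.\<close>

lemma has_sum_lattice_row_odd:
  assumes y: "0 < Im z"
  shows "((\<lambda>c::int. 1 / cmod (of_nat (2 * m + 1) * z + of_int c) ^ (2 * n + 2)) has_sum
    (lattice_main n (Im z) * (1 / real (2 * m + 1) ^ (2 * n + 1)) +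
     Re (lattice_factor n (Im z) * (\<Sum>j=n..2 * n. (-1) ^ j * (fact j * of_nat (n choose (j - n)) * (2 * z + 1 - cnj (2 * z + 1)) ^ (2 * n - j)) *
        (lip (2 * n - j) (exp (of_real pi * \<i> * (1 + of_nat (2 * m + 1) * (2 * z + 1)))) / (of_real pi * \<i> * of_nat (2 * m + 1)) ^ Suc j))))) UNIV"
proof -
  define d where "d = 2 * m + 1"
  have d: "0 < d" by (simp add: d_def)
  define v where "v = exp (of_real pi * \<i> * (1 + of_nat d * (2 * z + 1)))"
  have Imd: "Im (of_nat d * z) = real d * Im z" by simp
  have "0 < Im (of_nat d * z)" unfolding Imd using y d by simp
  note S = has_sum_lattice_row[OF this, of n, unfolded Imd]
  have v: "exp (2 * of_real pi * \<i> * (of_nat d * z)) = v"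
  proof -
    have "v = exp (2 * of_real pi * \<i> * (of_nat d * z) + 2 * of_nat (m + 1) * of_real pi * \<i>)"
      unfolding v_def d_def by (rule arg_cong[where f = exp]) (simp add: algebra_simps)
    also have "\<dots> = exp (2 * of_real pi * \<i> * (of_nat d * z)) * exp (of_int (2 * int (m + 1)) * of_real pi * \<i>)"
      unfolding exp_add by simp
    also have "exp (of_int (2 * int (m + 1)) * of_real pi * \<i>) = 1"
      unfolding exp_eq_1 by (auto intro!: exI[of _ "int (m + 1)"])
    finally show ?thesis by simp
  qed
  have h: "2 * z + 1 - cnj (2 * z + 1) = 4 * \<i> * of_real (Im z)" by (simp add: complex_eq_iff)
  have "lattice_factor n (Im z) * (\<Sum>j=n..2 * n. (-1) ^ j * (fact j * of_nat (n choose (j - n)) * (4 * \<i> * of_real (Im z)) ^ (2 * n - j)) *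
        (lip (2 * n - j) v / (of_real pi * \<i> * of_nat d) ^ Suc j)) =
    (\<Sum>i\<le>n. lattice_factor n (Im z) * ((-1) ^ (n + i) * (fact (n + i) * of_nat (n choose i) * (4 * \<i> * of_real (Im z)) ^ (n - i)) *
        (lip (n - i) v / (of_real pi * \<i> * of_nat d) ^ Suc (n + i))))"
    unfolding sum_distrib_left
    by (rule sum.reindex_bij_witness[of _ "\<lambda>i. n + i" "\<lambda>j. j - n"]) (auto simp: mult_2)
  also have "\<dots> = (\<Sum>i\<le>n. of_real (2 * real ((n + i) choose i) * (2 * pi) ^ Suc (n - i) / (fact (n - i) * (2 * (real d * Im z)) ^ (Suc n + i))) * lip (n - i) v)"
    by (intro sum.cong refl lattice_factor_term y d) simp
  finally have E: "lattice_factor n (Im z) * (\<Sum>j=n..2 * n. (-1) ^ j * (fact j * of_nat (n choose (j - n)) * (4 * \<i> * of_real (Im z)) ^ (2 * n - j)) *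
        (lip (2 * n - j) v / (of_real pi * \<i> * of_nat d) ^ Suc j)) = \<dots>" .
  have "2 * pi * real ((2 * n) choose n) / (2 * (real d * Im z)) ^ (2 * n + 1) +
     (\<Sum>i\<le>n. 2 * real ((n + i) choose i) * (2 * pi) ^ Suc (n - i) / (fact (n - i) * (2 * (real d * Im z)) ^ (Suc n + i)) * Re (lip (n - i) v)) =
    lattice_main n (Im z) * (1 / real d ^ (2 * n + 1)) +
     Re (lattice_factor n (Im z) * (\<Sum>j=n..2 * n. (-1) ^ j * (fact j * of_nat (n choose (j - n)) * (4 * \<i> * of_real (Im z)) ^ (2 * n - j)) *
        (lip (2 * n - j) v / (of_real pi * \<i> * of_nat d) ^ Suc j)))"
  proof (rule arg_cong2[where f = "(+)"])
    show "2 * pi * real ((2 * n) choose n) / (2 * (real d * Im z)) ^ (2 * n + 1) = lattice_main n (Im z) * (1 / real d ^ (2 * n + 1))"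
      unfolding lattice_main_def power_mult_distrib by (simp add: mult_ac)
    show "(\<Sum>i\<le>n. 2 * real ((n + i) choose i) * (2 * pi) ^ Suc (n - i) / (fact (n - i) * (2 * (real d * Im z)) ^ (Suc n + i)) * Re (lip (n - i) v)) =
      Re (lattice_factor n (Im z) * (\<Sum>j=n..2 * n. (-1) ^ j * (fact j * of_nat (n choose (j - n)) * (4 * \<i> * of_real (Im z)) ^ (2 * n - j)) *
        (lip (2 * n - j) v / (of_real pi * \<i> * of_nat d) ^ Suc j)))"
      unfolding E Re_sum by (simp only: complex_of_real_mult_Re)
  qed
  with S show ?thesis unfolding v h v_def[symmetric, unfolded d_def] d_def[symmetric] v_def[symmetric] by (simp only:)
qed

section \<open>The Epstein zeta function\<close>

unbundle no fps_syntax

lemma has_sum_odd_of_sums: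
  fixes f :: "nat \<Rightarrow> real"
  assumes "\<And>n. 0 \<le> f n" "(\<lambda>m. f (2 * m + 1)) sums S"
  shows "(f has_sum S) {n. odd n}"
proof -
  have 1: "((\<lambda>m. f (2 * m + 1)) has_sum S) UNIV" using assms by (intro sums_nonneg_imp_has_sum)
  have 2: "bij_betw (\<lambda>m::nat. 2 * m + 1) UNIV {n. odd n}"
    by (rule bij_betwI[of _ _ _ "\<lambda>n. n div 2"]) auto
  show ?thesis using 1 by (subst (asm) has_sum_reindex_bij_betw[OF 2])
qed

text \<open>The constant terms of the rows add up to \<open>odd_zeta\<close>, the others termwise to
  \<open>eichler\<close> at its base point. All summands are nonnegative, so the iterated sum is the
  double sum.\<close>

lemma has_sum_odd_lattice:
  assumes y: "0 < Im z" and n: "0 < n"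
  shows "((\<lambda>(d, c). 1 / cmod (of_nat d * z + of_int c) ^ (2 * n + 2)) has_sum
    (lattice_main n (Im z) * odd_zeta (2 * n + 1) + Re (lattice_factor n (Im z) * eichler (2 * z + 1) n (2 * z + 1))))
    ({d. odd d} \<times> UNIV)"
proof -
  define w where "w = 2 * z + 1"
  define T where "T = (\<lambda>m. \<Sum>j=n..2 * n. (-1) ^ j * (fact j * of_nat (n choose (j - n)) * (w - cnj w) ^ (2 * n - j)) *
        (lip (2 * n - j) (exp (of_real pi * \<i> * (1 + of_nat (2 * m + 1) * w))) / (of_real pi * \<i> * of_nat (2 * m + 1)) ^ Suc j))"
  define R where "R = (\<lambda>m. lattice_main n (Im z) * (1 / real (2 * m + 1) ^ (2 * n + 1)) + Re (lattice_factor n (Im z) * T m))"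
  define S where "S = lattice_main n (Im z) * odd_zeta (2 * n + 1) + Re (lattice_factor n (Im z) * eichler w n w)"
  define f where "f = (\<lambda>(d :: nat, c). 1 / cmod (of_nat d * z + of_int c) ^ (2 * n + 2))"
  define g where "g = (\<lambda>d. R ((d - 1) div 2))"
  have row: "((\<lambda>c. f (2 * m + 1, c)) has_sum R m) UNIV" for m
    unfolding R_def T_def w_def f_def split_conv by (rule has_sum_lattice_row_odd[OF y])
  have "0 < Im w" using y by (simp add: w_def)
  then have "T sums eichler w n w"
    unfolding T_def eichler_at_base by (intro sums_sum sums_mult) (unfold eis_def, rule summable_sums, rule eis_has_field_derivative(1))
  then have "R sums S"
    unfolding R_def S_def odd_zeta_def using n by (intro sums_add sums_mult sums_Re summable_sums summable_odd_zeta) auto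
  then have "(\<lambda>m. g (2 * m + 1)) sums S" by (simp add: g_def)
  moreover have R0: "0 \<le> R m" for m by (rule has_sum_nonneg[OF row]) (simp add: f_def)
  then have "0 \<le> g d" for d by (simp add: g_def)
  ultimately have outer: "(g has_sum S) {d. odd d}" by (intro has_sum_odd_of_sums)
  have inner: "((\<lambda>c. f (d, c)) has_sum g d) UNIV" if "d \<in> {d. odd d}" for d
  proof -
    from that obtain m where "d = 2 * m + 1" by (auto elim!: oddE)
    then show ?thesis using row[of m] by (simp add: g_def)
  qed
  have "f summable_on ({d. odd d} \<times> UNIV)"
    by (rule summable_on_SigmaI[OF inner]) (use outer in \<open>auto simp: summable_on_def f_def\<close>)
  then have "(f has_sum S) ({d. odd d} \<times> UNIV)" by (intro has_sum_SigmaI[OF inner outer])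
  then show ?thesis unfolding f_def S_def w_def .
qed

text \<open>Each pair is g times a coprime pair, where the gcd g is odd because it divides d; so the
  sum over all pairs is \<open>q\<close> times the sum over the coprime ones.\<close>

lemma has_sum_coprime_pairs:
  fixes F :: "nat \<times> int \<Rightarrow> real"
  assumes F: "(F has_sum S) ({d. odd d} \<times> UNIV)"
    and hom: "\<And>g d c. 0 < g \<Longrightarrow> F (g * d, int g * c) = r g * F (d, c)"
    and r: "(r has_sum q) {g. odd g}" and q: "q \<noteq> 0"
  shows "(F has_sum (S / q)) {(d, c). odd d \<and> coprime (int d) c}"
proof -
  define P where "P = {(d :: nat, c). odd d \<and> coprime (int d) c}"
  define h where "h = (\<lambda>(g :: nat, d :: nat, c). (g * d, int g * c))"
  have "P \<subseteq> {d. odd d} \<times> UNIV" by (auto simp: P_def)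
  moreover have "F summable_on ({d. odd d} \<times> UNIV)" using F by (auto simp: summable_on_def)
  ultimately have "F summable_on P" by (rule summable_on_subset_banach[rotated])
  then have E: "(F has_sum infsum F P) P" by (rule has_sum_infsum)
  define e where "e = (\<lambda>(d :: nat, c). (nat (gcd (int d) c), d div nat (gcd (int d) c), c div gcd (int d) c))"
  have e: "e (d, c) \<in> {g. odd g} \<times> P" "h (e (d, c)) = (d, c)" if d: "odd d" for d :: nat and c :: int
  proof -
    define k where "k = nat (gcd (int d) c)"
    have k: "gcd (int d) c = int k" by (simp add: k_def)
    have dv: "int k dvd int d" "int k dvd c" unfolding k[symmetric] by simp_all
    then have kd: "k dvd d" by simp
    have "odd k" using kd d by (auto dest: dvd_trans)
    moreover have "odd (d div k)" using d kd by (metis dvd_div_mult_self even_mult_iff)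
    moreover have "coprime (int (d div k)) (c div int k)"
      using div_gcd_coprime[of "int d" c] odd_pos[OF d] k by (auto simp: zdiv_int)
    ultimately show "e (d, c) \<in> {g. odd g} \<times> P" by (simp add: e_def k P_def)
    show "h (e (d, c)) = (d, c)" using kd dv(2) by (simp add: e_def h_def k)
  qed
  have he: "e (h (g, d, c)) = (g, d, c)" if "odd g" "coprime (int d) c" for g d :: nat and c :: int
  proof -
    have "gcd (int (g * d)) (int g * c) = int g"
      using that(2) by (simp add: gcd_mult_left)
    moreover have "0 < g" using that(1) by (rule odd_pos)
    ultimately show ?thesis by (simp add: e_def h_def)
  qed
  have bij: "bij_betw h ({g. odd g} \<times> P) ({d. odd d} \<times> UNIV)"
  proof (rule bij_betwI[where g = e])
    show "h \<in> {g. odd g} \<times> P \<rightarrow> {d. odd d} \<times> UNIV" by (auto simp: h_def P_def)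
    show "e \<in> {d. odd d} \<times> UNIV \<rightarrow> {g. odd g} \<times> P" using e(1) by blast
  qed (use e(2) he in \<open>auto simp: P_def\<close>)
  have "((\<lambda>x. F (h x)) has_sum S) ({g. odd g} \<times> P)"
    using F by (simp only: has_sum_reindex_bij_betw[OF bij])
  then have "((\<lambda>g. r g * infsum F P) has_sum S) {g. odd g}"
  proof (rule has_sum_SigmaD)
    fix g :: nat assume "g \<in> {g. odd g}"
    then have g: "0 < g" by (auto intro!: gr0I)
    have "(\<lambda>p. F (h (g, p))) = (\<lambda>p. r g * F p)"
      by (auto simp: h_def fun_eq_iff hom[OF g])
    then show "((\<lambda>p. F (h (g, p))) has_sum r g * infsum F P) P"
      using has_sum_cmult_right[OF E] by simp
  qed
  moreover have "((\<lambda>g. r g * infsum F P) has_sum q * infsum F P) {g. odd g}"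
    by (rule has_sum_cmult_left[OF r])
  ultimately have "S = q * infsum F P" by (rule has_sum_unique)
  then show ?thesis using E q by (simp add: P_def)
qed

text \<open>The bottom row is written as (-4c, d) because at -1/(4z) the denominator is then (d z +
  c)/z. As d is odd, d and 4c are coprime, and Bezout supplies the top row.\<close>

lemma exists_Gamma0_4_bottom_row:
  assumes "odd d" "coprime (int d) c"
  shows "\<exists>A. A \<in> carrier (Gamma0 4) \<and> A $ 2 $ 1 = - 4 * c \<and> A $ 2 $ 2 = int d"
proof -
  have "coprime (int d) 2" using assms(1) by (simp add: coprime_commute)
  then have "coprime (int d) (2 ^ 2)" by (simp only: coprime_power_right_iff simp_thms)
  then have "coprime (int d) (4 * c)" using assms(2) by simp
  then obtain u v where uv: "u * int d + v * (4 * c) = 1"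
    using bezout_int[of "int d" "4 * c"] by (auto simp: coprime_iff_gcd_eq_1)
  define A :: "int ^ 2 ^ 2" where
    "A = (\<chi> i j. if i = 1 then (if j = 1 then u else v) else (if j = 1 then - 4 * c else int d))"
  have "A \<in> carrier (Gamma0 4) \<and> A $ 2 $ 1 = - 4 * c \<and> A $ 2 $ 2 = int d"
    using uv by (simp add: A_def Gamma0_def det_2 algebra_simps)
  then show ?thesis by blast
qed

text \<open>Proportional bottom rows make the lower left entry of B A^(-1) vanish; \<open>C\<close>
  is the inverse of \<open>A\<close>.\<close>

lemma upper_Gamma0_coset_eqI:
  fixes A B :: "int ^ 2 ^ 2"
  assumes A: "A \<in> carrier (Gamma0 N)" and B: "B \<in> carrier (Gamma0 N)"
    and p: "A $ 2 $ 1 * B $ 2 $ 2 = A $ 2 $ 2 * B $ 2 $ 1"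
  shows "upper_Gamma0 N #>\<^bsub>Gamma0 N\<^esub> A = upper_Gamma0 N #>\<^bsub>Gamma0 N\<^esub> B"
proof -
  interpret G: group "Gamma0 N" by (rule group_Gamma0)
  define C :: "int ^ 2 ^ 2" where
    "C = (\<chi> i j. if i = 1 then (if j = 1 then A $ 2 $ 2 else - A $ 1 $ 2)
                 else (if j = 1 then - A $ 2 $ 1 else A $ 1 $ 1))"
  have C: "C \<in> carrier (Gamma0 N)" using A by (simp add: Gamma0_def C_def det_2 algebra_simps)
  have CA: "C ** A = mat 1"
    using A by (simp add: Gamma0_def C_def det_2 vec_eq_iff forall_2 matrix_matrix_mult_def mat_def sum_2 algebra_simps)
  define U where "U = B ** C"
  have "U \<in> carrier (Gamma0 N)" using G.m_closed[OF B C] by (simp add: U_def Gamma0_def)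
  moreover have "U $ 2 $ 1 = 0" using p by (simp add: U_def C_def matrix_matrix_mult_def sum_2 algebra_simps)
  ultimately have U: "U \<in> upper_Gamma0 N" by (simp add: upper_Gamma0_def)
  have "U ** A = B" unfolding U_def by (simp add: matrix_mul_assoc[symmetric] CA)
  then have "B \<in> upper_Gamma0 N #>\<^bsub>Gamma0 N\<^esub> A" using U unfolding r_coset_def by (auto simp: Gamma0_def)
  then show ?thesis by (rule G.repr_independence[OF _ A subgroup_upper_Gamma0])
qed

lemma upper_Gamma0_coset_bottom_row:
  fixes A B :: "int ^ 2 ^ 2"
  assumes A: "A \<in> carrier (Gamma0 N)" and B: "B \<in> carrier (Gamma0 N)"
    and eq: "upper_Gamma0 N #>\<^bsub>Gamma0 N\<^esub> A = upper_Gamma0 N #>\<^bsub>Gamma0 N\<^esub> B"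
  obtains e where "e \<in> {1, -1}" "\<And>i. B $ 2 $ i = e * A $ 2 $ i"
proof -
  interpret G: group "Gamma0 N" by (rule group_Gamma0)
  have "B \<in> upper_Gamma0 N #>\<^bsub>Gamma0 N\<^esub> A" unfolding eq by (rule G.rcos_self[OF B subgroup_upper_Gamma0])
  then obtain U where U: "U \<in> upper_Gamma0 N" "B = U ** A" unfolding r_coset_def by (auto simp: Gamma0_def)
  show thesis
  proof (rule that)
    show "U $ 2 $ 2 \<in> {1, -1}" using U(1) by (auto simp: upper_Gamma0_def Gamma0_def det_2 zmult_eq_1_iff)
    show "B $ 2 $ i = U $ 2 $ 2 * A $ 2 $ i" for i
      using U by (simp add: upper_Gamma0_def matrix_matrix_mult_def sum_2)
  qed
qed

text \<open>Each coset has exactly one bottom row (-4c, d) with d > 0, and then d is odd and coprime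
  to c. The imaginary part there is (Im z/4)/|d z + c|^2: the factors |z|^2 from -1/(4z) and from
  the denominator cancel.\<close>

lemma epstein_zeta_4_has_sum_imp:
  assumes y: "0 < Im z"
    and E: "((\<lambda>(d, c). 1 / cmod (of_nat d * z + of_int c) ^ (2 * n + 2)) has_sum E) {(d, c). odd d \<and> coprime (int d) c}"
  shows "epstein_zeta 4 (- 1 / (4 * z)) (of_nat (n + 1)) = of_real ((Im z / 4) ^ (n + 1) * E)"
proof -
  interpret G: group "Gamma0 4" by (rule group_Gamma0)
  define P where "P = {(d :: nat, c). odd d \<and> coprime (int d) c}"
  define M where "M = (\<lambda>(d, c). SOME A. A \<in> carrier (Gamma0 4) \<and> A $ 2 $ 1 = - 4 * c \<and> A $ 2 $ 2 = int d)"
  have M: "M (d, c) \<in> carrier (Gamma0 4)" "M (d, c) $ 2 $ 1 = - 4 * c" "M (d, c) $ 2 $ 2 = int d" if "(d, c) \<in> P" for d c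
    using someI_ex[OF exists_Gamma0_4_bottom_row[of d c]] that by (simp_all add: P_def M_def)
  define \<phi> where "\<phi> = (\<lambda>p. upper_Gamma0 4 #>\<^bsub>Gamma0 4\<^esub> M p)"
  have bij: "bij_betw \<phi> P (rcosets\<^bsub>Gamma0 4\<^esub> (upper_Gamma0 4))"
    unfolding bij_betw_def
  proof (intro conjI inj_onI equalityI subsetI)
    fix p q assume p: "p \<in> P" and q: "q \<in> P" and pq: "\<phi> p = \<phi> q"
    obtain d c d' c' where pp: "p = (d, c)" and qq: "q = (d', c')" by (metis surj_pair)
    note Mp = M[OF p[unfolded pp]] and Mq = M[OF q[unfolded qq]]
    obtain e where e: "e \<in> {1, -1}" "\<And>i. M q $ 2 $ i = e * M p $ 2 $ i"
      by (rule upper_Gamma0_coset_bottom_row[of "M p" 4 "M q"]) (use pq Mp(1) Mq(1) in \<open>auto simp: \<phi>_def pp qq\<close>)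
    have "odd d" using p by (simp add: P_def pp)
    then have "0 < d" by (rule odd_pos)
    moreover have "int d' = e * int d" using e(2)[of 2] unfolding pp qq Mp(3) Mq(3) .
    moreover have "- 4 * c' = e * (- 4 * c)" using e(2)[of 1] unfolding pp qq Mp(2) Mq(2) .
    ultimately show "p = q" using e(1) unfolding pp qq by auto
  next
    fix C assume "C \<in> \<phi> ` P"
    then show "C \<in> rcosets\<^bsub>Gamma0 4\<^esub> (upper_Gamma0 4)"
      using subgroup.subset[OF subgroup_upper_Gamma0, of 4] M by (auto simp: \<phi>_def P_def intro!: G.rcosetsI)
  next
    fix C assume "C \<in> rcosets\<^bsub>Gamma0 4\<^esub> (upper_Gamma0 4)"
    then obtain A where A: "A \<in> carrier (Gamma0 4)" and C: "C = upper_Gamma0 4 #>\<^bsub>Gamma0 4\<^esub> A"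
      unfolding RCOSETS_def by auto
    define a b where "a = A $ 2 $ 1" and "b = A $ 2 $ 2"
    have det: "A $ 1 $ 1 * b - A $ 1 $ 2 * a = 1" and 4: "4 dvd a"
      using A by (simp_all add: Gamma0_def det_2 a_def b_def)
    then obtain k where k: "a = 4 * k" by (auto elim!: dvdE)
    have "odd b"
    proof
      assume "even b"
      then have "even (A $ 1 $ 1 * b - A $ 1 $ 2 * a)" unfolding k by simp
      then show False unfolding det by simp
    qed
    have "coprime b k"
    proof (rule coprimeI)
      fix l assume "l dvd b" "l dvd k"
      then have "l dvd A $ 1 $ 1 * b - A $ 1 $ 2 * a" unfolding k by auto
      then show "is_unit l" unfolding det .
    qed
    \<comment> \<open>Multiplying the bottom row (4k, b) by the sign of b makes its second entry
      positive; the minus sign reflects the convention -4c.\<close>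
    define p where "p = (nat \<bar>b\<bar>, - sgn b * k)"
    have b0: "b \<noteq> 0" using \<open>odd b\<close> by auto
    have pP: "(nat \<bar>b\<bar>, - sgn b * k) \<in> P"
      using \<open>odd b\<close> \<open>coprime b k\<close> b0 by (cases "b > 0") (auto simp: P_def even_nat_iff)
    have "\<phi> p = C" unfolding \<phi>_def C p_def
      by (rule upper_Gamma0_coset_eqI[OF M(1)[OF pP] A]) (unfold M(2,3)[OF pP], fold a_def b_def, use b0 in \<open>cases "b > 0"; simp add: k\<close>)
    then show "C \<in> \<phi> ` P" using pP unfolding p_def by blast
  qed
  have z0: "z \<noteq> 0" using y by auto
  have val: "complex_of_real (the_elem ((\<lambda>A. Im (frac_lin A (- 1 / (4 * z)))) ` \<phi> p)) powr of_nat (n + 1) =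
      of_real ((Im z / 4) ^ (n + 1) * (case p of (d, c) \<Rightarrow> 1 / cmod (of_nat d * z + of_int c) ^ (2 * n + 2)))" if "p \<in> P" for p
  proof -
    obtain d c where p: "p = (d, c)" by (cases p)
    note M = M[OF that[unfolded p]]
    define x where "x = cmod (of_nat d * z + of_int c)"
    have x: "0 < x"
    proof -
      have "odd d" using that by (simp add: p P_def)
      then have "0 < d" by (rule odd_pos)
      then have "Im (of_nat d * z + of_int c) \<noteq> 0" using y by simp
      then show ?thesis unfolding x_def by (metis zero_less_norm_iff zero_complex.simps(2))
    qed
    have "the_elem ((\<lambda>A. Im (frac_lin A (- 1 / (4 * z)))) ` \<phi> p) = Im (frac_lin (M p) (- 1 / (4 * z)))"
      unfolding \<phi>_def p by (rule the_elem_Im_coset[OF M(1)])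
    also have "\<dots> = Im (- 1 / (4 * z)) / (cmod (of_int (- 4 * c) * (- 1 / (4 * z)) + of_int (int d)))\<^sup>2"
      using M(1) unfolding p by (subst Im_frac_lin) (simp_all only: Gamma0_def M partial_object.simps mem_Collect_eq)
    also have "of_int (- 4 * c) * (- 1 / (4 * z)) + of_int (int d) = (of_nat d * z + of_int c) / z"
      using z0 by (simp add: field_simps)
    also have "Im (- 1 / (4 * z)) = Im z / 4 / (cmod z)\<^sup>2"
    proof -
      have "- 1 / (4 * z) = - cnj z / of_real (4 * (cmod z)\<^sup>2)"
        unfolding of_real_mult complex_norm_square using z0 by simp
      then show ?thesis by simp
    qed
    also have "Im z / 4 / (cmod z)\<^sup>2 / (cmod ((of_nat d * z + of_int c) / z))\<^sup>2 = Im z / 4 / x\<^sup>2"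
      using z0 by (simp add: norm_divide power_divide x_def)
    finally have e: "the_elem ((\<lambda>A. Im (frac_lin A (- 1 / (4 * z)))) ` \<phi> p) = Im z / 4 / x\<^sup>2" .
    have "complex_of_real (Im z / 4 / x\<^sup>2) powr of_nat (n + 1) = of_real (Im z / 4 / x\<^sup>2) ^ (n + 1)"
      by (rule powr_nat') simp
    also have "\<dots> = of_real ((Im z / 4 / x\<^sup>2) ^ (n + 1))" by (simp only: of_real_power)
    also have "(Im z / 4 / x\<^sup>2) ^ (n + 1) = (Im z / 4) ^ (n + 1) * (1 / x ^ (2 * n + 2))"
    proof -
      have "2 * n + 2 = 2 * (n + 1)" by simp
      then have "(x\<^sup>2) ^ (n + 1) = x ^ (2 * n + 2)" by (simp only: power_mult)
      then show ?thesis by (simp only: power_divide times_divide_eq_right mult_1_right)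
    qed
    finally show ?thesis unfolding e unfolding p split_conv x_def .
  qed
  have "((\<lambda>p. (Im z / 4) ^ (n + 1) * (case p of (d, c) \<Rightarrow> 1 / cmod (of_nat d * z + of_int c) ^ (2 * n + 2))) has_sum (Im z / 4) ^ (n + 1) * E) P"
    using has_sum_cmult_right[OF E] unfolding P_def .
  then have "((\<lambda>p. of_real ((Im z / 4) ^ (n + 1) * (case p of (d, c) \<Rightarrow> 1 / cmod (of_nat d * z + of_int c) ^ (2 * n + 2)))) has_sum complex_of_real ((Im z / 4) ^ (n + 1) * E)) P"
    by (rule has_sum_of_real)
  then have "((\<lambda>p. complex_of_real (the_elem ((\<lambda>A. Im (frac_lin A (- 1 / (4 * z)))) ` \<phi> p)) powr of_nat (n + 1)) has_sum complex_of_real ((Im z / 4) ^ (n + 1) * E)) P"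
    by (rule has_sum_cong[THEN iffD1, rotated]) (rule val[symmetric])
  then have "((\<lambda>C. complex_of_real (the_elem ((\<lambda>A. Im (frac_lin A (- 1 / (4 * z)))) ` C)) powr of_nat (n + 1)) has_sum complex_of_real ((Im z / 4) ^ (n + 1) * E)) (rcosets\<^bsub>Gamma0 4\<^esub> (upper_Gamma0 4))"
    by (subst (asm) has_sum_reindex_bij_betw[OF bij])
  then show ?thesis unfolding epstein_zeta_def by (rule infsumI)
qed

section \<open>The Epstein zeta function as an integral over t\<close>

lemma odd_zeta_pos: "2 \<le> p \<Longrightarrow> 0 < odd_zeta p"
  unfolding odd_zeta_def by (rule suminf_pos[OF summable_odd_zeta]) auto

lemma epstein_zeta_4_eq_eichler:
  assumes y: "0 < Im z" and n: "0 < n"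
  shows "epstein_zeta 4 (- 1 / (4 * z)) (of_nat (n + 1)) =
    of_real ((Im z / 4) ^ (n + 1) / odd_zeta (2 * n + 2) *
      (lattice_main n (Im z) * odd_zeta (2 * n + 1) + Re (lattice_factor n (Im z) * eichler (2 * z + 1) n (2 * z + 1))))"
proof -
  have q: "0 < odd_zeta (2 * n + 2)" by (rule odd_zeta_pos) simp
  have r: "((\<lambda>g. 1 / real g ^ (2 * n + 2)) has_sum odd_zeta (2 * n + 2)) {g. odd g}"
    by (rule has_sum_odd_of_sums) (simp, unfold odd_zeta_def, rule summable_sums, rule summable_odd_zeta, simp)
  have hom: "(case (g * d, int g * c) of (d, c) \<Rightarrow> 1 / cmod (of_nat d * z + of_int c) ^ (2 * n + 2)) =
      1 / real g ^ (2 * n + 2) * (case (d, c) of (d, c) \<Rightarrow> 1 / cmod (of_nat d * z + of_int c) ^ (2 * n + 2))" for g d c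
  proof -
    have "of_nat (g * d) * z + of_int (int g * c) = of_nat g * (of_nat d * z + of_int c)" by (simp add: algebra_simps)
    then show ?thesis by (simp only: split_conv norm_mult norm_of_nat power_mult_distrib) simp
  qed
  from q have "odd_zeta (2 * n + 2) \<noteq> 0" by simp
  from has_sum_coprime_pairs[OF has_sum_odd_lattice[OF y n] hom r this]
  have "((\<lambda>(d, c). 1 / cmod (of_nat d * z + of_int c) ^ (2 * n + 2)) has_sum
    ((lattice_main n (Im z) * odd_zeta (2 * n + 1) + Re (lattice_factor n (Im z) * eichler (2 * z + 1) n (2 * z + 1))) / odd_zeta (2 * n + 2)))
    {(d, c). odd d \<and> coprime (int d) c}" .
  from epstein_zeta_4_has_sum_imp[OF y this] show ?thesis by (simp only: times_divide_eq_right times_divide_eq_left)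
qed

text \<open>With a = 1 - 2t, T = t (1 - t) and k = K^2/\<pi>^2 the relation a^2 = 1 - 4T lowers the
  power of \<open>a\<close> to at most one and produces the polynomials in the integrands of the
  theorem.\<close>

lemma wconst_scaled:
  fixes a k T :: complex
  assumes a: "a\<^sup>2 = 1 - 4 * T"
  shows "wconst (a * k) (T * k\<^sup>2) 1 = - 2 * T * k\<^sup>2"
    "wconst (a * k) (T * k\<^sup>2) 2 = - 8 * a * T * k ^ 3"
    "wconst (a * k) (T * k\<^sup>2) 3 = - 16 * (2 - 17 * T) * T * k ^ 4"
    "wconst (a * k) (T * k\<^sup>2) 4 = - 128 * a * (1 - 31 * T) * T * k ^ 5"
    "wconst (a * k) (T * k\<^sup>2) 6 = - 2048 * a * (1 - 512 * T + 5461 * T\<^sup>2) * T * k ^ 7"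
proof -
  have p: "a ^ 3 = a * a\<^sup>2" "a ^ 5 = a * (a\<^sup>2)\<^sup>2" by (simp_all add: eval_nat_numeral)
  show "wconst (a * k) (T * k\<^sup>2) 1 = - 2 * T * k\<^sup>2" unfolding wconst_values by simp
  show "wconst (a * k) (T * k\<^sup>2) 2 = - 8 * a * T * k ^ 3" unfolding wconst_values by (simp add: eval_nat_numeral)
  show "wconst (a * k) (T * k\<^sup>2) 3 = - 16 * (2 - 17 * T) * T * k ^ 4"
    unfolding wconst_values power_mult_distrib a by (simp add: eval_nat_numeral algebra_simps)
  show "wconst (a * k) (T * k\<^sup>2) 4 = - 128 * a * (1 - 31 * T) * T * k ^ 5"
    unfolding wconst_values power_mult_distrib p a by (simp add: eval_nat_numeral algebra_simps)
  show "wconst (a * k) (T * k\<^sup>2) 6 = - 2048 * a * (1 - 512 * T + 5461 * T\<^sup>2) * T * k ^ 7"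
    unfolding wconst_values power_mult_distrib p a by (simp add: eval_nat_numeral algebra_simps)
qed

text \<open>Every value in \<open>wconst_scaled\<close> is divisible by T k, which is just the
  denominator of tau' up to constants; what remains is a polynomial in t times an even power of
  K.\<close>

lemma eis_deriv_tau:
  fixes t :: complex
  assumes t: "t \<in> cut_plane"
  defines "k \<equiv> (ellK t)\<^sup>2 / of_real pi ^ 2" and "p \<equiv> complex_of_real pi" and "T \<equiv> t * (1 - t)"
  shows "eis 3 0 (tau t) * deriv tau t = \<i> * k / (4 * p)"
    "eis 5 0 (tau t) * deriv tau t = - \<i> * (2 * t - 1) * k\<^sup>2 / p"
    "eis 7 0 (tau t) * deriv tau t = 2 * \<i> * (2 - 17 * T) * k ^ 3 / p"
    "eis 9 0 (tau t) * deriv tau t = - 16 * \<i> * (2 * t - 1) * (1 - 31 * T) * k ^ 4 / p"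
    "eis 13 0 (tau t) * deriv tau t = - 256 * \<i> * (2 * t - 1) * (1 - 512 * T + 5461 * T\<^sup>2) * k ^ 6 / p"
proof -
  define a where "a = 1 - 2 * t"
  have p: "p \<noteq> 0" by (simp add: p_def)
  have "t \<noteq> 0" "1 - t \<noteq> 0" using t by (auto simp: cut_plane_def)
  then have T: "T \<noteq> 0" by (simp add: T_def)
  have k: "k \<noteq> 0" using ellK_nonzero[of t] t by (simp add: k_def cut_plane_ray)
  have a2: "a\<^sup>2 = 1 - 4 * T" by (simp add: a_def T_def power2_eq_square algebra_simps)
  have K: "(ellK t)\<^sup>2 = k * p\<^sup>2" by (simp add: k_def p_def)
  have D: "4 * \<i> * T * k * p * deriv tau t = 1"
  proof -
    have "p * (4 * \<i> * T * k * p * deriv tau t) = 4 * \<i> * t * (1 - t) * (ellK t)\<^sup>2 * deriv tau t"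
      unfolding K T_def by (simp add: power2_eq_square mult_ac)
    also have "\<dots> = p" unfolding p_def by (rule deriv_tau[OF t])
    finally show ?thesis using p by simp
  qed
  have E: "eis (2 * m + 1) 0 (tau t) * deriv tau t = - \<i> * wconst (a * k) (T * k\<^sup>2) m / (8 * T * k * p)" if "m \<in> {1, 2, 3, 4, 6}" for m
  proof -
    have "2 * eis (2 * m + 1) 0 (tau t) = wconst ((1 - 2 * t) * (ellK t)\<^sup>2 / of_real pi ^ 2) (t * (1 - t) * (ellK t) ^ 4 / of_real pi ^ 4) m"
      by (rule eis_tau[OF that t])
    also have "(1 - 2 * t) * (ellK t)\<^sup>2 / of_real pi ^ 2 = a * k" by (simp add: a_def k_def)
    also have "t * (1 - t) * (ellK t) ^ 4 / of_real pi ^ 4 = T * k\<^sup>2"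
      by (simp add: T_def k_def power_divide flip: power_mult)
    finally have e: "2 * eis (2 * m + 1) 0 (tau t) = wconst (a * k) (T * k\<^sup>2) m" .
    have "8 * \<i> * T * k * p * (eis (2 * m + 1) 0 (tau t) * deriv tau t) = wconst (a * k) (T * k\<^sup>2) m * (4 * \<i> * T * k * p * deriv tau t)"
      unfolding e[symmetric] by simp
    then have "8 * \<i> * T * k * p * (eis (2 * m + 1) 0 (tau t) * deriv tau t) = wconst (a * k) (T * k\<^sup>2) m" unfolding D by simp
    moreover have "8 * \<i> * T * k * p * (- \<i> * wconst (a * k) (T * k\<^sup>2) m / (8 * T * k * p)) = wconst (a * k) (T * k\<^sup>2) m"
      using T k p by simp
    moreover have "8 * \<i> * T * k * p \<noteq> 0" using T k p by simp
    ultimately show ?thesis by (metis mult_left_cancel)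
  qed
  have t1: "2 * t - 1 = - a" by (simp add: a_def)
  have cancel: "- \<i> * (C * T * k ^ Suc m) / (8 * T * k * p) = - \<i> * C * k ^ m / (8 * p)" for C m
    using T k by simp
  \<comment> \<open>Exponents are written as successors, the form in which \<open>cancel\<close>
    removes one factor k.\<close>
  have s: "(3 :: nat) = Suc 2" "(4 :: nat) = Suc 3" "(5 :: nat) = Suc 4" "(7 :: nat) = Suc 6" by simp_all
  define u where "u = 2 - 17 * T"
  note E' = E[of 1, unfolded wconst_scaled[OF a2]]
    E[of 2, unfolded wconst_scaled[OF a2] s(1)[THEN arg_cong, of "power k"] cancel]
    E[of 3, unfolded wconst_scaled[OF a2] s(2)[THEN arg_cong, of "power k"] cancel]
    E[of 4, unfolded wconst_scaled[OF a2] s(3)[THEN arg_cong, of "power k"] cancel]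
    E[of 6, unfolded wconst_scaled[OF a2] s(4)[THEN arg_cong, of "power k"] cancel]
  show "eis 3 0 (tau t) * deriv tau t = \<i> * k / (4 * p)" using E'(1) T k p by (simp add: numeral_3_eq_3 power2_eq_square)
  show "eis 5 0 (tau t) * deriv tau t = - \<i> * (2 * t - 1) * k\<^sup>2 / p" using E'(2) unfolding t1 by simp
  show "eis 7 0 (tau t) * deriv tau t = 2 * \<i> * (2 - 17 * T) * k ^ 3 / p" using E'(3) p unfolding u_def[symmetric] by simp
  show "eis 9 0 (tau t) * deriv tau t = - 16 * \<i> * (2 * t - 1) * (1 - 31 * T) * k ^ 4 / p"
    using E'(4) unfolding t1 by simp
  show "eis 13 0 (tau t) * deriv tau t = - 256 * \<i> * (2 * t - 1) * (1 - 512 * T + 5461 * T\<^sup>2) * k ^ 6 / p"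
    using E'(5) unfolding t1 by simp
qed

text \<open>The hypotheses \<open>c\<close> and \<open>r\<close> leave two numerical evaluations for
  each s: \<open>c\<close> is the coefficient of the Eichler integral without the factor
  \<open>\<i>\<close>, and \<open>r\<close> that of \<zeta>(2s - 1), including the factor 1 -
  2^(-2n-1) that relates the sum over odd integers to \<zeta>.\<close>

lemma epstein_zeta_4_eq_contour_integral:
  fixes z :: complex and n :: nat and r :: real
  defines "y \<equiv> Im z"
  assumes w: "2 * z + 1 \<in> fund_domain" and n: "0 < n"
    and c: "(y / 4) ^ (n + 1) / odd_zeta (2 * n + 2) * ((-1) ^ n * 2 * pi ^ (2 * n + 2) / (4 ^ n * (fact n)\<^sup>2 * y ^ (2 * n + 1))) = c"
    and r: "(y / 4) ^ (n + 1) / odd_zeta (2 * n + 2) * lattice_main n y * (1 - 1 / 2 ^ (2 * n + 1)) = r"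
    and G: "\<And>t. t \<in> cut_plane \<Longrightarrow> G t = \<i> * of_real c * (eis (2 * n + 1) 0 (tau t) * deriv tau t)"
  shows "epstein_zeta 4 (- 1 / (4 * z)) (of_nat (n + 1)) - of_real r * riemann_zeta (of_nat (2 * n + 1)) =
    of_real (Re (contour_integral (linepath 0 (modular_lambda (2 * z + 1)))
      (\<lambda>t. G t * (\<i> * ellK (1 - t) / ellK t - 2 * z - 1) ^ n * (\<i> * ellK (1 - t) / ellK t - 2 * cnj z - 1) ^ n)))"
proof -
  define v where "v = 2 * z + 1"
  define Q where "Q = (y / 4) ^ (n + 1) / odd_zeta (2 * n + 2)"
  have v: "v \<in> fund_domain" unfolding v_def by (rule w)
  have Imv: "0 < Im v" using v by (simp add: fund_domain_def)
  then have y: "0 < y" by (simp add: v_def y_def)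
  have c': "\<i> * of_real c = of_real Q * lattice_factor n y"
    unfolding c[symmetric] lattice_factor_def Q_def by (simp only: of_real_mult mult_ac)
  have "(\<lambda>t. G t * (\<i> * ellK (1 - t) / ellK t - 2 * z - 1) ^ n * (\<i> * ellK (1 - t) / ellK t - 2 * cnj z - 1) ^ n) =
      (\<lambda>t. G t * (tau t - v) ^ n * (tau t - cnj v) ^ n)"
    by (simp add: v_def tau_def fun_eq_iff diff_diff_eq)
  moreover have "modular_lambda (2 * z + 1) = lam v"
    unfolding lam_def v_def[symmetric] by (rule modular_lambda_eq_lamq[OF Imv])
  ultimately have I: "contour_integral (linepath 0 (modular_lambda (2 * z + 1)))
      (\<lambda>t. G t * (\<i> * ellK (1 - t) / ellK t - 2 * z - 1) ^ n * (\<i> * ellK (1 - t) / ellK t - 2 * cnj z - 1) ^ n)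
      = \<i> * of_real c * eichler v n v"
    by (simp only: contour_integral_eichler[OF v G])
  have "2 \<le> 2 * n + 1" using n by simp
  note oz = odd_zeta_eq_riemann_zeta[OF this]
  have "epstein_zeta 4 (- 1 / (4 * z)) (of_nat (n + 1)) =
      of_real (Q * (lattice_main n y * odd_zeta (2 * n + 1) + Re (lattice_factor n y * eichler v n v)))"
    unfolding Q_def y_def v_def by (rule epstein_zeta_4_eq_eichler[OF y[unfolded y_def] n])
  also have "\<dots> = of_real (Q * lattice_main n y) * of_real (odd_zeta (2 * n + 1)) + of_real (Re (of_real Q * (lattice_factor n y * eichler v n v)))"
    unfolding complex_of_real_mult_Re by (simp add: algebra_simps)
  also have "of_real (Q * lattice_main n y) * of_real (odd_zeta (2 * n + 1)) = of_real r * riemann_zeta (of_nat (2 * n + 1))"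
    unfolding oz r[symmetric] Q_def[symmetric] by simp
  finally show ?thesis unfolding I c' by (simp add: mult.assoc)
qed

theorem theorem1p2:
  fixes z :: complex
  assumes "Im z > 0"
    and "\<bar>Re (2 * z + 1)\<bar> < 1"
    and "cmod (2 * z + 1 / 2) > 1 / 2"
    and "cmod (2 * z + 3 / 2) > 1 / 2"
  shows
    "let y = complex_of_real (Im z);
         p = complex_of_real pi;
         A = (\<lambda>t. \<i> * ellK (1 - t) / ellK t - 2 * z - 1);
         B = (\<lambda>t. \<i> * ellK (1 - t) / ellK t - 2 * cnj z - 1);
         path = linepath 0 (modular_lambda (2 * z + 1))
     in
       epstein_zeta 4 (- 1 / (4 * z)) 2 - 21 * riemann_zeta 3 / (8 * p ^ 3 * y)
         = of_real (Re (contour_integral path (\<lambda>t.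
             3 * ellK t ^ 2 / (4 * p ^ 3 * y) * A t * B t)))
     \<and> epstein_zeta 4 (- 1 / (4 * z)) 3 - 1395 * riemann_zeta 5 / (256 * p ^ 5 * y ^ 2)
         = of_real (Re (contour_integral path (\<lambda>t.
             15 * (2 * t - 1) * ellK t ^ 4 / (32 * p ^ 5 * y ^ 2) * A t ^ 2 * B t ^ 2)))
     \<and> epstein_zeta 4 (- 1 / (4 * z)) 4 - 200025 * riemann_zeta 7 / (17408 * p ^ 7 * y ^ 3)
         = of_real (Re (contour_integral path (\<lambda>t.
             70 * (2 - 17 * t * (1 - t)) * ellK t ^ 6 / (1088 * p ^ 7 * y ^ 3)
               * A t ^ 3 * B t ^ 3)))
     \<and> epstein_zeta 4 (- 1 / (4 * z)) 5 - 50703975 * riemann_zeta 9 / (2031616 * p ^ 9 * y ^ 4)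
         = of_real (Re (contour_integral path (\<lambda>t.
             315 * (2 * t - 1) * (1 - 31 * t * (1 - t)) * ellK t ^ 8 / (15872 * p ^ 9 * y ^ 4)
               * A t ^ 4 * B t ^ 4)))
     \<and> epstein_zeta 4 (- 1 / (4 * z)) 7
           - 11506129710075 * riemann_zeta 13 / (91620376576 * p ^ 13 * y ^ 6)
         = of_real (Re (contour_integral path (\<lambda>t.
             3003 * (2 * t - 1) * (1 - 512 * t * (1 - t) + 5461 * t ^ 2 * (1 - t) ^ 2)
               * ellK t ^ 12 / (22368256 * p ^ 13 * y ^ 6)
               * A t ^ 6 * B t ^ 6)))"
proof -
  define y p where "y = complex_of_real (Im z)" and "p = complex_of_real pi"
  have y0: "Im z \<noteq> 0" and nz: "y \<noteq> 0" "p \<noteq> 0" using assms(1) by (simp_all add: y_def p_def)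
  \<comment> \<open>The circles are centred at 1/2 and -1/2 in w, hence at -1/4 and -3/4 in
    z.\<close>
  have s: "2 * z + 1 - 1 / 2 = 2 * z + 1 / 2" "2 * z + 1 + 1 / 2 = 2 * z + 3 / 2" by simp_all
  have w: "2 * z + 1 \<in> fund_domain"
    unfolding fund_domain_def using assms by (simp only: s mem_Collect_eq) simp
  define A B where "A = (\<lambda>t. \<i> * ellK (1 - t) / ellK t - 2 * z - 1)" and "B = (\<lambda>t. \<i> * ellK (1 - t) / ellK t - 2 * cnj z - 1)"
  define path where "path = linepath 0 (modular_lambda (2 * z + 1))"
  have main: "epstein_zeta 4 (- 1 / (4 * z)) (of_nat (n + 1)) - of_real r * riemann_zeta (of_nat (2 * n + 1)) =
      of_real (Re (contour_integral path (\<lambda>t. G t * A t ^ n * B t ^ n)))"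
    if "(Im z / 4) ^ (n + 1) / odd_zeta (2 * n + 2) * ((-1) ^ n * 2 * pi ^ (2 * n + 2) / (4 ^ n * (fact n)\<^sup>2 * Im z ^ (2 * n + 1))) = c"
      "(Im z / 4) ^ (n + 1) / odd_zeta (2 * n + 2) * lattice_main n (Im z) * (1 - 1 / 2 ^ (2 * n + 1)) = r"
      "\<And>t. t \<in> cut_plane \<Longrightarrow> G t = \<i> * of_real c * (eis (2 * n + 1) 0 (tau t) * deriv tau t)" "0 < n" for n c r G
    unfolding A_def B_def path_def by (rule epstein_zeta_4_eq_contour_integral[OF w that(4,1,2,3)])
  \<comment> \<open>Powers of K are rewritten in k = K^2/\<pi>^2, the quantity in which
    \<open>eis_deriv_tau\<close> is expressed.\<close>
  have Kp: "ellK t ^ (2 * m) = ((ellK t)\<^sup>2 / p\<^sup>2) ^ m * p ^ (2 * m)" for t m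
    using nz by (simp add: power_divide power_mult[symmetric])
  have 1: "epstein_zeta 4 (- 1 / (4 * z)) (of_nat (1 + 1)) - of_real (21 / (8 * pi ^ 3 * Im z)) * riemann_zeta (of_nat (2 * 1 + 1)) =
    of_real (Re (contour_integral path (\<lambda>t. 3 * ellK t ^ 2 / (4 * p ^ 3 * y) * A t ^ 1 * B t ^ 1)))"
  proof (rule main)
    have e: "1 + 1 = (2 :: nat)" "2 * 1 + 2 = (4 :: nat)" "2 * 1 + 1 = (3 :: nat)" "2 * 1 = (2 :: nat)" by simp_all
    have b: "2 choose 1 = (2 :: nat)" "fact 1 = (1 :: real)" by (simp_all add: binomial_fact' fact_numeral)
    \<comment> \<open>As \<open>odd_zeta 4\<close> is a rational multiple of \<pi>^4, the powers of
      \<pi> cancel here, and the sign is that of (-1)^n. The same happens in the cases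
      below.\<close>
    show "(Im z / 4) ^ (1 + 1) / odd_zeta (2 * 1 + 2) * ((-1) ^ 1 * 2 * pi ^ (2 * 1 + 2) / (4 ^ 1 * (fact 1)\<^sup>2 * Im z ^ (2 * 1 + 1))) = - 3 / Im z"
      unfolding e(1-3) odd_zeta_values unfolding e(4) b using y0 by (simp add: field_simps eval_nat_numeral)
    show "(Im z / 4) ^ (1 + 1) / odd_zeta (2 * 1 + 2) * lattice_main 1 (Im z) * (1 - 1 / 2 ^ (2 * 1 + 1)) = 21 / (8 * pi ^ 3 * Im z)"
      unfolding lattice_main_def e(1-3) odd_zeta_values unfolding e(4) b using y0 by (simp add: field_simps eval_nat_numeral)
    fix t assume t: "t \<in> cut_plane"
    show "3 * ellK t ^ 2 / (4 * p ^ 3 * y) = \<i> * of_real (- 3 / Im z) * (eis (2 * 1 + 1) 0 (tau t) * deriv tau t)"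
    proof -
      define k where "k = (ellK t)\<^sup>2 / p\<^sup>2"
      have K: "ellK t ^ 2 = k ^ 1 * p ^ 2" using Kp[of t 1] unfolding e(4) k_def .
      show ?thesis
        unfolding e(3) eis_deriv_tau[OF t] p_def[symmetric] k_def[symmetric] K using nz
        by (simp add: y_def[symmetric] field_simps eval_nat_numeral)
    qed
  qed simp
  have 2: "epstein_zeta 4 (- 1 / (4 * z)) (of_nat (2 + 1)) - of_real (1395 / (256 * pi ^ 5 * Im z ^ 2)) * riemann_zeta (of_nat (2 * 2 + 1)) =
    of_real (Re (contour_integral path (\<lambda>t. 15 * (2 * t - 1) * ellK t ^ 4 / (32 * p ^ 5 * y ^ 2) * A t ^ 2 * B t ^ 2)))"
  proof (rule main)
    have e: "2 + 1 = (3 :: nat)" "2 * 2 + 2 = (6 :: nat)" "2 * 2 + 1 = (5 :: nat)" "2 * 2 = (4 :: nat)" by simp_all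
    have b: "4 choose 2 = (6 :: nat)" "fact 2 = (2 :: real)" by (simp_all add: binomial_fact' fact_numeral)
    show "(Im z / 4) ^ (2 + 1) / odd_zeta (2 * 2 + 2) * ((-1) ^ 2 * 2 * pi ^ (2 * 2 + 2) / (4 ^ 2 * (fact 2)\<^sup>2 * Im z ^ (2 * 2 + 1))) = 15 / (32 * Im z ^ 2)"
      unfolding e(1-3) odd_zeta_values unfolding e(4) b using y0 by (simp add: field_simps eval_nat_numeral)
    show "(Im z / 4) ^ (2 + 1) / odd_zeta (2 * 2 + 2) * lattice_main 2 (Im z) * (1 - 1 / 2 ^ (2 * 2 + 1)) = 1395 / (256 * pi ^ 5 * Im z ^ 2)"
      unfolding lattice_main_def e(1-3) odd_zeta_values unfolding e(4) b using y0 by (simp add: field_simps eval_nat_numeral)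
    fix t assume t: "t \<in> cut_plane"
    show "15 * (2 * t - 1) * ellK t ^ 4 / (32 * p ^ 5 * y ^ 2) = \<i> * of_real (15 / (32 * Im z ^ 2)) * (eis (2 * 2 + 1) 0 (tau t) * deriv tau t)"
    proof -
      define k where "k = (ellK t)\<^sup>2 / p\<^sup>2"
      have K: "ellK t ^ 4 = k ^ 2 * p ^ 4" using Kp[of t 2] unfolding e(4) k_def .
      show ?thesis
        unfolding e(3) eis_deriv_tau[OF t] p_def[symmetric] k_def[symmetric] K using nz
        by (simp add: y_def[symmetric] field_simps eval_nat_numeral)
    qed
  qed simp
  have 3: "epstein_zeta 4 (- 1 / (4 * z)) (of_nat (3 + 1)) - of_real (200025 / (17408 * pi ^ 7 * Im z ^ 3)) * riemann_zeta (of_nat (2 * 3 + 1)) =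
    of_real (Re (contour_integral path (\<lambda>t. 70 * (2 - 17 * t * (1 - t)) * ellK t ^ 6 / (1088 * p ^ 7 * y ^ 3) * A t ^ 3 * B t ^ 3)))"
  proof (rule main)
    have e: "3 + 1 = (4 :: nat)" "2 * 3 + 2 = (8 :: nat)" "2 * 3 + 1 = (7 :: nat)" "2 * 3 = (6 :: nat)" by simp_all
    have b: "6 choose 3 = (20 :: nat)" "fact 3 = (6 :: real)" by (simp_all add: binomial_fact' fact_numeral)
    show "(Im z / 4) ^ (3 + 1) / odd_zeta (2 * 3 + 2) * ((-1) ^ 3 * 2 * pi ^ (2 * 3 + 2) / (4 ^ 3 * (fact 3)\<^sup>2 * Im z ^ (2 * 3 + 1))) = - 35 / (1088 * Im z ^ 3)"
      unfolding e(1-3) odd_zeta_values unfolding e(4) b using y0 by (simp add: field_simps eval_nat_numeral)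
    show "(Im z / 4) ^ (3 + 1) / odd_zeta (2 * 3 + 2) * lattice_main 3 (Im z) * (1 - 1 / 2 ^ (2 * 3 + 1)) = 200025 / (17408 * pi ^ 7 * Im z ^ 3)"
      unfolding lattice_main_def e(1-3) odd_zeta_values unfolding e(4) b using y0 by (simp add: field_simps eval_nat_numeral)
    fix t assume t: "t \<in> cut_plane"
    show "70 * (2 - 17 * t * (1 - t)) * ellK t ^ 6 / (1088 * p ^ 7 * y ^ 3) = \<i> * of_real (- 35 / (1088 * Im z ^ 3)) * (eis (2 * 3 + 1) 0 (tau t) * deriv tau t)"
    proof -
      define k where "k = (ellK t)\<^sup>2 / p\<^sup>2"
      have K: "ellK t ^ 6 = k ^ 3 * p ^ 6" using Kp[of t 3] unfolding e(4) k_def .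
      show ?thesis
        unfolding e(3) eis_deriv_tau[OF t] p_def[symmetric] k_def[symmetric] K using nz
        by (simp add: y_def[symmetric] field_simps eval_nat_numeral)
    qed
  qed simp
  have 4: "epstein_zeta 4 (- 1 / (4 * z)) (of_nat (4 + 1)) - of_real (50703975 / (2031616 * pi ^ 9 * Im z ^ 4)) * riemann_zeta (of_nat (2 * 4 + 1)) =
    of_real (Re (contour_integral path (\<lambda>t. 315 * (2 * t - 1) * (1 - 31 * t * (1 - t)) * ellK t ^ 8 / (15872 * p ^ 9 * y ^ 4) * A t ^ 4 * B t ^ 4)))"
  proof (rule main)
    have e: "4 + 1 = (5 :: nat)" "2 * 4 + 2 = (10 :: nat)" "2 * 4 + 1 = (9 :: nat)" "2 * 4 = (8 :: nat)" by simp_all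
    have b: "8 choose 4 = (70 :: nat)" "fact 4 = (24 :: real)" by (simp_all add: binomial_fact' fact_numeral)
    show "(Im z / 4) ^ (4 + 1) / odd_zeta (2 * 4 + 2) * ((-1) ^ 4 * 2 * pi ^ (2 * 4 + 2) / (4 ^ 4 * (fact 4)\<^sup>2 * Im z ^ (2 * 4 + 1))) = 315 / (253952 * Im z ^ 4)"
      unfolding e(1-3) odd_zeta_values unfolding e(4) b using y0 by (simp add: field_simps eval_nat_numeral)
    show "(Im z / 4) ^ (4 + 1) / odd_zeta (2 * 4 + 2) * lattice_main 4 (Im z) * (1 - 1 / 2 ^ (2 * 4 + 1)) = 50703975 / (2031616 * pi ^ 9 * Im z ^ 4)"
      unfolding lattice_main_def e(1-3) odd_zeta_values unfolding e(4) b using y0 by (simp add: field_simps eval_nat_numeral)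
    fix t assume t: "t \<in> cut_plane"
    show "315 * (2 * t - 1) * (1 - 31 * t * (1 - t)) * ellK t ^ 8 / (15872 * p ^ 9 * y ^ 4) = \<i> * of_real (315 / (253952 * Im z ^ 4)) * (eis (2 * 4 + 1) 0 (tau t) * deriv tau t)"
    proof -
      define k where "k = (ellK t)\<^sup>2 / p\<^sup>2"
      have K: "ellK t ^ 8 = k ^ 4 * p ^ 8" using Kp[of t 4] unfolding e(4) k_def .
      show ?thesis
        unfolding e(3) eis_deriv_tau[OF t] p_def[symmetric] k_def[symmetric] K using nz
        by (simp add: y_def[symmetric] field_simps eval_nat_numeral)
    qed
  qed simp
  \<comment> \<open>Here n = s - 1 = 6. The factor 5461 of \<open>odd_zeta 14\<close> enters both
    denominators: 22368256 = 5461 * 2^12 and 91620376576 = 5461 * 2^24.\<close>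
  have 6: "epstein_zeta 4 (- 1 / (4 * z)) (of_nat (6 + 1)) - of_real (11506129710075 / (91620376576 * pi ^ 13 * Im z ^ 6)) * riemann_zeta (of_nat (2 * 6 + 1)) =
    of_real (Re (contour_integral path (\<lambda>t. 3003 * (2 * t - 1) * (1 - 512 * t * (1 - t) + 5461 * t ^ 2 * (1 - t) ^ 2) * ellK t ^ 12 / (22368256 * p ^ 13 * y ^ 6) * A t ^ 6 * B t ^ 6)))"
  proof (rule main)
    have e: "6 + 1 = (7 :: nat)" "2 * 6 + 2 = (14 :: nat)" "2 * 6 + 1 = (13 :: nat)" "2 * 6 = (12 :: nat)" by simp_all
    have b: "12 choose 6 = (924 :: nat)" "fact 6 = (720 :: real)" by (simp_all add: binomial_fact' fact_numeral)
    show "(Im z / 4) ^ (6 + 1) / odd_zeta (2 * 6 + 2) * ((-1) ^ 6 * 2 * pi ^ (2 * 6 + 2) / (4 ^ 6 * (fact 6)\<^sup>2 * Im z ^ (2 * 6 + 1))) = 3003 / (5726273536 * Im z ^ 6)"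
      unfolding e(1-3) odd_zeta_values unfolding e(4) b using y0 by (simp add: field_simps eval_nat_numeral)
    show "(Im z / 4) ^ (6 + 1) / odd_zeta (2 * 6 + 2) * lattice_main 6 (Im z) * (1 - 1 / 2 ^ (2 * 6 + 1)) = 11506129710075 / (91620376576 * pi ^ 13 * Im z ^ 6)"
      unfolding lattice_main_def e(1-3) odd_zeta_values unfolding e(4) b using y0 by (simp add: field_simps eval_nat_numeral)
    fix t assume t: "t \<in> cut_plane"
    show "3003 * (2 * t - 1) * (1 - 512 * t * (1 - t) + 5461 * t ^ 2 * (1 - t) ^ 2) * ellK t ^ 12 / (22368256 * p ^ 13 * y ^ 6) = \<i> * of_real (3003 / (5726273536 * Im z ^ 6)) * (eis (2 * 6 + 1) 0 (tau t) * deriv tau t)"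
    proof -
      define k where "k = (ellK t)\<^sup>2 / p\<^sup>2"
      have K: "ellK t ^ 12 = k ^ 6 * p ^ 12" using Kp[of t 6] unfolding e(4) k_def .
      show ?thesis
        unfolding e(3) eis_deriv_tau[OF t] p_def[symmetric] k_def[symmetric] K using nz
        by (simp add: y_def[symmetric] field_simps eval_nat_numeral)
    qed
  qed simp
  show ?thesis
    unfolding Let_def A_def[symmetric] B_def[symmetric] path_def[symmetric] y_def[symmetric] p_def[symmetric]
    using 1 2 3 4 6 by (simp add: y_def p_def)
qed

end
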